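(* Let $\mathcal A_1$ and $\mathcal A_2$ be unital separable C$^*$-algebras with faithful tracial states $\tau_1$ and $\tau_2$ respectively. Suppose that $\mathcal A_1$ and $\mathcal A_2$ satisfy Avitzour's condition, i.e. there are unitaries $u\in\mathcal A_1$ and $v,w\in\mathcal A_2$ such that $$\tau_1(u)=\tau_2(v)=\tau_2(w)=\tau_2(w^*v)=0.$$ Then $(\mathcal A_1,\tau_1)*_{red}(\mathcal A_2,\tau_2)$ is not a quasidiagonal C$^*$-algebra.
   Context: Quasidiagonal: a separable C$^*$-algebra $\mathcal A$ is quasidiagonal if there are a faithful $*$-representation $\pi:\mathcal A\to B(\mathcal H)$ and an increasing sequence of finite-rank projections $p_i$ on $\mathcal H$ tending strongly to the identity with $\|\pi(x)p_i-p_i\pi(x)\|\to0$ for every $x\in\mathcal A$. Reduced free product: for unital C$^*$-algebras $\mathcal A_1,\mathcal A_2$ with states $\tau_1,\tau_2$, let $(\pi_i,\mathcal H_i,\xi_i)$ be the GNS representation of $(\mathcal A_i,\tau_i)$ and $\mathcal H_i^{\circ}=\mathcal H_i\ominus\mathbb C\xi_i$. Let $\mathcal H=\mathbb C\xi\oplus\bigoplus_{m\ge1}\bigoplus_{j_1\ne j_2\ne\cdots\ne j_m}\mathcal H_{j_1}^{\circ}\otimes\cdots\otimes\mathcal H_{j_m}^{\circ}$ (consecutive indices distinct), let $\mathcal H(i)$ be the subspace of $\mathcal H$ given by $\mathbb C\xi$ and the summands with $j_1\neq i$, let $V_i:\mathcal H_i\otimes\mathcal H(i)\to\mathcal H$ be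 the natural unitary, and $\lambda_i(a)=V_i(\pi_i(a)\otimes I_{\mathcal H(i)})V_i^*$. Then $(\mathcal A_1,\tau_1)*_{red}(\mathcal A_2,\tau_2)$ is the C$^*$-subalgebra of $B(\mathcal H)$ generated by $\lambda_1(\mathcal A_1)\cup\lambda_2(\mathcal A_2)$. *)

theory Defs
  imports "HOL-Analysis.Analysis" "HOL-Library.Function_Algebras"
begin

section \<open>Complex vector spaces and unital C*-algebras\<close>

class complex_vector = ab_group_add +
  fixes scaleC :: "complex \<Rightarrow> 'a \<Rightarrow> 'a"  (infixr \<open>*\<^sub>C\<close> 75)
  assumes scaleC_add_right: "c *\<^sub>C (x + y) = c *\<^sub>C x + c *\<^sub>C y"
    and scaleC_add_left: "(c + d) *\<^sub>C x = c *\<^sub>C x + d *\<^sub>C x"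
    and scaleC_scaleC: "c *\<^sub>C (d *\<^sub>C x) = (c * d) *\<^sub>C x"
    and scaleC_one: "1 *\<^sub>C x = x"

global_interpretation complex_vector:
  vector_space "scaleC :: complex \<Rightarrow> 'a \<Rightarrow> 'a::complex_vector"
  by unfold_locales (rule scaleC_add_right scaleC_add_left scaleC_scaleC scaleC_one)+

instantiation complex :: complex_vector
begin
definition scaleC_complex_def: "c *\<^sub>C (z::complex) = c * z"
instance by standard (simp_all add: scaleC_complex_def algebra_simps)
end

instantiation "fun" :: (type, complex_vector) complex_vector
begin
definition scaleC_fun_def: "c *\<^sub>C f = (\<lambda>x. c *\<^sub>C f x)"
instance
  by standard (simp_all add: scaleC_fun_def fun_eq_iff scaleC_add_right scaleC_add_left
      scaleC_scaleC scaleC_one)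
end

text \<open>The class \<open>real_normed_algebra_1\<close> requires \<open>norm 1 = 1\<close>; this only excludes the zero
  algebra, which has no states.\<close>

class unital_cstar_algebra = complex_vector + real_normed_algebra_1 + banach +
  fixes star :: "'a \<Rightarrow> 'a"
  assumes scaleR_scaleC: "r *\<^sub>R x = complex_of_real r *\<^sub>C x"
    and scaleC_mult_left: "(c *\<^sub>C x) * y = c *\<^sub>C (x * y)"
    and scaleC_mult_right: "x * (c *\<^sub>C y) = c *\<^sub>C (x * y)"
    and norm_scaleC: "norm (c *\<^sub>C x) = cmod c * norm x"
    and star_add: "star (x + y) = star x + star y"
    and star_scaleC: "star (c *\<^sub>C x) = cnj c *\<^sub>C star x"
    and star_mult: "star (x * y) = star y * star x"
    and star_star: "star (star x) = x"
    and cstar_identity: "norm (star x * x) = (norm x)\<^sup>2"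

definition unitary :: "'a::unital_cstar_algebra \<Rightarrow> bool"
  where "unitary u \<longleftrightarrow> star u * u = 1 \<and> u * star u = 1"

text \<open>A state is a positive linear functional of norm one. As \<open>norm 1 = 1\<close>, the last two
  conjuncts say that the norm is one.\<close>

definition state :: "('a::unital_cstar_algebra \<Rightarrow> complex) \<Rightarrow> bool"
  where "state \<tau> \<longleftrightarrow>
    (\<forall>x y. \<tau> (x + y) = \<tau> x + \<tau> y) \<and> (\<forall>c x. \<tau> (c *\<^sub>C x) = c * \<tau> x) \<and>
    (\<forall>x. \<tau> (star x * x) \<in> \<real>\<^sub>\<ge>\<^sub>0) \<and>
    (\<forall>x. cmod (\<tau> x) \<le> norm x) \<and> \<tau> 1 = 1"

definition faithful_tracial_state :: "('a::unital_cstar_algebra \<Rightarrow> complex) \<Rightarrow> bool"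
  where "faithful_tracial_state \<tau> \<longleftrightarrow> state \<tau> \<and> (\<forall>x y. \<tau> (x * y) = \<tau> (y * x)) \<and>
    (\<forall>x. \<tau> (star x * x) = 0 \<longrightarrow> x = 0)"


section \<open>Hilbert spaces and bounded operators\<close>

text \<open>The spaces below depend on states, so a Hilbert space is given by a carrier inside an ambient
  complex vector space. Its inner product is linear in the first argument, and its values outside
  the carrier are irrelevant. The same record is used for spaces that are not complete or carry
  only a positive semidefinite form.\<close>

record 'h hspace =
  hcarrier :: "'h set"
  hinner :: "'h \<Rightarrow> 'h \<Rightarrow> complex"

definition hnorm :: "'h hspace \<Rightarrow> 'h \<Rightarrow> real"
  where "hnorm H x = sqrt (Re (hinner H x x))"

definition hcauchy :: "'h::complex_vector hspace \<Rightarrow> (nat \<Rightarrow> 'h) \<Rightarrow> bool"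
  where "hcauchy H x \<longleftrightarrow> (\<forall>n. x n \<in> hcarrier H) \<and>
    (\<forall>e>0. \<exists>N. \<forall>m\<ge>N. \<forall>n\<ge>N. hnorm H (x m - x n) < e)"

definition htendsto :: "'h::complex_vector hspace \<Rightarrow> (nat \<Rightarrow> 'h) \<Rightarrow> 'h \<Rightarrow> bool"
  where "htendsto H x l \<longleftrightarrow> (\<lambda>n. hnorm H (x n - l)) \<longlonglongrightarrow> 0"

definition hilbert_space :: "'h::complex_vector hspace \<Rightarrow> bool"
  where "hilbert_space H \<longleftrightarrow>
    complex_vector.subspace (hcarrier H) \<and>
    (\<forall>x\<in>hcarrier H. \<forall>y\<in>hcarrier H. \<forall>z\<in>hcarrier H.
        hinner H (x + y) z = hinner H x z + hinner H y z) \<and>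
    (\<forall>c. \<forall>x\<in>hcarrier H. \<forall>y\<in>hcarrier H. hinner H (c *\<^sub>C x) y = c * hinner H x y) \<and>
    (\<forall>x\<in>hcarrier H. \<forall>y\<in>hcarrier H. hinner H y x = cnj (hinner H x y)) \<and>
    (\<forall>x\<in>hcarrier H. hinner H x x \<in> \<real>\<^sub>\<ge>\<^sub>0) \<and>
    (\<forall>x\<in>hcarrier H. hinner H x x = 0 \<longrightarrow> x = 0) \<and>
    (\<forall>x. hcauchy H x \<longrightarrow> (\<exists>l\<in>hcarrier H. htendsto H x l))"

definition hclosed_span :: "'h::complex_vector hspace \<Rightarrow> 'h set \<Rightarrow> 'h hspace"
  where "hclosed_span H S = H\<lparr>hcarrier :=
    {x \<in> hcarrier H. \<exists>s. (\<forall>n. s n \<in> complex_vector.span S) \<and> htendsto H s x}\<rparr>"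

text \<open>Operators are extended by \<open>0\<close> off the carrier, so that equality of operators is equality
  of functions. Sums and scalar multiples of operators are those of functions.\<close>

definition bop :: "'h::complex_vector hspace \<Rightarrow> 'k::complex_vector hspace \<Rightarrow> ('h \<Rightarrow> 'k) set"
  where "bop H K = {T.
    (\<forall>x\<in>hcarrier H. T x \<in> hcarrier K) \<and> (\<forall>x. x \<notin> hcarrier H \<longrightarrow> T x = 0) \<and>
    (\<forall>x\<in>hcarrier H. \<forall>y\<in>hcarrier H. T (x + y) = T x + T y) \<and>
    (\<forall>c. \<forall>x\<in>hcarrier H. T (c *\<^sub>C x) = c *\<^sub>C T x) \<and>
    (\<exists>C. \<forall>x\<in>hcarrier H. hnorm K (T x) \<le> C * hnorm H x)}"

definition opnorm :: "'h::complex_vector hspace \<Rightarrow> 'k::complex_vector hspace \<Rightarrow> ('h \<Rightarrow> 'k) \<Rightarrow> real"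
  where "opnorm H K T = Sup {hnorm K (T x) | x. x \<in> hcarrier H \<and> hnorm H x \<le> 1}"

definition adj ::
    "'h::complex_vector hspace \<Rightarrow> 'k::complex_vector hspace \<Rightarrow> ('h \<Rightarrow> 'k) \<Rightarrow> 'k \<Rightarrow> 'h"
  where "adj H K T = (THE S. S \<in> bop K H \<and>
    (\<forall>x\<in>hcarrier H. \<forall>y\<in>hcarrier K. hinner K (T x) y = hinner H x (S y)))"

definition projection :: "'h::complex_vector hspace \<Rightarrow> ('h \<Rightarrow> 'h) \<Rightarrow> bool"
  where "projection H p \<longleftrightarrow> p \<in> bop H H \<and> p \<circ> p = p \<and> adj H H p = p"

definition finite_rank :: "'h::complex_vector hspace \<Rightarrow> ('h \<Rightarrow> 'h) \<Rightarrow> bool"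
  where "finite_rank H T \<longleftrightarrow>
    (\<exists>B. finite B \<and> T ` hcarrier H \<subseteq> complex_vector.span B)"

definition cstar_subalgebra ::
    "'h::complex_vector hspace \<Rightarrow> ('h \<Rightarrow> 'h) set \<Rightarrow> bool"
  where "cstar_subalgebra H A \<longleftrightarrow> A \<subseteq> bop H H \<and> complex_vector.subspace A \<and>
    (\<forall>S\<in>A. \<forall>T\<in>A. S \<circ> T \<in> A) \<and> (\<forall>T\<in>A. adj H H T \<in> A) \<and>
    (\<forall>X. \<forall>T\<in>bop H H. (\<forall>n::nat. X n \<in> A) \<and> (\<lambda>n. opnorm H H (X n - T)) \<longlonglongrightarrow> 0
       \<longrightarrow> T \<in> A)"

definition cstar_generated ::
    "'h::complex_vector hspace \<Rightarrow> ('h \<Rightarrow> 'h) set \<Rightarrow> ('h \<Rightarrow> 'h) set"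
  where "cstar_generated H G = \<Inter>{A. cstar_subalgebra H A \<and> G \<subseteq> A}"


section \<open>Quasidiagonality\<close>

definition star_representation ::
    "'h::complex_vector hspace \<Rightarrow> ('h \<Rightarrow> 'h) set \<Rightarrow> 'k::complex_vector hspace \<Rightarrow>
      (('h \<Rightarrow> 'h) \<Rightarrow> 'k \<Rightarrow> 'k) \<Rightarrow> bool"
  where "star_representation H A K \<pi> \<longleftrightarrow>
    (\<forall>S\<in>A. \<pi> S \<in> bop K K) \<and>
    (\<forall>S\<in>A. \<forall>T\<in>A. \<pi> (S + T) = \<pi> S + \<pi> T) \<and>
    (\<forall>c. \<forall>S\<in>A. \<pi> (c *\<^sub>C S) = c *\<^sub>C \<pi> S) \<and>
    (\<forall>S\<in>A. \<forall>T\<in>A. \<pi> (S \<circ> T) = \<pi> S \<circ> \<pi> T) \<and>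
    (\<forall>S\<in>A. \<pi> (adj H H S) = adj K K (\<pi> S))"

text \<open>Quasidiagonality of a separable C*-algebra \<open>A\<close> of operators on \<open>H\<close>; only the
  *-algebra structure of \<open>A\<close> enters, since \<open>\<pi>\<close> is an arbitrary faithful representation.
  HOL cannot quantify over the ambient type \<open>'k\<close> of the Hilbert space \<open>K\<close> inside a formula, so
  that type is a parameter; a theorem denying \<open>quasidiagonal TYPE('k) H A\<close> for a type variable
  \<open>'k\<close> denies the existence of such a \<open>K\<close> over every type. Separability of \<open>A\<close> is not a
  conjunct: otherwise the denial would hold trivially for nonseparable algebras.\<close>

definition quasidiagonal ::
    "'k::complex_vector itself \<Rightarrow> 'h::complex_vector hspace \<Rightarrow> ('h \<Rightarrow> 'h) set \<Rightarrow> bool"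
  where "quasidiagonal _ H A \<longleftrightarrow>
    (\<exists>(K :: 'k hspace) \<pi> (p :: nat \<Rightarrow> 'k \<Rightarrow> 'k).
       hilbert_space K \<and> star_representation H A K \<pi> \<and> inj_on \<pi> A \<and>
       (\<forall>n. projection K (p n) \<and> finite_rank K (p n)) \<and>
       (\<forall>n. p n ` hcarrier K \<subseteq> p (Suc n) ` hcarrier K) \<and>
       (\<forall>x\<in>hcarrier K. htendsto K (\<lambda>n. p n x) x) \<and>
       (\<forall>T\<in>A. (\<lambda>n. opnorm K K ((\<pi> T \<circ> p n) - (p n \<circ> \<pi> T))) \<longlonglongrightarrow> 0))"


section \<open>Completions and tensor products\<close>

text \<open>The Hilbert space completion of a space \<open>V\<close> with a positive semidefinite form (null vectors
  being divided out). The class of a Cauchy sequence \<open>x\<close> is encoded by the function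
  \<open>v \<mapsto> lim \<langle>x\<^sub>n, v\<rangle>\<close> on \<open>V\<close>: two Cauchy sequences give the same function iff
  their difference tends to \<open>0\<close> in the seminorm. Hence the vector space operations are the pointwise
  ones, and no quotient is needed.\<close>

definition cauchy_class :: "'v::complex_vector hspace \<Rightarrow> (nat \<Rightarrow> 'v) \<Rightarrow> 'v \<Rightarrow> complex"
  where "cauchy_class V x = (\<lambda>v. if v \<in> hcarrier V then lim (\<lambda>n. hinner V (x n) v) else 0)"

definition cauchy_rep :: "'v::complex_vector hspace \<Rightarrow> ('v \<Rightarrow> complex) \<Rightarrow> nat \<Rightarrow> 'v"
  where "cauchy_rep V f = (SOME x. hcauchy V x \<and> cauchy_class V x = f)"

definition hcompletion :: "'v::complex_vector hspace \<Rightarrow> ('v \<Rightarrow> complex) hspace"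
  where "hcompletion V = \<lparr>hcarrier = {cauchy_class V x | x. hcauchy V x},
     hinner = (\<lambda>f g. lim (\<lambda>n. hinner V (cauchy_rep V f n) (cauchy_rep V g n)))\<rparr>"

definition hembed :: "'v::complex_vector hspace \<Rightarrow> 'v \<Rightarrow> 'v \<Rightarrow> complex"
  where "hembed V v = cauchy_class V (\<lambda>_. v)"

text \<open>Formal finite linear combinations of the elements of \<open>X\<close>, with the sesquilinear form
  determined by its values \<open>k\<close> on \<open>X\<close>, and their completion. For a family of elementary tensors
  and \<open>k\<close> the product of the inner products of the factors, the formal combinations modulo null
  vectors are the algebraic tensor product, and the completion is the Hilbert space tensor product.\<close>

definition formal_space :: "'x set \<Rightarrow> ('x \<Rightarrow> 'x \<Rightarrow> complex) \<Rightarrow> ('x \<Rightarrow> complex) hspace"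
  where "formal_space X k = \<lparr>hcarrier = {f. finite {x. f x \<noteq> 0} \<and> {x. f x \<noteq> 0} \<subseteq> X},
     hinner = (\<lambda>f g. \<Sum>x | f x \<noteq> 0. \<Sum>y | g y \<noteq> 0. f x * cnj (g y) * k x y)\<rparr>"

definition generated_space ::
    "'x set \<Rightarrow> ('x \<Rightarrow> 'x \<Rightarrow> complex) \<Rightarrow> (('x \<Rightarrow> complex) \<Rightarrow> complex) hspace"
  where "generated_space X k = hcompletion (formal_space X k)"

definition generator ::
    "'x set \<Rightarrow> ('x \<Rightarrow> 'x \<Rightarrow> complex) \<Rightarrow> 'x \<Rightarrow> ('x \<Rightarrow> complex) \<Rightarrow> complex"
  where "generator X k x = hembed (formal_space X k) (\<lambda>y. if y = x then 1 else 0)"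

definition pair_inner :: "'h hspace \<Rightarrow> 'k hspace \<Rightarrow> 'h \<times> 'k \<Rightarrow> 'h \<times> 'k \<Rightarrow> complex"
  where "pair_inner H K = (\<lambda>(x, y) (x', y'). hinner H x x' * hinner K y y')"

definition htensor :: "'h hspace \<Rightarrow> 'k hspace \<Rightarrow> (('h \<times> 'k \<Rightarrow> complex) \<Rightarrow> complex) hspace"
  where "htensor H K = generated_space (hcarrier H \<times> hcarrier K) (pair_inner H K)"

definition elem_tensor ::
    "'h hspace \<Rightarrow> 'k hspace \<Rightarrow> 'h \<Rightarrow> 'k \<Rightarrow> ('h \<times> 'k \<Rightarrow> complex) \<Rightarrow> complex"
  where "elem_tensor H K x y = generator (hcarrier H \<times> hcarrier K) (pair_inner H K) (x, y)"

definition tensor_id ::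
    "'h hspace \<Rightarrow> 'k hspace \<Rightarrow> ('h \<Rightarrow> 'h) \<Rightarrow>
      (('h \<times> 'k \<Rightarrow> complex) \<Rightarrow> complex) \<Rightarrow> ('h \<times> 'k \<Rightarrow> complex) \<Rightarrow> complex"
  where "tensor_id H K T = (THE S. S \<in> bop (htensor H K) (htensor H K) \<and>
    (\<forall>x\<in>hcarrier H. \<forall>y\<in>hcarrier K. S (elem_tensor H K x y) = elem_tensor H K (T x) y))"


section \<open>The GNS representation\<close>

definition gns_pre :: "('a::unital_cstar_algebra \<Rightarrow> complex) \<Rightarrow> 'a hspace"
  where "gns_pre \<tau> = \<lparr>hcarrier = UNIV, hinner = (\<lambda>a b. \<tau> (star b * a))\<rparr>"

definition gns_space :: "('a::unital_cstar_algebra \<Rightarrow> complex) \<Rightarrow> ('a \<Rightarrow> complex) hspace"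
  where "gns_space \<tau> = hcompletion (gns_pre \<tau>)"

definition gns_vector :: "('a::unital_cstar_algebra \<Rightarrow> complex) \<Rightarrow> 'a \<Rightarrow> complex"
  where "gns_vector \<tau> = hembed (gns_pre \<tau>) 1"

definition gns_rep ::
    "('a::unital_cstar_algebra \<Rightarrow> complex) \<Rightarrow> 'a \<Rightarrow> ('a \<Rightarrow> complex) \<Rightarrow> 'a \<Rightarrow> complex"
  where "gns_rep \<tau> a = (THE T. T \<in> bop (gns_space \<tau>) (gns_space \<tau>) \<and>
    (\<forall>b. T (hembed (gns_pre \<tau>) b) = hembed (gns_pre \<tau>) (a * b)))"


section \<open>The reduced free product\<close>

text \<open>A word \<open>x\<^sub>1 \<dots> x\<^sub>m\<close> stands for the elementary tensor \<open>x\<^sub>1 \<otimes> \<dots> \<otimes> x\<^sub>m\<close>, the empty word for \<open>\<xi>\<close>;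
  \<open>Inl\<close> and \<open>Inr\<close> tag the letters from \<open>H\<^sub>1\<close> and \<open>H\<^sub>2\<close>. Words with different
  tag patterns lie in different direct summands and are orthogonal.\<close>

definition free_words ::
    "'h hspace \<Rightarrow> 'h \<Rightarrow> 'k hspace \<Rightarrow> 'k \<Rightarrow> ('h + 'k) list set"
  where "free_words H1 \<xi>1 H2 \<xi>2 = {w. successively (\<lambda>a b. isl a \<noteq> isl b) w \<and>
    set w \<subseteq> Inl ` {x \<in> hcarrier H1. hinner H1 x \<xi>1 = 0} \<union>
             Inr ` {y \<in> hcarrier H2. hinner H2 y \<xi>2 = 0}}"

fun letter_inner :: "'h hspace \<Rightarrow> 'k hspace \<Rightarrow> 'h + 'k \<Rightarrow> 'h + 'k \<Rightarrow> complex"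
  where
    "letter_inner H1 H2 (Inl x) (Inl x') = hinner H1 x x'"
  | "letter_inner H1 H2 (Inr y) (Inr y') = hinner H2 y y'"
  | "letter_inner H1 H2 _ _ = 0"

fun word_inner :: "'h hspace \<Rightarrow> 'k hspace \<Rightarrow> ('h + 'k) list \<Rightarrow> ('h + 'k) list \<Rightarrow> complex"
  where
    "word_inner H1 H2 [] [] = 1"
  | "word_inner H1 H2 (a # v) (b # w) = letter_inner H1 H2 a b * word_inner H1 H2 v w"
  | "word_inner H1 H2 _ _ = 0"

definition free_space ::
    "'h hspace \<Rightarrow> 'h \<Rightarrow> 'k hspace \<Rightarrow> 'k \<Rightarrow> ((('h + 'k) list \<Rightarrow> complex) \<Rightarrow> complex) hspace"
  where "free_space H1 \<xi>1 H2 \<xi>2 =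
    generated_space (free_words H1 \<xi>1 H2 \<xi>2) (word_inner H1 H2)"

definition word_vector ::
    "'h hspace \<Rightarrow> 'h \<Rightarrow> 'k hspace \<Rightarrow> 'k \<Rightarrow> ('h + 'k) list \<Rightarrow>
      (('h + 'k) list \<Rightarrow> complex) \<Rightarrow> complex"
  where "word_vector H1 \<xi>1 H2 \<xi>2 = generator (free_words H1 \<xi>1 H2 \<xi>2) (word_inner H1 H2)"

text \<open>In the next four definitions \<open>\<iota>\<close> is \<open>Inl\<close> or \<open>Inr\<close> and selects the free factor \<open>i\<close>;
  \<open>Hi\<close>, \<open>\<xi>i\<close> are then \<open>H1\<close>, \<open>\<xi>1\<close> or \<open>H2\<close>, \<open>\<xi>2\<close>. They give the words not starting in
  \<open>H\<^sub>i\<close>, the space \<open>H(i)\<close>, the unitary \<open>V\<^sub>i : H\<^sub>i \<otimes> H(i) \<rightarrow> H\<close>, and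
  \<open>V\<^sub>i (T \<otimes> I) V\<^sub>i\<^sup>*\<close>.\<close>

definition leg_words ::
    "'h hspace \<Rightarrow> 'h \<Rightarrow> 'k hspace \<Rightarrow> 'k \<Rightarrow> ('i \<Rightarrow> 'h + 'k) \<Rightarrow> ('h + 'k) list set"
  where "leg_words H1 \<xi>1 H2 \<xi>2 \<iota> =
    {w \<in> free_words H1 \<xi>1 H2 \<xi>2. w = [] \<or> hd w \<notin> range \<iota>}"

definition leg_space ::
    "'h hspace \<Rightarrow> 'h \<Rightarrow> 'k hspace \<Rightarrow> 'k \<Rightarrow> ('i \<Rightarrow> 'h + 'k) \<Rightarrow>
      ((('h + 'k) list \<Rightarrow> complex) \<Rightarrow> complex) hspace"
  where "leg_space H1 \<xi>1 H2 \<xi>2 \<iota> = hclosed_span (free_space H1 \<xi>1 H2 \<xi>2)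
    (word_vector H1 \<xi>1 H2 \<xi>2 ` leg_words H1 \<xi>1 H2 \<xi>2 \<iota>)"

definition leg_unitary ::
    "'h hspace \<Rightarrow> 'h \<Rightarrow> 'k hspace \<Rightarrow> 'k \<Rightarrow> ('i \<Rightarrow> 'h + 'k) \<Rightarrow> 'i hspace \<Rightarrow> 'i \<Rightarrow>
      (('i \<times> ((('h + 'k) list \<Rightarrow> complex) \<Rightarrow> complex) \<Rightarrow> complex) \<Rightarrow> complex) \<Rightarrow>
      (('h + 'k) list \<Rightarrow> complex) \<Rightarrow> complex"
  where "leg_unitary H1 \<xi>1 H2 \<xi>2 \<iota> Hi \<xi>i =
    (let L = leg_space H1 \<xi>1 H2 \<xi>2 \<iota>; e = word_vector H1 \<xi>1 H2 \<xi>2 in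
     THE U. U \<in> bop (htensor Hi L) (free_space H1 \<xi>1 H2 \<xi>2) \<and>
       (\<forall>w\<in>leg_words H1 \<xi>1 H2 \<xi>2 \<iota>.
          U (elem_tensor Hi L \<xi>i (e w)) = e w \<and>
          (\<forall>x\<in>hcarrier Hi. hinner Hi x \<xi>i = 0 \<longrightarrow>
             U (elem_tensor Hi L x (e w)) = e (\<iota> x # w))))"

definition leg_action ::
    "'h hspace \<Rightarrow> 'h \<Rightarrow> 'k hspace \<Rightarrow> 'k \<Rightarrow> ('i \<Rightarrow> 'h + 'k) \<Rightarrow> 'i hspace \<Rightarrow> 'i \<Rightarrow>
      ('i \<Rightarrow> 'i) \<Rightarrow> ((('h + 'k) list \<Rightarrow> complex) \<Rightarrow> complex) \<Rightarrow>
      (('h + 'k) list \<Rightarrow> complex) \<Rightarrow> complex"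
  where "leg_action H1 \<xi>1 H2 \<xi>2 \<iota> Hi \<xi>i T =
    (let L = leg_space H1 \<xi>1 H2 \<xi>2 \<iota>; V = leg_unitary H1 \<xi>1 H2 \<xi>2 \<iota> Hi \<xi>i in
     V \<circ> tensor_id Hi L T \<circ> adj (htensor Hi L) (free_space H1 \<xi>1 H2 \<xi>2) V)"

definition free_product_space ::
    "('a::unital_cstar_algebra \<Rightarrow> complex) \<Rightarrow> ('b::unital_cstar_algebra \<Rightarrow> complex) \<Rightarrow>
      (((('a \<Rightarrow> complex) + ('b \<Rightarrow> complex)) list \<Rightarrow> complex) \<Rightarrow> complex) hspace"
  where "free_product_space \<tau>1 \<tau>2 =
    free_space (gns_space \<tau>1) (gns_vector \<tau>1) (gns_space \<tau>2) (gns_vector \<tau>2)"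

definition free_rep1 ::
    "('a::unital_cstar_algebra \<Rightarrow> complex) \<Rightarrow> ('b::unital_cstar_algebra \<Rightarrow> complex) \<Rightarrow> 'a \<Rightarrow>
      (((('a \<Rightarrow> complex) + ('b \<Rightarrow> complex)) list \<Rightarrow> complex) \<Rightarrow> complex) \<Rightarrow>
      ((('a \<Rightarrow> complex) + ('b \<Rightarrow> complex)) list \<Rightarrow> complex) \<Rightarrow> complex"
  where "free_rep1 \<tau>1 \<tau>2 a =
    leg_action (gns_space \<tau>1) (gns_vector \<tau>1) (gns_space \<tau>2) (gns_vector \<tau>2)
      Inl (gns_space \<tau>1) (gns_vector \<tau>1) (gns_rep \<tau>1 a)"

definition free_rep2 ::
    "('a::unital_cstar_algebra \<Rightarrow> complex) \<Rightarrow> ('b::unital_cstar_algebra \<Rightarrow> complex) \<Rightarrow> 'b \<Rightarrow>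
      (((('a \<Rightarrow> complex) + ('b \<Rightarrow> complex)) list \<Rightarrow> complex) \<Rightarrow> complex) \<Rightarrow>
      ((('a \<Rightarrow> complex) + ('b \<Rightarrow> complex)) list \<Rightarrow> complex) \<Rightarrow> complex"
  where "free_rep2 \<tau>1 \<tau>2 b =
    leg_action (gns_space \<tau>1) (gns_vector \<tau>1) (gns_space \<tau>2) (gns_vector \<tau>2)
      Inr (gns_space \<tau>2) (gns_vector \<tau>2) (gns_rep \<tau>2 b)"

definition reduced_free_product ::
    "('a::unital_cstar_algebra \<Rightarrow> complex) \<Rightarrow> ('b::unital_cstar_algebra \<Rightarrow> complex) \<Rightarrow>
      ((((('a \<Rightarrow> complex) + ('b \<Rightarrow> complex)) list \<Rightarrow> complex) \<Rightarrow> complex) \<Rightarrow>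
       ((('a \<Rightarrow> complex) + ('b \<Rightarrow> complex)) list \<Rightarrow> complex) \<Rightarrow> complex) set"
  where "reduced_free_product \<tau>1 \<tau>2 = cstar_generated (free_product_space \<tau>1 \<tau>2)
    (range (free_rep1 \<tau>1 \<tau>2) \<union> range (free_rep2 \<tau>1 \<tau>2))"

definition avitzour_condition ::
    "('a::unital_cstar_algebra \<Rightarrow> complex) \<Rightarrow> ('b::unital_cstar_algebra \<Rightarrow> complex) \<Rightarrow> bool"
  where "avitzour_condition \<tau>1 \<tau>2 \<longleftrightarrow> (\<exists>u v w. unitary u \<and> unitary v \<and> unitary w \<and>
    \<tau>1 u = 0 \<and> \<tau>2 v = 0 \<and> \<tau>2 w = 0 \<and> \<tau>2 (star w * v) = 0)"

end

theory Submission
  imports Defs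
begin

text \<open>Let \<open>A\<close> be the reduced free product. For \<open>C\<^sub>j = (vu)\<^sup>j w\<close> the unitaries \<open>U\<^sub>j = C\<^sub>j u C\<^sub>j\<^sup>*\<close> of \<open>A\<close> map the
  complements of certain pairwise orthogonal subspaces into these subspaces, as in Powers' proof that
  reduced free group algebras are simple. Hence \<open>\<parallel>\<Sum>\<^sub>j U\<^sub>j \<otimes> c\<^sub>j\<parallel> \<le> 2 \<surd>n\<close> for \<open>n\<close> scalar contraction
  matrices \<open>c\<^sub>j\<close>, and this survives in any representation \<open>\<pi>\<close> of \<open>A\<close>. If \<open>A\<close> were quasidiagonal, a finite
  rank projection \<open>q\<close> would almost commute with all \<open>\<pi>(U\<^sub>j)\<close>; taking for \<open>c\<^sub>j\<close> the complex conjugate of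
  \<open>q \<pi>(U\<^sub>j) q\<close>, the normalized vector \<open>\<Sum> f\<^sub>b \<otimes> f\<^sub>b\<close> over an orthonormal basis of the range of \<open>q\<close> is almost
  fixed by every \<open>\<pi>(U\<^sub>j) \<otimes> c\<^sub>j\<close>, so that the norm is close to \<open>n\<close>. This is absurd for \<open>n = 100\<close>.\<close>

section \<open>Semi-inner products, the Riesz theorem and orthogonal projection\<close>

section \<open>Spaces with a positive semidefinite form\<close>

text \<open>A unitary matrix tensored with its complex conjugate fixes the vector
  \<open>\<Sum> f\<^sub>b \<otimes> f\<^sub>b\<close>; the corners of the
  \<open>\<pi>(U\<^sub>j)\<close> are only nearly unitary, so constants matter. The norm estimate
  reaches \<open>\<pi>\<close> through a factorization \<open>1 - X\<^sup>* X = Y\<^sup>* Y\<close>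
  in matrices over \<open>A\<close>. Here \<open>Y\<close> comes from a contraction that requires
  \<open>X\<close> of norm at most 1/2, so a factor 2 is lost and 2 sqrt n becomes 4 sqrt n. Almost
  invariance up to 1/4 gives the lower bound (3/4)^2 n = 9n/16, and 4 sqrt n < 9n/16 for n > 50; the
  choice 100 has the integral root 10. A second obstacle is that \<open>\<pi>\<close> may fail to be
  unital. The image \<open>e\<close> of the unit is a projection, and the finite rank projection
  \<open>q\<close> must lie below it, because the \<open>\<pi>(U\<^sub>j)\<close> are isometric only
  there. The given projections \<open>p\<close> merely almost commute with \<open>e\<close>; so
  \<open>e p e\<close> is formed and replaced by a nearby true projection. Both the square root and
  this correction are fixed points of contractions on norm closed sets of operators, in place of
  spectral theory.\<close>

locale semi_inner =
  fixes H :: "'h::complex_vector hspace"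
  assumes subspace_carrier: "complex_vector.subspace (hcarrier H)"
    and hinner_add_left: "\<lbrakk>x \<in> hcarrier H; y \<in> hcarrier H; z \<in> hcarrier H\<rbrakk>
      \<Longrightarrow> hinner H (x + y) z = hinner H x z + hinner H y z"
    and hinner_scale_left: "\<lbrakk>x \<in> hcarrier H; y \<in> hcarrier H\<rbrakk>
      \<Longrightarrow> hinner H (c *\<^sub>C x) y = c * hinner H x y"
    and hinner_commute: "\<lbrakk>x \<in> hcarrier H; y \<in> hcarrier H\<rbrakk> \<Longrightarrow> hinner H y x = cnj (hinner H x y)"
    and hinner_nonneg: "x \<in> hcarrier H \<Longrightarrow> hinner H x x \<in> \<real>\<^sub>\<ge>\<^sub>0"
begin

lemma zero_closed [simp, intro]: "0 \<in> hcarrier H"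
  using subspace_carrier by (rule complex_vector.subspace_0)

lemma add_closed [simp, intro]: "x \<in> hcarrier H \<Longrightarrow> y \<in> hcarrier H \<Longrightarrow> x + y \<in> hcarrier H"
  using subspace_carrier by (rule complex_vector.subspace_add)

lemma scale_closed [simp, intro]: "x \<in> hcarrier H \<Longrightarrow> c *\<^sub>C x \<in> hcarrier H"
  using subspace_carrier by (rule complex_vector.subspace_scale)

lemma diff_closed [simp, intro]: "x \<in> hcarrier H \<Longrightarrow> y \<in> hcarrier H \<Longrightarrow> x - y \<in> hcarrier H"
  using subspace_carrier by (rule complex_vector.subspace_diff)

lemma minus_closed [simp, intro]: "x \<in> hcarrier H \<Longrightarrow> - x \<in> hcarrier H"
  using subspace_carrier by (rule complex_vector.subspace_neg)

lemma sum_closed [simp, intro]: "(\<And>i. i \<in> I \<Longrightarrow> f i \<in> hcarrier H) \<Longrightarrow> sum f I \<in> hcarrier H"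
  using subspace_carrier by (rule complex_vector.subspace_sum)

lemma span_closed: "S \<subseteq> hcarrier H \<Longrightarrow> x \<in> complex_vector.span S \<Longrightarrow> x \<in> hcarrier H"
  using complex_vector.span_minimal[OF _ subspace_carrier] by blast

lemma hinner_zero_left [simp]: "y \<in> hcarrier H \<Longrightarrow> hinner H 0 y = 0"
  using hinner_scale_left[of 0 y 0] by simp

lemma hinner_zero_right [simp]: "y \<in> hcarrier H \<Longrightarrow> hinner H y 0 = 0"
  using hinner_commute[of 0 y] by simp

lemma hinner_add_right: "\<lbrakk>x \<in> hcarrier H; y \<in> hcarrier H; z \<in> hcarrier H\<rbrakk>
    \<Longrightarrow> hinner H z (x + y) = hinner H z x + hinner H z y"
  by (simp add: hinner_commute[of _ z] hinner_add_left)

lemma hinner_scale_right: "\<lbrakk>x \<in> hcarrier H; y \<in> hcarrier H\<rbrakk>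
    \<Longrightarrow> hinner H y (c *\<^sub>C x) = cnj c * hinner H y x"
  by (simp add: hinner_commute[of _ y] hinner_scale_left)

lemma hinner_minus_left: "\<lbrakk>x \<in> hcarrier H; y \<in> hcarrier H\<rbrakk> \<Longrightarrow> hinner H (- x) y = - hinner H x y"
  using hinner_add_left[of x "- x" y] by (simp add: eq_neg_iff_add_eq_0 add.commute)

lemma hinner_minus_right: "\<lbrakk>x \<in> hcarrier H; y \<in> hcarrier H\<rbrakk> \<Longrightarrow> hinner H y (- x) = - hinner H y x"
  by (simp add: hinner_commute[of _ y] hinner_minus_left)

lemma hinner_diff_left: "\<lbrakk>x \<in> hcarrier H; y \<in> hcarrier H; z \<in> hcarrier H\<rbrakk>
    \<Longrightarrow> hinner H (x - y) z = hinner H x z - hinner H y z"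
  using hinner_add_left[of x "- y" z] by (simp add: hinner_minus_left)

lemma hinner_diff_right: "\<lbrakk>x \<in> hcarrier H; y \<in> hcarrier H; z \<in> hcarrier H\<rbrakk>
    \<Longrightarrow> hinner H z (x - y) = hinner H z x - hinner H z y"
  using hinner_add_right[of x "- y" z] by (simp add: hinner_minus_right)

lemma hinner_sum_left: "\<lbrakk>\<And>i. i \<in> I \<Longrightarrow> f i \<in> hcarrier H; y \<in> hcarrier H\<rbrakk>
    \<Longrightarrow> hinner H (\<Sum>i\<in>I. f i) y = (\<Sum>i\<in>I. hinner H (f i) y)"
  by (induction I rule: infinite_finite_induct) (simp_all add: hinner_add_left)

lemma hinner_sum_right: "\<lbrakk>\<And>i. i \<in> I \<Longrightarrow> f i \<in> hcarrier H; y \<in> hcarrier H\<rbrakk>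
    \<Longrightarrow> hinner H y (\<Sum>i\<in>I. f i) = (\<Sum>i\<in>I. hinner H y (f i))"
  by (induction I rule: infinite_finite_induct) (simp_all add: hinner_add_right)

lemmas hinner_simps = hinner_add_left hinner_add_right hinner_diff_left hinner_diff_right
  hinner_scale_left hinner_scale_right hinner_minus_left hinner_minus_right

lemma Re_hinner_self: "x \<in> hcarrier H \<Longrightarrow> Re (hinner H x x) = (hnorm H x)\<^sup>2"
  using hinner_nonneg[of x] by (simp add: hnorm_def complex_nonneg_Reals_iff)

lemma hinner_self: "x \<in> hcarrier H \<Longrightarrow> hinner H x x = complex_of_real ((hnorm H x)\<^sup>2)"
  using hinner_nonneg[of x] Re_hinner_self[of x] by (simp add: complex_eq_iff complex_nonneg_Reals_iff)

lemma hnorm_nonneg [simp]: "x \<in> hcarrier H \<Longrightarrow> 0 \<le> hnorm H x"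
  using hinner_nonneg[of x] by (simp add: hnorm_def complex_nonneg_Reals_iff)

lemma hnorm_zero [simp]: "hnorm H 0 = 0"
  by (simp add: hnorm_def)

lemma hnorm_scale: "x \<in> hcarrier H \<Longrightarrow> hnorm H (c *\<^sub>C x) = cmod c * hnorm H x"
proof -
  assume x: "x \<in> hcarrier H"
  have "complex_of_real ((hnorm H (c *\<^sub>C x))\<^sup>2) = c * cnj c * complex_of_real ((hnorm H x)\<^sup>2)"
    using x by (simp add: hinner_self[symmetric] hinner_simps del: of_real_power)
  also have "\<dots> = complex_of_real ((cmod c * hnorm H x)\<^sup>2)"
    by (simp only: complex_norm_square[symmetric] of_real_mult[symmetric] power_mult_distrib
        of_real_power[symmetric])
  finally have "(hnorm H (c *\<^sub>C x))\<^sup>2 = (cmod c * hnorm H x)\<^sup>2"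
    by (simp only: of_real_eq_iff)
  then show ?thesis
    using x by (simp add: power2_eq_iff_nonneg)
qed

lemma hnorm_minus: "x \<in> hcarrier H \<Longrightarrow> hnorm H (- x) = hnorm H x"
  using hnorm_scale[of x "-1"] by simp

lemma hnorm_minus_commute: "x \<in> hcarrier H \<Longrightarrow> y \<in> hcarrier H \<Longrightarrow> hnorm H (x - y) = hnorm H (y - x)"
  using hnorm_minus[of "x - y"] by simp

lemma hnorm_add_square: "x \<in> hcarrier H \<Longrightarrow> y \<in> hcarrier H \<Longrightarrow>
    (hnorm H (x + y))\<^sup>2 = (hnorm H x)\<^sup>2 + (hnorm H y)\<^sup>2 + 2 * Re (hinner H x y)"
  by (simp add: Re_hinner_self[symmetric] hinner_simps hinner_commute[of x y])

lemma hnorm_diff_square: "x \<in> hcarrier H \<Longrightarrow> y \<in> hcarrier H \<Longrightarrow>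
    (hnorm H (x - y))\<^sup>2 = (hnorm H x)\<^sup>2 + (hnorm H y)\<^sup>2 - 2 * Re (hinner H x y)"
  by (simp add: Re_hinner_self[symmetric] hinner_simps hinner_commute[of x y])

lemma parallelogram: "x \<in> hcarrier H \<Longrightarrow> y \<in> hcarrier H \<Longrightarrow>
    (hnorm H (x + y))\<^sup>2 + (hnorm H (x - y))\<^sup>2 = 2 * (hnorm H x)\<^sup>2 + 2 * (hnorm H y)\<^sup>2"
  by (simp add: hnorm_add_square hnorm_diff_square)

text \<open>The squared seminorm of \<open>x - t a y\<close>, with \<open>a\<close> the inner
  product, is a quadratic in the real variable \<open>t\<close> that is never negative. The form may
  be degenerate, so \<open>hnorm H y = 0\<close> is a genuine case: the quadratic is then affine in
  \<open>t\<close> and its slope must vanish.\<close>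

lemma Cauchy_Schwarz:
  assumes x: "x \<in> hcarrier H" and y: "y \<in> hcarrier H"
  shows "cmod (hinner H x y) \<le> hnorm H x * hnorm H y"
proof -
  define a where "a = hinner H x y"
  have quad: "0 \<le> (hnorm H x)\<^sup>2 + t\<^sup>2 * (cmod a)\<^sup>2 * (hnorm H y)\<^sup>2 - 2 * t * (cmod a)\<^sup>2" for t :: real
  proof -
    let ?c = "complex_of_real t * a"
    have "0 \<le> (hnorm H (x - ?c *\<^sub>C y))\<^sup>2" by simp
    also have "\<dots> = (hnorm H x)\<^sup>2 + (cmod ?c * hnorm H y)\<^sup>2 - 2 * Re (cnj ?c * a)"
      using x y by (simp add: hnorm_diff_square hnorm_scale hinner_scale_right a_def)
    also have "Re (cnj ?c * a) = t * (cmod a)\<^sup>2"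
      by (simp only: cmod_power2) (simp add: power2_eq_square algebra_simps)
    also have "(cmod ?c * hnorm H y)\<^sup>2 = t\<^sup>2 * (cmod a)\<^sup>2 * (hnorm H y)\<^sup>2"
      by (simp add: norm_mult power_mult_distrib)
    finally show ?thesis by simp
  qed
  show ?thesis
  proof (cases "hnorm H y = 0")
    case True
    have "(cmod a)\<^sup>2 \<le> 0"
    proof (rule ccontr)
      assume c: "\<not> (cmod a)\<^sup>2 \<le> 0"
      \<comment> \<open>At this value of \<open>t\<close> the affine function would equal
        -1.\<close>
      have "2 * (((hnorm H x)\<^sup>2 + 1) / (2 * (cmod a)\<^sup>2)) * (cmod a)\<^sup>2 = (hnorm H x)\<^sup>2 + 1"
        using c by simp
      then show False
        using quad[of "((hnorm H x)\<^sup>2 + 1) / (2 * (cmod a)\<^sup>2)"] True by simp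
    qed
    then show ?thesis using x y True by (simp add: a_def)
  next
    case False
    define N where "N = (hnorm H y)\<^sup>2"
    have N: "N > 0" using False by (simp add: N_def)
    have "0 \<le> (hnorm H x)\<^sup>2 + (1/N)\<^sup>2 * (cmod a)\<^sup>2 * N - 2 * (1/N) * (cmod a)\<^sup>2"
      using quad[of "1/N"] by (simp add: N_def)
    also have "\<dots> = (hnorm H x)\<^sup>2 - (cmod a)\<^sup>2 / N"
      using N by (simp add: power2_eq_square field_simps)
    finally have "(cmod a)\<^sup>2 \<le> (hnorm H x * hnorm H y)\<^sup>2"
      using N by (simp add: field_simps N_def power_mult_distrib)
    then show ?thesis
      using x y by (simp add: a_def power2_le_iff_abs_le)
  qed
qed

lemma hnorm_triangle:
  assumes x: "x \<in> hcarrier H" and y: "y \<in> hcarrier H"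
  shows "hnorm H (x + y) \<le> hnorm H x + hnorm H y"
proof -
  have "Re (hinner H x y) \<le> hnorm H x * hnorm H y"
    using Cauchy_Schwarz[OF x y] complex_Re_le_cmod order_trans by blast
  then have "(hnorm H (x + y))\<^sup>2 \<le> (hnorm H x + hnorm H y)\<^sup>2"
    using x y by (simp add: hnorm_add_square power2_sum)
  then show ?thesis
    using x y by (simp add: power2_le_iff_abs_le)
qed

lemma hnorm_triangle_diff: "x \<in> hcarrier H \<Longrightarrow> y \<in> hcarrier H \<Longrightarrow> hnorm H (x - y) \<le> hnorm H x + hnorm H y"
  using hnorm_triangle[of x "- y"] by (simp add: hnorm_minus)

lemma hnorm_triangle_mid: "\<lbrakk>x \<in> hcarrier H; y \<in> hcarrier H; z \<in> hcarrier H\<rbrakk>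
    \<Longrightarrow> hnorm H (x - z) \<le> hnorm H (x - y) + hnorm H (y - z)"
  using hnorm_triangle[of "x - y" "y - z"] by simp

lemma hnorm_triangle_sub: "x \<in> hcarrier H \<Longrightarrow> y \<in> hcarrier H \<Longrightarrow> \<bar>hnorm H x - hnorm H y\<bar> \<le> hnorm H (x - y)"
  using hnorm_triangle[of "x - y" y] hnorm_triangle[of "y - x" x] hnorm_minus_commute[of x y] by simp

lemma hnorm_sum_le: "(\<And>i. i \<in> I \<Longrightarrow> f i \<in> hcarrier H) \<Longrightarrow> hnorm H (sum f I) \<le> (\<Sum>i\<in>I. hnorm H (f i))"
proof (induction I rule: infinite_finite_induct)
  case (insert i I)
  then show ?case
    using hnorm_triangle[of "f i" "sum f I"] by fastforce
qed simp_all

lemma Pythagoras_sum: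
  assumes "finite I" "\<And>i. i \<in> I \<Longrightarrow> f i \<in> hcarrier H"
    and "\<And>i j. i \<in> I \<Longrightarrow> j \<in> I \<Longrightarrow> i \<noteq> j \<Longrightarrow> hinner H (f i) (f j) = 0"
  shows "(hnorm H (sum f I))\<^sup>2 = (\<Sum>i\<in>I. (hnorm H (f i))\<^sup>2)"
  using assms
proof (induction I)
  case (insert i I)
  have "hinner H (f i) (sum f I) = 0"
    using insert by (subst hinner_sum_right) (auto intro!: sum.neutral)
  with insert show ?case by (simp add: hnorm_add_square)
qed simp

lemma hcauchy_carrier: "hcauchy H x \<Longrightarrow> x n \<in> hcarrier H"
  by (simp add: hcauchy_def)

lemma hcauchyD: "hcauchy H x \<Longrightarrow> e > 0 \<Longrightarrow> \<exists>N. \<forall>m\<ge>N. \<forall>n\<ge>N. hnorm H (x m - x n) < e"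
  by (simp add: hcauchy_def)

lemma htendstoI:
  assumes "\<And>n. hnorm H (x n - l) \<le> b n" "b \<longlonglongrightarrow> 0" "\<And>n. x n \<in> hcarrier H" "l \<in> hcarrier H"
  shows "htendsto H x l"
  unfolding htendsto_def
  by (rule tendsto_sandwich[OF _ _ tendsto_const assms(2)]) (use assms in auto)

lemma htendsto_hinner:
  assumes "\<And>n. x n \<in> hcarrier H" "l \<in> hcarrier H" "htendsto H x l" "y \<in> hcarrier H"
  shows "(\<lambda>n. hinner H (x n) y) \<longlonglongrightarrow> hinner H l y"
proof -
  have "(\<lambda>n. hinner H (x n) y - hinner H l y) \<longlonglongrightarrow> 0"
  proof (rule Lim_null_comparison)
    show "\<forall>\<^sub>F n in sequentially. norm (hinner H (x n) y - hinner H l y) \<le> hnorm H (x n - l) * hnorm H y"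
      using assms Cauchy_Schwarz[of "x _ - l" y] by (simp add: hinner_diff_left)
    show "(\<lambda>n. hnorm H (x n - l) * hnorm H y) \<longlonglongrightarrow> 0"
      using assms(3) tendsto_mult_left_zero unfolding htendsto_def by blast
  qed
  then show ?thesis by (rule LIM_zero_cancel)
qed

lemma htendsto_hnorm:
  assumes "\<And>n. x n \<in> hcarrier H" "l \<in> hcarrier H" "htendsto H x l"
  shows "(\<lambda>n. hnorm H (x n)) \<longlonglongrightarrow> hnorm H l"
proof -
  have "(\<lambda>n. hnorm H (x n) - hnorm H l) \<longlonglongrightarrow> 0"
    by (rule Lim_null_comparison[OF _ assms(3)[unfolded htendsto_def]])
       (use assms hnorm_triangle_sub in auto)
  then show ?thesis by (rule LIM_zero_cancel)
qed

lemma htendsto_add: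
  assumes "\<And>n. x n \<in> hcarrier H" "l \<in> hcarrier H" "htendsto H x l"
    "\<And>n. y n \<in> hcarrier H" "m \<in> hcarrier H" "htendsto H y m"
  shows "htendsto H (\<lambda>n. x n + y n) (l + m)"
proof (rule htendstoI[where b = "\<lambda>n. hnorm H (x n - l) + hnorm H (y n - m)"])
  show "hnorm H (x n + y n - (l + m)) \<le> hnorm H (x n - l) + hnorm H (y n - m)" for n
    using hnorm_triangle[of "x n - l" "y n - m"] assms by (simp add: add_diff_add)
  show "(\<lambda>n. hnorm H (x n - l) + hnorm H (y n - m)) \<longlonglongrightarrow> 0"
    using assms tendsto_add[of _ 0 sequentially _ 0] unfolding htendsto_def by fastforce
qed (use assms in auto)

lemma htendsto_scale:
  assumes "\<And>n. x n \<in> hcarrier H" "l \<in> hcarrier H" "htendsto H x l"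
  shows "htendsto H (\<lambda>n. c *\<^sub>C x n) (c *\<^sub>C l)"
proof (rule htendstoI[where b = "\<lambda>n. cmod c * hnorm H (x n - l)"])
  show "hnorm H (c *\<^sub>C x n - c *\<^sub>C l) \<le> cmod c * hnorm H (x n - l)" for n
    using hnorm_scale[of "x n - l" c] assms by (simp add: complex_vector.scale_right_diff_distrib)
  show "(\<lambda>n. cmod c * hnorm H (x n - l)) \<longlonglongrightarrow> 0"
    using assms tendsto_mult_right_zero unfolding htendsto_def by blast
qed (use assms in auto)

end

text \<open>Definiteness and completeness are separated from \<open>semi_inner\<close> because the
  GNS form on the algebra and the form on formal combinations have only the weaker properties until
  they are completed.\<close>

locale hilb = semi_inner +
  assumes hinner_definite: "x \<in> hcarrier H \<Longrightarrow> hinner H x x = 0 \<Longrightarrow> x = 0"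
    and complete: "hcauchy H s \<Longrightarrow> \<exists>l\<in>hcarrier H. htendsto H s l"

lemma hilb_of_hilbert_space:
  assumes "hilbert_space H"
  shows "hilb H"
proof -
  note * = assms[unfolded hilbert_space_def]
  note c1 = *[THEN conjunct1] and c2 = *[THEN conjunct2]
  note d1 = c2[THEN conjunct1] and d2 = c2[THEN conjunct2]
  note e1 = d2[THEN conjunct1] and e2 = d2[THEN conjunct2]
  note f1 = e2[THEN conjunct1] and f2 = e2[THEN conjunct2]
  note g1 = f2[THEN conjunct1] and g2 = f2[THEN conjunct2]
  show ?thesis
    by (unfold_locales; (rule c1 d1[rule_format] e1[rule_format] f1[rule_format] g1[rule_format]
        g2[THEN conjunct1, rule_format] g2[THEN conjunct2, rule_format]; assumption))
qed

context hilb
begin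

lemma hnorm_eq_0_iff: "x \<in> hcarrier H \<Longrightarrow> hnorm H x = 0 \<longleftrightarrow> x = 0"
  using hinner_definite[of x] hinner_self[of x] by auto

lemma hinner_eqI:
  assumes "x \<in> hcarrier H" "y \<in> hcarrier H" "\<And>z. z \<in> hcarrier H \<Longrightarrow> hinner H x z = hinner H y z"
  shows "x = y"
proof -
  have "hinner H (x - y) (x - y) = 0" using assms by (simp add: hinner_diff_left)
  then show ?thesis using hinner_definite[of "x - y"] assms by simp
qed

lemma htendsto_unique:
  assumes "\<And>n. x n \<in> hcarrier H" "l \<in> hcarrier H" "m \<in> hcarrier H" "htendsto H x l" "htendsto H x m"
  shows "l = m"
  by (rule hinner_eqI[OF assms(2,3)])
     (rule LIMSEQ_unique[OF htendsto_hinner[OF assms(1,2,4)] htendsto_hinner[OF assms(1,3,5)]])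

text \<open>The representing vector minimises \<open>\<parallel>x\<parallel>\<^sup>2 - 2 Re \<phi>(x)\<close>.\<close>

lemma Riesz_representation:
  assumes add: "\<And>x y. x \<in> hcarrier H \<Longrightarrow> y \<in> hcarrier H \<Longrightarrow> \<phi> (x + y) = \<phi> x + \<phi> y"
    and scale: "\<And>c x. x \<in> hcarrier H \<Longrightarrow> \<phi> (c *\<^sub>C x) = c * \<phi> x"
    and bdd: "\<And>x. x \<in> hcarrier H \<Longrightarrow> cmod (\<phi> x) \<le> C * hnorm H x"
  shows "\<exists>y\<in>hcarrier H. \<forall>x\<in>hcarrier H. \<phi> x = hinner H x y"
proof -
  define J where "J x = (hnorm H x)\<^sup>2 - 2 * Re (\<phi> x)" for x
  have Jlow: "- (C\<^sup>2) \<le> J x" if x: "x \<in> hcarrier H" for x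
  proof -
    have "Re (\<phi> x) \<le> C * hnorm H x"
      using bdd[OF x] complex_Re_le_cmod order_trans by blast
    moreover have "0 \<le> (hnorm H x - C)\<^sup>2" by simp
    ultimately show ?thesis by (simp add: J_def power2_diff mult.commute)
  qed
  define a where "a = Inf (J ` hcarrier H)"
  have bb: "bdd_below (J ` hcarrier H)" using Jlow by (auto intro!: bdd_belowI2)
  have a_le: "a \<le> J x" if "x \<in> hcarrier H" for x
    unfolding a_def using that bb by (auto intro: cInf_lower)
  have "\<exists>x\<in>hcarrier H. J x < a + 1 / real (Suc n)" for n
    using cInf_lessD[of "J ` hcarrier H" "a + 1 / real (Suc n)"] zero_closed unfolding a_def by force
  then obtain s where s: "\<And>n. s n \<in> hcarrier H" "\<And>n. J (s n) < a + 1 / real (Suc n)"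
    by metis
  \<comment> \<open>The value of \<open>J\<close> at a midpoint cannot lie below the infimum
    \<open>a\<close>, so the parallelogram law bounds the distance of two near-minimisers. A
    minimising sequence is therefore Cauchy.\<close>
  have mid: "(hnorm H (x - y))\<^sup>2 \<le> 2 * (J x - a) + 2 * (J y - a)"
    if x: "x \<in> hcarrier H" and y: "y \<in> hcarrier H" for x y
  proof -
    have "J ((1/2) *\<^sub>C (x + y)) = (hnorm H (x + y))\<^sup>2 / 4 - Re (\<phi> x) - Re (\<phi> y)"
      using x y unfolding J_def hnorm_scale[OF add_closed[OF x y]] scale[OF add_closed[OF x y]]
      by (simp add: add power_divide field_simps)
    then show ?thesis
      using a_le[of "(1/2) *\<^sub>C (x + y)"] parallelogram[OF x y] x y by (simp add: J_def)
  qed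
  have "hcauchy H s"
    unfolding hcauchy_def
  proof (intro conjI allI impI)
    fix e :: real assume e: "e > 0"
    obtain N where N: "1 / real (Suc N) < e\<^sup>2 / 4"
      using e nat_approx_posE[of "e\<^sup>2 / 4"] by auto
    have "hnorm H (s m - s n) < e" if mn: "m \<ge> N" "n \<ge> N" for m n
    proof -
      have "1 / real (Suc m) \<le> 1 / real (Suc N)" "1 / real (Suc n) \<le> 1 / real (Suc N)"
        using mn by (auto simp: field_simps)
      then have "J (s m) - a < e\<^sup>2 / 4" "J (s n) - a < e\<^sup>2 / 4"
        using s(2)[of m] s(2)[of n] N by auto
      then have "(hnorm H (s m - s n))\<^sup>2 < e\<^sup>2"
        using mid[OF s(1) s(1), of m n] by argo
      then show ?thesis using e by (simp add: power2_less_imp_less)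
    qed
    then show "\<exists>N. \<forall>m\<ge>N. \<forall>n\<ge>N. hnorm H (s m - s n) < e" by blast
  qed (rule s)
  then obtain y where y: "y \<in> hcarrier H" "htendsto H s y" using complete by blast
  have "(\<lambda>n. \<phi> (s n) - \<phi> y) \<longlonglongrightarrow> 0"
  proof (rule Lim_null_comparison)
    have "\<phi> (s n) - \<phi> y = \<phi> (s n - y)" for n
      using add[of "s n - y" y] s(1)[of n] y(1) by simp
    then show "\<forall>\<^sub>F n in sequentially. norm (\<phi> (s n) - \<phi> y) \<le> C * hnorm H (s n - y)"
      using bdd s(1) y(1) by simp
    show "(\<lambda>n. C * hnorm H (s n - y)) \<longlonglongrightarrow> 0"
      using y(2) tendsto_mult_right_zero unfolding htendsto_def by blast
  qed
  then have "(\<lambda>n. \<phi> (s n)) \<longlonglongrightarrow> \<phi> y" by (rule LIM_zero_cancel)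
  moreover have "(\<lambda>n. hnorm H (s n)) \<longlonglongrightarrow> hnorm H y" using htendsto_hnorm s(1) y by blast
  ultimately have "(\<lambda>n. J (s n)) \<longlonglongrightarrow> J y" unfolding J_def by (intro tendsto_intros)
  moreover have "(\<lambda>n. a + 1 / real (Suc n)) \<longlonglongrightarrow> a"
    using LIMSEQ_Suc[OF lim_1_over_n] tendsto_add[OF tendsto_const, of _ 0 sequentially a] by fastforce
  ultimately have "J y \<le> a"
    using s(2) by (intro LIMSEQ_le[of "\<lambda>n. J (s n)"]) (auto intro: less_imp_le)
  then have min: "J y \<le> J x" if "x \<in> hcarrier H" for x using a_le[OF that] by simp
  have "\<phi> x = hinner H x y" if x: "x \<in> hcarrier H" for x
  proof -
    define p where "p = hinner H x y - \<phi> x"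
    define M where "M = (hnorm H x)\<^sup>2 + 1"
    have M: "M > 0" by (simp add: M_def add_nonneg_pos)
    \<comment> \<open>Perturbation of the minimiser along \<open>- cnj p\<close> with step 1/M; the
      summand 1 in \<open>M\<close> keeps it positive when \<open>x = 0\<close>. The change of
      \<open>J\<close> is \<open>(cmod p)\<^sup>2 / M\<close> times a number below -1, hence
      negative unless \<open>p = 0\<close>.\<close>
    define c where "c = - complex_of_real (1 / M) * cnj p"
    have "J (c *\<^sub>C x + y) = (cmod c * hnorm H x)\<^sup>2 + (hnorm H y)\<^sup>2 + 2 * Re (c * hinner H x y)
        - 2 * (Re (c * \<phi> x) + Re (\<phi> y))"
      using x y unfolding J_def hnorm_add_square[OF scale_closed[OF x] y(1)] hnorm_scale[OF x]
        add[OF scale_closed[OF x] y(1)] scale[OF x] hinner_scale_left[OF x y(1)] by simp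
    also have "\<dots> = J y + (cmod c * hnorm H x)\<^sup>2 + 2 * Re (c * p)"
      unfolding J_def p_def right_diff_distrib by simp
    finally have "0 \<le> (cmod c * hnorm H x)\<^sup>2 + 2 * Re (c * p)"
      using min[of "c *\<^sub>C x + y"] x y by simp
    also have "c * p = complex_of_real (- (cmod p)\<^sup>2 / M)"
      unfolding c_def using complex_norm_square[of p] by (simp add: mult.commute)
    also have "(cmod c * hnorm H x)\<^sup>2 = (cmod p)\<^sup>2 / M * ((M - 1) / M)"
    proof -
      have "cmod c = cmod p / M" using M by (simp add: c_def norm_mult norm_divide)
      moreover have "(hnorm H x)\<^sup>2 = M - 1" by (simp add: M_def)
      ultimately show ?thesis by (simp add: power_mult_distrib power_divide) (simp add: power2_eq_square)
    qed
    finally have "0 \<le> (cmod p)\<^sup>2 / M * ((M - 1) / M) - (cmod p)\<^sup>2 / M * 2"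
      by (simp add: mult.commute)
    then have "0 \<le> (cmod p)\<^sup>2 / M * ((M - 1) / M - 2)" by (simp only: right_diff_distrib)
    moreover have "(M - 1) / M - 2 < 0" using M by (simp add: field_simps)
    ultimately have "(cmod p)\<^sup>2 / M \<le> 0" by (meson mult_pos_neg not_le)
    then have "p = 0" using M by (simp add: divide_le_0_iff)
    then show ?thesis by (simp add: p_def)
  qed
  with y show ?thesis by blast
qed

text \<open>A closed subspace is itself a Hilbert space, and the vector that represents the
  functional \<open>y \<mapsto> hinner H y x\<close> on it is the projection of
  \<open>x\<close>.\<close>

lemma orthogonal_projection_ex:
  assumes sub: "complex_vector.subspace M" "M \<subseteq> hcarrier H"
    and closed: "\<And>s l. (\<And>n. s n \<in> M) \<Longrightarrow> l \<in> hcarrier H \<Longrightarrow> htendsto H s l \<Longrightarrow> l \<in> M"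
    and x: "x \<in> hcarrier H"
  shows "\<exists>m\<in>M. \<forall>y\<in>M. hinner H (x - m) y = 0"
proof -
  define HM where "HM = H\<lparr>hcarrier := M\<rparr>"
  have [simp]: "hcarrier HM = M" "hinner HM = hinner H" by (simp_all add: HM_def)
  have nm [simp]: "hnorm HM = hnorm H" "htendsto HM = htendsto H"
    by (simp_all add: hnorm_def htendsto_def fun_eq_iff)
  have MH: "y \<in> hcarrier H" if "y \<in> M" for y using that sub(2) by blast
  interpret M: hilb HM
  proof (unfold_locales, goal_cases)
    case (7 s)
    show "\<exists>l\<in>hcarrier HM. htendsto HM s l"
    proof -
      have "hcauchy H s" "\<And>n. s n \<in> M" using 7 sub(2) by (auto simp: hcauchy_def)
      then show ?thesis using complete[of s] closed[of s] by auto
    qed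
  next
    case (4 x y)
    then show ?case using hinner_commute[of x y] MH by simp
  qed (simp_all add: sub MH hinner_add_left hinner_scale_left hinner_nonneg hinner_definite)
  have "\<exists>m\<in>hcarrier HM. \<forall>y\<in>hcarrier HM. hinner H y x = hinner HM y m"
    using Cauchy_Schwarz[OF MH x]
    by (intro M.Riesz_representation[where C = "hnorm H x"]) (simp_all add: MH x hinner_simps mult.commute)
  then obtain m where m: "m \<in> M" "\<And>y. y \<in> M \<Longrightarrow> hinner H y x = hinner H y m" by auto
  have "hinner H (x - m) y = 0" if "y \<in> M" for y
    using m that sub(2) x hinner_commute[of y "x - m"] by (auto simp: subset_iff hinner_simps)
  with m show ?thesis by blast
qed

end

section \<open>Bounded operators, limits in operator norm, adjoints\<close>

section \<open>Bounded operators\<close>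

lemma bop_closed: "T \<in> bop H K \<Longrightarrow> x \<in> hcarrier H \<Longrightarrow> T x \<in> hcarrier K"
  by (simp add: bop_def)

lemma bop_off: "T \<in> bop H K \<Longrightarrow> x \<notin> hcarrier H \<Longrightarrow> T x = 0"
  by (simp add: bop_def)

lemma bop_add: "T \<in> bop H K \<Longrightarrow> x \<in> hcarrier H \<Longrightarrow> y \<in> hcarrier H \<Longrightarrow> T (x + y) = T x + T y"
  by (simp add: bop_def)

lemma bop_scale: "T \<in> bop H K \<Longrightarrow> x \<in> hcarrier H \<Longrightarrow> T (c *\<^sub>C x) = c *\<^sub>C T x"
  by (simp add: bop_def)

lemma bopI:
  assumes "\<And>x. x \<in> hcarrier H \<Longrightarrow> T x \<in> hcarrier K" "\<And>x. x \<notin> hcarrier H \<Longrightarrow> T x = 0"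
    "\<And>x y. x \<in> hcarrier H \<Longrightarrow> y \<in> hcarrier H \<Longrightarrow> T (x + y) = T x + T y"
    "\<And>c x. x \<in> hcarrier H \<Longrightarrow> T (c *\<^sub>C x) = c *\<^sub>C T x"
    "\<And>x. x \<in> hcarrier H \<Longrightarrow> hnorm K (T x) \<le> C * hnorm H x"
  shows "T \<in> bop H K"
  unfolding bop_def mem_Collect_eq
  by (intro conjI ballI allI impI exI[of _ C] assms)

text \<open>Norm bounds as a relation: constants add and multiply directly, without a detour through
  the supremum in \<open>opnorm\<close>. The clause \<open>0 \<le> c\<close> excludes negative
  constants, which would otherwise be bounds on the zero space.\<close>

definition op_bdd :: "'h::complex_vector hspace \<Rightarrow> 'k::complex_vector hspace \<Rightarrow> ('h \<Rightarrow> 'k) \<Rightarrow> real \<Rightarrow> bool"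
  where "op_bdd H K T c \<longleftrightarrow> 0 \<le> c \<and> (\<forall>x\<in>hcarrier H. hnorm K (T x) \<le> c * hnorm H x)"

lemma op_bddD: "op_bdd H K T c \<Longrightarrow> x \<in> hcarrier H \<Longrightarrow> hnorm K (T x) \<le> c * hnorm H x"
  by (simp add: op_bdd_def)

lemma op_bddD0: "op_bdd H K T c \<Longrightarrow> 0 \<le> c"
  by (simp add: op_bdd_def)

lemma bop_op_bddI:
  assumes "op_bdd H K T c"
    and "\<And>x. x \<in> hcarrier H \<Longrightarrow> T x \<in> hcarrier K" "\<And>x. x \<notin> hcarrier H \<Longrightarrow> T x = 0"
    "\<And>x y. x \<in> hcarrier H \<Longrightarrow> y \<in> hcarrier H \<Longrightarrow> T (x + y) = T x + T y"
    "\<And>c x. x \<in> hcarrier H \<Longrightarrow> T (c *\<^sub>C x) = c *\<^sub>C T x"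
  shows "T \<in> bop H K"
  by (rule bopI[OF assms(2-5) op_bddD[OF assms(1)]])

lemma op_bddI: "0 \<le> c \<Longrightarrow> (\<And>x. x \<in> hcarrier H \<Longrightarrow> hnorm K (T x) \<le> c * hnorm H x) \<Longrightarrow> op_bdd H K T c"
  by (simp add: op_bdd_def)

definition idop :: "'h::complex_vector hspace \<Rightarrow> 'h \<Rightarrow> 'h"
  where "idop H x = (if x \<in> hcarrier H then x else 0)"

lemma fun_diff_apply: "(f - g) x = f x - g x"
  for f g :: "'x \<Rightarrow> 'y::ab_group_add"
  by (simp add: fun_diff_def)

lemma scaleC_fun_apply: "(c *\<^sub>C f) x = c *\<^sub>C f x"
  by (simp add: scaleC_fun_def)

text \<open>Density of the span of \<open>D\<close>, expressed by its orthogonal complement. In a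
  Hilbert space this is the same condition, and this form combines well with adjoints.\<close>

definition total :: "'h::complex_vector hspace \<Rightarrow> 'h set \<Rightarrow> bool"
  where "total H D \<longleftrightarrow> D \<subseteq> hcarrier H \<and> (\<forall>y\<in>hcarrier H. (\<forall>d\<in>D. hinner H d y = 0) \<longrightarrow> y = 0)"

lemma totalD: "total H D \<Longrightarrow> y \<in> hcarrier H \<Longrightarrow> (\<And>d. d \<in> D \<Longrightarrow> hinner H d y = 0) \<Longrightarrow> y = 0"
  by (simp add: total_def)

locale semi_inner2 = H: semi_inner H + K: semi_inner K
  for H :: "'h::complex_vector hspace" and K :: "'k::complex_vector hspace"
begin

lemma bop_zero: "T \<in> bop H K \<Longrightarrow> T 0 = 0"
  using bop_scale[of T H K 0 0] by simp

lemma bop_minus: "T \<in> bop H K \<Longrightarrow> x \<in> hcarrier H \<Longrightarrow> T (- x) = - T x"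
  using bop_scale[of T H K x "- 1"] by simp

lemma bop_diff: "T \<in> bop H K \<Longrightarrow> x \<in> hcarrier H \<Longrightarrow> y \<in> hcarrier H \<Longrightarrow> T (x - y) = T x - T y"
  using bop_add[of T H K x "- y"] by (simp add: bop_minus)

lemma bop_sum: "T \<in> bop H K \<Longrightarrow> (\<And>i. i \<in> I \<Longrightarrow> f i \<in> hcarrier H) \<Longrightarrow> T (sum f I) = (\<Sum>i\<in>I. T (f i))"
  by (induction I rule: infinite_finite_induct) (auto simp: bop_zero bop_add)

lemma bop_bdd: "T \<in> bop H K \<Longrightarrow> \<exists>c. op_bdd H K T c"
proof -
  assume "T \<in> bop H K"
  then obtain C where C: "\<And>x. x \<in> hcarrier H \<Longrightarrow> hnorm K (T x) \<le> C * hnorm H x"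
    unfolding bop_def by blast
  have "hnorm K (T x) \<le> \<bar>C\<bar> * hnorm H x" if "x \<in> hcarrier H" for x
  proof -
    have "C * hnorm H x \<le> \<bar>C\<bar> * hnorm H x"
      using that by (intro mult_right_mono) auto
    then show ?thesis using C[OF that] by simp
  qed
  then have "op_bdd H K T \<bar>C\<bar>" by (simp add: op_bdd_def)
  then show ?thesis ..
qed

lemma op_bdd_mono: "op_bdd H K T c \<Longrightarrow> c \<le> d \<Longrightarrow> op_bdd H K T d"
proof (rule op_bddI)
  fix x assume *: "op_bdd H K T c" "c \<le> d" "x \<in> hcarrier H"
  have "c * hnorm H x \<le> d * hnorm H x" using * by (intro mult_right_mono) auto
  then show "hnorm K (T x) \<le> d * hnorm H x" using op_bddD[OF *(1,3)] by simp
qed (use op_bddD0 in force)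

lemma zero_op_bdd: "op_bdd H K 0 0"
  by (simp add: op_bdd_def)

lemma add_op_bdd: "S \<in> bop H K \<Longrightarrow> T \<in> bop H K \<Longrightarrow> op_bdd H K S c \<Longrightarrow> op_bdd H K T d
    \<Longrightarrow> op_bdd H K (S + T) (c + d)"
proof (rule op_bddI)
  fix x assume *: "S \<in> bop H K" "T \<in> bop H K" "op_bdd H K S c" "op_bdd H K T d" "x \<in> hcarrier H"
  have "hnorm K ((S + T) x) \<le> hnorm K (S x) + hnorm K (T x)"
    using * by (simp add: K.hnorm_triangle bop_closed)
  also have "\<dots> \<le> (c + d) * hnorm H x"
    using op_bddD[OF *(3,5)] op_bddD[OF *(4,5)] by (simp add: distrib_right)
  finally show "hnorm K ((S + T) x) \<le> (c + d) * hnorm H x" .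
qed (simp add: op_bdd_def)

lemma scale_op_bdd: "T \<in> bop H K \<Longrightarrow> op_bdd H K T d \<Longrightarrow> op_bdd H K (a *\<^sub>C T) (cmod a * d)"
  by (auto simp: op_bdd_def scaleC_fun_apply K.hnorm_scale bop_closed mult.assoc intro!: mult_left_mono)

lemma zero_bop: "0 \<in> bop H K"
  by (rule bopI[where C = 0]) auto

lemma add_bop: "S \<in> bop H K \<Longrightarrow> T \<in> bop H K \<Longrightarrow> S + T \<in> bop H K"
proof -
  assume *: "S \<in> bop H K" "T \<in> bop H K"
  obtain c d where "op_bdd H K S c" "op_bdd H K T d" using * bop_bdd by blast
  with * have "op_bdd H K (S + T) (c + d)" using add_op_bdd by blast
  then show ?thesis
    by (rule bop_op_bddI; use * in
      \<open>simp add: bop_closed bop_off bop_add bop_scale scaleC_fun_apply complex_vector.scale_right_distrib\<close>)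
qed

lemma scale_bop: "T \<in> bop H K \<Longrightarrow> a *\<^sub>C T \<in> bop H K"
proof -
  assume *: "T \<in> bop H K"
  obtain c where "op_bdd H K T c" using * bop_bdd by blast
  with * have "op_bdd H K (a *\<^sub>C T) (cmod a * c)" using scale_op_bdd by blast
  then show ?thesis
    by (rule bop_op_bddI; use * in
      \<open>simp add: bop_closed bop_off bop_add bop_scale scaleC_fun_apply complex_vector.scale_right_distrib mult.commute\<close>)
qed

lemma minus_bop: "T \<in> bop H K \<Longrightarrow> - T \<in> bop H K"
  using scale_bop[of T "- 1"] by simp

lemma diff_bop: "S \<in> bop H K \<Longrightarrow> T \<in> bop H K \<Longrightarrow> S - T \<in> bop H K"
  using add_bop[of S "- T"] by (simp add: minus_bop)

lemma minus_op_bdd: "T \<in> bop H K \<Longrightarrow> op_bdd H K T d \<Longrightarrow> op_bdd H K (- T) d"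
  using scale_op_bdd[of T d "- 1"] by simp

lemma diff_op_bdd: "S \<in> bop H K \<Longrightarrow> T \<in> bop H K \<Longrightarrow> op_bdd H K S c \<Longrightarrow> op_bdd H K T d
    \<Longrightarrow> op_bdd H K (S - T) (c + d)"
  using add_op_bdd[of S "- T" c d] by (simp add: minus_bop minus_op_bdd)

lemma diff_op_bdd_commute: "S \<in> bop H K \<Longrightarrow> T \<in> bop H K \<Longrightarrow> op_bdd H K (S - T) c \<Longrightarrow> op_bdd H K (T - S) c"
  using minus_op_bdd[of "S - T" c] by (simp add: diff_bop)

lemma subspace_bop: "complex_vector.subspace (bop H K)"
  by (rule complex_vector.subspaceI) (auto intro: zero_bop add_bop scale_bop)

lemma htendsto_bop:
  assumes T: "T \<in> bop H K" and "\<And>n. x n \<in> hcarrier H" "l \<in> hcarrier H" "htendsto H x l"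
  shows "htendsto K (\<lambda>n. T (x n)) (T l)"
proof -
  obtain c where c: "op_bdd H K T c" using bop_bdd[OF T] ..
  show ?thesis
  proof (rule K.htendstoI[where b = "\<lambda>n. c * hnorm H (x n - l)"])
    show "hnorm K (T (x n) - T l) \<le> c * hnorm H (x n - l)" for n
      using op_bddD[OF c, of "x n - l"] assms by (simp add: bop_diff)
    show "(\<lambda>n. c * hnorm H (x n - l)) \<longlonglongrightarrow> 0"
      using assms(4) tendsto_mult_right_zero unfolding htendsto_def by blast
  qed (use assms bop_closed[OF T] in blast)+
qed

end

lemma comp_op_bdd:
  assumes "op_bdd H K T c" "op_bdd K L S d" "T \<in> bop H K"
  shows "op_bdd H L (S \<circ> T) (d * c)"
proof (rule op_bddI)
  fix x assume x: "x \<in> hcarrier H"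
  have "hnorm L (S (T x)) \<le> d * hnorm K (T x)"
    using op_bddD[OF assms(2)] bop_closed[OF assms(3) x] by blast
  also have "\<dots> \<le> d * (c * hnorm H x)"
    using op_bddD0[OF assms(2)] op_bddD[OF assms(1) x] by (intro mult_left_mono)
  finally show "hnorm L ((S \<circ> T) x) \<le> d * c * hnorm H x" by simp
qed (use assms in \<open>simp add: op_bdd_def\<close>)

lemma comp_bop:
  assumes "semi_inner H" "semi_inner K" "semi_inner L" "T \<in> bop H K" "S \<in> bop K L"
  shows "S \<circ> T \<in> bop H L"
proof -
  interpret H: semi_inner H by fact
  interpret K: semi_inner K by fact
  interpret L: semi_inner L by fact
  interpret HK: semi_inner2 H K ..
  interpret KL: semi_inner2 K L ..
  obtain c d where "op_bdd H K T c" "op_bdd K L S d" using assms HK.bop_bdd KL.bop_bdd by blast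
  then have "op_bdd H L (S \<circ> T) (d * c)" using comp_op_bdd assms by blast
  then show ?thesis
    by (rule bop_op_bddI; use assms in
      \<open>simp add: bop_closed bop_off bop_add bop_scale KL.bop_zero\<close>)
qed

lemma comp_diff_left: "(S - T) \<circ> R = (S \<circ> R) - (T \<circ> R)" for S T :: "'h \<Rightarrow> 'k::ab_group_add"
  by (simp add: fun_eq_iff fun_diff_apply)

lemma idop_apply [simp]: "x \<in> hcarrier H \<Longrightarrow> idop H x = x"
  by (simp add: idop_def)

lemma (in semi_inner) idop_bop: "idop H \<in> bop H H"
  by (rule bopI[where C = 1]) (auto simp: idop_def)

lemma comp_idop: "T \<in> bop H K \<Longrightarrow> T \<circ> idop H = T" if "semi_inner2 H K"
proof -
  interpret semi_inner2 H K by fact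
  show "T \<in> bop H K \<Longrightarrow> T \<circ> idop H = T"
    by (auto simp: fun_eq_iff idop_def bop_off bop_zero)
qed

lemma idop_comp: "T \<in> bop H K \<Longrightarrow> idop K \<circ> T = T" if "semi_inner2 H K"
proof -
  interpret semi_inner2 H K by fact
  show "T \<in> bop H K \<Longrightarrow> idop K \<circ> T = T"
    by (auto simp: fun_eq_iff idop_def bop_off dest: bop_closed) (metis bop_off bop_closed)
qed

locale hilb2 = H: hilb H + K: hilb K
  for H :: "'h::complex_vector hspace" and K :: "'k::complex_vector hspace"

sublocale hilb2 \<subseteq> semi_inner2 ..

context hilb2
begin

lemma bop_eqI: "S \<in> bop H K \<Longrightarrow> T \<in> bop H K \<Longrightarrow> (\<And>x. x \<in> hcarrier H \<Longrightarrow> S x = T x) \<Longrightarrow> S = T"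
proof (rule ext)
  fix x assume *: "S \<in> bop H K" "T \<in> bop H K" "\<And>x. x \<in> hcarrier H \<Longrightarrow> S x = T x"
  show "S x = T x"
    using *(3) bop_off[OF *(1), of x] bop_off[OF *(2), of x] by (cases "x \<in> hcarrier H") simp_all
qed

lemma opnorm_bdd:
  assumes T: "T \<in> bop H K"
  shows "op_bdd H K T (opnorm H K T)"
proof -
  let ?A = "{hnorm K (T x) | x. x \<in> hcarrier H \<and> hnorm H x \<le> 1}"
  obtain c where c: "op_bdd H K T c" using bop_bdd[OF T] ..
  have "hnorm K (T x) \<le> c" if x: "x \<in> hcarrier H" "hnorm H x \<le> 1" for x
  proof -
    have "c * hnorm H x \<le> c * 1" using op_bddD0[OF c] x by (intro mult_left_mono) auto
    then show ?thesis using op_bddD[OF c x(1)] by simp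
  qed
  then have bdd: "bdd_above ?A" by (auto intro!: bdd_aboveI)
  have up: "hnorm K (T x) \<le> opnorm H K T" if "x \<in> hcarrier H" "hnorm H x \<le> 1" for x
    unfolding opnorm_def using that bdd by (intro cSup_upper) auto
  have "hnorm K (T 0) = 0" by (simp add: bop_zero[OF T])
  then have "0 \<le> opnorm H K T" using up[of 0] by simp
  moreover have "hnorm K (T x) \<le> opnorm H K T * hnorm H x" if x: "x \<in> hcarrier H" for x
  proof (cases "hnorm H x = 0")
    case True
    then show ?thesis using x by (simp add: H.hnorm_eq_0_iff bop_zero[OF T])
  next
    case False
    let ?y = "complex_of_real (1 / hnorm H x) *\<^sub>C x"
    have pos: "hnorm H x > 0" using False x H.hnorm_nonneg[of x] by linarith
    have "hnorm H ?y \<le> 1" using x pos by (simp add: H.hnorm_scale norm_divide)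
    then have "hnorm K (T ?y) \<le> opnorm H K T" using up x by blast
    then show ?thesis using x pos
      by (simp add: bop_scale[OF T] K.hnorm_scale bop_closed[OF T] norm_divide field_simps)
  qed
  ultimately show ?thesis by (simp add: op_bdd_def)
qed

lemma opnorm_nonneg: "T \<in> bop H K \<Longrightarrow> 0 \<le> opnorm H K T"
  using opnorm_bdd op_bddD0 by blast

lemma opnorm_le: "op_bdd H K T c \<Longrightarrow> opnorm H K T \<le> c"
  unfolding opnorm_def
proof (rule cSup_least)
  show "{hnorm K (T x) | x. x \<in> hcarrier H \<and> hnorm H x \<le> 1} \<noteq> {}"
    using H.zero_closed by (force intro!: exI[of _ 0])
  fix r assume c: "op_bdd H K T c" and "r \<in> {hnorm K (T x) | x. x \<in> hcarrier H \<and> hnorm H x \<le> 1}"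
  then obtain x where x: "r = hnorm K (T x)" "x \<in> hcarrier H" "hnorm H x \<le> 1" by auto
  have "c * hnorm H x \<le> c * 1" using op_bddD0[OF c] x by (intro mult_left_mono) auto
  then show "r \<le> c" using op_bddD[OF c x(2)] x(1) by simp
qed

lemma opnorm_triangle_mid: "R \<in> bop H K \<Longrightarrow> S \<in> bop H K \<Longrightarrow> T \<in> bop H K
    \<Longrightarrow> opnorm H K (R - T) \<le> opnorm H K (R - S) + opnorm H K (S - T)"
  using add_op_bdd[OF diff_bop diff_bop opnorm_bdd[OF diff_bop] opnorm_bdd[OF diff_bop], of R S S T]
  by (intro opnorm_le) simp_all

lemma opnorm_minus_commute: "S \<in> bop H K \<Longrightarrow> T \<in> bop H K \<Longrightarrow> opnorm H K (S - T) = opnorm H K (T - S)"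
  by (rule antisym; rule opnorm_le, rule diff_op_bdd_commute, assumption, assumption, rule opnorm_bdd,
      rule diff_bop)

lemma opnorm_eq_0: "T \<in> bop H K \<Longrightarrow> opnorm H K T \<le> 0 \<Longrightarrow> T = 0"
proof (rule bop_eqI)
  fix x assume *: "T \<in> bop H K" "opnorm H K T \<le> 0" "x \<in> hcarrier H"
  have "hnorm K (T x) \<le> 0"
    using op_bddD[OF opnorm_bdd[OF *(1)] *(3)] *(2) H.hnorm_nonneg[OF *(3)] opnorm_nonneg[OF *(1)] by simp
  then show "T x = 0 x" using K.hnorm_eq_0_iff[of "T x"] K.hnorm_nonneg[of "T x"] bop_closed[OF *(1,3)]
    by (metis order_antisym zero_fun_apply)
qed (simp_all add: zero_bop)

lemma op_limit_unique:
  assumes "\<And>n. X n \<in> bop H K" "S \<in> bop H K" "T \<in> bop H K"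
    "(\<lambda>n. opnorm H K (X n - S)) \<longlonglongrightarrow> 0" "(\<lambda>n. opnorm H K (X n - T)) \<longlonglongrightarrow> 0"
  shows "S = T"
proof -
  have "opnorm H K (S - T) \<le> opnorm H K (X n - S) + opnorm H K (X n - T)" for n
    using opnorm_triangle_mid[of S "X n" T] opnorm_minus_commute[of S "X n"] assms(1-3) by simp
  moreover have "(\<lambda>n. opnorm H K (X n - S) + opnorm H K (X n - T)) \<longlonglongrightarrow> 0 + 0"
    by (intro tendsto_add assms)
  ultimately have "opnorm H K (S - T) \<le> 0 + 0"
    by (intro LIMSEQ_le_const) blast+
  then have "opnorm H K (S - T) \<le> 0" by simp
  then show ?thesis using opnorm_eq_0[of "S - T"] assms by (simp add: diff_bop)
qed

text \<open>The increments are those of an iteration with contraction factor 1/2. The limit is first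
  taken pointwise; the geometric tail is uniform on the unit ball and turns this into convergence in
  operator norm.\<close>

lemma op_complete:
  assumes X: "\<And>n. X n \<in> bop H K" and d: "\<And>n. op_bdd H K (X (Suc n) - X n) (c / 2 ^ n)"
  shows "\<exists>T\<in>bop H K. (\<lambda>n. opnorm H K (X n - T)) \<longlonglongrightarrow> 0"
proof -
  have c: "c \<ge> 0" using op_bddD0[OF d[of 0]] by simp
  \<comment> \<open>The telescoped bound keeps the subtracted remainder so that the induction on
    \<open>k\<close> closes; the weaker bound 2c/2^n would not reproduce itself.\<close>
  have dk: "op_bdd H K (X (n + k) - X n) (2 * c / 2 ^ n - 2 * c / 2 ^ (n + k))" for n k
  proof (induction k)
    case 0
    show ?case unfolding add_0_right diff_self by (rule zero_op_bdd)
  next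
    case (Suc k)
    have e1: "X (n + Suc k) - X n = (X (Suc (n + k)) - X (n + k)) + (X (n + k) - X n)" by simp
    have e2: "2 * c / 2 ^ n - 2 * c / 2 ^ (n + Suc k) = c / 2 ^ (n + k) + (2 * c / 2 ^ n - 2 * c / 2 ^ (n + k))"
      by (simp add: field_simps)
    show ?case unfolding e1 e2 by (intro add_op_bdd diff_bop X d Suc)
  qed
  have dmn: "hnorm K (X m x - X n x) \<le> 2 * c / 2 ^ n * hnorm H x" if "n \<le> m" "x \<in> hcarrier H" for m n x
  proof -
    have "op_bdd H K (X m - X n) (2 * c / 2 ^ n)"
      using dk[of n "m - n"] that c by (auto intro: op_bdd_mono)
    then show ?thesis using op_bddD[OF _ that(2)] by (fastforce simp: fun_diff_apply)
  qed
  have pw0: "(\<lambda>n. 2 * c / 2 ^ n * r) \<longlonglongrightarrow> 0" for r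
    using tendsto_mult_left_zero[OF tendsto_mult_right_zero[OF LIMSEQ_inverse_realpow_zero[of 2], of "2 * c"], of r]
    by (simp add: divide_inverse)
  have "hcauchy K (\<lambda>n. X n x)" if x: "x \<in> hcarrier H" for x
    unfolding hcauchy_def
  proof (intro conjI allI impI)
    fix e :: real assume e: "e > 0"
    obtain N where N: "2 * c / 2 ^ N * hnorm H x < e / 2"
      using order_tendstoD(2)[OF pw0[of "hnorm H x"], of "e/2"] e
      by (auto simp: eventually_sequentially)
    have "hnorm K (X m x - X n x) < e" if mn: "m \<ge> N" "n \<ge> N" for m n
      using K.hnorm_triangle_mid[of "X m x" "X N x" "X n x"] dmn[OF mn(1) x] dmn[OF mn(2) x] N
        K.hnorm_minus_commute[of "X N x" "X n x"] bop_closed[OF X x] by fastforce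
    then show "\<exists>N. \<forall>m\<ge>N. \<forall>n\<ge>N. hnorm K (X m x - X n x) < e" by blast
  qed (rule bop_closed[OF X x])
  then have "\<forall>x\<in>hcarrier H. \<exists>l\<in>hcarrier K. htendsto K (\<lambda>n. X n x) l"
    using K.complete by blast
  then obtain L where L: "\<And>x. x \<in> hcarrier H \<Longrightarrow> L x \<in> hcarrier K"
    "\<And>x. x \<in> hcarrier H \<Longrightarrow> htendsto K (\<lambda>n. X n x) (L x)" by metis
  define T where "T x = (if x \<in> hcarrier H then L x else 0)" for x
  have T: "T x \<in> hcarrier K" "htendsto K (\<lambda>n. X n x) (T x)" if "x \<in> hcarrier H" for x
    using L that by (simp_all add: T_def)
  have near: "hnorm K (X n x - T x) \<le> 2 * c / 2 ^ n * hnorm H x" if x: "x \<in> hcarrier H" for n x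
  proof (rule LIMSEQ_le)
    show "(\<lambda>m. hnorm K (X m x - T x) + 2 * c / 2 ^ n * hnorm H x) \<longlonglongrightarrow> 2 * c / 2 ^ n * hnorm H x"
      using tendsto_add[OF T(2)[OF x, unfolded htendsto_def] tendsto_const] by simp
    show "(\<lambda>m. hnorm K (X n x - T x)) \<longlonglongrightarrow> hnorm K (X n x - T x)" by simp
    show "\<exists>N. \<forall>m\<ge>N. hnorm K (X n x - T x) \<le> hnorm K (X m x - T x) + 2 * c / 2 ^ n * hnorm H x"
    proof (intro exI allI impI)
      fix m assume "n \<le> m"
      then have "hnorm K (X n x - X m x) \<le> 2 * c / 2 ^ n * hnorm H x"
        using dmn[OF _ x] K.hnorm_minus_commute[OF bop_closed[OF X x] bop_closed[OF X x]] by metis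
      then show "hnorm K (X n x - T x) \<le> hnorm K (X m x - T x) + 2 * c / 2 ^ n * hnorm H x"
        using K.hnorm_triangle_mid[OF bop_closed[OF X x] bop_closed[OF X x] T(1)[OF x], of n m] by linarith
    qed
  qed
  have add: "T (x + y) = T x + T y" if "x \<in> hcarrier H" "y \<in> hcarrier H" for x y
  proof (rule K.htendsto_unique)
    show "htendsto K (\<lambda>n. X n (x + y)) (T x + T y)"
      using K.htendsto_add[OF _ T(1) T(2) _ T(1) T(2)] that by (simp add: bop_add[OF X] bop_closed[OF X])
  qed (use that T bop_closed[OF X] in auto)
  have scale: "T (a *\<^sub>C x) = a *\<^sub>C T x" if "x \<in> hcarrier H" for x a
  proof (rule K.htendsto_unique)
    show "htendsto K (\<lambda>n. X n (a *\<^sub>C x)) (a *\<^sub>C T x)"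
      using K.htendsto_scale[OF _ T(1) T(2)] that by (simp add: bop_scale[OF X] bop_closed[OF X])
  qed (use that T bop_closed[OF X] in auto)
  obtain c0 where c0: "op_bdd H K (X 0) c0" using bop_bdd[OF X] ..
  have "T \<in> bop H K"
  proof (rule bopI[OF T(1) _ add scale])
    fix x assume x: "x \<in> hcarrier H"
    have "hnorm K (T x) \<le> hnorm K (X 0 x) + hnorm K (X 0 x - T x)"
      using K.hnorm_triangle_diff[of "X 0 x" "X 0 x - T x"] bop_closed[OF X x] T(1)[OF x] by simp
    then show "hnorm K (T x) \<le> (c0 + 2 * c) * hnorm H x"
      using op_bddD[OF c0 x] near[OF x, of 0] by (simp add: distrib_right)
  qed (auto simp: T_def)
  moreover have "(\<lambda>n. opnorm H K (X n - T)) \<longlonglongrightarrow> 0"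
  proof (rule tendsto_sandwich[OF _ _ tendsto_const])
    show "\<forall>\<^sub>F n in sequentially. 0 \<le> opnorm H K (X n - T)"
      using calculation by (simp add: opnorm_nonneg diff_bop X)
    show "\<forall>\<^sub>F n in sequentially. opnorm H K (X n - T) \<le> 2 * c / 2 ^ n"
      using near c by (auto simp: fun_diff_apply intro!: opnorm_le op_bddI always_eventually)
    show "(\<lambda>n. 2 * c / 2 ^ n) \<longlonglongrightarrow> 0" using pw0[of 1] by simp
  qed
  ultimately show ?thesis by blast
qed

end

context hilb
begin

lemma hilb2_self: "hilb2 H H" ..

text \<open>Banach's fixed point theorem for operators. The norm closed set carries side conditions
  such as self-adjointness, commutation or membership in an algebra over to the fixed point. It
  stands in for functional calculus twice: for a square root and for a projection.\<close>

lemma op_fixed_point: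
  assumes sub: "\<S> \<subseteq> bop H H"
    and closed: "\<And>X T. (\<And>n. X n \<in> \<S>) \<Longrightarrow> T \<in> bop H H \<Longrightarrow> (\<lambda>n. opnorm H H (X n - T)) \<longlonglongrightarrow> 0 \<Longrightarrow> T \<in> \<S>"
    and F: "\<And>A. A \<in> \<S> \<Longrightarrow> F A \<in> \<S>" and A0: "A0 \<in> \<S>"
    and contr: "\<And>A B d. A \<in> \<S> \<Longrightarrow> B \<in> \<S> \<Longrightarrow> op_bdd H H (A - B) d \<Longrightarrow> op_bdd H H (F A - F B) (d / 2)"
  shows "\<exists>T\<in>\<S>. F T = T"
proof -
  interpret hilb2 H H by (rule hilb2_self)
  define X where "X n = (F ^^ n) A0" for n
  have XS: "X n \<in> \<S>" for n by (induction n) (auto simp: X_def A0 F)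
  have X: "X n \<in> bop H H" for n using XS sub by blast
  obtain c where c: "op_bdd H H (X 1 - X 0) c" using bop_bdd[OF diff_bop[OF X X]] by blast
  have "op_bdd H H (X (Suc n) - X n) (c / 2 ^ n)" for n
  proof (induction n)
    case 0
    show ?case using c unfolding One_nat_def power_0 div_by_1 .
  next
    case (Suc n)
    have e1: "F (X m) = X (Suc m)" for m by (simp add: X_def)
    have e2: "c / 2 ^ Suc n = c / 2 ^ n / 2" by simp
    show ?case using contr[OF XS XS Suc] unfolding e1 e2 .
  qed
  from op_complete[OF X this] obtain T where T: "T \<in> bop H H" "(\<lambda>n. opnorm H H (X n - T)) \<longlonglongrightarrow> 0" by blast
  have TS: "T \<in> \<S>" using closed[OF XS T] .
  have "(\<lambda>n. opnorm H H (X (Suc n) - F T)) \<longlonglongrightarrow> 0"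
  proof (rule tendsto_sandwich[OF _ _ tendsto_const])
    show "\<forall>\<^sub>F n in sequentially. 0 \<le> opnorm H H (X (Suc n) - F T)"
      using F[OF TS] sub by (intro always_eventually allI opnorm_nonneg diff_bop X) auto
    have "opnorm H H (X (Suc n) - F T) \<le> opnorm H H (X n - T) / 2" for n
      using contr[OF XS TS opnorm_bdd[OF diff_bop[OF X T(1)]], of n] by (intro opnorm_le) (simp add: X_def)
    then show "\<forall>\<^sub>F n in sequentially. opnorm H H (X (Suc n) - F T) \<le> opnorm H H (X n - T) / 2" by simp
    show "(\<lambda>n. opnorm H H (X n - T) / 2) \<longlonglongrightarrow> 0" using tendsto_divide[OF T(2) tendsto_const, of 2] by simp
  qed
  then have "F T = T"
    using op_limit_unique[of "\<lambda>n. X (Suc n)" "F T" T] X T(1) F[OF TS] sub LIMSEQ_Suc[OF T(2)] by blast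
  with TS show ?thesis by blast
qed

end

subsection \<open>Adjoints\<close>

context hilb2
begin

text \<open>Riesz, applied for each \<open>y\<close> to the functional
  \<open>x \<mapsto> hinner K (T x) y\<close>. Boundedness of the result follows by taking
  \<open>x = S y\<close> in Cauchy-Schwarz and dividing by the norm of \<open>S y\<close> unless it
  is zero.\<close>

lemma adj_ex:
  assumes T: "T \<in> bop H K"
  shows "\<exists>S\<in>bop K H. \<forall>x\<in>hcarrier H. \<forall>y\<in>hcarrier K. hinner K (T x) y = hinner H x (S y)"
proof -
  obtain c where c: "op_bdd H K T c" using bop_bdd[OF T] ..
  have "\<exists>z\<in>hcarrier H. \<forall>x\<in>hcarrier H. hinner K (T x) y = hinner H x z" if y: "y \<in> hcarrier K" for y
  proof (rule H.Riesz_representation[where C = "c * hnorm K y"])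
    fix x assume x: "x \<in> hcarrier H"
    have "cmod (hinner K (T x) y) \<le> hnorm K (T x) * hnorm K y"
      using K.Cauchy_Schwarz bop_closed[OF T x] y by blast
    also have "\<dots> \<le> (c * hnorm H x) * hnorm K y"
      using op_bddD[OF c x] y by (intro mult_right_mono) auto
    finally show "cmod (hinner K (T x) y) \<le> c * hnorm K y * hnorm H x" by (simp add: mult_ac)
  qed (use y in \<open>simp_all add: bop_add[OF T] bop_scale[OF T] bop_closed[OF T] K.hinner_simps\<close>)
  then obtain S0 where S0: "\<And>y. y \<in> hcarrier K \<Longrightarrow> S0 y \<in> hcarrier H"
    "\<And>x y. x \<in> hcarrier H \<Longrightarrow> y \<in> hcarrier K \<Longrightarrow> hinner K (T x) y = hinner H x (S0 y)" by metis
  define S where "S y = (if y \<in> hcarrier K then S0 y else 0)" for y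
  have S: "S y \<in> hcarrier H" if "y \<in> hcarrier K" for y using S0 that by (simp add: S_def)
  have SI: "hinner K (T x) y = hinner H x (S y)" if "x \<in> hcarrier H" "y \<in> hcarrier K" for x y
    using S0 that by (simp add: S_def)
  have SI': "hinner H (S y) x = hinner K y (T x)" if "x \<in> hcarrier H" "y \<in> hcarrier K" for x y
    using SI[OF that] H.hinner_commute[of x "S y"] K.hinner_commute[of "T x" y] S that bop_closed[OF T] by simp
  have "S \<in> bop K H"
  proof (rule bopI[where C = c])
    show "S (x + y) = S x + S y" if "x \<in> hcarrier K" "y \<in> hcarrier K" for x y
      by (rule H.hinner_eqI) (use that S bop_closed[OF T] in
        \<open>simp_all add: SI' H.hinner_add_left K.hinner_add_left\<close>)
    show "S (a *\<^sub>C x) = a *\<^sub>C S x" if "x \<in> hcarrier K" for x a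
      by (rule H.hinner_eqI) (use that S bop_closed[OF T] in
        \<open>simp_all add: SI' H.hinner_scale_left K.hinner_scale_left\<close>)
    fix y assume y: "y \<in> hcarrier K"
    have "(hnorm H (S y))\<^sup>2 = cmod (hinner K (T (S y)) y)"
      using y S SI[of "S y" y] H.hinner_self[of "S y"] by (simp add: norm_power)
    also have "\<dots> \<le> hnorm K (T (S y)) * hnorm K y"
      using K.Cauchy_Schwarz bop_closed[OF T] S y by blast
    also have "\<dots> \<le> (c * hnorm H (S y)) * hnorm K y"
      using op_bddD[OF c] S y by (intro mult_right_mono) auto
    finally have *: "hnorm H (S y) * hnorm H (S y) \<le> hnorm H (S y) * (c * hnorm K y)"
      by (simp add: power2_eq_square mult_ac)
    show "hnorm H (S y) \<le> c * hnorm K y"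
    proof (cases "hnorm H (S y) = 0")
      case True
      then show ?thesis using op_bddD0[OF c] y by simp
    next
      case False
      then have "hnorm H (S y) > 0" using H.hnorm_nonneg[OF S[OF y]] by linarith
      then show ?thesis using * by (simp add: mult_le_cancel_left_pos)
    qed
  qed (use S in \<open>auto simp: S_def\<close>)
  with SI show ?thesis by blast
qed

lemma adj_unique:
  assumes "S \<in> bop K H" "S' \<in> bop K H"
    and "\<And>x y. x \<in> hcarrier H \<Longrightarrow> y \<in> hcarrier K \<Longrightarrow> hinner H x (S y) = hinner H x (S' y)"
  shows "S = S'"
proof (rule ext)
  fix y show "S y = S' y"
  proof (cases "y \<in> hcarrier K")
    case True
    show ?thesis
    proof (rule H.hinner_eqI)
      show "S y \<in> hcarrier H" "S' y \<in> hcarrier H" using True assms bop_closed by blast+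
      then show "hinner H (S y) z = hinner H (S' y) z" if "z \<in> hcarrier H" for z
        using assms(3)[OF that True] H.hinner_commute[OF that, of "S y"] H.hinner_commute[OF that, of "S' y"] that
        by simp
    qed
  next
    case False
    then show ?thesis using bop_off[OF assms(1)] bop_off[OF assms(2)] by simp
  qed
qed

lemma adj_props:
  assumes T: "T \<in> bop H K"
  shows "adj H K T \<in> bop K H \<and>
    (\<forall>x\<in>hcarrier H. \<forall>y\<in>hcarrier K. hinner K (T x) y = hinner H x (adj H K T y))"
proof -
  obtain S where S: "S \<in> bop K H" "\<forall>x\<in>hcarrier H. \<forall>y\<in>hcarrier K. hinner K (T x) y = hinner H x (S y)"
    using adj_ex[OF T] by blast
  show ?thesis
    unfolding adj_def
  proof (rule theI[of _ S])
    fix S' assume S': "S' \<in> bop K H \<and> (\<forall>x\<in>hcarrier H. \<forall>y\<in>hcarrier K. hinner K (T x) y = hinner H x (S' y))"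
    show "S' = S"
    proof (rule adj_unique)
      show "hinner H x (S' y) = hinner H x (S y)" if "x \<in> hcarrier H" "y \<in> hcarrier K" for x y
        using S(2)[rule_format, OF that] S'[THEN conjunct2, rule_format, OF that] by simp
    qed (use S' S in blast)+
  qed (use S in blast)
qed

lemma adj_bop: "T \<in> bop H K \<Longrightarrow> adj H K T \<in> bop K H"
  by (rule adj_props[THEN conjunct1])

lemma adj_closed: "T \<in> bop H K \<Longrightarrow> y \<in> hcarrier K \<Longrightarrow> adj H K T y \<in> hcarrier H"
  by (rule bop_closed[OF adj_bop])

lemma adj_inner: "T \<in> bop H K \<Longrightarrow> x \<in> hcarrier H \<Longrightarrow> y \<in> hcarrier K \<Longrightarrow>
    hinner K (T x) y = hinner H x (adj H K T y)"
  by (rule adj_props[THEN conjunct2, rule_format])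

lemma adj_inner': "T \<in> bop H K \<Longrightarrow> x \<in> hcarrier H \<Longrightarrow> y \<in> hcarrier K \<Longrightarrow>
    hinner H (adj H K T y) x = hinner K y (T x)"
  using adj_inner[of T x y] H.hinner_commute[of x "adj H K T y"] K.hinner_commute[of "T x" y]
    adj_closed[of T y] bop_closed[of T H K x] by simp

lemma adjI:
  assumes "T \<in> bop H K" "S \<in> bop K H"
    and "\<And>x y. x \<in> hcarrier H \<Longrightarrow> y \<in> hcarrier K \<Longrightarrow> hinner K (T x) y = hinner H x (S y)"
  shows "adj H K T = S"
  by (rule adj_unique[OF adj_bop[OF assms(1)] assms(2)])
     (metis assms(3) adj_inner[OF assms(1)])

lemma adj_adj: "T \<in> bop H K \<Longrightarrow> adj K H (adj H K T) = T"
proof -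
  assume T: "T \<in> bop H K"
  interpret KH: hilb2 K H ..
  show ?thesis by (rule KH.adjI[OF adj_bop[OF T] T adj_inner'[OF T]])
qed

lemma adj_add: "S \<in> bop H K \<Longrightarrow> T \<in> bop H K \<Longrightarrow> adj H K (S + T) = adj H K S + adj H K T"
proof (rule adjI)
  interpret KH: hilb2 K H ..
  assume *: "S \<in> bop H K" "T \<in> bop H K"
  then show "S + T \<in> bop H K" "adj H K S + adj H K T \<in> bop K H"
    by (auto intro: add_bop KH.add_bop adj_bop)
  show "hinner K ((S + T) x) y = hinner H x ((adj H K S + adj H K T) y)"
    if "x \<in> hcarrier H" "y \<in> hcarrier K" for x y
    using * that by (simp add: K.hinner_add_left H.hinner_add_right bop_closed adj_closed adj_inner)
qed

lemma adj_scale: "T \<in> bop H K \<Longrightarrow> adj H K (c *\<^sub>C T) = cnj c *\<^sub>C adj H K T"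
proof (rule adjI)
  interpret KH: hilb2 K H ..
  assume *: "T \<in> bop H K"
  then show "c *\<^sub>C T \<in> bop H K" "cnj c *\<^sub>C adj H K T \<in> bop K H"
    by (auto intro: scale_bop KH.scale_bop adj_bop)
  show "hinner K ((c *\<^sub>C T) x) y = hinner H x ((cnj c *\<^sub>C adj H K T) y)"
    if "x \<in> hcarrier H" "y \<in> hcarrier K" for x y
    using * that by (simp add: K.hinner_scale_left H.hinner_scale_right scaleC_fun_apply bop_closed adj_closed adj_inner)
qed

lemma adj_diff: "S \<in> bop H K \<Longrightarrow> T \<in> bop H K \<Longrightarrow> adj H K (S - T) = adj H K S - adj H K T"
  using adj_add[of S "(- 1) *\<^sub>C T"] adj_scale[of T "- 1"] by (simp add: scale_bop minus_bop)

lemma adj_op_bdd: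
  assumes T: "T \<in> bop H K" and c: "op_bdd H K T c"
  shows "op_bdd K H (adj H K T) c"
proof (rule op_bddI)
  fix y assume y: "y \<in> hcarrier K"
  let ?S = "adj H K T y"
  have S: "?S \<in> hcarrier H" using adj_closed[OF T y] .
  have "(hnorm H ?S)\<^sup>2 = cmod (hinner K (T ?S) y)"
    using y S adj_inner[OF T S y] H.hinner_self[OF S] by (simp add: norm_power)
  also have "\<dots> \<le> hnorm K (T ?S) * hnorm K y"
    using K.Cauchy_Schwarz bop_closed[OF T] S y by blast
  also have "\<dots> \<le> (c * hnorm H ?S) * hnorm K y"
    using op_bddD[OF c] S y by (intro mult_right_mono) auto
  finally have *: "hnorm H ?S * hnorm H ?S \<le> hnorm H ?S * (c * hnorm K y)"
    by (simp add: power2_eq_square mult_ac)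
  show "hnorm H ?S \<le> c * hnorm K y"
  proof (cases "hnorm H ?S = 0")
    case True
    then show ?thesis using op_bddD0[OF c] y by simp
  next
    case False
    then have "hnorm H ?S > 0" using H.hnorm_nonneg[OF S] by linarith
    then show ?thesis using * by (simp add: mult_le_cancel_left_pos)
  qed
qed (rule op_bddD0[OF c])

lemma adj_limit:
  assumes X: "\<And>n. X n \<in> bop H K" and T: "T \<in> bop H K" "(\<lambda>n. opnorm H K (X n - T)) \<longlonglongrightarrow> 0"
  shows "(\<lambda>n. opnorm K H (adj H K (X n) - adj H K T)) \<longlonglongrightarrow> 0"
proof -
  interpret KH: hilb2 K H ..
  show ?thesis
  proof (rule tendsto_sandwich[OF _ _ tendsto_const T(2)])
    show "\<forall>\<^sub>F n in sequentially. 0 \<le> opnorm K H (adj H K (X n) - adj H K T)"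
      by (intro always_eventually allI KH.opnorm_nonneg KH.diff_bop adj_bop X T)
    show "\<forall>\<^sub>F n in sequentially. opnorm K H (adj H K (X n) - adj H K T) \<le> opnorm H K (X n - T)"
      using adj_op_bdd[OF diff_bop[OF X T(1)] opnorm_bdd[OF diff_bop[OF X T(1)]]]
      by (intro always_eventually allI KH.opnorm_le) (simp add: adj_diff[OF X T(1)])
  qed
qed

text \<open>The adjoint of \<open>R = S - T\<close> has values orthogonal to \<open>D\<close>, so it
  vanishes, and then so does \<open>R\<close>. This avoids approximating vectors by linear
  combinations from \<open>D\<close>.\<close>

lemma bop_eqI_total:
  assumes S: "S \<in> bop H K" and T: "T \<in> bop H K" and D: "total H D" "\<And>d. d \<in> D \<Longrightarrow> S d = T d"
  shows "S = T"
proof (rule bop_eqI[OF S T])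
  fix x assume x: "x \<in> hcarrier H"
  define R where "R = S - T"
  have R: "R \<in> bop H K" using diff_bop S T by (simp add: R_def)
  have adj0: "adj H K R y = 0" if y: "y \<in> hcarrier K" for y
  proof -
    have "hinner H d (adj H K R y) = 0" if d: "d \<in> D" for d
    proof -
      have "R d = 0" "d \<in> hcarrier H" using D d by (auto simp: R_def total_def fun_diff_apply)
      then show ?thesis using adj_inner[OF R _ y, of d] y by simp
    qed
    then show ?thesis using D(1) adj_closed[OF R y] by (auto simp: total_def)
  qed
  have "hinner K (R x) (R x) = 0"
    using adj_inner[OF R x bop_closed[OF R x]] adj0 bop_closed[OF R x] x by simp
  then have "R x = 0" using K.hinner_definite bop_closed[OF R x] by blast
  then show "S x = T x" by (simp add: R_def fun_diff_apply)
qed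

end

lemma adj_comp:
  assumes "hilb H" "hilb K" "hilb L" "T \<in> bop H K" "S \<in> bop K L"
  shows "adj H L (S \<circ> T) = adj H K T \<circ> adj K L S"
proof -
  interpret H: hilb H by fact
  interpret K: hilb K by fact
  interpret L: hilb L by fact
  interpret HL: hilb2 H L ..
  interpret HK: hilb2 H K ..
  interpret KL: hilb2 K L ..
  show ?thesis
  proof (rule HL.adjI)
    show "S \<circ> T \<in> bop H L"
      by (rule comp_bop[OF H.semi_inner_axioms K.semi_inner_axioms L.semi_inner_axioms assms(4,5)])
    show "adj H K T \<circ> adj K L S \<in> bop L H"
      by (rule comp_bop[OF L.semi_inner_axioms K.semi_inner_axioms H.semi_inner_axioms])
         (use assms HK.adj_bop KL.adj_bop in auto)
    show "hinner L ((S \<circ> T) x) y = hinner H x ((adj H K T \<circ> adj K L S) y)"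
      if "x \<in> hcarrier H" "y \<in> hcarrier L" for x y
      using KL.adj_inner[OF assms(5) bop_closed[OF assms(4) that(1)] that(2)]
        HK.adj_inner[OF assms(4) that(1) KL.adj_closed[OF assms(5) that(2)]] by simp
  qed
qed

lemma (in hilb) adj_idop: "adj H H (idop H) = idop H"
proof -
  interpret hilb2 H H by (rule hilb2_self)
  show ?thesis by (rule adjI) (auto simp: idop_bop)
qed

section \<open>The completion of a space with a semidefinite form\<close>

section \<open>Completions\<close>

context semi_inner
begin

lemma hcauchy_const: "v \<in> hcarrier H \<Longrightarrow> hcauchy H (\<lambda>_. v)"
  by (auto simp: hcauchy_def)

lemma hcauchy_bounded:
  assumes "hcauchy H x"
  shows "\<exists>B. \<forall>n. hnorm H (x n) \<le> B"
proof -
  note x = hcauchy_carrier[OF assms]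
  obtain N where N: "\<And>m n. m \<ge> N \<Longrightarrow> n \<ge> N \<Longrightarrow> hnorm H (x m - x n) < 1"
    using hcauchyD[OF assms, of 1] by auto
  define B where "B = Max ((\<lambda>n. hnorm H (x n)) ` {..N}) + 1"
  have "hnorm H (x n) \<le> B" for n
  proof (cases "n \<le> N")
    case True
    then have "hnorm H (x n) \<le> Max ((\<lambda>n. hnorm H (x n)) ` {..N})" by (intro Max_ge) auto
    then show ?thesis by (simp add: B_def)
  next
    case False
    have "hnorm H (x N) \<le> Max ((\<lambda>n. hnorm H (x n)) ` {..N})" by (intro Max_ge) auto
    moreover have "hnorm H (x n) \<le> hnorm H (x n - x N) + hnorm H (x N)"
      using hnorm_triangle[of "x n - x N" "x N"] x by simp
    ultimately show ?thesis using N[of n N] False unfolding B_def by linarith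
  qed
  then show ?thesis by blast
qed

lemma hcauchy_hinner:
  assumes cx: "hcauchy H x" and cy: "hcauchy H y"
  shows "convergent (\<lambda>n. hinner H (x n) (y n))"
proof -
  note x = hcauchy_carrier[OF cx] and y = hcauchy_carrier[OF cy]
  obtain B1 B2 where B12: "\<And>n. hnorm H (x n) \<le> B1" "\<And>n. hnorm H (y n) \<le> B2"
    using hcauchy_bounded[OF cx] hcauchy_bounded[OF cy] by blast
  define B where "B = max B1 B2 + 1"
  have B: "hnorm H (x n) \<le> B" "hnorm H (y n) \<le> B" for n
    using B12(1)[of n] B12(2)[of n] by (auto simp: B_def)
  have "0 \<le> B1" using B12(1)[of 0] hnorm_nonneg[OF x, of 0] by linarith
  then have Bpos: "B > 0" by (simp add: B_def)
  have diff: "cmod (hinner H (x m) (y m) - hinner H (x n) (y n))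
      \<le> hnorm H (x m - x n) * B + B * hnorm H (y m - y n)" for m n
  proof -
    have "hinner H (x m) (y m) - hinner H (x n) (y n) = hinner H (x m - x n) (y m) + hinner H (x n) (y m - y n)"
      using x y by (simp add: hinner_diff_left hinner_diff_right)
    also have "cmod \<dots> \<le> cmod (hinner H (x m - x n) (y m)) + cmod (hinner H (x n) (y m - y n))"
      by (rule norm_triangle_ineq)
    also have "\<dots> \<le> hnorm H (x m - x n) * hnorm H (y m) + hnorm H (x n) * hnorm H (y m - y n)"
      using x y by (intro add_mono Cauchy_Schwarz) auto
    also have "\<dots> \<le> hnorm H (x m - x n) * B + B * hnorm H (y m - y n)"
      using x y B by (intro add_mono mult_left_mono mult_right_mono) auto
    finally show ?thesis .
  qed
  have "Cauchy (\<lambda>n. hinner H (x n) (y n))"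
    unfolding Cauchy_def
  proof (intro allI impI)
    fix e :: real assume e: "e > 0"
    have e': "e / (2 * B) > 0" using e Bpos by simp
    obtain N1 N2 where N: "\<And>m n. m \<ge> N1 \<Longrightarrow> n \<ge> N1 \<Longrightarrow> hnorm H (x m - x n) < e / (2 * B)"
      "\<And>m n. m \<ge> N2 \<Longrightarrow> n \<ge> N2 \<Longrightarrow> hnorm H (y m - y n) < e / (2 * B)"
      using hcauchyD[OF cx e'] hcauchyD[OF cy e'] by blast
    have "dist (hinner H (x m) (y m)) (hinner H (x n) (y n)) < e" if mn: "m \<ge> max N1 N2" "n \<ge> max N1 N2" for m n
    proof -
      have "hnorm H (x m - x n) * B < e / (2 * B) * B"
        by (rule mult_strict_right_mono[OF N(1) Bpos]) (use mn in auto)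
      moreover have "B * hnorm H (y m - y n) < B * (e / (2 * B))"
        by (rule mult_strict_left_mono[OF N(2) Bpos]) (use mn in auto)
      moreover have "e / (2 * B) * B = e / 2" "B * (e / (2 * B)) = e / 2" using Bpos by simp_all
      ultimately show ?thesis using diff[of m n] by (simp add: dist_norm)
    qed
    then show "\<exists>M. \<forall>m\<ge>M. \<forall>n\<ge>M. dist (hinner H (x m) (y m)) (hinner H (x n) (y n)) < e" by blast
  qed
  then show ?thesis by (rule Cauchy_convergent)
qed

lemma hcauchy_add: "hcauchy H x \<Longrightarrow> hcauchy H y \<Longrightarrow> hcauchy H (\<lambda>n. x n + y n)"
  unfolding hcauchy_def
proof (intro conjI allI impI)
  assume x: "(\<forall>n. x n \<in> hcarrier H) \<and> (\<forall>e>0. \<exists>N. \<forall>m\<ge>N. \<forall>n\<ge>N. hnorm H (x m - x n) < e)"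
    and y: "(\<forall>n. y n \<in> hcarrier H) \<and> (\<forall>e>0. \<exists>N. \<forall>m\<ge>N. \<forall>n\<ge>N. hnorm H (y m - y n) < e)"
  then show "x n + y n \<in> hcarrier H" for n by blast
  fix e :: real assume "e > 0"
  then have e: "e / 2 > 0" by simp
  obtain N1 N2 where N: "\<forall>m\<ge>N1. \<forall>n\<ge>N1. hnorm H (x m - x n) < e / 2" "\<forall>m\<ge>N2. \<forall>n\<ge>N2. hnorm H (y m - y n) < e / 2"
    using x y e by meson
  have "hnorm H (x m + y m - (x n + y n)) < e" if "m \<ge> max N1 N2" "n \<ge> max N1 N2" for m n
  proof -
    have "hnorm H ((x m - x n) + (y m - y n)) \<le> hnorm H (x m - x n) + hnorm H (y m - y n)"
      using x y by (intro hnorm_triangle) auto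
    moreover have "hnorm H (x m - x n) < e / 2" "hnorm H (y m - y n) < e / 2" using N that by auto
    ultimately show ?thesis by (simp add: add_diff_add)
  qed
  then show "\<exists>N. \<forall>m\<ge>N. \<forall>n\<ge>N. hnorm H (x m + y m - (x n + y n)) < e" by blast
qed

lemma hcauchy_scale: "hcauchy H x \<Longrightarrow> hcauchy H (\<lambda>n. c *\<^sub>C x n)"
  unfolding hcauchy_def
proof (intro conjI allI impI)
  assume x: "(\<forall>n. x n \<in> hcarrier H) \<and> (\<forall>e>0. \<exists>N. \<forall>m\<ge>N. \<forall>n\<ge>N. hnorm H (x m - x n) < e)"
  then show "c *\<^sub>C x n \<in> hcarrier H" for n by blast
  fix e :: real assume "e > 0"
  then have e: "e / (cmod c + 1) > 0" by (simp add: add_nonneg_pos)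
  then obtain N where N: "\<And>m n. m \<ge> N \<Longrightarrow> n \<ge> N \<Longrightarrow> hnorm H (x m - x n) < e / (cmod c + 1)"
    using x by meson
  have "hnorm H (c *\<^sub>C x m - c *\<^sub>C x n) < e" if "m \<ge> N" "n \<ge> N" for m n
  proof -
    have xx: "x m - x n \<in> hcarrier H" using x by blast
    have "hnorm H (c *\<^sub>C x m - c *\<^sub>C x n) = cmod c * hnorm H (x m - x n)"
      unfolding complex_vector.scale_right_diff_distrib[symmetric] by (rule hnorm_scale[OF xx])
    also have "\<dots> \<le> (cmod c + 1) * hnorm H (x m - x n)"
      using hnorm_nonneg[OF xx] by (intro mult_right_mono) auto
    also have "\<dots> < (cmod c + 1) * (e / (cmod c + 1))"
      using N[OF that] by (intro mult_strict_left_mono) (auto intro: add_nonneg_pos)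
    also have "\<dots> = e" by (simp add: add_nonneg_eq_0_iff)
    finally show ?thesis .
  qed
  then show "\<exists>N. \<forall>m\<ge>N. \<forall>n\<ge>N. hnorm H (c *\<^sub>C x m - c *\<^sub>C x n) < e" by blast
qed

lemma hcauchy_minus: "hcauchy H x \<Longrightarrow> hcauchy H (\<lambda>n. - x n)"
  using hcauchy_scale[of x "- 1"] by simp

lemma hcauchy_diff: "hcauchy H x \<Longrightarrow> hcauchy H y \<Longrightarrow> hcauchy H (\<lambda>n. x n - y n)"
  using hcauchy_add[OF _ hcauchy_minus, of x y] by simp

lemma cauchy_class_tendsto:
  assumes "hcauchy H x" "v \<in> hcarrier H"
  shows "(\<lambda>n. hinner H (x n) v) \<longlonglongrightarrow> cauchy_class H x v"
  using hcauchy_hinner[OF assms(1) hcauchy_const[OF assms(2)]] assms(2)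
  by (simp add: cauchy_class_def convergent_LIMSEQ_iff)

lemma cauchy_class_off: "v \<notin> hcarrier H \<Longrightarrow> cauchy_class H x v = 0"
  by (simp add: cauchy_class_def)

lemma cauchy_class_eqI:
  assumes "hcauchy H x" "\<And>v. v \<in> hcarrier H \<Longrightarrow> (\<lambda>n. hinner H (x n) v) \<longlonglongrightarrow> f v"
    "\<And>v. v \<notin> hcarrier H \<Longrightarrow> f v = 0"
  shows "cauchy_class H x = f"
proof
  fix v show "cauchy_class H x v = f v"
    using LIMSEQ_unique[OF cauchy_class_tendsto[OF assms(1)] assms(2)] assms(3)[of v] cauchy_class_off[of v x]
    by (cases "v \<in> hcarrier H") auto
qed

lemma cauchy_class_add:
  assumes "hcauchy H x" "hcauchy H y"
  shows "cauchy_class H (\<lambda>n. x n + y n) = cauchy_class H x + cauchy_class H y"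
proof (rule cauchy_class_eqI[OF hcauchy_add[OF assms]])
  fix v assume v: "v \<in> hcarrier H"
  have "(\<lambda>n. hinner H (x n) v + hinner H (y n) v) \<longlonglongrightarrow> cauchy_class H x v + cauchy_class H y v"
    by (intro tendsto_add cauchy_class_tendsto assms v)
  then show "(\<lambda>n. hinner H (x n + y n) v) \<longlonglongrightarrow> (cauchy_class H x + cauchy_class H y) v"
    using v by (simp add: hinner_add_left hcauchy_carrier[OF assms(1)] hcauchy_carrier[OF assms(2)])
qed (simp add: cauchy_class_off)

lemma cauchy_class_scale:
  assumes "hcauchy H x"
  shows "cauchy_class H (\<lambda>n. c *\<^sub>C x n) = c *\<^sub>C cauchy_class H x"
proof (rule cauchy_class_eqI[OF hcauchy_scale[OF assms]])
  fix v assume v: "v \<in> hcarrier H"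
  have "(\<lambda>n. c * hinner H (x n) v) \<longlonglongrightarrow> c * cauchy_class H x v"
    by (intro tendsto_mult_left cauchy_class_tendsto assms v)
  then show "(\<lambda>n. hinner H (c *\<^sub>C x n) v) \<longlonglongrightarrow> (c *\<^sub>C cauchy_class H x) v"
    using v by (simp add: hinner_scale_left hcauchy_carrier[OF assms] scaleC_fun_apply scaleC_complex_def)
qed (simp add: cauchy_class_off scaleC_fun_apply)

text \<open>For a Cauchy sequence, weak convergence to zero implies convergence in norm: the squared
  norm of \<open>d n\<close> splits into its inner products with \<open>d n - d N\<close> and with a
  fixed late term \<open>d N\<close>. This is why a class may be encoded by its functional.\<close>

lemma cauchy_class_zero_imp:
  assumes d: "hcauchy H d" and 0: "cauchy_class H d = 0"
  shows "(\<lambda>n. hnorm H (d n)) \<longlonglongrightarrow> 0"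
proof -
  note dc = hcauchy_carrier[OF d]
  obtain B where B: "\<And>n. hnorm H (d n) \<le> B" using hcauchy_bounded[OF d] by blast
  have B0: "B \<ge> 0" using B[of 0] hnorm_nonneg[OF dc, of 0] by linarith
  have "(\<lambda>n. (hnorm H (d n))\<^sup>2) \<longlonglongrightarrow> 0"
  proof (rule LIMSEQ_I)
    fix r :: real assume r: "r > 0"
    have r': "r / (2 * (B + 1)) > 0" using r B0 by simp
    obtain N where N: "\<And>m n. m \<ge> N \<Longrightarrow> n \<ge> N \<Longrightarrow> hnorm H (d m - d n) < r / (2 * (B + 1))"
      using hcauchyD[OF d r'] by blast
    have "(\<lambda>n. hinner H (d n) (d N)) \<longlonglongrightarrow> 0" using cauchy_class_tendsto[OF d dc, of N] 0 by simp
    then obtain M where M: "\<And>n. n \<ge> M \<Longrightarrow> cmod (hinner H (d n) (d N)) < r / 2"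
      using r LIMSEQ_D[of _ 0 "r/2"] by fastforce
    have "(hnorm H (d n))\<^sup>2 < r" if n: "n \<ge> max M N" for n
    proof -
      have "complex_of_real ((hnorm H (d n))\<^sup>2) = hinner H (d n) (d n - d N) + hinner H (d n) (d N)"
        unfolding hinner_self[OF dc, symmetric] using dc by (simp add: hinner_diff_right)
      then have "cmod (complex_of_real ((hnorm H (d n))\<^sup>2)) \<le> cmod (hinner H (d n) (d n - d N)) + cmod (hinner H (d n) (d N))"
        by (metis norm_triangle_ineq)
      then have "(hnorm H (d n))\<^sup>2 \<le> cmod (hinner H (d n) (d n - d N)) + cmod (hinner H (d n) (d N))"
        by (simp add: norm_power)
      also have "cmod (hinner H (d n) (d n - d N)) \<le> hnorm H (d n) * hnorm H (d n - d N)"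
        using dc by (intro Cauchy_Schwarz) auto
      also have "\<dots> \<le> (B + 1) * (r / (2 * (B + 1)))"
        using B[of n] N[of n N] n B0 dc by (intro mult_mono) auto
      also have "\<dots> = r / 2" using B0 by (simp add: add_nonneg_eq_0_iff field_simps)
      finally show ?thesis using M[of n] n by simp
    qed
    then show "\<exists>no. \<forall>n\<ge>no. norm ((hnorm H (d n))\<^sup>2 - 0) < r" by (intro exI[of _ "max M N"]) auto
  qed
  then have "(\<lambda>n. sqrt ((hnorm H (d n))\<^sup>2)) \<longlonglongrightarrow> sqrt 0" by (rule tendsto_real_sqrt)
  then show ?thesis using dc by simp
qed

lemma cauchy_class_eq_imp:
  assumes "hcauchy H x" "hcauchy H y" "cauchy_class H x = cauchy_class H y"
  shows "(\<lambda>n. hnorm H (x n - y n)) \<longlonglongrightarrow> 0"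
proof (rule cauchy_class_zero_imp[OF hcauchy_diff[OF assms(1,2)]])
  have "cauchy_class H (\<lambda>n. x n + (- 1) *\<^sub>C y n) = cauchy_class H x + (- 1) *\<^sub>C cauchy_class H y"
    unfolding cauchy_class_add[OF assms(1) hcauchy_scale[OF assms(2)]] cauchy_class_scale[OF assms(2)] ..
  then show "cauchy_class H (\<lambda>n. x n - y n) = 0" using assms(3) by simp
qed

lemma cauchy_rep:
  assumes "hcauchy H x"
  shows "hcauchy H (cauchy_rep H (cauchy_class H x))"
    and "cauchy_class H (cauchy_rep H (cauchy_class H x)) = cauchy_class H x"
proof -
  have "hcauchy H (cauchy_rep H (cauchy_class H x)) \<and>
      cauchy_class H (cauchy_rep H (cauchy_class H x)) = cauchy_class H x"
    unfolding cauchy_rep_def by (rule someI[of _ x]) (use assms in simp)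
  then show "hcauchy H (cauchy_rep H (cauchy_class H x))"
    "cauchy_class H (cauchy_rep H (cauchy_class H x)) = cauchy_class H x" by blast+
qed

lemma hcompletion_carrier: "hcarrier (hcompletion H) = {cauchy_class H x | x. hcauchy H x}"
  by (simp add: hcompletion_def)

lemma hcompletion_carrierI: "hcauchy H x \<Longrightarrow> cauchy_class H x \<in> hcarrier (hcompletion H)"
  by (auto simp: hcompletion_carrier)

text \<open>The inner product of the completion is computed from representatives picked by
  \<open>cauchy_rep\<close>. Arbitrary representatives give the same limit, as they differ from the
  picked ones by null sequences and all are bounded.\<close>

lemma hcompletion_hinner:
  assumes x: "hcauchy H x" and y: "hcauchy H y"
  shows "(\<lambda>n. hinner H (x n) (y n)) \<longlonglongrightarrow> hinner (hcompletion H) (cauchy_class H x) (cauchy_class H y)"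
proof -
  define x' y' where "x' = cauchy_rep H (cauchy_class H x)" and "y' = cauchy_rep H (cauchy_class H y)"
  note rx = cauchy_rep[OF x, folded x'_def] and ry = cauchy_rep[OF y, folded y'_def]
  note c = hcauchy_carrier[OF x] hcauchy_carrier[OF y] hcauchy_carrier[OF rx(1)] hcauchy_carrier[OF ry(1)]
  obtain B1 B2 where B: "\<And>n. hnorm H (y n) \<le> B1" "\<And>n. hnorm H (x' n) \<le> B2"
    using hcauchy_bounded[OF y] hcauchy_bounded[OF rx(1)] by blast
  have "(\<lambda>n. hinner H (x n) (y n) - hinner H (x' n) (y' n)) \<longlonglongrightarrow> 0"
  proof (rule Lim_null_comparison)
    have "cmod (hinner H (x n) (y n) - hinner H (x' n) (y' n)) \<le> hnorm H (x n - x' n) * B1 + B2 * hnorm H (y n - y' n)" for n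
    proof -
      have "hinner H (x n) (y n) - hinner H (x' n) (y' n) = hinner H (x n - x' n) (y n) + hinner H (x' n) (y n - y' n)"
        using c by (simp add: hinner_diff_left hinner_diff_right)
      also have "cmod \<dots> \<le> cmod (hinner H (x n - x' n) (y n)) + cmod (hinner H (x' n) (y n - y' n))"
        by (rule norm_triangle_ineq)
      also have "\<dots> \<le> hnorm H (x n - x' n) * hnorm H (y n) + hnorm H (x' n) * hnorm H (y n - y' n)"
        using c by (intro add_mono Cauchy_Schwarz) auto
      also have "\<dots> \<le> hnorm H (x n - x' n) * B1 + B2 * hnorm H (y n - y' n)"
        using c B by (intro add_mono mult_left_mono mult_right_mono) auto
      finally show ?thesis .
    qed
    then show "\<forall>\<^sub>F n in sequentially. norm (hinner H (x n) (y n) - hinner H (x' n) (y' n))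
        \<le> hnorm H (x n - x' n) * B1 + B2 * hnorm H (y n - y' n)" by simp
    show "(\<lambda>n. hnorm H (x n - x' n) * B1 + B2 * hnorm H (y n - y' n)) \<longlonglongrightarrow> 0"
      using cauchy_class_eq_imp[OF x rx(1) rx(2)[symmetric]] cauchy_class_eq_imp[OF y ry(1) ry(2)[symmetric]]
      by (auto intro!: tendsto_add_zero tendsto_mult_left_zero tendsto_mult_right_zero)
  qed
  moreover have "(\<lambda>n. hinner H (x' n) (y' n)) \<longlonglongrightarrow> hinner (hcompletion H) (cauchy_class H x) (cauchy_class H y)"
    using hcauchy_hinner[OF rx(1) ry(1)] by (simp add: hcompletion_def x'_def y'_def convergent_LIMSEQ_iff)
  ultimately have "(\<lambda>n. (hinner H (x n) (y n) - hinner H (x' n) (y' n)) + hinner H (x' n) (y' n))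
      \<longlonglongrightarrow> 0 + hinner (hcompletion H) (cauchy_class H x) (cauchy_class H y)" by (rule tendsto_add)
  then show ?thesis by simp
qed

lemma hcompletion_semi_inner: "semi_inner (hcompletion H)"
proof
  show "complex_vector.subspace (hcarrier (hcompletion H))"
  proof (rule complex_vector.subspaceI)
    have "cauchy_class H (\<lambda>_. 0) = 0"
      using cauchy_class_scale[OF hcauchy_const[OF zero_closed], of 0] by simp
    then show "0 \<in> hcarrier (hcompletion H)"
      using hcompletion_carrierI[OF hcauchy_const[OF zero_closed]] by simp
    show "f + g \<in> hcarrier (hcompletion H)" if "f \<in> hcarrier (hcompletion H)" "g \<in> hcarrier (hcompletion H)" for f g
      using that hcauchy_add by (auto simp: hcompletion_carrier cauchy_class_add[symmetric])
    show "c *\<^sub>C f \<in> hcarrier (hcompletion H)" if "f \<in> hcarrier (hcompletion H)" for f c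
      using that hcauchy_scale by (auto simp: hcompletion_carrier cauchy_class_scale[symmetric])
  qed
next
  fix f g h assume "f \<in> hcarrier (hcompletion H)" "g \<in> hcarrier (hcompletion H)" "h \<in> hcarrier (hcompletion H)"
  then obtain x y z where fgh: "f = cauchy_class H x" "g = cauchy_class H y" "h = cauchy_class H z"
    and c: "hcauchy H x" "hcauchy H y" "hcauchy H z" by (auto simp: hcompletion_carrier)
  note k = hcauchy_carrier[OF c(1)] hcauchy_carrier[OF c(2)] hcauchy_carrier[OF c(3)]
  have "(\<lambda>n. hinner H (x n + y n) (z n)) \<longlonglongrightarrow> hinner (hcompletion H) f h + hinner (hcompletion H) g h"
    using tendsto_add[OF hcompletion_hinner[OF c(1,3)] hcompletion_hinner[OF c(2,3)]] k
    by (simp add: fgh hinner_add_left)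
  moreover have "(\<lambda>n. hinner H (x n + y n) (z n)) \<longlonglongrightarrow> hinner (hcompletion H) (f + g) h"
    using hcompletion_hinner[OF hcauchy_add[OF c(1,2)] c(3)] by (simp add: fgh cauchy_class_add[OF c(1,2)])
  ultimately show "hinner (hcompletion H) (f + g) h = hinner (hcompletion H) f h + hinner (hcompletion H) g h"
    by (rule LIMSEQ_unique[symmetric])
next
  fix f g c assume "f \<in> hcarrier (hcompletion H)" "g \<in> hcarrier (hcompletion H)"
  then obtain x y where fg: "f = cauchy_class H x" "g = cauchy_class H y"
    and c: "hcauchy H x" "hcauchy H y" by (auto simp: hcompletion_carrier)
  note k = hcauchy_carrier[OF c(1)] hcauchy_carrier[OF c(2)]
  have "(\<lambda>n. hinner H (c *\<^sub>C x n) (y n)) \<longlonglongrightarrow> c * hinner (hcompletion H) f g"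
    using tendsto_mult_left[OF hcompletion_hinner[OF c], of c] k by (simp add: fg hinner_scale_left)
  moreover have "(\<lambda>n. hinner H (c *\<^sub>C x n) (y n)) \<longlonglongrightarrow> hinner (hcompletion H) (c *\<^sub>C f) g"
    using hcompletion_hinner[OF hcauchy_scale[OF c(1)] c(2)] by (simp add: fg cauchy_class_scale[OF c(1)])
  ultimately show "hinner (hcompletion H) (c *\<^sub>C f) g = c * hinner (hcompletion H) f g"
    by (rule LIMSEQ_unique[symmetric])
next
  fix f g assume "f \<in> hcarrier (hcompletion H)" "g \<in> hcarrier (hcompletion H)"
  then obtain x y where fg: "f = cauchy_class H x" "g = cauchy_class H y"
    and c: "hcauchy H x" "hcauchy H y" by (auto simp: hcompletion_carrier)
  have "(\<lambda>n. cnj (hinner H (x n) (y n))) \<longlonglongrightarrow> cnj (hinner (hcompletion H) f g)"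
    unfolding fg by (rule tendsto_cnj[OF hcompletion_hinner[OF c]])
  moreover have "(\<lambda>n. hinner H (y n) (x n)) = (\<lambda>n. cnj (hinner H (x n) (y n)))"
    by (rule ext) (rule hinner_commute[OF hcauchy_carrier[OF c(1)] hcauchy_carrier[OF c(2)]])
  moreover have "(\<lambda>n. hinner H (y n) (x n)) \<longlonglongrightarrow> hinner (hcompletion H) g f"
    unfolding fg by (rule hcompletion_hinner[OF c(2,1)])
  ultimately show "hinner (hcompletion H) g f = cnj (hinner (hcompletion H) f g)"
    using LIMSEQ_unique by metis
next
  fix f assume "f \<in> hcarrier (hcompletion H)"
  then obtain x where f: "f = cauchy_class H x" and c: "hcauchy H x" by (auto simp: hcompletion_carrier)
  note t = hcompletion_hinner[OF c c, folded f]
  note k = hcauchy_carrier[OF c]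
  have "0 \<le> Re (hinner (hcompletion H) f f)"
    by (rule LIMSEQ_le_const[OF tendsto_Re[OF t]]) (simp add: Re_hinner_self k)
  moreover have "Im (hinner H (x n) (x n)) = 0" for n using hinner_self[OF k] by simp
  then have "(\<lambda>n. Im (hinner H (x n) (x n))) \<longlonglongrightarrow> 0" by simp
  then have "Im (hinner (hcompletion H) f f) = 0" using LIMSEQ_unique[OF tendsto_Im[OF t]] by blast
  ultimately show "hinner (hcompletion H) f f \<in> \<real>\<^sub>\<ge>\<^sub>0" by (simp add: complex_nonneg_Reals_iff)
qed

lemma hembed_closed: "v \<in> hcarrier H \<Longrightarrow> hembed H v \<in> hcarrier (hcompletion H)"
  unfolding hembed_def by (rule hcompletion_carrierI[OF hcauchy_const])

lemma hembed_add: "v \<in> hcarrier H \<Longrightarrow> w \<in> hcarrier H \<Longrightarrow> hembed H (v + w) = hembed H v + hembed H w"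
  unfolding hembed_def by (rule cauchy_class_add[OF hcauchy_const hcauchy_const])

lemma hembed_scale: "v \<in> hcarrier H \<Longrightarrow> hembed H (c *\<^sub>C v) = c *\<^sub>C hembed H v"
  unfolding hembed_def by (rule cauchy_class_scale[OF hcauchy_const])

lemma hembed_zero: "hembed H 0 = 0"
  using hembed_scale[OF zero_closed, of 0] by simp

lemma hembed_sum: "(\<And>i. i \<in> I \<Longrightarrow> f i \<in> hcarrier H) \<Longrightarrow> hembed H (sum f I) = (\<Sum>i\<in>I. hembed H (f i))"
  by (induction I rule: infinite_finite_induct) (simp_all add: hembed_zero hembed_add)

lemma hinner_hembed: "v \<in> hcarrier H \<Longrightarrow> w \<in> hcarrier H \<Longrightarrow>
    hinner (hcompletion H) (hembed H v) (hembed H w) = hinner H v w"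
  using LIMSEQ_unique[OF hcompletion_hinner[OF hcauchy_const hcauchy_const, of v w] tendsto_const]
  by (simp add: hembed_def)

text \<open>Reproducing property: pairing with an embedded vector evaluates the function that
  encodes the class. Definiteness of the completed form and totality of the embedded vectors rest on
  it.\<close>

lemma hinner_hembed_right:
  assumes f: "f \<in> hcarrier (hcompletion H)" and v: "v \<in> hcarrier H"
  shows "hinner (hcompletion H) f (hembed H v) = f v"
proof -
  obtain x where x: "f = cauchy_class H x" "hcauchy H x" using f by (auto simp: hcompletion_carrier)
  show ?thesis
    using LIMSEQ_unique[OF hcompletion_hinner[OF x(2) hcauchy_const[OF v]] cauchy_class_tendsto[OF x(2) v]]
    by (simp add: hembed_def x(1))
qed

lemma hcompletion_off: "f \<in> hcarrier (hcompletion H) \<Longrightarrow> v \<notin> hcarrier H \<Longrightarrow> f v = 0"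
  by (auto simp: hcompletion_carrier cauchy_class_off)

lemma hcompletion_hnorm:
  assumes "hcauchy H x"
  shows "(\<lambda>n. hnorm H (x n)) \<longlonglongrightarrow> hnorm (hcompletion H) (cauchy_class H x)"
  unfolding hnorm_def by (intro tendsto_real_sqrt tendsto_Re hcompletion_hinner assms)

lemma htendsto_hembed:
  assumes x: "hcauchy H x"
  shows "htendsto (hcompletion H) (\<lambda>n. hembed H (x n)) (cauchy_class H x)"
  unfolding htendsto_def
proof (rule LIMSEQ_I)
  fix r :: real assume r: "r > 0"
  interpret C: semi_inner "hcompletion H" by (rule hcompletion_semi_inner)
  note k = hcauchy_carrier[OF x]
  have r2: "r / 2 > 0" using r by simp
  obtain N where N: "\<And>m n. m \<ge> N \<Longrightarrow> n \<ge> N \<Longrightarrow> hnorm H (x m - x n) < r / 2"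
    using hcauchyD[OF x r2] by blast
  have "hnorm (hcompletion H) (hembed H (x n) - cauchy_class H x) < r" if n: "n \<ge> N" for n
  proof -
    have c: "hcauchy H (\<lambda>m. x n - x m)" by (rule hcauchy_diff[OF hcauchy_const[OF k] x])
    have "cauchy_class H (\<lambda>m. x n + (- 1) *\<^sub>C x m) = hembed H (x n) + (- 1) *\<^sub>C cauchy_class H x"
      unfolding cauchy_class_add[OF hcauchy_const[OF k] hcauchy_scale[OF x]] cauchy_class_scale[OF x] hembed_def ..
    then have "cauchy_class H (\<lambda>m. x n - x m) = hembed H (x n) - cauchy_class H x" by simp
    then have "(\<lambda>m. hnorm H (x n - x m)) \<longlonglongrightarrow> hnorm (hcompletion H) (hembed H (x n) - cauchy_class H x)"
      using hcompletion_hnorm[OF c] by simp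
    then have "hnorm (hcompletion H) (hembed H (x n) - cauchy_class H x) \<le> r / 2"
      by (rule LIMSEQ_le_const2) (use N n in \<open>auto intro!: exI[of _ N] less_imp_le\<close>)
    then show ?thesis using r by simp
  qed
  moreover have "0 \<le> hnorm (hcompletion H) (hembed H (x n) - cauchy_class H x)" for n
    by (intro C.hnorm_nonneg C.diff_closed hembed_closed k hcompletion_carrierI x)
  ultimately show "\<exists>no. \<forall>n\<ge>no. norm (hnorm (hcompletion H) (hembed H (x n) - cauchy_class H x) - 0) < r"
    by (intro exI[of _ N]) auto
qed

lemma hcompletion_hilb: "hilb (hcompletion H)"
proof -
  interpret C: semi_inner "hcompletion H" by (rule hcompletion_semi_inner)
  show ?thesis
  proof
    fix f assume f: "f \<in> hcarrier (hcompletion H)" "hinner (hcompletion H) f f = 0"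
    then have "hnorm (hcompletion H) f = 0" by (simp add: hnorm_def)
    then have "cmod (hinner (hcompletion H) f (hembed H v)) \<le> 0" if "v \<in> hcarrier H" for v
      using C.Cauchy_Schwarz[OF f(1) hembed_closed[OF that]] by simp
    then have "f v = 0" if "v \<in> hcarrier H" for v
      using hinner_hembed_right[OF f(1) that] that by simp
    then show "f = 0" using hcompletion_off[OF f(1)] by (auto simp: fun_eq_iff)
  next
    fix s assume s: "hcauchy (hcompletion H) s"
    note sc = C.hcauchy_carrier[OF s]
    \<comment> \<open>Diagonal choice: the \<open>k\<close>-th class is replaced by one embedded
      vector within 1/(k+1) of it. These vectors form a Cauchy sequence in \<open>H\<close> itself,
      whose class is the limit sought.\<close>
    have "\<exists>v\<in>hcarrier H. hnorm (hcompletion H) (s k - hembed H v) < 1 / real (Suc k)" for k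
    proof -
      obtain x where x: "s k = cauchy_class H x" "hcauchy H x" using sc[of k] by (auto simp: hcompletion_carrier)
      obtain n where "hnorm (hcompletion H) (hembed H (x n) - s k) < 1 / real (Suc k)"
        using order_tendstoD(2)[OF htendsto_hembed[OF x(2), unfolded htendsto_def], of "1 / real (Suc k)"]
        unfolding x(1) eventually_sequentially by auto
      then show ?thesis
        using C.hnorm_minus_commute[OF hembed_closed[OF hcauchy_carrier[OF x(2)]] sc] hcauchy_carrier[OF x(2)] by metis
    qed
    then obtain v where v: "\<And>k. v k \<in> hcarrier H" "\<And>k. hnorm (hcompletion H) (s k - hembed H (v k)) < 1 / real (Suc k)"
      by metis
    have ev: "hnorm H (v m - v n) = hnorm (hcompletion H) (hembed H (v m) - hembed H (v n))" for m n
    proof -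
      have "hembed H (v m + (- 1) *\<^sub>C v n) = hembed H (v m) + (- 1) *\<^sub>C hembed H (v n)"
        unfolding hembed_add[OF v(1) scale_closed[OF v(1)]] hembed_scale[OF v(1)] ..
      then have "hembed H (v m - v n) = hembed H (v m) - hembed H (v n)" by simp
      then have "hinner H (v m - v n) (v m - v n) =
          hinner (hcompletion H) (hembed H (v m) - hembed H (v n)) (hembed H (v m) - hembed H (v n))"
        using hinner_hembed[OF diff_closed[OF v(1) v(1)] diff_closed[OF v(1) v(1)], of m n m n] by simp
      then show ?thesis by (simp only: hnorm_def)
    qed
    have cv: "hcauchy H v"
      unfolding hcauchy_def
    proof (intro conjI allI impI v(1))
      fix e :: real assume e: "e > 0"
      have e3: "e / 3 > 0" using e by simp
      obtain N1 where N1: "\<And>m n. m \<ge> N1 \<Longrightarrow> n \<ge> N1 \<Longrightarrow> hnorm (hcompletion H) (s m - s n) < e / 3"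
        using C.hcauchyD[OF s e3] by blast
      obtain N2 where N2: "1 / real (Suc N2) < e / 3" by (rule nat_approx_posE[OF e3])
      have small: "1 / real (Suc m) < e / 3" if "m \<ge> N2" for m
      proof -
        have "1 / real (Suc m) \<le> 1 / real (Suc N2)" using that by (simp add: field_simps)
        then show ?thesis using N2 by linarith
      qed
      have "hnorm H (v m - v n) < e" if mn: "m \<ge> max N1 N2" "n \<ge> max N1 N2" for m n
      proof -
        have em: "hembed H (v m) \<in> hcarrier (hcompletion H)" "hembed H (v n) \<in> hcarrier (hcompletion H)"
          using v(1) hembed_closed by blast+
        have a: "hnorm (hcompletion H) (hembed H (v m) - s m) < e / 3"
          unfolding C.hnorm_minus_commute[OF em(1) sc, of m] using v(2)[of m] small[of m] mn by auto
        have b: "hnorm (hcompletion H) (s n - hembed H (v n)) < e / 3"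
          using v(2)[of n] small[of n] mn by auto
        have c: "hnorm (hcompletion H) (s m - s n) < e / 3" using N1 mn by auto
        show ?thesis
          using a b c C.hnorm_triangle_mid[OF em(1) sc em(2), of m] C.hnorm_triangle_mid[OF sc sc em(2), of m n] ev[of m n]
          by linarith
      qed
      then show "\<exists>N. \<forall>m\<ge>N. \<forall>n\<ge>N. hnorm H (v m - v n) < e" by blast
    qed
    have lc: "cauchy_class H v \<in> hcarrier (hcompletion H)" by (rule hcompletion_carrierI[OF cv])
    moreover have "htendsto (hcompletion H) s (cauchy_class H v)"
    proof (rule C.htendstoI[OF _ _ sc lc])
      show "hnorm (hcompletion H) (s n - cauchy_class H v)
          \<le> 1 / real (Suc n) + hnorm (hcompletion H) (hembed H (v n) - cauchy_class H v)" for n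
        using C.hnorm_triangle_mid[OF sc hembed_closed[OF v(1)] lc, of n n] v(2)[of n] by linarith
      show "(\<lambda>n. 1 / real (Suc n) + hnorm (hcompletion H) (hembed H (v n) - cauchy_class H v)) \<longlonglongrightarrow> 0"
        using htendsto_hembed[OF cv] LIMSEQ_Suc[OF lim_1_over_n] unfolding htendsto_def
        by (intro tendsto_add_zero)
    qed
    ultimately show "\<exists>l\<in>hcarrier (hcompletion H). htendsto (hcompletion H) s l" by blast
  qed
qed

lemma hembed_total:
  assumes y: "y \<in> hcarrier (hcompletion H)"
    and "\<And>v. v \<in> hcarrier H \<Longrightarrow> hinner (hcompletion H) (hembed H v) y = 0"
  shows "y = 0"
proof
  interpret C: semi_inner "hcompletion H" by (rule hcompletion_semi_inner)
  fix v
  show "y v = 0 v"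
  proof (cases "v \<in> hcarrier H")
    case True
    have "y v = cnj (hinner (hcompletion H) (hembed H v) y)"
      unfolding hinner_hembed_right[OF y True, symmetric] by (rule C.hinner_commute[OF hembed_closed[OF True] y])
    then show ?thesis using assms(2)[OF True] by simp
  qed (simp add: hcompletion_off[OF y])
qed

text \<open>Extension by continuity. Boundedness with respect to the seminorm makes \<open>g\<close>
  compatible with dividing out null vectors, so no separate condition on these appears.\<close>

lemma hcompletion_extend:
  assumes K: "hilb K"
    and g: "\<And>v. v \<in> hcarrier H \<Longrightarrow> g v \<in> hcarrier K"
    and g_add: "\<And>v w. v \<in> hcarrier H \<Longrightarrow> w \<in> hcarrier H \<Longrightarrow> g (v + w) = g v + g w"
    and g_scale: "\<And>c v. v \<in> hcarrier H \<Longrightarrow> g (c *\<^sub>C v) = c *\<^sub>C g v"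
    and g_bdd: "\<And>v. v \<in> hcarrier H \<Longrightarrow> hnorm K (g v) \<le> c * hnorm H v"
  shows "\<exists>T\<in>bop (hcompletion H) K. \<forall>v\<in>hcarrier H. T (hembed H v) = g v"
proof -
  interpret K: hilb K by fact
  interpret C: hilb "hcompletion H" by (rule hcompletion_hilb)
  have g_diff: "g (v - w) = g v - g w" if "v \<in> hcarrier H" "w \<in> hcarrier H" for v w
    using g_add[of v "(- 1) *\<^sub>C w"] g_scale[of w "- 1"] that by simp
  \<comment> \<open>\<open>c\<close> may be zero or negative, whereas
    \<open>\<bar>c\<bar> + 1\<close> is a Lipschitz constant by which one can divide.\<close>
  have lip: "hnorm K (g v - g w) \<le> (\<bar>c\<bar> + 1) * hnorm H (v - w)" if vw: "v \<in> hcarrier H" "w \<in> hcarrier H" for v w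
  proof -
    have "c * hnorm H (v - w) \<le> (\<bar>c\<bar> + 1) * hnorm H (v - w)"
      by (intro mult_right_mono hnorm_nonneg diff_closed vw) simp
    then show ?thesis using g_bdd[OF diff_closed[OF vw]] g_diff[OF vw] by simp
  qed
  have ex: "\<exists>l\<in>hcarrier K. htendsto K (\<lambda>n. g (x n)) l" if x: "hcauchy H x" for x
  proof (rule K.complete, unfold hcauchy_def, intro conjI allI impI)
    note k = hcauchy_carrier[OF x]
    show "g (x n) \<in> hcarrier K" for n using g k by blast
    fix e :: real assume e: "e > 0"
    have c1: "\<bar>c\<bar> + 1 > 0" by simp
    then have "e / (\<bar>c\<bar> + 1) > 0" using e by simp
    then obtain N where N: "\<And>m n. m \<ge> N \<Longrightarrow> n \<ge> N \<Longrightarrow> hnorm H (x m - x n) < e / (\<bar>c\<bar> + 1)"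
      using hcauchyD[OF x] by blast
    have "hnorm K (g (x m) - g (x n)) < e" if mn: "m \<ge> N" "n \<ge> N" for m n
    proof -
      have "(\<bar>c\<bar> + 1) * hnorm H (x m - x n) < (\<bar>c\<bar> + 1) * (e / (\<bar>c\<bar> + 1))"
        by (rule mult_strict_left_mono[OF N[OF mn] c1])
      then show ?thesis using lip[OF k k, of m n] c1 by simp
    qed
    then show "\<exists>N. \<forall>m\<ge>N. \<forall>n\<ge>N. hnorm K (g (x m) - g (x n)) < e" by blast
  qed
  define T where "T f = (if f \<in> hcarrier (hcompletion H)
    then SOME l. l \<in> hcarrier K \<and> htendsto K (\<lambda>n. g (cauchy_rep H f n)) l else 0)" for f
  \<comment> \<open>The value obtained from the picked representative is the limit along every
    representative, since two of them differ by a null sequence and \<open>g\<close> is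
    Lipschitz.\<close>
  have T: "T (cauchy_class H x) \<in> hcarrier K \<and> htendsto K (\<lambda>n. g (x n)) (T (cauchy_class H x))"
    if x: "hcauchy H x" for x
  proof -
    define x' where "x' = cauchy_rep H (cauchy_class H x)"
    note rx = cauchy_rep[OF x, folded x'_def]
    note k = hcauchy_carrier[OF x] hcauchy_carrier[OF rx(1)]
    define l where "l = T (cauchy_class H x)"
    have "l \<in> hcarrier K \<and> htendsto K (\<lambda>n. g (x' n)) l"
      using someI_ex[of "\<lambda>l. l \<in> hcarrier K \<and> htendsto K (\<lambda>n. g (x' n)) l"] ex[OF rx(1)] hcompletion_carrierI[OF x]
      by (auto simp: l_def T_def x'_def)
    then have l: "l \<in> hcarrier K" "htendsto K (\<lambda>n. g (x' n)) l" by blast+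
    have "htendsto K (\<lambda>n. g (x n)) l"
    proof (rule K.htendstoI[OF _ _ _ l(1)])
      show "hnorm K (g (x n) - l) \<le> (\<bar>c\<bar> + 1) * hnorm H (x n - x' n) + hnorm K (g (x' n) - l)" for n
        using K.hnorm_triangle_mid[OF g[OF k(1)] g[OF k(2)] l(1), of n n] lip[OF k, of n n] by linarith
      show "(\<lambda>n. (\<bar>c\<bar> + 1) * hnorm H (x n - x' n) + hnorm K (g (x' n) - l)) \<longlonglongrightarrow> 0"
        by (intro tendsto_add_zero tendsto_mult_right_zero cauchy_class_eq_imp[OF x rx(1) rx(2)[symmetric]]
            l(2)[unfolded htendsto_def])
      show "g (x n) \<in> hcarrier K" for n using g k by blast
    qed
    with l show ?thesis by (simp add: l_def)
  qed
  have Tl: "T (cauchy_class H x) = l" if "hcauchy H x" "l \<in> hcarrier K" "htendsto K (\<lambda>n. g (x n)) l" for x l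
    by (rule K.htendsto_unique[of "\<lambda>n. g (x n)"]) (use that T[OF that(1)] g hcauchy_carrier[OF that(1)] in blast)+
  have "T \<in> bop (hcompletion H) K"
  proof (rule bopI[where C = c])
    fix f assume "f \<in> hcarrier (hcompletion H)"
    then obtain x where x: "f = cauchy_class H x" "hcauchy H x" by (auto simp: hcompletion_carrier)
    note k = hcauchy_carrier[OF x(2)] and Tx = T[OF x(2), folded x(1)]
    show "T f \<in> hcarrier K" using Tx by blast
    have gx: "g (x n) \<in> hcarrier K" for n using g k by blast
    show "T (a *\<^sub>C f) = a *\<^sub>C T f" for a
      unfolding x(1) cauchy_class_scale[OF x(2), symmetric]
    proof (rule Tl[OF hcauchy_scale[OF x(2)]])
      show "a *\<^sub>C T (cauchy_class H x) \<in> hcarrier K" using Tx x(1) by auto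
      show "htendsto K (\<lambda>n. g (a *\<^sub>C x n)) (a *\<^sub>C T (cauchy_class H x))"
        using K.htendsto_scale[OF gx conjunct1[OF Tx] conjunct2[OF Tx], of a] x(1) by (simp add: g_scale[OF k])
    qed
    have "hnorm K (T f) \<le> c * hnorm (hcompletion H) f"
    proof (rule LIMSEQ_le)
      show "(\<lambda>n. hnorm K (g (x n))) \<longlonglongrightarrow> hnorm K (T f)" by (rule K.htendsto_hnorm[OF gx conjunct1[OF Tx] conjunct2[OF Tx]])
      show "(\<lambda>n. c * hnorm H (x n)) \<longlonglongrightarrow> c * hnorm (hcompletion H) f"
        unfolding x(1) by (rule tendsto_mult_left[OF hcompletion_hnorm[OF x(2)]])
    qed (simp add: g_bdd[OF k])
    then show "hnorm K (T f) \<le> c * hnorm (hcompletion H) f" .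
    fix f' assume "f' \<in> hcarrier (hcompletion H)"
    then obtain y where y: "f' = cauchy_class H y" "hcauchy H y" by (auto simp: hcompletion_carrier)
    note k' = hcauchy_carrier[OF y(2)] and Ty = T[OF y(2), folded y(1)]
    have gy: "g (y n) \<in> hcarrier K" for n using g k' by blast
    show "T (f + f') = T f + T f'"
      unfolding x(1) y(1) cauchy_class_add[OF x(2) y(2), symmetric]
    proof (rule Tl[OF hcauchy_add[OF x(2) y(2)]])
      show "T (cauchy_class H x) + T (cauchy_class H y) \<in> hcarrier K" using Tx Ty x(1) y(1) by auto
      show "htendsto K (\<lambda>n. g (x n + y n)) (T (cauchy_class H x) + T (cauchy_class H y))"
        using K.htendsto_add[OF gx conjunct1[OF Tx] conjunct2[OF Tx] gy conjunct1[OF Ty] conjunct2[OF Ty]] x(1) y(1)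
        by (simp add: g_add[OF k k'])
    qed
  qed (simp add: T_def)
  moreover have "T (hembed H v) = g v" if v: "v \<in> hcarrier H" for v
    unfolding hembed_def by (rule Tl[OF hcauchy_const[OF v] g[OF v]]) (simp add: htendsto_def)
  ultimately show ?thesis by blast
qed

end

section \<open>Gram-Schmidt and expansions in finite orthonormal systems\<close>

section \<open>Orthonormal bases of finite-dimensional subspaces\<close>

definition orthonormal :: "'h hspace \<Rightarrow> 'h set \<Rightarrow> bool"
  where "orthonormal H E \<longleftrightarrow> finite E \<and> E \<subseteq> hcarrier H \<and>
    (\<forall>e\<in>E. \<forall>f\<in>E. hinner H e f = (if e = f then 1 else 0))"

context hilb
begin

lemma orthonormal_hinner_sum:
  assumes E: "orthonormal H E" and f: "f \<in> E"
  shows "hinner H (\<Sum>e\<in>E. a e *\<^sub>C e) f = a f"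
proof -
  have EH: "\<And>e. e \<in> E \<Longrightarrow> e \<in> hcarrier H" and fin: "finite E" using E by (auto simp: orthonormal_def)
  have "hinner H (\<Sum>e\<in>E. a e *\<^sub>C e) f = (\<Sum>e\<in>E. a e * hinner H e f)"
    using EH f by (simp add: hinner_sum_left hinner_scale_left)
  also have "\<dots> = (\<Sum>e\<in>E. if e = f then a e else 0)"
    using E f by (intro sum.cong) (auto simp: orthonormal_def)
  also have "\<dots> = a f" using fin f by simp
  finally show ?thesis .
qed

text \<open>Gram-Schmidt, one vector at a time; a vector whose residue \<open>r\<close> vanishes
  leaves \<open>E\<close> unchanged. The inclusion of \<open>E\<close> in the span ensures later
  that a projection fixes the basis built from its range.\<close>

lemma orthonormal_basis_ex:
  assumes "finite B" "B \<subseteq> hcarrier H"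
  shows "\<exists>E. orthonormal H E \<and> E \<subseteq> complex_vector.span B \<and> (\<forall>b\<in>B. b = (\<Sum>e\<in>E. hinner H b e *\<^sub>C e))"
  using assms
proof (induction B)
  case empty
  have "orthonormal H {}" by (simp add: orthonormal_def)
  then show ?case by (intro exI[of _ "{}"]) simp
next
  case (insert b B)
  then obtain E where E: "orthonormal H E" "E \<subseteq> complex_vector.span B"
    "\<And>b. b \<in> B \<Longrightarrow> b = (\<Sum>e\<in>E. hinner H b e *\<^sub>C e)" by auto
  have EH: "\<And>e. e \<in> E \<Longrightarrow> e \<in> hcarrier H" and fin: "finite E" using E by (auto simp: orthonormal_def)
  have b: "b \<in> hcarrier H" and B: "B \<subseteq> hcarrier H" using insert by auto
  define s where "s = (\<Sum>e\<in>E. hinner H b e *\<^sub>C e)"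
  define r where "r = b - s"
  have s: "s \<in> hcarrier H" unfolding s_def using EH by (intro sum_closed scale_closed)
  have r: "r \<in> hcarrier H" using b s by (simp add: r_def)
  have re: "hinner H r e = 0" if "e \<in> E" for e
    using orthonormal_hinner_sum[OF E(1) that, of "hinner H b"] that EH b s
    by (simp add: r_def hinner_diff_left s_def[symmetric])
  have Esub: "E \<subseteq> complex_vector.span (insert b B)"
    using E(2) complex_vector.span_mono[of B "insert b B"] by blast
  show ?case
  proof (cases "r = 0")
    case True
    then have "b = (\<Sum>e\<in>E. hinner H b e *\<^sub>C e)" by (simp add: r_def s_def)
    then show ?thesis using E Esub by (intro exI[of _ E]) auto
  next
    case False
    define N where "N = hnorm H r"
    have N: "N > 0" using False r hnorm_eq_0_iff[OF r] hnorm_nonneg[OF r] by (simp add: N_def less_le)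
    define e0 where "e0 = complex_of_real (1 / N) *\<^sub>C r"
    have e0: "e0 \<in> hcarrier H" using r by (simp add: e0_def)
    have r0: "r = complex_of_real N *\<^sub>C e0" using N by (simp add: e0_def scaleC_scaleC scaleC_one)
    have e00: "hinner H e0 e0 = 1"
    proof -
      have "hinner H e0 e0 = complex_of_real (1 / N) * (complex_of_real (1 / N) * hinner H r r)"
        using r by (simp add: e0_def hinner_scale_left hinner_scale_right)
      also have "\<dots> = 1" unfolding hinner_self[OF r] N_def[symmetric] using N
        by (simp add: power2_eq_square)
      finally show ?thesis .
    qed
    have e0e: "hinner H e0 e = 0" if "e \<in> E" for e
      using re[OF that] r EH[OF that] by (simp add: e0_def hinner_scale_left)
    have ee0: "hinner H e e0 = 0" if "e \<in> E" for e
      using e0e[OF that] hinner_commute[OF e0 EH[OF that]] by simp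
    have notin: "e0 \<notin> E" using e00 e0e by auto
    have ON: "orthonormal H (insert e0 E)"
      using E(1) e0 e00 e0e ee0 notin by (auto simp: orthonormal_def)
    have "s \<in> complex_vector.span (insert b B)"
      unfolding s_def using Esub by (intro complex_vector.span_sum complex_vector.span_scale) auto
    then have "r \<in> complex_vector.span (insert b B)"
      unfolding r_def by (intro complex_vector.span_diff) (auto intro: complex_vector.span_base)
    then have "insert e0 E \<subseteq> complex_vector.span (insert b B)"
      using Esub unfolding e0_def by (auto intro: complex_vector.span_scale)
    moreover have "b' = (\<Sum>e\<in>insert e0 E. hinner H b' e *\<^sub>C e)" if "b' \<in> insert b B" for b'
    proof (cases "b' = b")
      case True
      have "hinner H s e0 = 0"
        unfolding s_def using EH e0 ee0 by (simp add: hinner_sum_left hinner_scale_left)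
      moreover have "hinner H r e0 = complex_of_real N"
        using r0 e0 e00 hinner_scale_left[OF e0 e0, of "complex_of_real N"] by simp
      ultimately have "hinner H b e0 = complex_of_real N"
        using r s e0 hinner_add_left[OF r s e0] by (simp add: r_def)
      then have "(\<Sum>e\<in>insert e0 E. hinner H b e *\<^sub>C e) = r + s"
        using fin notin by (simp add: r0[symmetric] s_def)
      then show ?thesis using True by (simp add: r_def)
    next
      case False
      then have b': "b' \<in> B" using that by simp
      have "hinner H b' e0 = hinner H (\<Sum>e\<in>E. hinner H b' e *\<^sub>C e) e0" using E(3)[OF b'] by simp
      also have "\<dots> = 0" using EH e0 ee0 by (simp add: hinner_sum_left hinner_scale_left)
      finally show ?thesis using E(3)[OF b'] fin notin by simp
    qed
    ultimately show ?thesis using ON by (intro exI[of _ "insert e0 E"]) blast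
  qed
qed

lemma orthonormal_expand_span:
  assumes E: "orthonormal H E" and B: "B \<subseteq> hcarrier H"
    and ex: "\<And>b. b \<in> B \<Longrightarrow> b = (\<Sum>e\<in>E. hinner H b e *\<^sub>C e)"
    and x: "x \<in> complex_vector.span B"
  shows "x = (\<Sum>e\<in>E. hinner H x e *\<^sub>C e)"
proof -
  have EH: "\<And>e. e \<in> E \<Longrightarrow> e \<in> hcarrier H" using E by (auto simp: orthonormal_def)
  have "x \<in> hcarrier H \<and> x = (\<Sum>e\<in>E. hinner H x e *\<^sub>C e)"
    using x
  proof (induction rule: complex_vector.span_induct_alt)
    case base
    then show ?case using EH by simp
  next
    case (step c b y)
    have b: "b \<in> hcarrier H" using step B by blast
    have "(\<Sum>e\<in>E. hinner H (c *\<^sub>C b + y) e *\<^sub>C e) = (\<Sum>e\<in>E. c *\<^sub>C (hinner H b e *\<^sub>C e) + hinner H y e *\<^sub>C e)"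
      using b step EH by (intro sum.cong)
        (auto simp: hinner_add_left hinner_scale_left scaleC_add_left scaleC_scaleC)
    also have "\<dots> = c *\<^sub>C (\<Sum>e\<in>E. hinner H b e *\<^sub>C e) + (\<Sum>e\<in>E. hinner H y e *\<^sub>C e)"
      by (simp add: sum.distrib complex_vector.scale_sum_right)
    also have "\<dots> = c *\<^sub>C b + y" using ex[OF step(1)] step(2) by simp
    finally show ?case using b step by simp
  qed
  then show ?thesis by blast
qed

end

section \<open>Positive kernels, Schur products and operators prescribed on generators\<close>

section \<open>Positive semidefinite kernels\<close>

text \<open>A common language for the constructions below: that a form on generators is
  semidefinite, and that an operator prescribed on generators is bounded, are both positivity
  statements for a kernel. Products of kernels then account for tensor products.\<close>

definition psd :: "'x set \<Rightarrow> ('x \<Rightarrow> 'x \<Rightarrow> complex) \<Rightarrow> bool"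
  where "psd X k \<longleftrightarrow> (\<forall>x\<in>X. \<forall>y\<in>X. k y x = cnj (k x y)) \<and>
    (\<forall>I c. finite I \<longrightarrow> I \<subseteq> X \<longrightarrow> (\<Sum>x\<in>I. \<Sum>y\<in>I. c x * cnj (c y) * k x y) \<in> \<real>\<^sub>\<ge>\<^sub>0)"

lemma psdI:
  assumes "\<And>x y. x \<in> X \<Longrightarrow> y \<in> X \<Longrightarrow> k y x = cnj (k x y)"
    and "\<And>I c. finite I \<Longrightarrow> I \<subseteq> X \<Longrightarrow> (\<Sum>x\<in>I. \<Sum>y\<in>I. c x * cnj (c y) * k x y) \<in> \<real>\<^sub>\<ge>\<^sub>0"
  shows "psd X k"
  unfolding psd_def by (intro conjI ballI allI impI assms)

lemma psd_commute: "psd X k \<Longrightarrow> x \<in> X \<Longrightarrow> y \<in> X \<Longrightarrow> k y x = cnj (k x y)"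
  unfolding psd_def by (elim conjE) (drule bspec, assumption, drule bspec, assumption, assumption)

lemma psd_nonneg: "psd X k \<Longrightarrow> finite I \<Longrightarrow> I \<subseteq> X \<Longrightarrow> (\<Sum>x\<in>I. \<Sum>y\<in>I. c x * cnj (c y) * k x y) \<in> \<real>\<^sub>\<ge>\<^sub>0"
  unfolding psd_def by (elim conjE) (drule spec, drule spec, drule mp, assumption, drule mp, assumption, assumption)

lemma sum_nonneg_Reals: "(\<And>i. i \<in> I \<Longrightarrow> f i \<in> \<real>\<^sub>\<ge>\<^sub>0) \<Longrightarrow> sum f I \<in> (\<real>\<^sub>\<ge>\<^sub>0 :: complex set)"
  by (induction I rule: infinite_finite_induct) (auto simp: complex_nonneg_Reals_iff)

lemma psd_cong: "(\<And>x y. x \<in> X \<Longrightarrow> y \<in> X \<Longrightarrow> k x y = k' x y) \<Longrightarrow> psd X k \<Longrightarrow> psd X k'"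
proof (rule psdI)
  fix I c assume *: "\<And>x y. x \<in> X \<Longrightarrow> y \<in> X \<Longrightarrow> k x y = k' x y" "psd X k" "finite I" "I \<subseteq> X"
  have "(\<Sum>x\<in>I. \<Sum>y\<in>I. c x * cnj (c y) * k' x y) = (\<Sum>x\<in>I. \<Sum>y\<in>I. c x * cnj (c y) * k x y)"
    using * by (intro sum.cong) (auto simp: subset_iff)
  then show "(\<Sum>x\<in>I. \<Sum>y\<in>I. c x * cnj (c y) * k' x y) \<in> \<real>\<^sub>\<ge>\<^sub>0"
    using psd_nonneg[OF *(2-4)] by simp
next
  fix x y assume *: "\<And>x y. x \<in> X \<Longrightarrow> y \<in> X \<Longrightarrow> k x y = k' x y" "psd X k" "x \<in> X" "y \<in> X"
  show "k' y x = cnj (k' x y)"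
    unfolding *(1)[OF *(4,3), symmetric] *(1)[OF *(3,4), symmetric] by (rule psd_commute[OF *(2-4)])
qed

lemma psd_zero: "psd X (\<lambda>x y. 0)"
  by (rule psdI) simp_all

lemma psd_add: "psd X k \<Longrightarrow> psd X k' \<Longrightarrow> psd X (\<lambda>x y. k x y + k' x y)"
proof (rule psdI)
  fix x y assume "psd X k" "psd X k'" "x \<in> X" "y \<in> X"
  then show "k y x + k' y x = cnj (k x y + k' x y)"
    unfolding complex_cnj_add by (intro arg_cong2[of _ _ _ _ "(+)"] psd_commute)
next
  fix I c assume *: "psd X k" "psd X k'" "finite I" "I \<subseteq> X"
  have "(\<Sum>x\<in>I. \<Sum>y\<in>I. c x * cnj (c y) * (k x y + k' x y)) =
    (\<Sum>x\<in>I. \<Sum>y\<in>I. c x * cnj (c y) * k x y) + (\<Sum>x\<in>I. \<Sum>y\<in>I. c x * cnj (c y) * k' x y)"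
    by (simp add: distrib_left sum.distrib)
  then show "(\<Sum>x\<in>I. \<Sum>y\<in>I. c x * cnj (c y) * (k x y + k' x y)) \<in> \<real>\<^sub>\<ge>\<^sub>0"
    using psd_nonneg[OF *(1,3,4)] psd_nonneg[OF *(2,3,4)] by simp
qed

context semi_inner
begin

lemma hinner_lincomb:
  assumes "\<And>x. x \<in> I \<Longrightarrow> F x \<in> hcarrier H"
  shows "hinner H (\<Sum>x\<in>I. c x *\<^sub>C F x) (\<Sum>x\<in>I. c x *\<^sub>C F x) = (\<Sum>x\<in>I. \<Sum>y\<in>I. c x * cnj (c y) * hinner H (F x) (F y))"
proof -
  define s where "s = (\<Sum>x\<in>I. c x *\<^sub>C F x)"
  have s: "s \<in> hcarrier H" unfolding s_def using assms by (intro sum_closed scale_closed)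
  have r: "hinner H (F x) s = (\<Sum>y\<in>I. cnj (c y) * hinner H (F x) (F y))" if "x \<in> I" for x
    unfolding s_def using assms that by (simp add: hinner_sum_right hinner_scale_right)
  have "hinner H s s = (\<Sum>x\<in>I. hinner H (c x *\<^sub>C F x) s)"
    by (subst (1) s_def, rule hinner_sum_left) (use assms s in auto)
  also have "\<dots> = (\<Sum>x\<in>I. \<Sum>y\<in>I. c x * cnj (c y) * hinner H (F x) (F y))"
    using assms s by (intro sum.cong refl) (simp add: hinner_scale_left r sum_distrib_left mult.assoc)
  finally show ?thesis by (simp add: s_def)
qed

lemma gram_psd:
  assumes "\<And>x. x \<in> X \<Longrightarrow> F x \<in> hcarrier H"
  shows "psd X (\<lambda>x y. hinner H (F x) (F y))"
proof (rule psdI)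
  show "hinner H (F y) (F x) = cnj (hinner H (F x) (F y))" if "x \<in> X" "y \<in> X" for x y
    by (rule hinner_commute[OF assms[OF that(1)] assms[OF that(2)]])
  fix I c assume I: "finite I" "I \<subseteq> X"
  have F: "F x \<in> hcarrier H" if "x \<in> I" for x using I assms that by blast
  show "(\<Sum>x\<in>I. \<Sum>y\<in>I. c x * cnj (c y) * hinner H (F x) (F y)) \<in> \<real>\<^sub>\<ge>\<^sub>0"
    using hinner_nonneg[of "\<Sum>x\<in>I. c x *\<^sub>C F x"] F by (simp add: hinner_lincomb[of I F c, OF F])
qed

lemma hinner_psd: "psd (hcarrier H) (hinner H)"
  using gram_psd[of "hcarrier H" "\<lambda>x. x"] by simp

end

text \<open>Positivity of \<open>c\<^sup>2 - T\<^sup>* T\<close>, read off on the family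
  \<open>F\<close>. In this form a norm bound survives multiplication by another positive
  kernel.\<close>

lemma (in semi_inner2) op_psd:
  assumes T: "T \<in> bop H K" and c: "op_bdd H K T c" and F: "\<And>x. x \<in> X \<Longrightarrow> F x \<in> hcarrier H"
  shows "psd X (\<lambda>x y. complex_of_real (c\<^sup>2) * hinner H (F x) (F y) - hinner K (T (F x)) (T (F y)))"
proof (rule psdI)
  fix x y assume "x \<in> X" "y \<in> X"
  then have k: "F x \<in> hcarrier H" "F y \<in> hcarrier H" using F by auto
  show "complex_of_real (c\<^sup>2) * hinner H (F y) (F x) - hinner K (T (F y)) (T (F x)) =
    cnj (complex_of_real (c\<^sup>2) * hinner H (F x) (F y) - hinner K (T (F x)) (T (F y)))"
    unfolding H.hinner_commute[OF k] K.hinner_commute[OF bop_closed[OF T k(1)] bop_closed[OF T k(2)]]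
    by simp
next
  fix I d assume I: "finite I" "I \<subseteq> X"
  have k: "F x \<in> hcarrier H" if "x \<in> I" for x using I F that by blast
  define s where "s = (\<Sum>x\<in>I. d x *\<^sub>C F x)"
  have s: "s \<in> hcarrier H" unfolding s_def using k by (intro H.sum_closed H.scale_closed)
  have Ts: "T s = (\<Sum>x\<in>I. d x *\<^sub>C T (F x))"
    unfolding s_def using k by (simp add: bop_sum[OF T] bop_scale[OF T])
  have "(\<Sum>x\<in>I. \<Sum>y\<in>I. d x * cnj (d y) * (complex_of_real (c\<^sup>2) * hinner H (F x) (F y) - hinner K (T (F x)) (T (F y))))
     = complex_of_real (c\<^sup>2) * (\<Sum>x\<in>I. \<Sum>y\<in>I. d x * cnj (d y) * hinner H (F x) (F y))
       - (\<Sum>x\<in>I. \<Sum>y\<in>I. d x * cnj (d y) * hinner K (T (F x)) (T (F y)))"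
    by (simp add: right_diff_distrib sum_subtractf sum_distrib_left mult.left_commute)
  also have "\<dots> = complex_of_real (c\<^sup>2) * hinner H s s - hinner K (T s) (T s)"
    using H.hinner_lincomb[of I F d, OF k] K.hinner_lincomb[of I "\<lambda>x. T (F x)" d, OF bop_closed[OF T k]]
    by (simp only: Ts s_def[symmetric])
  also have "\<dots> = complex_of_real ((c * hnorm H s)\<^sup>2 - (hnorm K (T s))\<^sup>2)"
    unfolding H.hinner_self[OF s] K.hinner_self[OF bop_closed[OF T s]] by (simp add: power_mult_distrib)
  also have "\<dots> \<in> \<real>\<^sub>\<ge>\<^sub>0"
    using power_mono[OF op_bddD[OF c s] K.hnorm_nonneg[OF bop_closed[OF T s]], of 2]
    by (simp add: complex_nonneg_Reals_iff del: of_real_diff of_real_power)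
  finally show "(\<Sum>x\<in>I. \<Sum>y\<in>I. d x * cnj (d y) * (complex_of_real (c\<^sup>2) * hinner H (F x) (F y) - hinner K (T (F x)) (T (F y)))) \<in> \<real>\<^sub>\<ge>\<^sub>0" .
qed

subsection \<open>The Hilbert space of a kernel\<close>

lemma formal_carrier: "f \<in> hcarrier (formal_space X k) \<longleftrightarrow> finite {x. f x \<noteq> 0} \<and> {x. f x \<noteq> 0} \<subseteq> X"
  by (simp add: formal_space_def)

lemma formal_hinner:
  assumes "finite I" "{x. f x \<noteq> 0} \<subseteq> I" "{x. g x \<noteq> 0} \<subseteq> I"
  shows "hinner (formal_space X k) f g = (\<Sum>x\<in>I. \<Sum>y\<in>I. f x * cnj (g y) * k x y)"
proof -
  have "(\<Sum>x\<in>I. \<Sum>y\<in>I. f x * cnj (g y) * k x y) = (\<Sum>x\<in>I. \<Sum>y | g y \<noteq> 0. f x * cnj (g y) * k x y)"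
    using assms by (intro sum.cong refl sum.mono_neutral_right) auto
  also have "\<dots> = (\<Sum>x | f x \<noteq> 0. \<Sum>y | g y \<noteq> 0. f x * cnj (g y) * k x y)"
    using assms by (intro sum.mono_neutral_right) auto
  finally show ?thesis by (simp add: formal_space_def)
qed

lemma formal_semi_inner:
  assumes k: "psd X k"
  shows "semi_inner (formal_space X k)"
proof
  let ?F = "formal_space X k"
  have fin: "finite {x. f x \<noteq> 0}" "{x. f x \<noteq> 0} \<subseteq> X" if "f \<in> hcarrier ?F" for f
    using that by (auto simp: formal_carrier)
  show "complex_vector.subspace (hcarrier ?F)"
  proof (rule complex_vector.subspaceI)
    show "0 \<in> hcarrier ?F" by (simp add: formal_carrier)
    show "f + g \<in> hcarrier ?F" if "f \<in> hcarrier ?F" "g \<in> hcarrier ?F" for f g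
    proof -
      have "{x. (f + g) x \<noteq> 0} \<subseteq> {x. f x \<noteq> 0} \<union> {x. g x \<noteq> 0}" by auto
      then show ?thesis using fin[OF that(1)] fin[OF that(2)] unfolding formal_carrier
        by (meson Un_least finite_UnI finite_subset order_trans)
    qed
    show "c *\<^sub>C f \<in> hcarrier ?F" if "f \<in> hcarrier ?F" for f c
    proof -
      have "{x. (c *\<^sub>C f) x \<noteq> 0} \<subseteq> {x. f x \<noteq> 0}" by (auto simp: scaleC_fun_apply scaleC_complex_def)
      then show ?thesis using fin[OF that] unfolding formal_carrier by (meson finite_subset order_trans)
    qed
  qed
  show "hinner ?F (f + g) h = hinner ?F f h + hinner ?F g h"
    if "f \<in> hcarrier ?F" "g \<in> hcarrier ?F" "h \<in> hcarrier ?F" for f g h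
  proof -
    let ?I = "{x. f x \<noteq> 0} \<union> {x. g x \<noteq> 0} \<union> {x. h x \<noteq> 0}"
    have I: "finite ?I" using that fin by blast
    have e: "hinner ?F (f + g) h = (\<Sum>x\<in>?I. \<Sum>y\<in>?I. (f + g) x * cnj (h y) * k x y)"
      "hinner ?F f h = (\<Sum>x\<in>?I. \<Sum>y\<in>?I. f x * cnj (h y) * k x y)"
      "hinner ?F g h = (\<Sum>x\<in>?I. \<Sum>y\<in>?I. g x * cnj (h y) * k x y)"
      by (rule formal_hinner[OF I]; auto)+
    show ?thesis unfolding e by (simp add: distrib_right sum.distrib)
  qed
  show "hinner ?F (c *\<^sub>C f) g = c * hinner ?F f g" if "f \<in> hcarrier ?F" "g \<in> hcarrier ?F" for f g c
  proof -
    let ?I = "{x. f x \<noteq> 0} \<union> {x. g x \<noteq> 0}"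
    have I: "finite ?I" using that fin by blast
    have e: "hinner ?F (c *\<^sub>C f) g = (\<Sum>x\<in>?I. \<Sum>y\<in>?I. (c *\<^sub>C f) x * cnj (g y) * k x y)"
      "hinner ?F f g = (\<Sum>x\<in>?I. \<Sum>y\<in>?I. f x * cnj (g y) * k x y)"
      by (rule formal_hinner[OF I]; auto simp: scaleC_fun_apply scaleC_complex_def)+
    show ?thesis unfolding e by (simp add: scaleC_fun_apply scaleC_complex_def sum_distrib_left mult.assoc)
  qed
  show "hinner ?F g f = cnj (hinner ?F f g)" if "f \<in> hcarrier ?F" "g \<in> hcarrier ?F" for f g
  proof -
    let ?I = "{x. f x \<noteq> 0} \<union> {x. g x \<noteq> 0}"
    have I: "finite ?I" "?I \<subseteq> X" using that fin by blast+
    have e: "hinner ?F f g = (\<Sum>x\<in>?I. \<Sum>y\<in>?I. f x * cnj (g y) * k x y)"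
      "hinner ?F g f = (\<Sum>x\<in>?I. \<Sum>y\<in>?I. g x * cnj (f y) * k x y)"
      by (rule formal_hinner[OF I(1)]; auto)+
    have "cnj (hinner ?F f g) = (\<Sum>x\<in>?I. \<Sum>y\<in>?I. cnj (f x * cnj (g y) * k x y))"
      unfolding e by simp
    also have "\<dots> = (\<Sum>x\<in>?I. \<Sum>y\<in>?I. g y * cnj (f x) * k y x)"
    proof (intro sum.cong refl)
      fix x y assume "x \<in> ?I" "y \<in> ?I"
      then have "k y x = cnj (k x y)" using psd_commute[OF k] I(2) by blast
      then show "cnj (f x * cnj (g y) * k x y) = g y * cnj (f x) * k y x" by (simp add: mult_ac)
    qed
    also have "\<dots> = hinner ?F g f" unfolding e by (rule sum.swap)
    finally show ?thesis ..
  qed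
  show "hinner ?F f f \<in> \<real>\<^sub>\<ge>\<^sub>0" if "f \<in> hcarrier ?F" for f
    unfolding formal_hinner[OF fin(1)[OF that] subset_refl subset_refl]
    by (rule psd_nonneg[OF k fin[OF that]])
qed

lemma generated_hilb: "psd X k \<Longrightarrow> hilb (generated_space X k)"
  unfolding generated_space_def by (rule semi_inner.hcompletion_hilb[OF formal_semi_inner])

lemma delta_carrier: "x \<in> X \<Longrightarrow> (\<lambda>y. if y = x then 1 else 0) \<in> hcarrier (formal_space X k)"
  by (simp add: formal_carrier)

lemma generator_closed: "psd X k \<Longrightarrow> x \<in> X \<Longrightarrow> generator X k x \<in> hcarrier (generated_space X k)"
  unfolding generator_def generated_space_def
  by (rule semi_inner.hembed_closed[OF formal_semi_inner delta_carrier])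

lemma generator_hinner:
  assumes "psd X k" "x \<in> X" "y \<in> X"
  shows "hinner (generated_space X k) (generator X k x) (generator X k y) = k x y"
proof -
  have "hinner (generated_space X k) (generator X k x) (generator X k y) =
    hinner (formal_space X k) (\<lambda>z. if z = x then 1 else 0) (\<lambda>z. if z = y then 1 else 0)"
    unfolding generator_def generated_space_def
    by (rule semi_inner.hinner_hembed[OF formal_semi_inner[OF assms(1)] delta_carrier[OF assms(2)] delta_carrier[OF assms(3)]])
  also have "\<dots> = (\<Sum>a\<in>{x, y}. \<Sum>b\<in>{x, y}. (if a = x then 1 else 0) * cnj (if b = y then 1 else 0) * k a b)"
    by (rule formal_hinner) auto
  also have "\<dots> = k x y" by (cases "x = y") auto
  finally show ?thesis .
qed

lemma sum_fun_apply: "(\<Sum>i\<in>I. f i) x = (\<Sum>i\<in>I. f i x)" for f :: "'i \<Rightarrow> 'x \<Rightarrow> 'y::comm_monoid_add"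
  by (induction I rule: infinite_finite_induct) auto

lemma hembed_eq_sum_generator:
  assumes k: "psd X k" and v: "v \<in> hcarrier (formal_space X k)"
  shows "hembed (formal_space X k) v = (\<Sum>x | v x \<noteq> 0. v x *\<^sub>C generator X k x)"
proof -
  interpret semi_inner "formal_space X k" by (rule formal_semi_inner[OF k])
  have fin: "finite {x. v x \<noteq> 0}" "{x. v x \<noteq> 0} \<subseteq> X" using v by (auto simp: formal_carrier)
  have d: "(\<lambda>y. if y = x then 1 else 0) \<in> hcarrier (formal_space X k)" if "x \<in> {x. v x \<noteq> 0}" for x
    using fin that by (intro delta_carrier) blast
  have "v = (\<Sum>x | v x \<noteq> 0. v x *\<^sub>C (\<lambda>y. if y = x then 1 else 0))"
    using fin(1)
    by (auto simp: fun_eq_iff sum_fun_apply scaleC_fun_apply scaleC_complex_def if_distrib sum.delta sum.delta'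
        cong: if_cong)
  then have "hembed (formal_space X k) v = hembed (formal_space X k) (\<Sum>x | v x \<noteq> 0. v x *\<^sub>C (\<lambda>y. if y = x then 1 else 0))"
    by simp
  also have "\<dots> = (\<Sum>x | v x \<noteq> 0. v x *\<^sub>C generator X k x)"
    unfolding generator_def using d by (subst hembed_sum) (auto simp: hembed_scale)
  finally show ?thesis .
qed

lemma generator_total:
  assumes k: "psd X k"
  shows "total (generated_space X k) (generator X k ` X)"
  unfolding total_def
proof (intro conjI ballI impI)
  show "generator X k ` X \<subseteq> hcarrier (generated_space X k)" using generator_closed[OF k] by blast
  interpret F: semi_inner "formal_space X k" by (rule formal_semi_inner[OF k])
  interpret G: hilb "generated_space X k" by (rule generated_hilb[OF k])
  fix y assume y: "y \<in> hcarrier (generated_space X k)"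
    and 0: "\<forall>d\<in>generator X k ` X. hinner (generated_space X k) d y = 0"
  show "y = 0"
  proof (rule F.hembed_total)
    show "y \<in> hcarrier (hcompletion (formal_space X k))" using y by (simp add: generated_space_def)
    fix v assume v: "v \<in> hcarrier (formal_space X k)"
    have X: "x \<in> X" if "v x \<noteq> 0" for x using v that by (auto simp: formal_carrier)
    have "hinner (generated_space X k) (hembed (formal_space X k) v) y =
      (\<Sum>x | v x \<noteq> 0. hinner (generated_space X k) (v x *\<^sub>C generator X k x) y)"
      unfolding hembed_eq_sum_generator[OF k v]
      by (rule G.hinner_sum_left) (use X y generator_closed[OF k] in auto)
    also have "\<dots> = 0"
      using X y 0 by (intro sum.neutral) (auto simp: G.hinner_scale_left generator_closed[OF k])
    finally show "hinner (hcompletion (formal_space X k)) (hembed (formal_space X k) v) y = 0"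
      by (simp add: generated_space_def)
  qed
qed

text \<open>Positivity of the difference kernel says that the linear extension of \<open>F\<close>
  to formal combinations is bounded by \<open>c\<close>; the extension then passes to the
  completion. Relations among the generators need no attention, since the bound sends null
  combinations to zero.\<close>

lemma generated_extend:
  assumes k: "psd X k" and K: "hilb K" and F: "\<And>x. x \<in> X \<Longrightarrow> F x \<in> hcarrier K" and c: "0 \<le> c"
    and pos: "psd X (\<lambda>x y. complex_of_real (c\<^sup>2) * k x y - hinner K (F x) (F y))"
  shows "\<exists>T\<in>bop (generated_space X k) K. \<forall>x\<in>X. T (generator X k x) = F x"
proof -
  interpret V: semi_inner "formal_space X k" by (rule formal_semi_inner[OF k])
  interpret K: hilb K by fact
  let ?V = "formal_space X k"
  define g where "g v = (\<Sum>x | v x \<noteq> 0. v x *\<^sub>C F x)" for v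
  have fin: "finite {x. f x \<noteq> 0}" "{x. f x \<noteq> 0} \<subseteq> X" if "f \<in> hcarrier ?V" for f
    using that by (auto simp: formal_carrier)
  have gI: "g v = (\<Sum>x\<in>I. v x *\<^sub>C F x)" if "finite I" "{x. v x \<noteq> 0} \<subseteq> I" for v I
    unfolding g_def by (rule sum.mono_neutral_left) (use that in auto)
  have "\<exists>T\<in>bop (hcompletion ?V) K. \<forall>v\<in>hcarrier ?V. T (hembed ?V v) = g v"
  proof (rule V.hcompletion_extend[OF K, where c = c])
    fix v assume v: "v \<in> hcarrier ?V"
    have Fv: "F x \<in> hcarrier K" if "x \<in> {x. v x \<noteq> 0}" for x using fin[OF v] F that by blast
    show gv: "g v \<in> hcarrier K" unfolding g_def using Fv by (intro K.sum_closed K.scale_closed)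
    show "g (a *\<^sub>C v) = a *\<^sub>C g v" for a
    proof -
      have "g (a *\<^sub>C v) = (\<Sum>x | v x \<noteq> 0. (a *\<^sub>C v) x *\<^sub>C F x)"
        by (rule gI) (use fin[OF v] in \<open>auto simp: scaleC_fun_apply scaleC_complex_def\<close>)
      then show ?thesis
        by (simp add: g_def complex_vector.scale_sum_right scaleC_scaleC scaleC_fun_apply scaleC_complex_def)
    qed
    have "(hnorm K (g v))\<^sup>2 \<le> (c * hnorm ?V v)\<^sup>2"
    proof -
      let ?I = "{x. v x \<noteq> 0}"
      have "complex_of_real ((c * hnorm ?V v)\<^sup>2 - (hnorm K (g v))\<^sup>2) =
          complex_of_real (c\<^sup>2) * hinner ?V v v - hinner K (g v) (g v)"
        unfolding V.hinner_self[OF v] K.hinner_self[OF gv] by (simp add: power_mult_distrib)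
      also have "\<dots> = complex_of_real (c\<^sup>2) * (\<Sum>x\<in>?I. \<Sum>y\<in>?I. v x * cnj (v y) * k x y)
          - (\<Sum>x\<in>?I. \<Sum>y\<in>?I. v x * cnj (v y) * hinner K (F x) (F y))"
        using formal_hinner[OF fin(1)[OF v] subset_refl subset_refl, of X k] K.hinner_lincomb[of ?I F v, OF Fv]
        by (simp only: g_def)
      also have "\<dots> = (\<Sum>x\<in>?I. \<Sum>y\<in>?I. v x * cnj (v y) * (complex_of_real (c\<^sup>2) * k x y - hinner K (F x) (F y)))"
        by (simp add: right_diff_distrib sum_subtractf sum_distrib_left mult.left_commute)
      also have "\<dots> \<in> \<real>\<^sub>\<ge>\<^sub>0" by (rule psd_nonneg[OF pos fin[OF v]])
      finally show ?thesis by (simp add: complex_nonneg_Reals_iff del: of_real_diff of_real_power)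
    qed
    then show "hnorm K (g v) \<le> c * hnorm ?V v"
      using c V.hnorm_nonneg[OF v] by (auto intro: power2_le_imp_le)
    fix w assume w: "w \<in> hcarrier ?V"
    let ?I = "{x. v x \<noteq> 0} \<union> {x. w x \<noteq> 0}"
    have e: "g (v + w) = (\<Sum>x\<in>?I. (v + w) x *\<^sub>C F x)" "g v = (\<Sum>x\<in>?I. v x *\<^sub>C F x)" "g w = (\<Sum>x\<in>?I. w x *\<^sub>C F x)"
      by (rule gI; use fin[OF v] fin[OF w] in auto)+
    show "g (v + w) = g v + g w" unfolding e by (simp add: scaleC_add_left sum.distrib)
  qed
  then obtain T where T: "T \<in> bop (generated_space X k) K" "\<And>v. v \<in> hcarrier ?V \<Longrightarrow> T (hembed ?V v) = g v"
    unfolding generated_space_def by blast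
  have "T (generator X k x) = F x" if x: "x \<in> X" for x
  proof -
    have "T (generator X k x) = (\<Sum>z\<in>{x}. (if z = x then 1 else 0) *\<^sub>C F z)"
      unfolding generator_def T(2)[OF delta_carrier[OF x]] by (rule gI) auto
    then show ?thesis by (simp add: scaleC_one)
  qed
  with T(1) show ?thesis by blast
qed

text \<open>\<open>f\<close> may identify points, and a direct proof would have to collect
  coefficients over its fibres. Realising \<open>k\<close> by inner products of generators turns the
  pullback into a Gram kernel at once.\<close>

lemma psd_comap:
  assumes k: "psd Y k" and f: "\<And>x. x \<in> X \<Longrightarrow> f x \<in> Y"
  shows "psd X (\<lambda>x y. k (f x) (f y))"
proof -
  interpret G: hilb "generated_space Y k" by (rule generated_hilb[OF k])
  have "psd X (\<lambda>x y. hinner (generated_space Y k) (generator Y k (f x)) (generator Y k (f y)))"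
    by (rule G.gram_psd) (use f generator_closed[OF k] in blast)
  then show ?thesis by (rule psd_cong[rotated]) (use f in \<open>simp add: generator_hinner[OF k]\<close>)
qed

text \<open>Expanding the generators of \<open>k2\<close> in a finite orthonormal system writes
  \<open>k2\<close> as a sum of rank one kernels \<open>\<beta> x * cnj (\<beta> y)\<close>.
  Multiplying \<open>k1\<close> by such a kernel merely changes the coefficients \<open>c x\<close>
  to \<open>c x * \<beta> x\<close>.\<close>

theorem Schur_product:
  assumes k1: "psd X k1" and k2: "psd X k2"
  shows "psd X (\<lambda>x y. k1 x y * k2 x y)"
proof (rule psdI)
  show "k1 y x * k2 y x = cnj (k1 x y * k2 x y)" if "x \<in> X" "y \<in> X" for x y
    unfolding psd_commute[OF k1 that] psd_commute[OF k2 that] by simp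
  fix I c assume I: "finite I" "I \<subseteq> X"
  interpret G: hilb "generated_space X k2" by (rule generated_hilb[OF k2])
  let ?G = "generated_space X k2"
  let ?b = "generator X k2"
  have b: "?b x \<in> hcarrier ?G" if "x \<in> I" for x using generator_closed[OF k2] I that by blast
  have "finite (?b ` I)" "?b ` I \<subseteq> hcarrier ?G" using I b by auto
  then obtain E where E: "orthonormal ?G E" "\<And>x. x \<in> I \<Longrightarrow> ?b x = (\<Sum>e\<in>E. hinner ?G (?b x) e *\<^sub>C e)"
    using G.orthonormal_basis_ex[of "?b ` I"] by blast
  have EH: "\<And>e. e \<in> E \<Longrightarrow> e \<in> hcarrier ?G" using E by (auto simp: orthonormal_def)
  have k2_eq: "k2 x y = (\<Sum>e\<in>E. hinner ?G (?b x) e * cnj (hinner ?G (?b y) e))" if "x \<in> I" "y \<in> I" for x y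
  proof -
    have xy: "x \<in> X" "y \<in> X" using that I by auto
    have "k2 x y = hinner ?G (?b x) (\<Sum>e\<in>E. hinner ?G (?b y) e *\<^sub>C e)"
      using generator_hinner[OF k2 xy] E(2)[OF that(2)] by simp
    also have "\<dots> = (\<Sum>e\<in>E. hinner ?G (?b x) (hinner ?G (?b y) e *\<^sub>C e))"
      by (rule G.hinner_sum_right) (use EH b that in auto)
    also have "\<dots> = (\<Sum>e\<in>E. hinner ?G (?b x) e * cnj (hinner ?G (?b y) e))"
      by (intro sum.cong refl) (simp add: G.hinner_scale_right EH b that)
    finally show ?thesis .
  qed
  have "(\<Sum>x\<in>I. \<Sum>y\<in>I. c x * cnj (c y) * (k1 x y * k2 x y)) =
    (\<Sum>x\<in>I. \<Sum>y\<in>I. \<Sum>e\<in>E. (c x * hinner ?G (?b x) e) * cnj (c y * hinner ?G (?b y) e) * k1 x y)"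
    by (intro sum.cong refl) (simp add: k2_eq sum_distrib_left mult_ac)
  also have "\<dots> = (\<Sum>x\<in>I. \<Sum>e\<in>E. \<Sum>y\<in>I. (c x * hinner ?G (?b x) e) * cnj (c y * hinner ?G (?b y) e) * k1 x y)"
    by (intro sum.cong refl) (rule sum.swap)
  also have "\<dots> = (\<Sum>e\<in>E. \<Sum>x\<in>I. \<Sum>y\<in>I. (c x * hinner ?G (?b x) e) * cnj (c y * hinner ?G (?b y) e) * k1 x y)"
    by (rule sum.swap)
  also have "\<dots> \<in> \<real>\<^sub>\<ge>\<^sub>0"
    by (rule sum_nonneg_Reals, rule psd_nonneg[OF k1 I, where c = "\<lambda>x. c x * hinner ?G (?b x) _"])
  finally show "(\<Sum>x\<in>I. \<Sum>y\<in>I. c x * cnj (c y) * (k1 x y * k2 x y)) \<in> \<real>\<^sub>\<ge>\<^sub>0" .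
qed

section \<open>Elementary tensors and the operators \<open>T \<otimes> 1\<close>\<close>

section \<open>Hilbert space tensor products\<close>

lemma (in hilb) eqI_total:
  assumes D: "total H D" and a: "a \<in> hcarrier H" and b: "b \<in> hcarrier H"
    and eq: "\<And>d. d \<in> D \<Longrightarrow> hinner H d a = hinner H d b"
  shows "a = b"
proof -
  have "a - b = 0"
    by (rule totalD[OF D]) (use D a b eq in \<open>auto simp: total_def hinner_diff_right subset_iff\<close>)
  then show ?thesis by simp
qed

context semi_inner2
begin

lemma pair_psd: "psd (hcarrier H \<times> hcarrier K) (pair_inner H K)"
proof -
  have "psd (hcarrier H \<times> hcarrier K) (\<lambda>p q. hinner H (fst p) (fst q) * hinner K (snd p) (snd q))"
    by (intro Schur_product psd_comap[OF H.hinner_psd] psd_comap[OF K.hinner_psd]) auto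
  then show ?thesis by (rule psd_cong[rotated]) (auto simp: pair_inner_def)
qed

lemma htensor_hilb: "hilb (htensor H K)"
  unfolding htensor_def by (rule generated_hilb[OF pair_psd])

lemma elem_tensor_closed: "x \<in> hcarrier H \<Longrightarrow> y \<in> hcarrier K \<Longrightarrow> elem_tensor H K x y \<in> hcarrier (htensor H K)"
  unfolding htensor_def elem_tensor_def by (rule generator_closed[OF pair_psd]) simp

lemma elem_tensor_hinner:
  "\<lbrakk>x \<in> hcarrier H; y \<in> hcarrier K; x' \<in> hcarrier H; y' \<in> hcarrier K\<rbrakk> \<Longrightarrow>
    hinner (htensor H K) (elem_tensor H K x y) (elem_tensor H K x' y') = hinner H x x' * hinner K y y'"
  unfolding htensor_def elem_tensor_def
  by (subst generator_hinner[OF pair_psd]) (auto simp: pair_inner_def)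

definition elems :: "(('h \<times> 'k \<Rightarrow> complex) \<Rightarrow> complex) set"
  where "elems = {elem_tensor H K x y | x y. x \<in> hcarrier H \<and> y \<in> hcarrier K}"

lemma elems_total: "total (htensor H K) elems"
proof -
  have "elems = generator (hcarrier H \<times> hcarrier K) (pair_inner H K) ` (hcarrier H \<times> hcarrier K)"
    by (auto simp: elems_def elem_tensor_def)
  then show ?thesis unfolding htensor_def using generator_total[OF pair_psd] by simp
qed

lemma elem_tensor_eqI:
  assumes "a \<in> hcarrier (htensor H K)" "b \<in> hcarrier (htensor H K)"
    and "\<And>x y. x \<in> hcarrier H \<Longrightarrow> y \<in> hcarrier K \<Longrightarrow>
      hinner (htensor H K) (elem_tensor H K x y) a = hinner (htensor H K) (elem_tensor H K x y) b"
  shows "a = b"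
proof (rule hilb.eqI_total[OF htensor_hilb elems_total assms(1,2)])
  fix d assume "d \<in> elems"
  then obtain x y where "x \<in> hcarrier H" "y \<in> hcarrier K" "d = elem_tensor H K x y" by (auto simp: elems_def)
  then show "hinner (htensor H K) d a = hinner (htensor H K) d b" using assms(3) by blast
qed

text \<open>The generators are labelled by pairs of vectors, and bilinearity is not built into
  formal combinations. It holds in the completion because both sides have the same inner products
  with all elementary tensors, which are total. The three companions below work in the same
  way.\<close>

lemma elem_tensor_add_left:
  assumes "x \<in> hcarrier H" "x' \<in> hcarrier H" "y \<in> hcarrier K"
  shows "elem_tensor H K (x + x') y = elem_tensor H K x y + elem_tensor H K x' y"
proof -
  interpret M: hilb "htensor H K" by (rule htensor_hilb)
  show ?thesis
    by (rule elem_tensor_eqI) (use assms in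
      \<open>simp_all add: elem_tensor_closed elem_tensor_hinner M.hinner_add_right H.hinner_add_right distrib_right\<close>)
qed

lemma elem_tensor_scale_left:
  assumes "x \<in> hcarrier H" "y \<in> hcarrier K"
  shows "elem_tensor H K (c *\<^sub>C x) y = c *\<^sub>C elem_tensor H K x y"
proof -
  interpret M: hilb "htensor H K" by (rule htensor_hilb)
  show ?thesis
    by (rule elem_tensor_eqI) (use assms in
      \<open>simp_all add: elem_tensor_closed elem_tensor_hinner M.hinner_scale_right H.hinner_scale_right mult.assoc\<close>)
qed

lemma elem_tensor_add_right:
  assumes "x \<in> hcarrier H" "y \<in> hcarrier K" "y' \<in> hcarrier K"
  shows "elem_tensor H K x (y + y') = elem_tensor H K x y + elem_tensor H K x y'"
proof -
  interpret M: hilb "htensor H K" by (rule htensor_hilb)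
  show ?thesis
    by (rule elem_tensor_eqI) (use assms in
      \<open>simp_all add: elem_tensor_closed elem_tensor_hinner M.hinner_add_right K.hinner_add_right distrib_left\<close>)
qed

lemma elem_tensor_scale_right:
  assumes "x \<in> hcarrier H" "y \<in> hcarrier K"
  shows "elem_tensor H K x (c *\<^sub>C y) = c *\<^sub>C elem_tensor H K x y"
proof -
  interpret M: hilb "htensor H K" by (rule htensor_hilb)
  show ?thesis
    by (rule elem_tensor_eqI) (use assms in
      \<open>simp_all add: elem_tensor_closed elem_tensor_hinner M.hinner_scale_right K.hinner_scale_right mult.left_commute\<close>)
qed

lemma elem_tensor_hnorm:
  assumes "x \<in> hcarrier H" "y \<in> hcarrier K"
  shows "hnorm (htensor H K) (elem_tensor H K x y) = hnorm H x * hnorm K y"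
proof -
  have "hinner (htensor H K) (elem_tensor H K x y) (elem_tensor H K x y) =
      complex_of_real ((hnorm H x * hnorm K y)\<^sup>2)"
    unfolding elem_tensor_hinner[OF assms assms] H.hinner_self[OF assms(1)] K.hinner_self[OF assms(2)]
    by (simp add: power_mult_distrib)
  then have "hnorm (htensor H K) (elem_tensor H K x y) = sqrt ((hnorm H x * hnorm K y)\<^sup>2)"
    by (simp only: hnorm_def[of "htensor H K"] Re_complex_of_real)
  then show ?thesis using assms by simp
qed

lemma elem_tensor_htendsto:
  assumes x: "x \<in> hcarrier H" and s: "\<And>n. s n \<in> hcarrier K" "y \<in> hcarrier K" "htendsto K s y"
  shows "htendsto (htensor H K) (\<lambda>n. elem_tensor H K x (s n)) (elem_tensor H K x y)"
proof -
  interpret M: hilb "htensor H K" by (rule htensor_hilb)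
  have e: "elem_tensor H K x (s n) - elem_tensor H K x y = elem_tensor H K x (s n - y)" for n
    using elem_tensor_add_right[OF x s(1) K.scale_closed[OF s(2), of "- 1"], of n]
      elem_tensor_scale_right[OF x s(2), of "- 1"] by simp
  show ?thesis
    unfolding htendsto_def e
    using tendsto_mult_right_zero[OF s(3)[unfolded htendsto_def], of "hnorm H x"]
    by (simp add: elem_tensor_hnorm[OF x] s)
qed

end

text \<open>The second factor is only semi-inner: it will be the closed span
  \<open>leg_space\<close>, whose completeness is not established. The tensor product is a
  completion anyway.\<close>

locale tensor_op = H: hilb H + K: semi_inner K
  for H :: "'h::complex_vector hspace" and K :: "'k::complex_vector hspace"

sublocale tensor_op \<subseteq> semi_inner2 ..

context tensor_op
begin

text \<open>The kernel of \<open>c\<^sup>2 - T\<^sup>* T\<close> on the first factor times the Gram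
  kernel of the second is positive by the Schur product theorem; this is the bound \<open>c\<close>
  for \<open>T \<otimes> 1\<close>.\<close>

lemma tensor_id_ex:
  assumes T: "T \<in> bop H H"
  shows "\<exists>S\<in>bop (htensor H K) (htensor H K).
    \<forall>x\<in>hcarrier H. \<forall>y\<in>hcarrier K. S (elem_tensor H K x y) = elem_tensor H K (T x) y"
proof -
  interpret HH: hilb2 H H ..
  obtain c where c: "op_bdd H H T c" using HH.bop_bdd[OF T] ..
  let ?X = "hcarrier H \<times> hcarrier K"
  let ?F = "\<lambda>p. elem_tensor H K (T (fst p)) (snd p)"
  have "\<exists>S\<in>bop (generated_space ?X (pair_inner H K)) (htensor H K). \<forall>p\<in>?X. S (generator ?X (pair_inner H K) p) = ?F p"
  proof (rule generated_extend[OF pair_psd htensor_hilb])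
    show "?F p \<in> hcarrier (htensor H K)" if "p \<in> ?X" for p
      using that by (intro elem_tensor_closed bop_closed[OF T]) auto
    show "0 \<le> c" by (rule op_bddD0[OF c])
    have "psd ?X (\<lambda>p q. (complex_of_real (c\<^sup>2) * hinner H (fst p) (fst q) - hinner H (T (fst p)) (T (fst q))) * hinner K (snd p) (snd q))"
      by (intro Schur_product HH.op_psd[OF T c] psd_comap[OF K.hinner_psd]) auto
    then show "psd ?X (\<lambda>p q. complex_of_real (c\<^sup>2) * pair_inner H K p q - hinner (htensor H K) (?F p) (?F q))"
      by (rule psd_cong[rotated])
        (auto simp: pair_inner_def elem_tensor_hinner bop_closed[OF T] left_diff_distrib mult.assoc)
  qed
  then show ?thesis by (auto simp: htensor_def elem_tensor_def)
qed

lemma tensor_bop_eqI: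
  assumes "S \<in> bop (htensor H K) G" "S' \<in> bop (htensor H K) G" "hilb G"
    and "\<And>x y. x \<in> hcarrier H \<Longrightarrow> y \<in> hcarrier K \<Longrightarrow> S (elem_tensor H K x y) = S' (elem_tensor H K x y)"
  shows "S = S'"
proof -
  interpret M: hilb "htensor H K" by (rule htensor_hilb)
  interpret G: hilb G by fact
  interpret MG: hilb2 "htensor H K" G ..
  show ?thesis
  proof (rule MG.bop_eqI_total[OF assms(1,2) elems_total])
    fix d assume "d \<in> elems"
    then obtain x y where "x \<in> hcarrier H" "y \<in> hcarrier K" "d = elem_tensor H K x y" by (auto simp: elems_def)
    then show "S d = S' d" using assms(4) by blast
  qed
qed

lemma tensor_id_props:
  assumes T: "T \<in> bop H H"
  shows "tensor_id H K T \<in> bop (htensor H K) (htensor H K) \<and>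
    (\<forall>x\<in>hcarrier H. \<forall>y\<in>hcarrier K. tensor_id H K T (elem_tensor H K x y) = elem_tensor H K (T x) y)"
proof -
  obtain S where S: "S \<in> bop (htensor H K) (htensor H K)"
    "\<forall>x\<in>hcarrier H. \<forall>y\<in>hcarrier K. S (elem_tensor H K x y) = elem_tensor H K (T x) y"
    using tensor_id_ex[OF T] by blast
  show ?thesis
    unfolding tensor_id_def
  proof (rule theI[of _ S])
    fix S' assume S': "S' \<in> bop (htensor H K) (htensor H K) \<and>
      (\<forall>x\<in>hcarrier H. \<forall>y\<in>hcarrier K. S' (elem_tensor H K x y) = elem_tensor H K (T x) y)"
    show "S' = S"
      by (rule tensor_bop_eqI[OF conjunct1[OF S'] S(1) htensor_hilb]) (simp add: S' S(2))
  qed (use S in blast)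
qed

lemmas tensor_id_bop = tensor_id_props[THEN conjunct1]
lemmas tensor_id_elem = tensor_id_props[THEN conjunct2, rule_format]

lemma tensor_id_eqI:
  assumes "T \<in> bop H H" "S \<in> bop (htensor H K) (htensor H K)"
    and "\<And>x y. x \<in> hcarrier H \<Longrightarrow> y \<in> hcarrier K \<Longrightarrow> S (elem_tensor H K x y) = elem_tensor H K (T x) y"
  shows "tensor_id H K T = S"
  by (rule tensor_bop_eqI[OF tensor_id_bop[OF assms(1)] assms(2) htensor_hilb])
     (simp add: assms(3) tensor_id_elem[OF assms(1)])

lemma tensor_id_comp:
  assumes S: "S \<in> bop H H" and T: "T \<in> bop H H"
  shows "tensor_id H K (S \<circ> T) = tensor_id H K S \<circ> tensor_id H K T"
proof (rule tensor_id_eqI)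
  interpret M: hilb "htensor H K" by (rule htensor_hilb)
  show "S \<circ> T \<in> bop H H"
    by (rule comp_bop[OF H.semi_inner_axioms H.semi_inner_axioms H.semi_inner_axioms T S])
  show "tensor_id H K S \<circ> tensor_id H K T \<in> bop (htensor H K) (htensor H K)"
    by (rule comp_bop[OF M.semi_inner_axioms M.semi_inner_axioms M.semi_inner_axioms tensor_id_bop[OF T] tensor_id_bop[OF S]])
qed (simp add: tensor_id_elem[OF T] tensor_id_elem[OF S] bop_closed[OF T])

lemma tensor_id_idop: "tensor_id H K (idop H) = idop (htensor H K)"
proof (rule tensor_id_eqI[OF H.idop_bop])
  interpret M: hilb "htensor H K" by (rule htensor_hilb)
  show "idop (htensor H K) \<in> bop (htensor H K) (htensor H K)" by (rule M.idop_bop)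
qed (simp add: elem_tensor_closed)

lemma tensor_id_adj:
  assumes T: "T \<in> bop H H"
  shows "tensor_id H K (adj H H T) = adj (htensor H K) (htensor H K) (tensor_id H K T)"
proof -
  interpret M: hilb "htensor H K" by (rule htensor_hilb)
  interpret HH: hilb2 H H ..
  interpret MM: hilb2 "htensor H K" "htensor H K" ..
  note TT = tensor_id_bop[OF T] and aT = HH.adj_bop[OF T]
  show ?thesis
  proof (rule tensor_id_eqI[OF aT MM.adj_bop[OF TT]])
    fix x y assume xy: "x \<in> hcarrier H" "y \<in> hcarrier K"
    note ec = elem_tensor_closed[OF xy]
    show "adj (htensor H K) (htensor H K) (tensor_id H K T) (elem_tensor H K x y) = elem_tensor H K (adj H H T x) y"
    proof (rule elem_tensor_eqI[OF MM.adj_closed[OF TT ec] elem_tensor_closed[OF HH.adj_closed[OF T xy(1)] xy(2)]])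
      fix x' y' assume xy': "x' \<in> hcarrier H" "y' \<in> hcarrier K"
      show "hinner (htensor H K) (elem_tensor H K x' y') (adj (htensor H K) (htensor H K) (tensor_id H K T) (elem_tensor H K x y))
        = hinner (htensor H K) (elem_tensor H K x' y') (elem_tensor H K (adj H H T x) y)"
        unfolding MM.adj_inner[OF TT elem_tensor_closed[OF xy'] ec, symmetric] tensor_id_elem[OF T xy']
          elem_tensor_hinner[OF bop_closed[OF T xy'(1)] xy'(2) xy] elem_tensor_hinner[OF xy' HH.adj_closed[OF T xy(1)] xy(2)]
          HH.adj_inner[OF T xy'(1) xy(1)] ..
    qed
  qed
qed

end

section \<open>The GNS representation of a state\<close>

section \<open>The GNS representation\<close>

locale gns =
  fixes \<tau> :: "'a::unital_cstar_algebra \<Rightarrow> complex"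
  assumes state: "state \<tau>"
begin

lemma state_add: "\<tau> (x + y) = \<tau> x + \<tau> y"
  by (rule state[unfolded state_def, THEN conjunct1, rule_format])

lemma state_scale: "\<tau> (c *\<^sub>C x) = c * \<tau> x"
  by (rule state[unfolded state_def, THEN conjunct2, THEN conjunct1, rule_format])

lemma state_pos: "\<tau> (star x * x) \<in> \<real>\<^sub>\<ge>\<^sub>0"
  by (rule state[unfolded state_def, THEN conjunct2, THEN conjunct2, THEN conjunct1, rule_format])

lemma state_bound: "cmod (\<tau> x) \<le> norm x"
  by (rule state[unfolded state_def, THEN conjunct2, THEN conjunct2, THEN conjunct2, THEN conjunct1, rule_format])

lemma state_one: "\<tau> 1 = 1"
  by (rule state[unfolded state_def, THEN conjunct2, THEN conjunct2, THEN conjunct2, THEN conjunct2])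

lemma state_diff: "\<tau> (x - y) = \<tau> x - \<tau> y"
  using state_add[of "x - y" y] by simp

lemma star_one: "star (1::'a) = 1"
  using star_mult[of "star (1::'a)" 1] star_star[of "1::'a"] by simp

text \<open>Polarization: a sesquilinear form whose diagonal is real is Hermitian.\<close>

lemma state_hermitian: "\<tau> (star a * b) = cnj (\<tau> (star b * a))"
proof -
  have im: "Im (\<tau> (star x * x)) = 0" for x
    using state_pos[of x] by (simp add: complex_nonneg_Reals_iff)
  have 1: "\<tau> (star (a + b) * (a + b)) = \<tau> (star a * a) + \<tau> (star a * b) + \<tau> (star b * a) + \<tau> (star b * b)"
    by (simp add: star_add distrib_left distrib_right state_add)
  have 2: "\<tau> (star (a + \<i> *\<^sub>C b) * (a + \<i> *\<^sub>C b)) =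
      \<tau> (star a * a) + \<i> * \<tau> (star a * b) - \<i> * \<tau> (star b * a) + \<tau> (star b * b)"
    by (simp add: star_add star_scaleC distrib_left distrib_right left_diff_distrib state_add state_diff
        scaleC_mult_left scaleC_mult_right state_scale right_diff_distrib scaleC_scaleC)
  have "Im (\<tau> (star a * b) + \<tau> (star b * a)) = 0"
    using im[of "a + b"] im[of a] im[of b] unfolding 1 by simp
  moreover have "Re (\<tau> (star a * b)) - Re (\<tau> (star b * a)) = 0"
    using im[of "a + \<i> *\<^sub>C b"] im[of a] im[of b] unfolding 2 by simp
  ultimately show ?thesis by (simp add: complex_eq_iff)
qed

lemma gns_pre_simps [simp]: "hcarrier (gns_pre \<tau>) = UNIV" "hinner (gns_pre \<tau>) a b = \<tau> (star b * a)"
  by (simp_all add: gns_pre_def)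

sublocale V: semi_inner "gns_pre \<tau>"
proof
  show "hinner (gns_pre \<tau>) y x = cnj (hinner (gns_pre \<tau>) x y)" for x y
    unfolding gns_pre_simps by (rule state_hermitian)
qed (simp_all add: distrib_left state_add scaleC_mult_right state_scale state_pos)

sublocale G: hilb "gns_space \<tau>"
  unfolding gns_space_def by (rule V.hcompletion_hilb)

text \<open>Iterating Cauchy-Schwarz bounds \<open>\<phi>(h)\<close> for \<open>\<phi> = \<tau>(b\<^sup>* \<cdot> b)\<close> and \<open>h = a\<^sup>* a\<close> by
  \<open>\<phi>(1)\<close> times the spectral radius of \<open>h\<close>, hence by \<open>\<phi>(1) \<parallel>a\<parallel>\<^sup>2\<close>.\<close>

lemma gns_left_mult_bound: "hnorm (gns_pre \<tau>) (a * b) \<le> norm a * hnorm (gns_pre \<tau>) b"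
proof -
  define h where "h = star a * a"
  define N where "N = (hnorm (gns_pre \<tau>) b)\<^sup>2"
  define g where "g n = h ^ (2 ^ n)" for n :: nat
  define r where "r n = \<tau> (star b * (g n * b))" for n
  have sh: "star (h ^ m) = h ^ m" for m
  proof (induction m)
    case (Suc m)
    have "star h = h" by (simp add: h_def star_mult star_star)
    then show ?case using Suc by (simp add: star_mult power_commutes)
  qed (simp add: star_one)
  \<comment> \<open>Cauchy-Schwarz for \<open>g n * b\<close> and \<open>b\<close>. As
    \<open>g n\<close> is self-adjoint with square \<open>g (Suc n)\<close>, the squared norm of the
    first vector is the next term \<open>r (Suc n)\<close>.\<close>
  have step: "(cmod (r n))\<^sup>2 \<le> N * cmod (r (Suc n))" for n
  proof -
    have "r n = hinner (gns_pre \<tau>) (g n * b) b" by (simp add: r_def)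
    then have "cmod (r n) \<le> hnorm (gns_pre \<tau>) (g n * b) * hnorm (gns_pre \<tau>) b"
      using V.Cauchy_Schwarz[of "g n * b" b] by simp
    then have "(cmod (r n))\<^sup>2 \<le> (hnorm (gns_pre \<tau>) (g n * b) * hnorm (gns_pre \<tau>) b)\<^sup>2"
      by (rule power_mono) simp
    then have "(cmod (r n))\<^sup>2 \<le> (hnorm (gns_pre \<tau>) (g n * b))\<^sup>2 * N"
      by (simp only: N_def power_mult_distrib)
    also have "(hnorm (gns_pre \<tau>) (g n * b))\<^sup>2 = cmod (hinner (gns_pre \<tau>) (g n * b) (g n * b))"
      using V.hinner_self[of "g n * b"] by (simp add: norm_power del: gns_pre_simps(2))
    also have "hinner (gns_pre \<tau>) (g n * b) (g n * b) = r (Suc n)"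
    proof -
      have "g (Suc n) = g n * g n" unfolding g_def by (simp add: mult_2 power_add)
      then show ?thesis by (simp add: r_def star_mult sh g_def mult.assoc)
    qed
    finally show ?thesis by (simp add: mult.commute)
  qed
  \<comment> \<open>A crude bound, but its constant does not depend on \<open>n\<close> and is
    swamped by the growing exponent 2^n.\<close>
  have bnd: "cmod (r n) \<le> norm (star b) * norm b * norm h ^ (2 ^ n)" for n
  proof -
    have "cmod (r n) \<le> norm (star b * (g n * b))" unfolding r_def by (rule state_bound)
    also have "\<dots> \<le> norm (star b) * (norm (g n) * norm b)"
      by (meson mult_left_mono norm_ge_zero norm_mult_ineq order_trans)
    also have "\<dots> \<le> norm (star b) * (norm h ^ (2 ^ n) * norm b)"
      unfolding g_def by (intro mult_left_mono mult_right_mono norm_power_ineq) auto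
    finally show ?thesis by (simp add: mult_ac)
  qed
  have r0: "cmod (r 0) = (hnorm (gns_pre \<tau>) (a * b))\<^sup>2"
  proof -
    have "r 0 = hinner (gns_pre \<tau>) (a * b) (a * b)" by (simp add: r_def g_def h_def star_mult mult.assoc)
    then show ?thesis using V.hinner_self[of "a * b"] by (simp add: norm_power del: gns_pre_simps(2))
  qed
  have nh: "norm h = (norm a)\<^sup>2" by (simp add: h_def cstar_identity)
  have "cmod (r 0) \<le> norm h * N"
  proof (cases "N = 0")
    case True
    then show ?thesis using step[of 0] by simp
  next
    case False
    then have N: "N > 0" by (simp add: N_def less_le)
    define t where "t n = cmod (r n) / N" for n
    have t0: "t n \<ge> 0" for n using N by (simp add: t_def)
    have tstep: "(t n)\<^sup>2 \<le> t (Suc n)" for n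
      using step[of n] N by (simp add: t_def power_divide power2_eq_square field_simps)
    have tpow: "t 0 ^ (2 ^ n) \<le> t n" for n
    proof (induction n)
      case (Suc n)
      have "t 0 ^ (2 ^ Suc n) = (t 0 ^ (2 ^ n))\<^sup>2" by (simp add: power_mult[symmetric] mult.commute)
      also have "\<dots> \<le> (t n)\<^sup>2" using Suc t0[of 0] by (intro power_mono) auto
      finally show ?case using tstep[of n] by simp
    qed simp
    \<comment> \<open>If \<open>t 0\<close> exceeded \<open>norm h\<close>, powers of their quotient
      with exponents 2^n would all stay below the constant \<open>C\<close>, although the quotient
      is larger than 1.\<close>
    have "t 0 \<le> norm h"
    proof (rule ccontr)
      assume "\<not> t 0 \<le> norm h"
      then have less: "norm h < t 0" by simp
      define C where "C = norm (star b) * norm b / N"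
      have le: "t 0 ^ (2 ^ n) \<le> C * norm h ^ (2 ^ n)" for n
      proof -
        have "t n \<le> C * norm h ^ (2 ^ n)"
          using divide_right_mono[OF bnd[of n], of N] N by (simp add: t_def C_def)
        then show ?thesis using tpow[of n] by simp
      qed
      show False
      proof (cases "norm h = 0")
        case True
        then show False using le[of 0] less by simp
      next
        case False
        then have h0: "norm h > 0" by simp
        define q where "q = t 0 / norm h"
        have q: "q > 1" using less h0 by (simp add: q_def)
        have "q ^ (2 ^ n) \<le> C" for n
          using le[of n] h0 by (simp add: q_def power_divide divide_le_eq)
        moreover obtain m where m: "C < q ^ m" using real_arch_pow[OF q] by blast
        moreover have "q ^ m \<le> q ^ (2 ^ m)" using q by (intro power_increasing) (auto simp: less_imp_le)
        ultimately show False by (meson not_le order_trans)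
      qed
    qed
    then show ?thesis using N by (simp add: t_def divide_le_eq)
  qed
  then have "(hnorm (gns_pre \<tau>) (a * b))\<^sup>2 \<le> (norm a * hnorm (gns_pre \<tau>) b)\<^sup>2"
    unfolding r0 nh by (simp add: N_def power_mult_distrib)
  then show ?thesis by (rule power2_le_imp_le) simp
qed

lemma hembed_closed: "hembed (gns_pre \<tau>) a \<in> hcarrier (gns_space \<tau>)"
  unfolding gns_space_def by (rule V.hembed_closed) simp

lemma hembed_hinner: "hinner (gns_space \<tau>) (hembed (gns_pre \<tau>) a) (hembed (gns_pre \<tau>) b) = \<tau> (star b * a)"
  unfolding gns_space_def using V.hinner_hembed[of a b] by simp

lemma hembed_total: "total (gns_space \<tau>) (range (hembed (gns_pre \<tau>)))"
  unfolding total_def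
proof (intro conjI ballI impI)
  show "range (hembed (gns_pre \<tau>)) \<subseteq> hcarrier (gns_space \<tau>)" using hembed_closed by blast
  fix y assume "y \<in> hcarrier (gns_space \<tau>)" "\<forall>d\<in>range (hembed (gns_pre \<tau>)). hinner (gns_space \<tau>) d y = 0"
  then show "y = 0" using V.hembed_total[of y] by (simp add: gns_space_def)
qed

lemma gns_bop_eqI:
  assumes "S \<in> bop (gns_space \<tau>) (gns_space \<tau>)" "T \<in> bop (gns_space \<tau>) (gns_space \<tau>)"
    and "\<And>b. S (hembed (gns_pre \<tau>) b) = T (hembed (gns_pre \<tau>) b)"
  shows "S = T"
proof (rule hilb2.bop_eqI_total[OF G.hilb2_self assms(1,2) hembed_total])
  fix d assume "d \<in> range (hembed (gns_pre \<tau>))"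
  then obtain b where "d = hembed (gns_pre \<tau>) b" by (rule rangeE)
  then show "S d = T d" by (simp only: assms(3))
qed

lemma gns_rep_props: "gns_rep \<tau> a \<in> bop (gns_space \<tau>) (gns_space \<tau>) \<and>
    (\<forall>b. gns_rep \<tau> a (hembed (gns_pre \<tau>) b) = hembed (gns_pre \<tau>) (a * b))"
proof -
  have "\<exists>T\<in>bop (hcompletion (gns_pre \<tau>)) (gns_space \<tau>).
      \<forall>v\<in>hcarrier (gns_pre \<tau>). T (hembed (gns_pre \<tau>) v) = hembed (gns_pre \<tau>) (a * v)"
  proof (rule V.hcompletion_extend[OF G.hilb_axioms, where c = "norm a"])
    fix v w :: 'a and c
    show "hembed (gns_pre \<tau>) (a * v) \<in> hcarrier (gns_space \<tau>)" by (rule hembed_closed)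
    show "hembed (gns_pre \<tau>) (a * (v + w)) = hembed (gns_pre \<tau>) (a * v) + hembed (gns_pre \<tau>) (a * w)"
      unfolding distrib_left by (rule V.hembed_add) simp_all
    show "hembed (gns_pre \<tau>) (a * (c *\<^sub>C v)) = c *\<^sub>C hembed (gns_pre \<tau>) (a * v)"
      unfolding scaleC_mult_right by (rule V.hembed_scale) simp
    have "hnorm (gns_space \<tau>) (hembed (gns_pre \<tau>) x) = hnorm (gns_pre \<tau>) x" for x
      unfolding hnorm_def hembed_hinner by simp
    then show "hnorm (gns_space \<tau>) (hembed (gns_pre \<tau>) (a * v)) \<le> norm a * hnorm (gns_pre \<tau>) v"
      using gns_left_mult_bound by simp
  qed
  then obtain T where T: "T \<in> bop (gns_space \<tau>) (gns_space \<tau>)"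
    "\<forall>b. T (hembed (gns_pre \<tau>) b) = hembed (gns_pre \<tau>) (a * b)" unfolding gns_space_def gns_pre_simps(1) by blast
  show ?thesis
    unfolding gns_rep_def
  proof (rule theI[of _ T])
    fix T' assume T': "T' \<in> bop (gns_space \<tau>) (gns_space \<tau>) \<and> (\<forall>b. T' (hembed (gns_pre \<tau>) b) = hembed (gns_pre \<tau>) (a * b))"
    show "T' = T" by (rule gns_bop_eqI[OF conjunct1[OF T'] T(1)]) (simp add: T' T(2))
  qed (use T in blast)
qed

lemmas gns_rep_bop = gns_rep_props[THEN conjunct1]
lemmas gns_rep_hembed = gns_rep_props[THEN conjunct2, rule_format]

lemma gns_rep_mult: "gns_rep \<tau> (a * b) = gns_rep \<tau> a \<circ> gns_rep \<tau> b"
  by (rule gns_bop_eqI[OF gns_rep_bop comp_bop[OF G.semi_inner_axioms G.semi_inner_axioms G.semi_inner_axioms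
        gns_rep_bop gns_rep_bop]])
     (simp add: gns_rep_hembed mult.assoc)

lemma gns_rep_one: "gns_rep \<tau> 1 = idop (gns_space \<tau>)"
  by (rule gns_bop_eqI[OF gns_rep_bop G.idop_bop]) (simp add: gns_rep_hembed hembed_closed)

lemma gns_rep_star: "gns_rep \<tau> (star a) = adj (gns_space \<tau>) (gns_space \<tau>) (gns_rep \<tau> a)"
proof -
  interpret GG: hilb2 "gns_space \<tau>" "gns_space \<tau>" by (rule G.hilb2_self)
  show ?thesis
  proof (rule gns_bop_eqI[OF gns_rep_bop GG.adj_bop[OF gns_rep_bop]])
    fix b
    show "gns_rep \<tau> (star a) (hembed (gns_pre \<tau>) b) =
        adj (gns_space \<tau>) (gns_space \<tau>) (gns_rep \<tau> a) (hembed (gns_pre \<tau>) b)"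
    proof (rule G.eqI_total[OF hembed_total bop_closed[OF gns_rep_bop hembed_closed] GG.adj_closed[OF gns_rep_bop hembed_closed]])
      fix d assume "d \<in> range (hembed (gns_pre \<tau>))"
      then obtain c where d: "d = hembed (gns_pre \<tau>) c" by blast
      show "hinner (gns_space \<tau>) d (gns_rep \<tau> (star a) (hembed (gns_pre \<tau>) b)) =
        hinner (gns_space \<tau>) d (adj (gns_space \<tau>) (gns_space \<tau>) (gns_rep \<tau> a) (hembed (gns_pre \<tau>) b))"
        unfolding d GG.adj_inner[OF gns_rep_bop hembed_closed hembed_closed, symmetric] gns_rep_hembed hembed_hinner
        by (simp add: star_mult star_star mult.assoc)
    qed
  qed
qed

lemma gns_vector_closed: "gns_vector \<tau> \<in> hcarrier (gns_space \<tau>)"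
  unfolding gns_vector_def by (rule hembed_closed)

lemma gns_vector_unit: "hinner (gns_space \<tau>) (gns_vector \<tau>) (gns_vector \<tau>) = 1"
  by (simp add: gns_vector_def hembed_hinner star_one state_one)

lemma gns_rep_vector: "hinner (gns_space \<tau>) (gns_rep \<tau> a (gns_vector \<tau>)) (gns_vector \<tau>) = \<tau> a"
  by (simp add: gns_vector_def gns_rep_hembed hembed_hinner star_one)

text \<open>Stated for the adjoint because \<open>act_ann\<close> moves the operator to the other
  side of an inner product; a state is Hermitian, so adjoints of centered elements are
  centered.\<close>

lemma gns_rep_centered:
  assumes "\<tau> a = 0"
  shows "hinner (gns_space \<tau>) (adj (gns_space \<tau>) (gns_space \<tau>) (gns_rep \<tau> a) (gns_vector \<tau>)) (gns_vector \<tau>) = 0"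
proof -
  have "\<tau> (star a * 1) = cnj (\<tau> (star 1 * a))" by (rule state_hermitian)
  then show ?thesis using assms unfolding gns_rep_star[symmetric] gns_rep_vector by (simp add: star_one)
qed

lemma gns_rep_unitary:
  assumes "unitary a"
  shows "adj (gns_space \<tau>) (gns_space \<tau>) (gns_rep \<tau> a) \<circ> gns_rep \<tau> a = idop (gns_space \<tau>)"
    and "gns_rep \<tau> a \<circ> adj (gns_space \<tau>) (gns_space \<tau>) (gns_rep \<tau> a) = idop (gns_space \<tau>)"
  using assms unfolding unitary_def gns_rep_star[symmetric] gns_rep_mult[symmetric] gns_rep_one[symmetric] by simp_all

end

section \<open>The free product Hilbert space and the two left actions on it\<close>

section \<open>The free product of Hilbert spaces\<close>

lemma hclosed_span_simps [simp]:
  "hinner (hclosed_span H S) = hinner H"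
  "hnorm (hclosed_span H S) = hnorm H"
  "htendsto (hclosed_span H S) = htendsto H"
  by (simp_all add: hclosed_span_def hnorm_def htendsto_def fun_eq_iff)

lemma hclosed_span_carrier: "x \<in> hcarrier (hclosed_span H S) \<longleftrightarrow>
    x \<in> hcarrier H \<and> (\<exists>s. (\<forall>n. s n \<in> complex_vector.span S) \<and> htendsto H s x)"
  by (simp add: hclosed_span_def)

context semi_inner
begin

lemma span_in_hclosed_span:
  assumes "S \<subseteq> hcarrier H" "x \<in> complex_vector.span S"
  shows "x \<in> hcarrier (hclosed_span H S)"
proof -
  have "htendsto H (\<lambda>_. x) x" by (simp add: htendsto_def)
  then show ?thesis
    unfolding hclosed_span_carrier by (intro conjI span_closed[OF assms] exI[of _ "\<lambda>_. x"] allI assms(2))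
qed

lemma hclosed_span_semi_inner:
  assumes S: "S \<subseteq> hcarrier H"
  shows "semi_inner (hclosed_span H S)"
proof -
  let ?L = "hclosed_span H S"
  have LH: "x \<in> hcarrier H" if "x \<in> hcarrier ?L" for x using that by (simp add: hclosed_span_carrier)
  have SH: "\<And>x. x \<in> complex_vector.span S \<Longrightarrow> x \<in> hcarrier H" using span_closed[OF S] .
  show ?thesis
  proof
    show "complex_vector.subspace (hcarrier ?L)"
    proof (rule complex_vector.subspaceI)
      show "0 \<in> hcarrier ?L" by (rule span_in_hclosed_span[OF S complex_vector.span_zero])
      fix x y assume x: "x \<in> hcarrier ?L" and y: "y \<in> hcarrier ?L"
      obtain s t where s: "\<And>n. s n \<in> complex_vector.span S" "htendsto H s x"
        and t: "\<And>n. t n \<in> complex_vector.span S" "htendsto H t y"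
        using x y unfolding hclosed_span_carrier by blast
      have "htendsto H (\<lambda>n. s n + t n) (x + y)"
        by (rule htendsto_add[OF SH[OF s(1)] LH[OF x] s(2) SH[OF t(1)] LH[OF y] t(2)])
      moreover have "s n + t n \<in> complex_vector.span S" for n by (rule complex_vector.span_add[OF s(1) t(1)])
      ultimately show "x + y \<in> hcarrier ?L"
        unfolding hclosed_span_carrier using add_closed[OF LH[OF x] LH[OF y]]
        by (intro conjI exI[of _ "\<lambda>n. s n + t n"]) blast+
    next
      fix c x assume x: "x \<in> hcarrier ?L"
      obtain s where s: "\<And>n. s n \<in> complex_vector.span S" "htendsto H s x"
        using x unfolding hclosed_span_carrier by blast
      have "htendsto H (\<lambda>n. c *\<^sub>C s n) (c *\<^sub>C x)"
        by (rule htendsto_scale[OF SH[OF s(1)] LH[OF x] s(2)])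
      moreover have "c *\<^sub>C s n \<in> complex_vector.span S" for n by (rule complex_vector.span_scale[OF s(1)])
      ultimately show "c *\<^sub>C x \<in> hcarrier ?L"
        unfolding hclosed_span_carrier using scale_closed[OF LH[OF x]]
        by (intro conjI exI[of _ "\<lambda>n. c *\<^sub>C s n"]) blast+
    qed
  next
    fix x y z c assume k: "x \<in> hcarrier ?L" "y \<in> hcarrier ?L" "z \<in> hcarrier ?L"
    show "hinner ?L (x + y) z = hinner ?L x z + hinner ?L y z"
      unfolding hclosed_span_simps by (rule hinner_add_left[OF LH LH LH, OF k])
  next
    fix x y c assume k: "x \<in> hcarrier ?L" "y \<in> hcarrier ?L"
    show "hinner ?L (c *\<^sub>C x) y = c * hinner ?L x y"
      unfolding hclosed_span_simps by (rule hinner_scale_left[OF LH LH, OF k])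
    show "hinner ?L y x = cnj (hinner ?L x y)"
      unfolding hclosed_span_simps by (rule hinner_commute[OF LH LH, OF k])
  next
    fix x assume "x \<in> hcarrier ?L"
    then show "hinner ?L x x \<in> \<real>\<^sub>\<ge>\<^sub>0"
      unfolding hclosed_span_simps by (rule hinner_nonneg[OF LH])
  qed
qed

end

text \<open>Finitely many words have bounded length, so this reduces positivity of the word kernel
  to an induction on the length.\<close>

lemma psd_finite: "(\<And>I. finite I \<Longrightarrow> I \<subseteq> X \<Longrightarrow> psd I k) \<Longrightarrow> psd X k"
proof (rule psdI)
  assume *: "\<And>I. finite I \<Longrightarrow> I \<subseteq> X \<Longrightarrow> psd I k"
  show "k y x = cnj (k x y)" if "x \<in> X" "y \<in> X" for x y
    by (rule psd_commute[OF *[of "{x, y}"]]) (use that in auto)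
  show "(\<Sum>x\<in>I. \<Sum>y\<in>I. c x * cnj (c y) * k x y) \<in> \<real>\<^sub>\<ge>\<^sub>0" if "finite I" "I \<subseteq> X" for I c
    by (rule psd_nonneg[OF *[OF that] that(1) subset_refl])
qed

lemma psd_subset: "psd X k \<Longrightarrow> Y \<subseteq> X \<Longrightarrow> psd Y k"
  using psd_comap[of X k Y "\<lambda>x. x"] by auto

lemma psd_one: "psd X (\<lambda>x y. 1)"
proof (rule psdI)
  fix I :: "'a set" and c :: "'a \<Rightarrow> complex"
  have "(\<Sum>x\<in>I. \<Sum>y\<in>I. c x * cnj (c y) * 1) = sum c I * cnj (sum c I)"
    by (simp add: sum_product)
  also have "\<dots> \<in> \<real>\<^sub>\<ge>\<^sub>0"
    unfolding complex_norm_square[symmetric] by (simp add: complex_nonneg_Reals_iff del: of_real_power)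
  finally show "(\<Sum>x\<in>I. \<Sum>y\<in>I. c x * cnj (c y) * 1) \<in> \<real>\<^sub>\<ge>\<^sub>0" .
qed simp

text \<open>Extension of a diagonal block by zero; together with \<open>psd_add\<close> it assembles
  block diagonal kernels.\<close>

lemma psd_restrict:
  assumes k: "psd (X \<inter> Y) k"
  shows "psd X (\<lambda>x y. if x \<in> Y \<and> y \<in> Y then k x y else 0)"
proof (rule psdI)
  show "(if y \<in> Y \<and> x \<in> Y then k y x else 0) = cnj (if x \<in> Y \<and> y \<in> Y then k x y else 0)"
    if "x \<in> X" "y \<in> X" for x y
  proof (cases "x \<in> Y \<and> y \<in> Y")
    case True
    then show ?thesis using psd_commute[OF k, of x y] that by (simp only: if_True simp_thms Int_iff)
  next
    case False
    then show ?thesis by auto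
  qed
  fix I c assume I: "finite I" "I \<subseteq> X"
  have "(\<Sum>x\<in>I. \<Sum>y\<in>I. c x * cnj (c y) * (if x \<in> Y \<and> y \<in> Y then k x y else 0)) =
    (\<Sum>x\<in>I \<inter> Y. \<Sum>y\<in>I. c x * cnj (c y) * (if x \<in> Y \<and> y \<in> Y then k x y else 0))"
    by (rule sum.mono_neutral_right) (use I in auto)
  also have "\<dots> = (\<Sum>x\<in>I \<inter> Y. \<Sum>y\<in>I \<inter> Y. c x * cnj (c y) * (if x \<in> Y \<and> y \<in> Y then k x y else 0))"
    by (intro sum.cong refl sum.mono_neutral_right) (use I in auto)
  also have "\<dots> = (\<Sum>x\<in>I \<inter> Y. \<Sum>y\<in>I \<inter> Y. c x * cnj (c y) * k x y)"
    by (intro sum.cong refl) auto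
  also have "\<dots> \<in> \<real>\<^sub>\<ge>\<^sub>0" by (rule psd_nonneg[OF k]) (use I in auto)
  finally show "(\<Sum>x\<in>I. \<Sum>y\<in>I. c x * cnj (c y) * (if x \<in> Y \<and> y \<in> Y then k x y else 0)) \<in> \<real>\<^sub>\<ge>\<^sub>0" .
qed

locale free_pair = H1: hilb H1 + H2: hilb H2
  for H1 :: "'h::complex_vector hspace" and H2 :: "'k::complex_vector hspace" +
  fixes \<xi>1 :: 'h and \<xi>2 :: 'k
  assumes \<xi>1: "\<xi>1 \<in> hcarrier H1" "hinner H1 \<xi>1 \<xi>1 = 1"
    and \<xi>2: "\<xi>2 \<in> hcarrier H2" "hinner H2 \<xi>2 \<xi>2 = 1"
begin

abbreviation "words \<equiv> free_words H1 \<xi>1 H2 \<xi>2"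
abbreviation "F \<equiv> free_space H1 \<xi>1 H2 \<xi>2"
abbreviation "e \<equiv> word_vector H1 \<xi>1 H2 \<xi>2"
abbreviation "letters \<equiv> Inl ` hcarrier H1 \<union> Inr ` hcarrier H2"

lemma letter_psd: "psd letters (letter_inner H1 H2)"
proof -
  define p1 where "p1 = case_sum (\<lambda>x::'h. x) (\<lambda>y::'k. 0)"
  define p2 where "p2 = case_sum (\<lambda>x::'h. 0) (\<lambda>y::'k. y)"
  have "psd letters (\<lambda>a b. hinner H1 (p1 a) (p1 b) + hinner H2 (p2 a) (p2 b))"
    by (intro psd_add H1.gram_psd H2.gram_psd) (auto simp: p1_def p2_def)
  then show ?thesis by (rule psd_cong[rotated]) (auto simp: p1_def p2_def)
qed

text \<open>On nonempty words the kernel is the product of the letter kernel at the heads and the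
  word kernel at the tails, so Schur's theorem gives the induction step. The empty word is a
  one-dimensional block orthogonal to the rest.\<close>

lemma word_psd_bounded: "psd {w \<in> lists letters. length w \<le> n} (word_inner H1 H2)"
proof (induction n)
  case 0
  show ?case by (rule psd_cong[OF _ psd_one]) auto
next
  case (Suc n)
  let ?X = "{w \<in> lists letters. length w \<le> Suc n}"
  let ?N = "{w::('h + 'k) list. w = []}" and ?C = "{w::('h + 'k) list. w \<noteq> []}"
  have "psd (?X \<inter> ?C) (\<lambda>v w. letter_inner H1 H2 (hd v) (hd w) * word_inner H1 H2 (tl v) (tl w))"
    by (intro Schur_product psd_comap[OF letter_psd] psd_comap[OF Suc.IH])
       (auto simp: neq_Nil_conv)
  then have "psd ?X (\<lambda>v w. (if v \<in> ?N \<and> w \<in> ?N then 1 else 0) +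
      (if v \<in> ?C \<and> w \<in> ?C then letter_inner H1 H2 (hd v) (hd w) * word_inner H1 H2 (tl v) (tl w) else 0))"
    by (intro psd_add psd_restrict psd_one)
  then show ?case
  proof (rule psd_cong[rotated])
    fix v w :: "('h + 'k) list"
    show "(if v \<in> ?N \<and> w \<in> ?N then 1 else 0) +
      (if v \<in> ?C \<and> w \<in> ?C then letter_inner H1 H2 (hd v) (hd w) * word_inner H1 H2 (tl v) (tl w) else 0)
      = word_inner H1 H2 v w" by (cases v; cases w) auto
  qed
qed

lemma words_lists: "w \<in> words \<Longrightarrow> w \<in> lists letters"
  by (auto simp: free_words_def)

lemma word_psd: "psd words (word_inner H1 H2)"
proof (rule psd_finite)
  fix I assume I: "finite I" "I \<subseteq> words"
  have "length w \<le> Max (length ` I)" if "w \<in> I" for w using I that by simp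
  then have "I \<subseteq> {w \<in> lists letters. length w \<le> Max (length ` I)}" using I words_lists by blast
  then show "psd I (word_inner H1 H2)" by (rule psd_subset[OF word_psd_bounded])
qed

sublocale F: hilb F
  unfolding free_space_def by (rule generated_hilb[OF word_psd])

lemma e_closed: "w \<in> words \<Longrightarrow> e w \<in> hcarrier F"
  unfolding free_space_def word_vector_def by (rule generator_closed[OF word_psd])

lemma e_hinner: "v \<in> words \<Longrightarrow> w \<in> words \<Longrightarrow> hinner F (e v) (e w) = word_inner H1 H2 v w"
  unfolding free_space_def word_vector_def by (rule generator_hinner[OF word_psd])

lemma e_total: "total F (e ` words)"
  unfolding free_space_def word_vector_def by (rule generator_total[OF word_psd])

lemma Nil_words: "[] \<in> words"
  by (simp add: free_words_def)

end

text \<open>The unitary \<open>leg_unitary\<close> is obtained as the adjoint of the isometry \<open>W\<close> below.\<close>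

locale free_leg = free_pair H1 H2 \<xi>1 \<xi>2 + Hi: hilb Hi
  for H1 :: "'h::complex_vector hspace" and H2 :: "'k::complex_vector hspace" and \<xi>1 \<xi>2
    and Hi :: "'i::complex_vector hspace" +
  fixes \<iota> :: "'i \<Rightarrow> 'h + 'k" and \<xi>i :: 'i
  assumes \<xi>i: "\<xi>i \<in> hcarrier Hi" "hinner Hi \<xi>i \<xi>i = 1"
    and inj_\<iota>: "inj \<iota>"
    and letter_\<iota>: "letter_inner H1 H2 (\<iota> x) (\<iota> x') = hinner Hi x x'"
    and letter_off: "a \<notin> range \<iota> \<Longrightarrow> letter_inner H1 H2 (\<iota> x) a = 0" "a \<notin> range \<iota> \<Longrightarrow> letter_inner H1 H2 a (\<iota> x) = 0"
    and Cons_words: "\<iota> x # w \<in> free_words H1 \<xi>1 H2 \<xi>2 \<longleftrightarrow>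
      x \<in> hcarrier Hi \<and> hinner Hi x \<xi>i = 0 \<and> w \<in> leg_words H1 \<xi>1 H2 \<xi>2 \<iota>"
begin

abbreviation "legs \<equiv> leg_words H1 \<xi>1 H2 \<xi>2 \<iota>"
abbreviation "L \<equiv> leg_space H1 \<xi>1 H2 \<xi>2 \<iota>"
abbreviation "M \<equiv> htensor Hi L"

lemma legs_words: "w \<in> legs \<Longrightarrow> w \<in> words"
  by (simp add: leg_words_def)

lemma words_cases:
  assumes "w \<in> words"
  obtains "w \<in> legs" | x v where "w = \<iota> x # v" "x \<in> hcarrier Hi" "hinner Hi x \<xi>i = 0" "v \<in> legs"
proof (cases "w \<in> legs")
  case False
  then obtain x v where "w = \<iota> x # v" using assms by (cases w) (auto simp: leg_words_def)
  then show ?thesis using that(2) assms Cons_words by blast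
qed

lemma not_legs: "\<iota> x # v \<notin> legs"
  by (simp add: leg_words_def)

lemma legs_e_closed: "e ` legs \<subseteq> hcarrier F"
  using e_closed legs_words by blast

sublocale L: semi_inner L
  unfolding leg_space_def by (rule F.hclosed_span_semi_inner[OF legs_e_closed])

lemma L_simps [simp]: "hinner L = hinner F" "hnorm L = hnorm F" "htendsto L = htendsto F"
  by (simp_all add: leg_space_def)

lemma e_L: "w \<in> legs \<Longrightarrow> e w \<in> hcarrier L"
  unfolding leg_space_def
  by (rule F.span_in_hclosed_span[OF legs_e_closed complex_vector.span_base]) blast

sublocale T: tensor_op Hi L ..

sublocale M: hilb M by (rule T.htensor_hilb)

sublocale MF: hilb2 M F ..

sublocale FM: hilb2 F M ..

lemma word_inner_leg: "v \<in> legs \<Longrightarrow> word_inner H1 H2 v (\<iota> x # w) = 0" "v \<in> legs \<Longrightarrow> word_inner H1 H2 (\<iota> x # w) v = 0"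
  by (cases v; simp add: leg_words_def letter_off)+

text \<open>The vector \<open>V\<^sub>i\<^sup>* e\<^sub>w\<close>: a word that starts in factor
  \<open>i\<close> is cut after its first letter, and any other word receives \<open>\<xi>i\<close>
  as its first tensor factor. Here \<open>inv \<iota>\<close> strips the tag of the letter.\<close>

definition vec :: "('h + 'k) list \<Rightarrow> ('i \<times> ((('h + 'k) list \<Rightarrow> complex) \<Rightarrow> complex) \<Rightarrow> complex) \<Rightarrow> complex"
  where "vec w = (if w \<in> legs then elem_tensor Hi L \<xi>i (e w) else elem_tensor Hi L (inv \<iota> (hd w)) (e (tl w)))"

lemma vec_leg: "w \<in> legs \<Longrightarrow> vec w = elem_tensor Hi L \<xi>i (e w)"
  by (simp add: vec_def)

lemma vec_Cons: "vec (\<iota> x # w) = elem_tensor Hi L x (e w)"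
  by (simp add: vec_def not_legs inv_f_f[OF inj_\<iota>])

lemma vec_closed: "w \<in> words \<Longrightarrow> vec w \<in> hcarrier M"
  by (erule words_cases) (auto simp: vec_leg vec_Cons intro!: T.elem_tensor_closed \<xi>i e_L)

lemma vec_hinner:
  assumes v: "v \<in> words" and w: "w \<in> words"
  shows "hinner M (vec v) (vec w) = word_inner H1 H2 v w"
proof -
  have sym: "hinner Hi \<xi>i x = 0" if "x \<in> hcarrier Hi" "hinner Hi x \<xi>i = 0" for x
    using Hi.hinner_commute[OF that(1) \<xi>i(1)] that(2) by simp
  show ?thesis
    using v w
    by (elim words_cases)
       (auto simp: vec_leg vec_Cons T.elem_tensor_hinner \<xi>i e_L e_hinner legs_words word_inner_leg letter_\<iota> sym)
qed

text \<open>The vectors \<open>vec w\<close> have the same inner products as the words, so the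
  difference kernel for the constant 1 is zero.\<close>

lemma W_ex: "\<exists>W\<in>bop F M. \<forall>w\<in>words. W (e w) = vec w"
  unfolding free_space_def word_vector_def
proof (rule generated_extend[OF word_psd M.hilb_axioms, where c = 1])
  show "psd words (\<lambda>x y. complex_of_real (1\<^sup>2) * word_inner H1 H2 x y - hinner M (vec x) (vec y))"
    by (rule psd_cong[OF _ psd_zero]) (simp add: vec_hinner)
qed (simp_all add: vec_closed)

definition W where "W = (SOME W. W \<in> bop F M \<and> (\<forall>w\<in>words. W (e w) = vec w))"

lemma W_bop: "W \<in> bop F M" and W_e: "w \<in> words \<Longrightarrow> W (e w) = vec w"
proof -
  have "W \<in> bop F M \<and> (\<forall>w\<in>words. W (e w) = vec w)"
    unfolding W_def by (rule someI_ex[OF W_ex[unfolded Bex_def]])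
  then show "W \<in> bop F M" "w \<in> words \<Longrightarrow> W (e w) = vec w" by blast+
qed

definition V where "V = adj F M W"

lemma V_bop: "V \<in> bop M F"
  unfolding V_def by (rule FM.adj_bop[OF W_bop])

text \<open>\<open>W\<close> preserves inner products of the total family of words, so its adjoint
  is a left inverse.\<close>

lemma V_W: "V \<circ> W = idop F"
proof -
  interpret FF: hilb2 F F ..
  have VW: "V \<circ> W \<in> bop F F"
    by (rule comp_bop[OF F.semi_inner_axioms M.semi_inner_axioms F.semi_inner_axioms W_bop V_bop])
  show ?thesis
  proof (rule FF.bop_eqI_total[OF VW F.idop_bop e_total])
    fix d assume "d \<in> e ` words"
    then obtain w where w: "w \<in> words" "d = e w" by blast
    note k = bop_closed[OF W_bop e_closed[OF w(1)]]
    have "V (W (e w)) = e w"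
    proof (rule F.eqI_total[OF e_total bop_closed[OF V_bop k] e_closed[OF w(1)]])
      fix d' assume "d' \<in> e ` words"
      then obtain v where v: "v \<in> words" "d' = e v" by blast
      show "hinner F d' (V (W (e w))) = hinner F d' (e w)"
        using FM.adj_inner[OF W_bop e_closed[OF v(1)] k, folded V_def]
          vec_hinner[OF v(1) w(1)] e_hinner[OF v(1) w(1)]
        by (simp only: v(2) W_e[OF v(1)] W_e[OF w(1)])
    qed
    then show "(V \<circ> W) d = idop F d" by (simp add: w(2) e_closed[OF w(1)])
  qed
qed

text \<open>Density of the range of \<open>W\<close>, which upgrades this isometry to a unitary.
  Splitting \<open>x\<close> into its component along \<open>\<xi>i\<close> and the rest writes
  \<open>x \<otimes> e w\<close> through two of the vectors; linearity and limits in the second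
  factor then reach all elementary tensors.\<close>

lemma vec_total: "total M (vec ` words)"
  unfolding total_def
proof (intro conjI ballI impI)
  show "vec ` words \<subseteq> hcarrier M" using vec_closed by blast
  fix t assume t: "t \<in> hcarrier M" and 0: "\<forall>d\<in>vec ` words. hinner M d t = 0"
  have leg0: "hinner M (elem_tensor Hi L x (e w)) t = 0" if x: "x \<in> hcarrier Hi" and w: "w \<in> legs" for x w
  proof -
    define a where "a = hinner Hi x \<xi>i"
    define y where "y = x - a *\<^sub>C \<xi>i"
    have y: "y \<in> hcarrier Hi" "hinner Hi y \<xi>i = 0"
      using x \<xi>i by (simp_all add: y_def a_def Hi.hinner_diff_left Hi.hinner_scale_left)
    have x_eq: "x = a *\<^sub>C \<xi>i + y" by (simp add: y_def)
    have "elem_tensor Hi L x (e w) = a *\<^sub>C vec w + vec (\<iota> y # w)"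
      unfolding vec_leg[OF w] vec_Cons x_eq
      by (simp add: T.elem_tensor_add_left T.elem_tensor_scale_left \<xi>i y e_L[OF w])
    moreover have yw: "\<iota> y # w \<in> words" using y w Cons_words by blast
    ultimately show ?thesis
      using 0 t vec_closed[OF yw] vec_closed[OF legs_words[OF w]] legs_words[OF w]
      by (simp add: M.hinner_add_left M.hinner_scale_left)
  qed
  have span0: "hinner M (elem_tensor Hi L x s) t = 0"
    if x: "x \<in> hcarrier Hi" and s: "s \<in> complex_vector.span (e ` legs)" for x s
  proof -
    have "s \<in> hcarrier L \<and> hinner M (elem_tensor Hi L x s) t = 0"
      using s
    proof (induction rule: complex_vector.span_induct_alt)
      case base
      have "elem_tensor Hi L x (0 *\<^sub>C 0) = 0 *\<^sub>C elem_tensor Hi L x 0"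
        by (rule T.elem_tensor_scale_right[OF x L.zero_closed])
      then have "elem_tensor Hi L x 0 = 0"
        unfolding complex_vector.scale_zero_left .
      then have "hinner M (elem_tensor Hi L x 0) t = 0" using t by simp
      then show ?case by (intro conjI L.zero_closed)
    next
      case (step c b y)
      then obtain w where w: "w \<in> legs" "b = e w" by blast
      have b: "b \<in> hcarrier L" using w e_L by simp
      have y: "y \<in> hcarrier L" "hinner M (elem_tensor Hi L x y) t = 0" using step by auto
      have "hinner M (elem_tensor Hi L x (c *\<^sub>C b + y)) t = 0"
        using leg0[OF x w(1)] w(2) y b x t
        by (simp add: T.elem_tensor_add_right T.elem_tensor_scale_right M.hinner_add_left M.hinner_scale_left
            T.elem_tensor_closed)
      then show ?case by (intro conjI L.add_closed L.scale_closed b y(1))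
    qed
    then show ?thesis by blast
  qed
  show "t = 0"
  proof (rule totalD[OF T.elems_total t])
    fix d assume "d \<in> T.elems"
    then obtain x y where d: "x \<in> hcarrier Hi" "y \<in> hcarrier L" "d = elem_tensor Hi L x y"
      by (auto simp: T.elems_def)
    obtain s where s: "\<And>n. s n \<in> complex_vector.span (e ` legs)" "htendsto F s y"
      using d(2) unfolding leg_space_def hclosed_span_carrier by blast
    have sL: "s n \<in> hcarrier L" for n
      unfolding leg_space_def by (rule F.span_in_hclosed_span[OF legs_e_closed s(1)])
    have "htendsto M (\<lambda>n. elem_tensor Hi L x (s n)) (elem_tensor Hi L x y)"
      by (rule T.elem_tensor_htendsto[OF d(1) sL d(2)]) (simp add: s(2))
    then have "(\<lambda>n. hinner M (elem_tensor Hi L x (s n)) t) \<longlonglongrightarrow> hinner M (elem_tensor Hi L x y) t"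
      by (rule M.htendsto_hinner[OF T.elem_tensor_closed[OF d(1) sL] T.elem_tensor_closed[OF d(1,2)] _ t])
    then show "hinner M d t = 0"
      using LIMSEQ_unique[OF _ tendsto_const, of "\<lambda>n. 0"] by (simp add: span0[OF d(1) s(1)] d(3) LIMSEQ_const_iff)
  qed
qed

lemma V_vec: "w \<in> words \<Longrightarrow> V (vec w) = e w"
  using fun_cong[OF V_W, of "e w"] W_e[of w] e_closed[of w] by simp

lemma W_V: "W \<circ> V = idop M"
proof -
  interpret MM: hilb2 M M ..
  have WV: "W \<circ> V \<in> bop M M"
    by (rule comp_bop[OF M.semi_inner_axioms F.semi_inner_axioms M.semi_inner_axioms V_bop W_bop])
  show ?thesis
    by (rule MM.bop_eqI_total[OF WV M.idop_bop vec_total]) (auto simp: V_vec W_e vec_closed)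
qed

lemma leg_unitary_eq: "leg_unitary H1 \<xi>1 H2 \<xi>2 \<iota> Hi \<xi>i = V"
  unfolding leg_unitary_def Let_def
proof (rule the_equality)
  show "V \<in> bop M F \<and> (\<forall>w\<in>legs. V (elem_tensor Hi L \<xi>i (e w)) = e w \<and>
      (\<forall>x\<in>hcarrier Hi. hinner Hi x \<xi>i = 0 \<longrightarrow> V (elem_tensor Hi L x (e w)) = e (\<iota> x # w)))"
    using V_bop V_vec legs_words Cons_words vec_leg vec_Cons by metis
next
  fix U assume U: "U \<in> bop M F \<and> (\<forall>w\<in>legs. U (elem_tensor Hi L \<xi>i (e w)) = e w \<and>
      (\<forall>x\<in>hcarrier Hi. hinner Hi x \<xi>i = 0 \<longrightarrow> U (elem_tensor Hi L x (e w)) = e (\<iota> x # w)))"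
  show "U = V"
  proof (rule MF.bop_eqI_total[OF conjunct1[OF U] V_bop vec_total])
    fix d assume "d \<in> vec ` words"
    then obtain w where w: "w \<in> words" "d = vec w" by blast
    have "U (vec w) = e w"
      using w(1) by (rule words_cases) (use U in \<open>auto simp: vec_leg vec_Cons\<close>)
    then show "U d = V d" using V_vec w by simp
  qed
qed

definition act where "act = leg_action H1 \<xi>1 H2 \<xi>2 \<iota> Hi \<xi>i"

lemma act_eq: "act T = V \<circ> tensor_id Hi L T \<circ> W"
proof -
  have "adj M F V = W" unfolding V_def by (rule FM.adj_adj[OF W_bop])
  then show ?thesis by (simp add: act_def leg_action_def Let_def leg_unitary_eq)
qed

lemma act_bop: "T \<in> bop Hi Hi \<Longrightarrow> act T \<in> bop F F"
  unfolding act_eq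
  by (rule comp_bop[OF F.semi_inner_axioms M.semi_inner_axioms F.semi_inner_axioms W_bop
        comp_bop[OF M.semi_inner_axioms M.semi_inner_axioms F.semi_inner_axioms T.tensor_id_bop V_bop]])

lemma act_comp:
  assumes "S \<in> bop Hi Hi" "T \<in> bop Hi Hi"
  shows "act (S \<circ> T) = act S \<circ> act T"
proof -
  interpret MM: hilb2 M M ..
  have "act S \<circ> act T = V \<circ> tensor_id Hi L S \<circ> ((W \<circ> V) \<circ> tensor_id Hi L T) \<circ> W"
    by (simp only: act_eq comp_assoc)
  also have "\<dots> = V \<circ> (tensor_id Hi L S \<circ> tensor_id Hi L T) \<circ> W"
    unfolding W_V idop_comp[OF MM.semi_inner2_axioms T.tensor_id_bop[OF assms(2)]] by (simp only: comp_assoc)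
  finally show ?thesis by (simp add: act_eq T.tensor_id_comp[OF assms])
qed

lemma act_idop: "act (idop Hi) = idop F"
  unfolding act_eq T.tensor_id_idop comp_idop[OF MF.semi_inner2_axioms V_bop] by (rule V_W)

lemma act_adj:
  assumes T: "T \<in> bop Hi Hi"
  shows "act (adj Hi Hi T) = adj F F (act T)"
proof -
  have VT: "V \<circ> tensor_id Hi L T \<in> bop M F"
    by (rule comp_bop[OF M.semi_inner_axioms M.semi_inner_axioms F.semi_inner_axioms T.tensor_id_bop[OF T] V_bop])
  have "adj F F (act T) = adj F M W \<circ> adj M F (V \<circ> tensor_id Hi L T)"
    unfolding act_eq by (rule adj_comp[OF F.hilb_axioms M.hilb_axioms F.hilb_axioms W_bop VT])
  also have "adj M F (V \<circ> tensor_id Hi L T) = adj M M (tensor_id Hi L T) \<circ> adj M F V"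
    by (rule adj_comp[OF M.hilb_axioms M.hilb_axioms F.hilb_axioms T.tensor_id_bop[OF T] V_bop])
  also have "adj M F V = W" unfolding V_def by (rule FM.adj_adj[OF W_bop])
  finally show ?thesis by (simp only: act_eq T.tensor_id_adj[OF T] V_def comp_assoc)
qed

lemma act_unitary:
  assumes T: "T \<in> bop Hi Hi" and unit: "adj Hi Hi T \<circ> T = idop Hi" "T \<circ> adj Hi Hi T = idop Hi"
  shows "adj F F (act T) \<circ> act T = idop F" and "act T \<circ> adj F F (act T) = idop F"
proof -
  interpret Hii: hilb2 Hi Hi ..
  note aT = Hii.adj_bop[OF T]
  show "adj F F (act T) \<circ> act T = idop F" "act T \<circ> adj F F (act T) = idop F"
    unfolding act_adj[OF T, symmetric] act_comp[OF aT T, symmetric] act_comp[OF T aT, symmetric] unit act_idop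
    by (rule refl)+
qed

text \<open>Under \<open>W\<close> a word not starting in factor \<open>i\<close> carries
  \<open>\<xi>i\<close> in the tensor factor on which \<open>T\<close> acts. Since
  \<open>T \<xi>i\<close> is orthogonal to \<open>\<xi>i\<close>, no multiple of the word itself
  appears; the result is the word with the letter \<open>T \<xi>i\<close> put in front.\<close>

lemma act_e:
  assumes T: "T \<in> bop Hi Hi" "hinner Hi (T \<xi>i) \<xi>i = 0" and w: "w \<in> legs"
  shows "act T (e w) = e (\<iota> (T \<xi>i) # w)" and "\<iota> (T \<xi>i) # w \<in> words"
proof -
  show *: "\<iota> (T \<xi>i) # w \<in> words" using Cons_words T w bop_closed[OF T(1) \<xi>i(1)] by blast
  have "act T (e w) = V (tensor_id Hi L T (vec w))"
    by (simp add: act_eq W_e[OF legs_words[OF w]])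
  also have "\<dots> = V (vec (\<iota> (T \<xi>i) # w))"
    unfolding vec_leg[OF w] vec_Cons T.tensor_id_elem[OF T(1) \<xi>i(1) e_L[OF w]] ..
  finally show "act T (e w) = e (\<iota> (T \<xi>i) # w)" using V_vec[OF *] by simp
qed

end

lemma (in free_pair) free_leg_Inl: "free_leg H1 H2 \<xi>1 \<xi>2 H1 Inl \<xi>1"
proof
  show "letter_inner H1 H2 (Inl x) a = 0" if "a \<notin> range Inl" for x a
    using that by (cases a) auto
  show "letter_inner H1 H2 a (Inl x) = 0" if "a \<notin> range Inl" for x a
    using that by (cases a) auto
  show "Inl x # w \<in> words \<longleftrightarrow> x \<in> hcarrier H1 \<and> hinner H1 x \<xi>1 = 0 \<and> w \<in> leg_words H1 \<xi>1 H2 \<xi>2 Inl" for x w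
    by (cases w; cases "hd w") (auto simp: free_words_def leg_words_def)
qed (simp_all add: \<xi>1)

lemma (in free_pair) free_leg_Inr: "free_leg H1 H2 \<xi>1 \<xi>2 H2 Inr \<xi>2"
proof
  show "letter_inner H1 H2 (Inr x) a = 0" if "a \<notin> range Inr" for x a
    using that by (cases a) auto
  show "letter_inner H1 H2 a (Inr x) = 0" if "a \<notin> range Inr" for x a
    using that by (cases a) auto
  show "Inr x # w \<in> words \<longleftrightarrow> x \<in> hcarrier H2 \<and> hinner H2 x \<xi>2 = 0 \<and> w \<in> leg_words H1 \<xi>1 H2 \<xi>2 Inr" for x w
    by (cases w; cases "hd w") (auto simp: free_words_def leg_words_def)
qed (simp_all add: \<xi>2)

section \<open>C*-algebras of operators and square roots in them\<close>

section \<open>C*-algebras of operators\<close>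

lemma cstar_subalgebraD:
  assumes "cstar_subalgebra H A"
  shows "S \<in> A \<Longrightarrow> S \<in> bop H H" "complex_vector.subspace A"
    "S \<in> A \<Longrightarrow> T \<in> A \<Longrightarrow> S \<circ> T \<in> A" "S \<in> A \<Longrightarrow> adj H H S \<in> A"
    "T \<in> bop H H \<Longrightarrow> (\<And>n::nat. X n \<in> A) \<Longrightarrow> (\<lambda>n. opnorm H H (X n - T)) \<longlonglongrightarrow> 0 \<Longrightarrow> T \<in> A"
proof -
  note a1 = assms[unfolded cstar_subalgebra_def]
  note a2 = a1[THEN conjunct2] and a3 = a1[THEN conjunct2, THEN conjunct2]
  show "S \<in> A \<Longrightarrow> S \<in> bop H H" using a1[THEN conjunct1] by blast
  show "complex_vector.subspace A" by (rule a2[THEN conjunct1])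
  show "S \<in> A \<Longrightarrow> T \<in> A \<Longrightarrow> S \<circ> T \<in> A" using a3[THEN conjunct1] by blast
  show "S \<in> A \<Longrightarrow> adj H H S \<in> A" using a3[THEN conjunct2, THEN conjunct1] by blast
  assume *: "T \<in> bop H H" "\<And>n::nat. X n \<in> A" "(\<lambda>n. opnorm H H (X n - T)) \<longlonglongrightarrow> 0"
  show "T \<in> A"
    by (rule a3[THEN conjunct2, THEN conjunct2, rule_format, of T X]) (use * in auto)
qed

lemma cstar_subalgebraI:
  assumes "\<And>S. S \<in> A \<Longrightarrow> S \<in> bop H H" "complex_vector.subspace A"
    "\<And>S T. S \<in> A \<Longrightarrow> T \<in> A \<Longrightarrow> S \<circ> T \<in> A" "\<And>S. S \<in> A \<Longrightarrow> adj H H S \<in> A"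
    "\<And>X T. T \<in> bop H H \<Longrightarrow> (\<And>n::nat. X n \<in> A) \<Longrightarrow> (\<lambda>n. opnorm H H (X n - T)) \<longlonglongrightarrow> 0 \<Longrightarrow> T \<in> A"
  shows "cstar_subalgebra H A"
  unfolding cstar_subalgebra_def
proof (intro conjI subsetI ballI allI impI)
  fix X T assume "T \<in> bop H H" "(\<forall>n::nat. X n \<in> A) \<and> (\<lambda>n. opnorm H H (X n - T)) \<longlonglongrightarrow> 0"
  then show "T \<in> A" using assms(5)[of T X] by blast
qed (use assms(1-4) in blast)+

context hilb
begin

lemma cstar_subalgebra_bop: "cstar_subalgebra H (bop H H)"
proof (rule cstar_subalgebraI)
  interpret HH: hilb2 H H by (rule hilb2_self)
  show "complex_vector.subspace (bop H H)" by (rule HH.subspace_bop)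
  show "S \<circ> T \<in> bop H H" if "S \<in> bop H H" "T \<in> bop H H" for S T
    by (rule comp_bop[OF semi_inner_axioms semi_inner_axioms semi_inner_axioms that(2,1)])
  show "adj H H S \<in> bop H H" if "S \<in> bop H H" for S by (rule HH.adj_bop[OF that])
qed

text \<open>The family that is intersected contains \<open>bop H H\<close>, so it is not empty and
  the intersection consists of operators.\<close>

lemma cstar_generated_subalgebra:
  assumes G: "G \<subseteq> bop H H"
  shows "cstar_subalgebra H (cstar_generated H G)" "G \<subseteq> cstar_generated H G"
proof -
  let ?\<A> = "{A. cstar_subalgebra H A \<and> G \<subseteq> A}"
  have mem: "bop H H \<in> ?\<A>" using G cstar_subalgebra_bop by blast
  show "G \<subseteq> cstar_generated H G" unfolding cstar_generated_def by blast
  show "cstar_subalgebra H (cstar_generated H G)"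
    unfolding cstar_generated_def
  proof (rule cstar_subalgebraI)
    show "S \<in> bop H H" if "S \<in> \<Inter>?\<A>" for S using that mem by blast
    show "complex_vector.subspace (\<Inter>?\<A>)"
      by (rule complex_vector.subspace_Inter) (use cstar_subalgebraD(2) in blast)
    show "S \<circ> T \<in> \<Inter>?\<A>" if "S \<in> \<Inter>?\<A>" "T \<in> \<Inter>?\<A>" for S T
      using that cstar_subalgebraD(3) by blast
    show "adj H H S \<in> \<Inter>?\<A>" if "S \<in> \<Inter>?\<A>" for S
      using that cstar_subalgebraD(4) by blast
    fix X T assume T: "T \<in> bop H H" "\<And>n::nat. X n \<in> \<Inter>?\<A>" "(\<lambda>n. opnorm H H (X n - T)) \<longlonglongrightarrow> 0"
    show "T \<in> \<Inter>?\<A>"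
    proof
      fix A assume A: "A \<in> ?\<A>"
      then have c: "cstar_subalgebra H A" by blast
      show "T \<in> A" by (rule cstar_subalgebraD(5)[OF c T(1) _ T(3)]) (use T(2) A in blast)
    qed
  qed
qed

lemma op_bdd_limit:
  assumes X: "\<And>n. X n \<in> bop H H" "\<And>n. op_bdd H H (X n) c" and T: "T \<in> bop H H"
    "(\<lambda>n. opnorm H H (X n - T)) \<longlonglongrightarrow> 0"
  shows "op_bdd H H T c"
proof (rule op_bddI[OF op_bddD0[OF X(2)]])
  interpret HH: hilb2 H H by (rule hilb2_self)
  fix x assume x: "x \<in> hcarrier H"
  have "hnorm H (T x) \<le> c * hnorm H x + opnorm H H (X n - T) * hnorm H x" for n
  proof -
    note k = bop_closed[OF X(1) x, of n] bop_closed[OF T(1) x]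
    have "hnorm H (T x) \<le> hnorm H (X n x) + hnorm H (X n x - T x)"
      using hnorm_triangle_diff[OF k(1) diff_closed[OF k]] by simp
    moreover have "hnorm H (X n x - T x) \<le> opnorm H H (X n - T) * hnorm H x"
      using op_bddD[OF HH.opnorm_bdd[OF HH.diff_bop[OF X(1) T(1)]] x, of n] by (simp add: fun_diff_apply)
    ultimately show ?thesis using op_bddD[OF X(2) x, of n] by linarith
  qed
  moreover have "(\<lambda>n. c * hnorm H x + opnorm H H (X n - T) * hnorm H x) \<longlonglongrightarrow> c * hnorm H x + 0"
    by (intro tendsto_add tendsto_const tendsto_mult_left_zero T(2))
  ultimately have "hnorm H (T x) \<le> c * hnorm H x + 0"
    by (intro LIMSEQ_le_const) blast+
  then show "hnorm H (T x) \<le> c * hnorm H x" by simp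
qed

lemma comp_bop_self: "S \<in> bop H H \<Longrightarrow> T \<in> bop H H \<Longrightarrow> S \<circ> T \<in> bop H H"
  by (rule comp_bop[OF semi_inner_axioms semi_inner_axioms semi_inner_axioms])

lemma comp_diff_right: "S \<in> bop H H \<Longrightarrow> T \<in> bop H H \<Longrightarrow> R \<in> bop H H \<Longrightarrow> S \<circ> (T - R) = (S \<circ> T) - (S \<circ> R)"
proof (rule ext)
  interpret HH: hilb2 H H by (rule hilb2_self)
  fix x assume *: "S \<in> bop H H" "T \<in> bop H H" "R \<in> bop H H"
  show "(S \<circ> (T - R)) x = ((S \<circ> T) - (S \<circ> R)) x"
  proof (cases "x \<in> hcarrier H")
    case True
    then show ?thesis using HH.bop_diff[OF *(1) bop_closed[OF *(2) True] bop_closed[OF *(3) True]]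
      by (simp add: fun_diff_apply)
  next
    case False
    then show ?thesis using * by (simp add: fun_diff_apply bop_off[OF *(2)] bop_off[OF *(3)] HH.bop_zero)
  qed
qed

text \<open>The square root of \<open>1 - h\<close> is \<open>1 - y\<close>, where \<open>y\<close> is the fixed point of \<open>y \<mapsto> (h + y\<^sup>2)/2\<close>.\<close>

lemma sqrt_one_minus:
  assumes A: "cstar_subalgebra H A" and h: "h \<in> A" "adj H H h = h" "op_bdd H H h (1/4)"
  shows "\<exists>y\<in>A. adj H H y = y \<and> h + (y \<circ> y) = y + y"
proof -
  interpret HH: hilb2 H H by (rule hilb2_self)
  note AD = cstar_subalgebraD[OF A]
  \<comment> \<open>On radius 1/2 the map has values of norm at most (1/4 + 1/4)/2 = 1/4, and
    \<open>a\<^sup>2 - b\<^sup>2 = a (a - b) + (a - b) b\<close> yields the contraction factor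
    1/2.\<close>
  define S where "S = {y \<in> A. adj H H y = y \<and> op_bdd H H y (1/2)}"
  define F where "F y = (1/2) *\<^sub>C (h + (y \<circ> y))" for y
  have SA: "y \<in> A" "y \<in> bop H H" "adj H H y = y" "op_bdd H H y (1/2)" if "y \<in> S" for y
    using that AD(1) by (auto simp: S_def)
  have hb: "h \<in> bop H H" by (rule AD(1)[OF h(1)])
  have "\<exists>T\<in>S. F T = T"
  proof (rule op_fixed_point)
    show "S \<subseteq> bop H H" using SA by blast
    show "T \<in> S" if X: "\<And>n. X n \<in> S" and T: "T \<in> bop H H" "(\<lambda>n. opnorm H H (X n - T)) \<longlonglongrightarrow> 0" for X T
    proof -
      have "T \<in> A" by (rule AD(5)[OF T(1) SA(1)[OF X] T(2)])
      moreover have "adj H H T = T"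
      proof (rule HH.op_limit_unique[OF SA(2)[OF X] HH.adj_bop[OF T(1)] T(1) _ T(2)])
        show "(\<lambda>n. opnorm H H (X n - adj H H T)) \<longlonglongrightarrow> 0"
          using HH.adj_limit[OF SA(2)[OF X] T] by (simp only: SA(3)[OF X])
      qed
      moreover have "op_bdd H H T (1/2)" by (rule op_bdd_limit[OF SA(2)[OF X] SA(4)[OF X] T])
      ultimately show ?thesis by (simp add: S_def)
    qed
    show "F y \<in> S" if y: "y \<in> S" for y
    proof -
      note yb = SA(2)[OF y]
      have yy: "y \<circ> y \<in> bop H H" by (rule comp_bop_self[OF yb yb])
      have hy: "h + (y \<circ> y) \<in> bop H H" by (rule HH.add_bop[OF hb yy])
      have "F y \<in> A" unfolding F_def
        by (intro complex_vector.subspace_scale[OF AD(2)] complex_vector.subspace_add[OF AD(2)] h(1) AD(3) SA(1)[OF y])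
      moreover have "adj H H (F y) = F y"
        unfolding F_def HH.adj_scale[OF hy] HH.adj_add[OF hb yy] adj_comp[OF hilb_axioms hilb_axioms hilb_axioms yb yb]
          h(2) SA(3)[OF y] by simp
      moreover have "op_bdd H H (F y) (cmod (1/2) * (1/4 + 1/2 * (1/2)))"
        unfolding F_def
        by (intro HH.scale_op_bdd[OF hy] HH.add_op_bdd[OF hb yy] h(3) comp_op_bdd[OF SA(4)[OF y] SA(4)[OF y] yb])
      then have "op_bdd H H (F y) (1/2)" by (rule HH.op_bdd_mono) (simp add: norm_divide)
      ultimately show ?thesis by (simp add: S_def)
    qed
    have "adj H H 0 = 0"
      using HH.adj_scale[OF HH.zero_bop, of 0] unfolding complex_vector.scale_zero_left complex_cnj_zero .
    moreover have "op_bdd H H 0 (1/2)" by (rule HH.op_bdd_mono[OF HH.zero_op_bdd]) simp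
    ultimately show "0 \<in> S" unfolding S_def using complex_vector.subspace_0[OF AD(2)] by blast
    fix a b d assume a: "a \<in> S" and b: "b \<in> S" and d: "op_bdd H H (a - b) d"
    note ab = SA(2)[OF a] and bb = SA(2)[OF b]
    note db = HH.diff_bop[OF ab bb]
    have eq: "F a - F b = (1/2) *\<^sub>C ((a \<circ> (a - b)) + ((a - b) \<circ> b))"
      unfolding F_def comp_diff_right[OF ab ab bb] comp_diff_left complex_vector.scale_right_diff_distrib[symmetric]
      by simp
    have "op_bdd H H (F a - F b) (cmod (1/2) * (1/2 * d + d * (1/2)))"
      unfolding eq
      by (intro HH.scale_op_bdd HH.add_op_bdd HH.add_bop comp_bop_self ab bb db comp_op_bdd[OF d SA(4)[OF a] db]
          comp_op_bdd[OF SA(4)[OF b] d bb])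
    then show "op_bdd H H (F a - F b) (d / 2)"
      by (rule HH.op_bdd_mono) (simp add: norm_divide)
  qed
  then obtain y where y: "y \<in> S" "F y = y" by blast
  have "h + (y \<circ> y) = (1 + 1) *\<^sub>C F y" unfolding F_def scaleC_scaleC by (simp add: scaleC_one)
  then have "h + (y \<circ> y) = y + y" unfolding y(2) scaleC_add_left scaleC_one .
  then show ?thesis using SA[OF y(1)] by blast
qed

text \<open>The iteration behind \<open>sqrt_one_minus\<close> requires
  \<open>h = X\<^sup>* X\<close> of norm at most 1/4. This is the origin of the bound 1/2 on
  \<open>X\<close>, in place of 1, and of the factor 4 in \<open>matrix_contraction\<close>.\<close>

lemma positive_factor:
  assumes A: "cstar_subalgebra H A" "idop H \<in> A" and X: "X \<in> A" "op_bdd H H X (1/2)"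
  shows "\<exists>Y\<in>A. adj H H Y \<circ> Y = idop H - (adj H H X \<circ> X)"
proof -
  interpret HH: hilb2 H H by (rule hilb2_self)
  note AD = cstar_subalgebraD[OF A(1)]
  have Xb: "X \<in> bop H H" and aX: "adj H H X \<in> bop H H" using AD X by blast+
  define h where "h = adj H H X \<circ> X"
  have h: "h \<in> A" unfolding h_def using AD X by blast
  have hs: "adj H H h = h"
    unfolding h_def adj_comp[OF hilb_axioms hilb_axioms hilb_axioms Xb aX] HH.adj_adj[OF Xb] ..
  have hbd: "op_bdd H H h (1/4)"
    using comp_op_bdd[OF X(2) HH.adj_op_bdd[OF Xb X(2)] Xb] by (simp add: h_def)
  obtain y where y: "y \<in> A" "adj H H y = y" "h + (y \<circ> y) = y + y"
    using sqrt_one_minus[OF A(1) h hs hbd] by blast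
  have yb: "y \<in> bop H H" using AD y by blast
  define Y where "Y = idop H - y"
  have YA: "Y \<in> A" unfolding Y_def by (intro complex_vector.subspace_diff[OF AD(2)] A(2) y(1))
  have Ys: "adj H H Y = Y" unfolding Y_def HH.adj_diff[OF idop_bop yb] adj_idop y(2) ..
  have "Y \<circ> Y = idop H - y - (y - (y \<circ> y))"
    unfolding Y_def comp_diff_left comp_diff_right[OF idop_bop idop_bop yb] comp_diff_right[OF yb idop_bop yb]
      comp_idop[OF HH.semi_inner2_axioms idop_bop] comp_idop[OF HH.semi_inner2_axioms yb]
      idop_comp[OF HH.semi_inner2_axioms yb] ..
  also have "\<dots> = idop H - h"
  proof -
    have "h = y + y - (y \<circ> y)" unfolding y(3)[symmetric] by (rule add_diff_cancel_right'[symmetric])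
    then show ?thesis by (simp only: diff_diff_eq2 diff_diff_eq diff_add_eq)
  qed
  finally show ?thesis using YA by (intro bexI[of _ Y]) (simp_all only: Ys h_def)
qed

end

section \<open>Finite direct sums and matrices of operators\<close>

subsection \<open>Matrices over a C*-algebra\<close>

text \<open>The direct sum of \<open>k\<close> copies of \<open>H\<close>, on which matrices over an
  algebra act. Tuples are functions that vanish from \<open>k\<close> on: they inherit the pointwise
  vector space structure, and one type serves every \<open>k\<close>.\<close>

definition hpow :: "nat \<Rightarrow> 'h::complex_vector hspace \<Rightarrow> (nat \<Rightarrow> 'h) hspace"
  where "hpow k H = \<lparr>hcarrier = {x. \<forall>i. (i < k \<longrightarrow> x i \<in> hcarrier H) \<and> (\<not> i < k \<longrightarrow> x i = 0)},
    hinner = (\<lambda>x y. \<Sum>i<k. hinner H (x i) (y i))\<rparr>"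

definition single :: "nat \<Rightarrow> 'h \<Rightarrow> nat \<Rightarrow> 'h::zero"
  where "single b x i = (if i = b then x else 0)"

definition entry :: "'h::complex_vector hspace \<Rightarrow> ((nat \<Rightarrow> 'h) \<Rightarrow> nat \<Rightarrow> 'h) \<Rightarrow> nat \<Rightarrow> nat \<Rightarrow> 'h \<Rightarrow> 'h"
  where "entry H X a b x = (if x \<in> hcarrier H then X (single b x) a else 0)"

lemma hpow_hinner: "hinner (hpow k H) x y = (\<Sum>i<k. hinner H (x i) (y i))"
  by (simp add: hpow_def)

lemma hpow_carrier: "x \<in> hcarrier (hpow k H) \<longleftrightarrow> (\<forall>i<k. x i \<in> hcarrier H) \<and> (\<forall>i. \<not> i < k \<longrightarrow> x i = 0)"
  by (auto simp: hpow_def)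

lemma hpow_carrierD: "x \<in> hcarrier (hpow k H) \<Longrightarrow> i < k \<Longrightarrow> x i \<in> hcarrier H"
  by (simp add: hpow_carrier)

lemma hpow_off: "x \<in> hcarrier (hpow k H) \<Longrightarrow> \<not> i < k \<Longrightarrow> x i = 0"
  by (simp add: hpow_carrier)

context hilb
begin

lemma hpow_semi_inner: "semi_inner (hpow k H)"
proof
  let ?P = "hpow k H"
  show "complex_vector.subspace (hcarrier ?P)"
    by (rule complex_vector.subspaceI) (auto simp: hpow_carrier scaleC_fun_apply)
  fix x y z c assume k: "x \<in> hcarrier ?P" "y \<in> hcarrier ?P" "z \<in> hcarrier ?P"
  show "hinner ?P (x + y) z = hinner ?P x z + hinner ?P y z"
    unfolding hpow_hinner sum.distrib[symmetric]
    by (intro sum.cong refl) (use k in \<open>simp add: hinner_add_left hpow_carrierD\<close>)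
next
  let ?P = "hpow k H"
  fix x y c assume k: "x \<in> hcarrier ?P" "y \<in> hcarrier ?P"
  show "hinner ?P (c *\<^sub>C x) y = c * hinner ?P x y"
    unfolding hpow_hinner sum_distrib_left
    by (intro sum.cong refl) (use k in \<open>simp add: scaleC_fun_apply hinner_scale_left hpow_carrierD\<close>)
  show "hinner ?P y x = cnj (hinner ?P x y)"
    unfolding hpow_hinner cnj_sum
    by (intro sum.cong refl hinner_commute) (use k in \<open>simp_all add: hpow_carrierD\<close>)
next
  let ?P = "hpow k H"
  fix x assume k: "x \<in> hcarrier ?P"
  show "hinner ?P x x \<in> \<real>\<^sub>\<ge>\<^sub>0"
    unfolding hpow_hinner by (rule sum_nonneg_Reals) (use k in \<open>simp add: hinner_nonneg hpow_carrierD\<close>)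
qed

lemma hpow_hnorm: "x \<in> hcarrier (hpow k H) \<Longrightarrow> (hnorm (hpow k H) x)\<^sup>2 = (\<Sum>i<k. (hnorm H (x i))\<^sup>2)"
proof -
  assume x: "x \<in> hcarrier (hpow k H)"
  interpret P: semi_inner "hpow k H" by (rule hpow_semi_inner)
  have "(hnorm (hpow k H) x)\<^sup>2 = (\<Sum>i<k. Re (hinner H (x i) (x i)))"
    unfolding P.Re_hinner_self[OF x, symmetric] hpow_hinner by simp
  then show ?thesis using x by (simp add: Re_hinner_self hpow_carrierD)
qed

lemma hpow_component_le:
  assumes x: "x \<in> hcarrier (hpow k H)" and i: "i < k"
  shows "hnorm H (x i) \<le> hnorm (hpow k H) x"
proof -
  interpret P: semi_inner "hpow k H" by (rule hpow_semi_inner)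
  have "(hnorm H (x i))\<^sup>2 \<le> (hnorm (hpow k H) x)\<^sup>2"
    unfolding hpow_hnorm[OF x] by (rule member_le_sum) (use i in auto)
  then show ?thesis using P.hnorm_nonneg[OF x] by (rule power2_le_imp_le)
qed

lemma hpow_hilb: "hilb (hpow k H)"
proof -
  let ?P = "hpow k H"
  interpret P: semi_inner ?P by (rule hpow_semi_inner)
  show ?thesis
  proof
    fix x assume x: "x \<in> hcarrier ?P" "hinner ?P x x = 0"
    then have "hnorm ?P x = 0" by (simp add: hnorm_def)
    have "x i = 0" for i
    proof (cases "i < k")
      case True
      note xi = hpow_carrierD[OF x(1) True]
      have "hnorm H (x i) = 0"
        using hpow_component_le[OF x(1) True] \<open>hnorm ?P x = 0\<close> hnorm_nonneg[OF xi] by linarith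
      then show ?thesis using hnorm_eq_0_iff[OF xi] by blast
    qed (rule hpow_off[OF x(1)])
    then show "x = 0" by (simp add: fun_eq_iff)
  next
    fix s assume s: "hcauchy ?P s"
    note sc = P.hcauchy_carrier[OF s]
    have "hcauchy H (\<lambda>n. s n i)" if i: "i < k" for i
      unfolding hcauchy_def
    proof (intro conjI allI impI)
      show "s n i \<in> hcarrier H" for n by (rule hpow_carrierD[OF sc i])
      fix r :: real assume "r > 0"
      then obtain N where N: "\<And>m n. m \<ge> N \<Longrightarrow> n \<ge> N \<Longrightarrow> hnorm ?P (s m - s n) < r" using P.hcauchyD[OF s] by blast
      have "hnorm H (s m i - s n i) < r" if "m \<ge> N" "n \<ge> N" for m n
        using hpow_component_le[OF P.diff_closed[OF sc sc] i, of m n] N[OF that] by (simp add: fun_diff_apply)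
      then show "\<exists>N. \<forall>m\<ge>N. \<forall>n\<ge>N. hnorm H (s m i - s n i) < r" by blast
    qed
    then have "\<forall>i. \<exists>l. i < k \<longrightarrow> l \<in> hcarrier H \<and> htendsto H (\<lambda>n. s n i) l" using complete by blast
    then obtain l where l: "\<And>i. i < k \<Longrightarrow> l i \<in> hcarrier H \<and> htendsto H (\<lambda>n. s n i) (l i)" by metis
    define l' where "l' i = (if i < k then l i else 0)" for i
    have l': "l' \<in> hcarrier ?P" using l by (simp add: hpow_carrier l'_def)
    have "(\<lambda>n. sqrt (\<Sum>i<k. (hnorm H (s n i - l' i))\<^sup>2)) \<longlonglongrightarrow> sqrt (\<Sum>i<k. 0\<^sup>2)"
      by (intro tendsto_real_sqrt tendsto_sum tendsto_power)
         (use l in \<open>auto simp: htendsto_def l'_def\<close>)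
    moreover have "hnorm ?P (s n - l') = sqrt (\<Sum>i<k. (hnorm H (s n i - l' i))\<^sup>2)" for n
      using hpow_hnorm[OF P.diff_closed[OF sc l'], of n] P.hnorm_nonneg[OF P.diff_closed[OF sc l'], of n]
      by (simp add: real_sqrt_unique fun_diff_apply)
    ultimately have "htendsto ?P s l'" by (simp add: htendsto_def)
    with l' show "\<exists>l\<in>hcarrier ?P. htendsto ?P s l" by blast
  qed
qed

lemma single_closed: "b < k \<Longrightarrow> x \<in> hcarrier H \<Longrightarrow> single b x \<in> hcarrier (hpow k H)"
  by (auto simp: hpow_carrier single_def)

lemma single_add: "single b (x + y) = single b x + single b y" for x y :: "'a"
  by (auto simp: single_def fun_eq_iff)

lemma single_scale: "single b (c *\<^sub>C x) = c *\<^sub>C single b x" for x :: "'a"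
  by (auto simp: single_def fun_eq_iff scaleC_fun_apply)

lemma single_hnorm: "b < k \<Longrightarrow> x \<in> hcarrier H \<Longrightarrow> hnorm (hpow k H) (single b x) = hnorm H x"
proof -
  assume b: "b < k" and x: "x \<in> hcarrier H"
  have "(\<Sum>i<k. hinner H (single b x i) (single b x i)) = (\<Sum>i<k. if i = b then hinner H x x else 0)"
    using x by (intro sum.cong) (auto simp: single_def)
  then show ?thesis using b by (simp add: hnorm_def hpow_hinner)
qed

lemma hpow_hinner_single: "b < k \<Longrightarrow> y \<in> hcarrier (hpow k H) \<Longrightarrow> x \<in> hcarrier H \<Longrightarrow>
    hinner (hpow k H) (single b x) y = hinner H x (y b)"
proof -
  assume b: "b < k" and y: "y \<in> hcarrier (hpow k H)" and x: "x \<in> hcarrier H"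
  have "(\<Sum>i<k. hinner H (single b x i) (y i)) = (\<Sum>i<k. if i = b then hinner H x (y b) else 0)"
    using x y by (intro sum.cong) (auto simp: single_def hpow_carrierD)
  then show ?thesis using b by (simp add: hpow_hinner)
qed

lemma hpow_hinner_single': "b < k \<Longrightarrow> y \<in> hcarrier (hpow k H) \<Longrightarrow> x \<in> hcarrier H \<Longrightarrow>
    hinner (hpow k H) y (single b x) = hinner H (y b) x"
proof -
  assume b: "b < k" and y: "y \<in> hcarrier (hpow k H)" and x: "x \<in> hcarrier H"
  have "(\<Sum>i<k. hinner H (y i) (single b x i)) = (\<Sum>i<k. if i = b then hinner H (y b) x else 0)"
    using x y by (intro sum.cong) (auto simp: single_def hpow_carrierD)
  then show ?thesis using b by (simp add: hpow_hinner)
qed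

lemma entry_op_bdd:
  assumes X: "X \<in> bop (hpow k H) (hpow k H)" "op_bdd (hpow k H) (hpow k H) X c" and ab: "a < k" "b < k"
  shows "op_bdd H H (entry H X a b) c"
proof (rule op_bddI[OF op_bddD0[OF X(2)]])
  fix x assume x: "x \<in> hcarrier H"
  have "hnorm H (entry H X a b x) \<le> hnorm (hpow k H) (X (single b x))"
    using hpow_component_le[OF bop_closed[OF X(1) single_closed[OF ab(2) x]] ab(1)] x by (simp add: entry_def)
  also have "\<dots> \<le> c * hnorm H x"
    using op_bddD[OF X(2) single_closed[OF ab(2) x]] single_hnorm[OF ab(2) x] by simp
  finally show "hnorm H (entry H X a b x) \<le> c * hnorm H x" .
qed

lemma entry_bop:
  assumes X: "X \<in> bop (hpow k H) (hpow k H)" and ab: "a < k" "b < k"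
  shows "entry H X a b \<in> bop H H"
proof -
  interpret P: hilb "hpow k H" by (rule hpow_hilb)
  interpret PP: hilb2 "hpow k H" "hpow k H" ..
  obtain c where c: "op_bdd (hpow k H) (hpow k H) X c" using PP.bop_bdd[OF X] ..
  show ?thesis
  proof (rule bop_op_bddI[OF entry_op_bdd[OF X c ab]])
    show "entry H X a b x \<in> hcarrier H" if "x \<in> hcarrier H" for x
      using hpow_carrierD[OF bop_closed[OF X single_closed[OF ab(2) that]] ab(1)] that by (simp add: entry_def)
    show "entry H X a b x = 0" if "x \<notin> hcarrier H" for x using that by (simp add: entry_def)
    show "entry H X a b (x + y) = entry H X a b x + entry H X a b y" if "x \<in> hcarrier H" "y \<in> hcarrier H" for x y
      using bop_add[OF X single_closed[OF ab(2) that(1)] single_closed[OF ab(2) that(2)]] that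
      by (simp add: entry_def single_add)
    show "entry H X a b (c *\<^sub>C x) = c *\<^sub>C entry H X a b x" if "x \<in> hcarrier H" for x c
      using bop_scale[OF X single_closed[OF ab(2) that], of c] that by (simp add: entry_def single_scale scaleC_fun_apply)
  qed
qed

lemma apply_entry:
  assumes X: "X \<in> bop (hpow k H) (hpow k H)" and x: "x \<in> hcarrier (hpow k H)"
  shows "X x a = (\<Sum>b<k. entry H X a b (x b))"
proof -
  interpret P: hilb "hpow k H" by (rule hpow_hilb)
  interpret PP: hilb2 "hpow k H" "hpow k H" ..
  have xb: "x b \<in> hcarrier H" if "b \<in> {..<k}" for b using x that by (simp add: hpow_carrierD)
  have "x = (\<Sum>b<k. single b (x b))"
    using hpow_off[OF x] by (auto simp: fun_eq_iff sum_fun_apply single_def)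
  then have "X x = X (\<Sum>b<k. single b (x b))" by simp
  also have "\<dots> = (\<Sum>b<k. X (single b (x b)))"
    by (rule PP.bop_sum[OF X]) (use xb single_closed in simp)
  finally show ?thesis using xb by (simp add: sum_fun_apply entry_def)
qed

lemma entry_add: "entry H (X + Y) a b = entry H X a b + entry H Y a b"
  by (auto simp: entry_def fun_eq_iff)

lemma entry_diff: "entry H (X - Y) a b = entry H X a b - entry H Y a b"
  by (auto simp: entry_def fun_eq_iff fun_diff_apply)

lemma entry_scale: "entry H (c *\<^sub>C X) a b = c *\<^sub>C entry H X a b"
  by (auto simp: entry_def fun_eq_iff scaleC_fun_apply)

lemma entry_idop: "a < k \<Longrightarrow> b < k \<Longrightarrow> entry H (idop (hpow k H)) a b = (if a = b then idop H else 0)"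
  by (rule ext) (simp add: entry_def idop_def single_closed, simp add: single_def)

lemma entry_comp:
  assumes X: "X \<in> bop (hpow k H) (hpow k H)" and Y: "Y \<in> bop (hpow k H) (hpow k H)" and ab: "a < k" "b < k"
  shows "entry H (X \<circ> Y) a b = (\<Sum>c<k. entry H X a c \<circ> entry H Y c b)"
proof
  interpret HH: hilb2 H H by (rule hilb2_self)
  fix x
  show "entry H (X \<circ> Y) a b x = (\<Sum>c<k. entry H X a c \<circ> entry H Y c b) x"
  proof (cases "x \<in> hcarrier H")
    case True
    have "entry H (X \<circ> Y) a b x = X (Y (single b x)) a" using True by (simp add: entry_def)
    also have "\<dots> = (\<Sum>c<k. entry H X a c (Y (single b x) c))"
      by (rule apply_entry[OF X bop_closed[OF Y single_closed[OF ab(2) True]]])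
    finally show ?thesis using True by (simp add: sum_fun_apply entry_def[of H Y])
  next
    case False
    have "entry H X a c 0 = 0" if "c < k" for c using HH.bop_zero[OF entry_bop[OF X ab(1) that]] .
    then show ?thesis using False by (simp add: sum_fun_apply entry_def[of H Y] entry_def[of H "X \<circ> Y"])
  qed
qed

lemma entry_adj:
  assumes X: "X \<in> bop (hpow k H) (hpow k H)" and ab: "a < k" "b < k"
  shows "entry H (adj (hpow k H) (hpow k H) X) a b = adj H H (entry H X b a)"
proof -
  interpret P: hilb "hpow k H" by (rule hpow_hilb)
  interpret PP: hilb2 "hpow k H" "hpow k H" ..
  interpret HH: hilb2 H H by (rule hilb2_self)
  note aX = PP.adj_bop[OF X]
  have "adj H H (entry H X b a) = entry H (adj (hpow k H) (hpow k H) X) a b"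
  proof (rule HH.adjI[OF entry_bop[OF X ab(2,1)] entry_bop[OF aX ab]])
    fix x y assume x: "x \<in> hcarrier H" and y: "y \<in> hcarrier H"
    note sx = single_closed[OF ab(1) x] and sy = single_closed[OF ab(2) y]
    have "hinner H (entry H X b a x) y = hinner (hpow k H) (X (single a x)) (single b y)"
      using hpow_hinner_single'[OF ab(2) bop_closed[OF X sx] y] x by (simp add: entry_def)
    also have "\<dots> = hinner (hpow k H) (single a x) (adj (hpow k H) (hpow k H) X (single b y))"
      by (rule PP.adj_inner[OF X sx sy])
    also have "\<dots> = hinner H x (entry H (adj (hpow k H) (hpow k H) X) a b y)"
      using hpow_hinner_single[OF ab(1) bop_closed[OF aX sy] x] y by (simp add: entry_def)
    finally show "hinner H (entry H X b a x) y = hinner H x (entry H (adj (hpow k H) (hpow k H) X) a b y)" .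
  qed
  then show ?thesis ..
qed

definition matrices :: "nat \<Rightarrow> ('a \<Rightarrow> 'a) set \<Rightarrow> ((nat \<Rightarrow> 'a) \<Rightarrow> nat \<Rightarrow> 'a) set"
  where "matrices k A = {X \<in> bop (hpow k H) (hpow k H). \<forall>a<k. \<forall>b<k. entry H X a b \<in> A}"

text \<open>A matrix dominates each of its entries in norm, so limits can be taken entrywise. It
  follows that \<open>positive_factor\<close> yields a matrix \<open>Y\<close> with entries in
  \<open>A\<close>, to which \<open>\<pi>\<close> can be applied.\<close>

lemma matrices_cstar:
  assumes A: "cstar_subalgebra H A"
  shows "cstar_subalgebra (hpow k H) (matrices k A)"
proof -
  interpret P: hilb "hpow k H" by (rule hpow_hilb)
  interpret PP: hilb2 "hpow k H" "hpow k H" ..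
  interpret HH: hilb2 H H by (rule hilb2_self)
  note AD = cstar_subalgebraD[OF A]
  have mb: "X \<in> bop (hpow k H) (hpow k H)" if "X \<in> matrices k A" for X using that by (simp add: matrices_def)
  have me: "entry H X a b \<in> A" if "X \<in> matrices k A" "a < k" "b < k" for X a b using that by (simp add: matrices_def)
  have mI: "X \<in> matrices k A" if "X \<in> bop (hpow k H) (hpow k H)" "\<And>a b. a < k \<Longrightarrow> b < k \<Longrightarrow> entry H X a b \<in> A" for X
    using that by (simp add: matrices_def)
  show ?thesis
  proof (rule cstar_subalgebraI[OF mb])
    show "complex_vector.subspace (matrices k A)"
    proof (rule complex_vector.subspaceI)
      have "entry H 0 a b = 0" for a b by (auto simp: entry_def fun_eq_iff)
      then show "0 \<in> matrices k A"
        using complex_vector.subspace_0[OF AD(2)] by (intro mI PP.zero_bop) (simp only:)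
      show "X + Y \<in> matrices k A" if "X \<in> matrices k A" "Y \<in> matrices k A" for X Y
      proof (rule mI[OF PP.add_bop[OF mb[OF that(1)] mb[OF that(2)]]])
        fix a b assume ab: "a < k" "b < k"
        show "entry H (X + Y) a b \<in> A"
          unfolding entry_add by (rule complex_vector.subspace_add[OF AD(2) me[OF that(1) ab] me[OF that(2) ab]])
      qed
      show "c *\<^sub>C X \<in> matrices k A" if "X \<in> matrices k A" for X c
      proof (rule mI[OF PP.scale_bop[OF mb[OF that]]])
        fix a b assume ab: "a < k" "b < k"
        show "entry H (c *\<^sub>C X) a b \<in> A"
          unfolding entry_scale by (rule complex_vector.subspace_scale[OF AD(2) me[OF that ab]])
      qed
    qed
    show "X \<circ> Y \<in> matrices k A" if X: "X \<in> matrices k A" and Y: "Y \<in> matrices k A" for X Y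
    proof (rule mI[OF P.comp_bop_self[OF mb[OF X] mb[OF Y]]])
      fix a b assume ab: "a < k" "b < k"
      show "entry H (X \<circ> Y) a b \<in> A"
        unfolding entry_comp[OF mb[OF X] mb[OF Y] ab]
        by (rule complex_vector.subspace_sum[OF AD(2)]) (simp add: AD(3) me X Y ab)
    qed
    show "adj (hpow k H) (hpow k H) X \<in> matrices k A" if X: "X \<in> matrices k A" for X
    proof (rule mI[OF PP.adj_bop[OF mb[OF X]]])
      fix a b assume ab: "a < k" "b < k"
      show "entry H (adj (hpow k H) (hpow k H) X) a b \<in> A"
        unfolding entry_adj[OF mb[OF X] ab] by (rule AD(4)[OF me[OF X ab(2,1)]])
    qed
    fix X T assume T: "T \<in> bop (hpow k H) (hpow k H)" and X: "\<And>n::nat. X n \<in> matrices k A"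
      and lim: "(\<lambda>n. opnorm (hpow k H) (hpow k H) (X n - T)) \<longlonglongrightarrow> 0"
    show "T \<in> matrices k A"
    proof (rule mI[OF T])
      fix a b assume ab: "a < k" "b < k"
      show "entry H T a b \<in> A"
      proof (rule AD(5)[OF entry_bop[OF T ab] me[OF X ab]])
        have d: "X n - T \<in> bop (hpow k H) (hpow k H)" for n by (rule PP.diff_bop[OF mb[OF X] T])
        have "op_bdd H H (entry H (X n) a b - entry H T a b) (opnorm (hpow k H) (hpow k H) (X n - T))" for n
          unfolding entry_diff[symmetric] by (rule entry_op_bdd[OF d PP.opnorm_bdd[OF d] ab])
        then have le: "opnorm H H (entry H (X n) a b - entry H T a b) \<le> opnorm (hpow k H) (hpow k H) (X n - T)" for n
          by (rule HH.opnorm_le)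
        have ge: "0 \<le> opnorm H H (entry H (X n) a b - entry H T a b)" for n
          by (rule HH.opnorm_nonneg[OF HH.diff_bop[OF entry_bop[OF mb[OF X] ab] entry_bop[OF T ab]]])
        show "(\<lambda>n. opnorm H H (entry H (X n) a b - entry H T a b)) \<longlonglongrightarrow> 0"
          by (rule tendsto_sandwich[OF _ _ tendsto_const lim]) (use le ge in auto)
      qed
    qed
  qed
qed

lemma matrices_idop:
  assumes A: "cstar_subalgebra H A" "idop H \<in> A"
  shows "idop (hpow k H) \<in> matrices k A"
proof -
  interpret P: hilb "hpow k H" by (rule hpow_hilb)
  have "entry H (idop (hpow k H)) a b \<in> A" if "a < k" "b < k" for a b
    unfolding entry_idop[OF that] using A(2) complex_vector.subspace_0[OF cstar_subalgebraD(2)[OF A(1)]]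
    by (cases "a = b") (simp_all only: if_True if_False simp_thms)
  then show ?thesis using P.idop_bop by (simp add: matrices_def)
qed

end

section \<open>Representations applied to matrices entry by entry\<close>

lemma star_representationD:
  assumes "star_representation H A K \<pi>"
  shows "S \<in> A \<Longrightarrow> \<pi> S \<in> bop K K" "S \<in> A \<Longrightarrow> T \<in> A \<Longrightarrow> \<pi> (S + T) = \<pi> S + \<pi> T"
    "S \<in> A \<Longrightarrow> \<pi> (c *\<^sub>C S) = c *\<^sub>C \<pi> S" "S \<in> A \<Longrightarrow> T \<in> A \<Longrightarrow> \<pi> (S \<circ> T) = \<pi> S \<circ> \<pi> T"
    "S \<in> A \<Longrightarrow> \<pi> (adj H H S) = adj K K (\<pi> S)"
proof -
  note a1 = assms[unfolded star_representation_def]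
  note a2 = a1[THEN conjunct2] and a3 = a1[THEN conjunct2, THEN conjunct2]
  note a4 = a3[THEN conjunct2]
  show "S \<in> A \<Longrightarrow> \<pi> S \<in> bop K K" by (rule a1[THEN conjunct1, rule_format])
  show "S \<in> A \<Longrightarrow> T \<in> A \<Longrightarrow> \<pi> (S + T) = \<pi> S + \<pi> T" by (rule a2[THEN conjunct1, rule_format])
  show "S \<in> A \<Longrightarrow> \<pi> (c *\<^sub>C S) = c *\<^sub>C \<pi> S" by (rule a3[THEN conjunct1, rule_format])
  show "S \<in> A \<Longrightarrow> T \<in> A \<Longrightarrow> \<pi> (S \<circ> T) = \<pi> S \<circ> \<pi> T" by (rule a4[THEN conjunct1, rule_format])
  show "S \<in> A \<Longrightarrow> \<pi> (adj H H S) = adj K K (\<pi> S)" by (rule a4[THEN conjunct2, rule_format])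
qed

locale cstar_rep = H: hilb H + K: hilb K
  for H :: "'h::complex_vector hspace" and K :: "'k::complex_vector hspace" +
  fixes A :: "('h \<Rightarrow> 'h) set" and \<pi> :: "('h \<Rightarrow> 'h) \<Rightarrow> 'k \<Rightarrow> 'k"
  assumes A: "cstar_subalgebra H A" "idop H \<in> A" and rep: "star_representation H A K \<pi>"
begin

sublocale HH: hilb2 H H ..
sublocale KK: hilb2 K K ..

lemmas AD = cstar_subalgebraD[OF A(1)]
lemmas \<pi>D = star_representationD[OF rep]

lemma rep_zero: "\<pi> 0 = 0"
  using \<pi>D(3)[OF A(2), of 0] unfolding complex_vector.scale_zero_left .

lemma rep_diff: "S \<in> A \<Longrightarrow> T \<in> A \<Longrightarrow> \<pi> (S - T) = \<pi> S - \<pi> T"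
proof -
  assume *: "S \<in> A" "T \<in> A"
  have "\<pi> (S + (- 1) *\<^sub>C T) = \<pi> S + (- 1) *\<^sub>C \<pi> T"
    unfolding \<pi>D(2)[OF *(1) complex_vector.subspace_scale[OF AD(2) *(2)]] \<pi>D(3)[OF *(2)] ..
  then show ?thesis by simp
qed

lemma rep_sum:
  assumes "\<And>i. i \<in> I \<Longrightarrow> f i \<in> A"
  shows "\<pi> (sum f I) = (\<Sum>i\<in>I. \<pi> (f i))"
proof -
  have fin: "sum f J \<in> A \<and> \<pi> (sum f J) = (\<Sum>i\<in>J. \<pi> (f i))" if "finite J" "J \<subseteq> I" for J
    using that
  proof (induction J)
    case empty
    show ?case unfolding sum.empty using rep_zero complex_vector.subspace_0[OF AD(2)] by blast
  next
    case (insert i J)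
    then have *: "f i \<in> A" "sum f J \<in> A" "\<pi> (sum f J) = (\<Sum>i\<in>J. \<pi> (f i))" using assms by auto
    show ?case
      unfolding sum.insert[OF insert(1,2)] \<pi>D(2)[OF *(1,2)] *(3)
      using complex_vector.subspace_add[OF AD(2) *(1,2)] by blast
  qed
  show ?thesis
  proof (cases "finite I")
    case True
    then show ?thesis using fin by blast
  next
    case False
    show ?thesis unfolding sum.infinite[OF False] by (rule rep_zero)
  qed
qed

text \<open>\<open>star_representation\<close> does not ask that the unit be sent to the identity of
  \<open>K\<close>. Its image is a projection that acts as a unit on the range of
  \<open>\<pi>\<close>, and vectors fixed by it must be used wherever unitarity of some
  \<open>\<pi> S\<close> is wanted.\<close>

definition e where "e = \<pi> (idop H)"

lemma e_bop: "e \<in> bop K K"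
  unfolding e_def by (rule \<pi>D(1)[OF A(2)])

lemma e_adj: "adj K K e = e"
  unfolding e_def \<pi>D(5)[OF A(2), symmetric] H.adj_idop ..

lemma e_mult: "S \<in> A \<Longrightarrow> e \<circ> \<pi> S = \<pi> S" "S \<in> A \<Longrightarrow> \<pi> S \<circ> e = \<pi> S"
  unfolding e_def using \<pi>D(4)[OF A(2), of S] \<pi>D(4)[OF _ A(2), of S]
    comp_idop[OF HH.semi_inner2_axioms AD(1), of S] idop_comp[OF HH.semi_inner2_axioms AD(1), of S]
  by (simp_all only:)

lemma e_idem: "e \<circ> e = e"
  using e_mult(1)[OF A(2)] by (simp only: e_def)

lemma e_hinner: "x \<in> hcarrier K \<Longrightarrow> Re (hinner K (e x) x) \<le> (hnorm K x)\<^sup>2"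
proof -
  assume x: "x \<in> hcarrier K"
  note ex = bop_closed[OF e_bop x]
  have "hinner K (e x) x = hinner K (e x) (e x)"
    using KK.adj_inner[OF e_bop ex x] e_adj fun_cong[OF e_idem, of x] by simp
  then have sq: "Re (hinner K (e x) x) = (hnorm K (e x))\<^sup>2" using K.Re_hinner_self[OF ex] by simp
  moreover have "Re (hinner K (e x) x) \<le> hnorm K (e x) * hnorm K x"
    using K.Cauchy_Schwarz[OF ex x] complex_Re_le_cmod order_trans by blast
  ultimately have le: "hnorm K (e x) * hnorm K (e x) \<le> hnorm K (e x) * hnorm K x" by (simp add: power2_eq_square)
  have "hnorm K (e x) \<le> hnorm K x"
  proof (cases "hnorm K (e x) = 0")
    case True
    then show ?thesis using x by simp
  next
    case False
    then have "hnorm K (e x) > 0" using K.hnorm_nonneg[OF ex] by linarith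
    then show ?thesis using le by (simp only: mult_le_cancel_left_pos)
  qed
  then show ?thesis unfolding sq using ex by (intro power_mono) auto
qed

text \<open>Positivity of \<open>[x\<^sub>a\<^sub>b] \<mapsto> \<Sum> \<langle>\<pi>(x\<^sub>a\<^sub>b) f\<^sub>b, f\<^sub>a\<rangle>\<close> on matrices over \<open>A\<close>, evaluated at
  \<open>1 - X\<^sup>* X = Y\<^sup>* Y\<close>.\<close>

lemma matrix_contraction_half:
  assumes X: "X \<in> H.matrices k A" "op_bdd (hpow k H) (hpow k H) X (1/2)"
    and f: "\<And>b. b < k \<Longrightarrow> f b \<in> hcarrier K"
  shows "(\<Sum>a<k. (hnorm K (\<Sum>b<k. \<pi> (entry H X a b) (f b)))\<^sup>2) \<le> (\<Sum>a<k. (hnorm K (f a))\<^sup>2)"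
proof -
  interpret P: hilb "hpow k H" by (rule H.hpow_hilb)
  interpret PP: hilb2 "hpow k H" "hpow k H" ..
  let ?M = "H.matrices k A"
  have M: "cstar_subalgebra (hpow k H) ?M" by (rule H.matrices_cstar[OF A(1)])
  have I: "idop (hpow k H) \<in> ?M" by (rule H.matrices_idop[OF A])
  note MD = cstar_subalgebraD[OF M]
  have me: "entry H Z a b \<in> A" if "Z \<in> ?M" "a < k" "b < k" for Z a b using that by (simp add: H.matrices_def)
  \<comment> \<open>The positive functional given by the tuple \<open>(f b)\<close> in the
    representation of matrices on copies of \<open>K\<close>; \<open>g Z\<close> is the image of
    this tuple.\<close>
  define q where "q Z = (\<Sum>a<k. \<Sum>b<k. hinner K (\<pi> (entry H Z a b) (f b)) (f a))" for Z
  define g where "g Z a = (\<Sum>b<k. \<pi> (entry H Z a b) (f b))" for Z a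
  have \<pi>f: "\<pi> (entry H Z a b) (f b) \<in> hcarrier K" if "Z \<in> ?M" "a < k" "b < k" for Z a b
    by (rule bop_closed[OF \<pi>D(1)[OF me[OF that]] f[OF that(3)]])
  have gc: "g Z a \<in> hcarrier K" if "Z \<in> ?M" "a < k" for Z a
    unfolding g_def by (rule K.sum_closed) (use \<pi>f that in simp)
  have q_diff: "q (Z - Z') = q Z - q Z'" if "Z \<in> ?M" "Z' \<in> ?M" for Z Z'
  proof -
    have "q (Z - Z') = (\<Sum>a<k. \<Sum>b<k. hinner K (\<pi> (entry H Z a b) (f b)) (f a) - hinner K (\<pi> (entry H Z' a b) (f b)) (f a))"
      unfolding q_def
    proof (intro sum.cong refl)
      fix a b assume "a \<in> {..<k}" "b \<in> {..<k}"
      then have ab: "a < k" "b < k" by auto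
      show "hinner K (\<pi> (entry H (Z - Z') a b) (f b)) (f a) =
          hinner K (\<pi> (entry H Z a b) (f b)) (f a) - hinner K (\<pi> (entry H Z' a b) (f b)) (f a)"
        unfolding H.entry_diff rep_diff[OF me[OF that(1) ab] me[OF that(2) ab]] fun_diff_apply
        by (rule K.hinner_diff_left[OF \<pi>f[OF that(1) ab] \<pi>f[OF that(2) ab] f[OF ab(1)]])
    qed
    then show ?thesis by (simp add: q_def sum_subtractf)
  qed
  \<comment> \<open>This uses the algebraic rules of a representation alone. A norm inequality
    results from it although \<open>star_representation\<close> says nothing about the norm of
    \<open>\<pi>\<close>.\<close>
  have q_sq: "q (adj (hpow k H) (hpow k H) Z \<circ> Z) = complex_of_real (\<Sum>c<k. (hnorm K (g Z c))\<^sup>2)" if Z: "Z \<in> ?M" for Z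
  proof -
    have ent: "hinner K (\<pi> (entry H (adj (hpow k H) (hpow k H) Z \<circ> Z) a b) (f b)) (f a) =
        (\<Sum>c<k. hinner K (\<pi> (entry H Z c b) (f b)) (\<pi> (entry H Z c a) (f a)))" if ab: "a < k" "b < k" for a b
    proof -
      have inA: "adj H H (entry H Z c a) \<circ> entry H Z c b \<in> A" if "c \<in> {..<k}" for c
        using that by (intro AD(3) AD(4) me Z ab) auto
      have "entry H (adj (hpow k H) (hpow k H) Z \<circ> Z) a b = (\<Sum>c<k. adj H H (entry H Z c a) \<circ> entry H Z c b)"
        unfolding H.entry_comp[OF PP.adj_bop[OF MD(1)[OF Z]] MD(1)[OF Z] ab]
        by (intro sum.cong refl) (simp add: H.entry_adj[OF MD(1)[OF Z] ab(1)])
      then have "\<pi> (entry H (adj (hpow k H) (hpow k H) Z \<circ> Z) a b) = (\<Sum>c<k. \<pi> (adj H H (entry H Z c a) \<circ> entry H Z c b))"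
        using rep_sum[OF inA] by (simp only:)
      also have "\<dots> = (\<Sum>c<k. adj K K (\<pi> (entry H Z c a)) \<circ> \<pi> (entry H Z c b))"
      proof (intro sum.cong refl)
        fix c assume "c \<in> {..<k}"
        then have c: "c < k" by simp
        show "\<pi> (adj H H (entry H Z c a) \<circ> entry H Z c b) = adj K K (\<pi> (entry H Z c a)) \<circ> \<pi> (entry H Z c b)"
          unfolding \<pi>D(4)[OF AD(4)[OF me[OF Z c ab(1)]] me[OF Z c ab(2)]] \<pi>D(5)[OF me[OF Z c ab(1)]] ..
      qed
      finally have "\<pi> (entry H (adj (hpow k H) (hpow k H) Z \<circ> Z) a b) (f b) =
          (\<Sum>c<k. adj K K (\<pi> (entry H Z c a)) (\<pi> (entry H Z c b) (f b)))"
        by (simp only: sum_fun_apply comp_apply)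
      moreover have "hinner K (\<Sum>c<k. adj K K (\<pi> (entry H Z c a)) (\<pi> (entry H Z c b) (f b))) (f a) =
          (\<Sum>c<k. hinner K (adj K K (\<pi> (entry H Z c a)) (\<pi> (entry H Z c b) (f b))) (f a))"
        by (rule K.hinner_sum_left[OF KK.adj_closed[OF \<pi>D(1)[OF me[OF Z]] \<pi>f[OF Z]]]) (use ab f in auto)
      moreover have "\<dots> = (\<Sum>c<k. hinner K (\<pi> (entry H Z c b) (f b)) (\<pi> (entry H Z c a) (f a)))"
      proof (intro sum.cong refl)
        fix c assume "c \<in> {..<k}"
        then have c: "c < k" by simp
        show "hinner K (adj K K (\<pi> (entry H Z c a)) (\<pi> (entry H Z c b) (f b))) (f a) =
            hinner K (\<pi> (entry H Z c b) (f b)) (\<pi> (entry H Z c a) (f a))"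
          by (rule KK.adj_inner'[OF \<pi>D(1)[OF me[OF Z c ab(1)]] f[OF ab(1)] \<pi>f[OF Z c ab(2)]])
      qed
      ultimately show ?thesis by (simp only:)
    qed
    have "q (adj (hpow k H) (hpow k H) Z \<circ> Z) =
        (\<Sum>a<k. \<Sum>b<k. \<Sum>c<k. hinner K (\<pi> (entry H Z c b) (f b)) (\<pi> (entry H Z c a) (f a)))"
      unfolding q_def by (intro sum.cong refl ent) auto
    also have "\<dots> = (\<Sum>a<k. \<Sum>c<k. \<Sum>b<k. hinner K (\<pi> (entry H Z c b) (f b)) (\<pi> (entry H Z c a) (f a)))"
      by (rule sum.cong[OF refl]) (rule sum.swap)
    also have "\<dots> = (\<Sum>c<k. \<Sum>a<k. \<Sum>b<k. hinner K (\<pi> (entry H Z c b) (f b)) (\<pi> (entry H Z c a) (f a)))"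
      by (rule sum.swap)
    also have "\<dots> = (\<Sum>c<k. complex_of_real ((hnorm K (g Z c))\<^sup>2))"
    proof (intro sum.cong refl)
      fix c assume "c \<in> {..<k}"
      then have c: "c < k" by simp
      have r: "hinner K (g Z c) y = (\<Sum>b<k. hinner K (\<pi> (entry H Z c b) (f b)) y)" if "y \<in> hcarrier K" for y
        unfolding g_def by (rule K.hinner_sum_left[OF \<pi>f[OF Z c] that]) auto
      have "hinner K (g Z c) (g Z c) = (\<Sum>a<k. hinner K (g Z c) (\<pi> (entry H Z c a) (f a)))"
        by (subst (2) g_def, rule K.hinner_sum_right[OF \<pi>f[OF Z c] gc[OF Z c]]) auto
      also have "\<dots> = (\<Sum>a<k. \<Sum>b<k. hinner K (\<pi> (entry H Z c b) (f b)) (\<pi> (entry H Z c a) (f a)))"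
        by (intro sum.cong refl r \<pi>f Z c) auto
      finally show "(\<Sum>a<k. \<Sum>b<k. hinner K (\<pi> (entry H Z c b) (f b)) (\<pi> (entry H Z c a) (f a))) =
          complex_of_real ((hnorm K (g Z c))\<^sup>2)"
        unfolding K.hinner_self[OF gc[OF Z c]] ..
    qed
    finally show ?thesis by (simp only: of_real_sum)
  qed
  have q_id: "q (idop (hpow k H)) = (\<Sum>a<k. hinner K (e (f a)) (f a))"
    unfolding q_def
  proof (intro sum.cong refl)
    fix a assume "a \<in> {..<k}"
    then have a: "a < k" by simp
    have "(\<Sum>b<k. hinner K (\<pi> (entry H (idop (hpow k H)) a b) (f b)) (f a)) =
        (\<Sum>b<k. if b = a then hinner K (e (f a)) (f a) else 0)"
    proof (intro sum.cong refl)
      fix b assume "b \<in> {..<k}"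
      then have b: "b < k" by simp
      show "hinner K (\<pi> (entry H (idop (hpow k H)) a b) (f b)) (f a) = (if b = a then hinner K (e (f a)) (f a) else 0)"
        unfolding H.entry_idop[OF a b] using f[OF a] by (cases "b = a") (simp_all add: e_def rep_zero)
    qed
    then show "(\<Sum>b<k. hinner K (\<pi> (entry H (idop (hpow k H)) a b) (f b)) (f a)) = hinner K (e (f a)) (f a)"
      using a by simp
  qed
  obtain Y where Y: "Y \<in> ?M" "adj (hpow k H) (hpow k H) Y \<circ> Y = idop (hpow k H) - (adj (hpow k H) (hpow k H) X \<circ> X)"
    using P.positive_factor[OF M I X] by blast
  have XX: "adj (hpow k H) (hpow k H) X \<circ> X \<in> ?M" by (rule MD(3)[OF MD(4)[OF X(1)] X(1)])
  \<comment> \<open>The left side is \<open>q\<close> of \<open>Y\<^sup>* Y\<close> and hence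
    nonnegative, so the claim is reduced to the value of \<open>q\<close> at the unit, which
    \<open>e_hinner\<close> controls.\<close>
  have "complex_of_real (\<Sum>c<k. (hnorm K (g Y c))\<^sup>2) = q (idop (hpow k H)) - complex_of_real (\<Sum>c<k. (hnorm K (g X c))\<^sup>2)"
    unfolding q_sq[OF Y(1), symmetric] Y(2) q_diff[OF I XX] q_sq[OF X(1)] ..
  then have "Re (complex_of_real (\<Sum>c<k. (hnorm K (g Y c))\<^sup>2)) = Re (q (idop (hpow k H)) - complex_of_real (\<Sum>c<k. (hnorm K (g X c))\<^sup>2))"
    by (rule arg_cong)
  then have "(\<Sum>c<k. (hnorm K (g X c))\<^sup>2) = Re (q (idop (hpow k H))) - (\<Sum>c<k. (hnorm K (g Y c))\<^sup>2)"
    by (simp only: minus_complex.sel Re_complex_of_real)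
  also have "\<dots> \<le> Re (q (idop (hpow k H)))" by (simp add: sum_nonneg)
  also have "\<dots> \<le> (\<Sum>a<k. (hnorm K (f a))\<^sup>2)"
    unfolding q_id Re_sum by (intro sum_mono e_hinner f) simp
  finally show ?thesis by (simp only: g_def)
qed

text \<open>Scaling by \<open>1 / (2 * r)\<close> brings \<open>X\<close> into the range of the
  previous lemma; squaring the scale gives the factor 4.\<close>

lemma matrix_contraction:
  assumes X: "X \<in> H.matrices k A" "op_bdd (hpow k H) (hpow k H) X r" and r: "r > 0"
    and f: "\<And>b. b < k \<Longrightarrow> f b \<in> hcarrier K"
  shows "(\<Sum>a<k. (hnorm K (\<Sum>b<k. \<pi> (entry H X a b) (f b)))\<^sup>2) \<le> 4 * r\<^sup>2 * (\<Sum>a<k. (hnorm K (f a))\<^sup>2)"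
proof -
  interpret P: hilb "hpow k H" by (rule H.hpow_hilb)
  interpret PP: hilb2 "hpow k H" "hpow k H" ..
  note MD = cstar_subalgebraD[OF H.matrices_cstar[OF A(1), of k]]
  have me: "entry H X a b \<in> A" if "a < k" "b < k" for a b using that X by (simp add: H.matrices_def)
  let ?s = "complex_of_real (1 / (2 * r))"
  let ?g = "\<lambda>a. \<Sum>b<k. \<pi> (entry H X a b) (f b)"
  have gc: "?g a \<in> hcarrier K" if "a < k" for a
    by (rule K.sum_closed) (use that me f in \<open>auto intro: bop_closed[OF \<pi>D(1)]\<close>)
  have bd: "op_bdd (hpow k H) (hpow k H) (?s *\<^sub>C X) (1/2)"
    by (rule PP.op_bdd_mono[OF PP.scale_op_bdd[OF MD(1)[OF X(1)] X(2)]]) (use r in \<open>simp add: norm_divide\<close>)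
  have eq: "(hnorm K (\<Sum>b<k. \<pi> (entry H (?s *\<^sub>C X) a b) (f b)))\<^sup>2 = (hnorm K (?g a))\<^sup>2 / (4 * r\<^sup>2)" if a: "a < k" for a
  proof -
    have "(\<Sum>b<k. \<pi> (entry H (?s *\<^sub>C X) a b) (f b)) = (\<Sum>b<k. ?s *\<^sub>C \<pi> (entry H X a b) (f b))"
    proof (intro sum.cong refl)
      fix b assume "b \<in> {..<k}"
      then have b: "b < k" by simp
      show "\<pi> (entry H (?s *\<^sub>C X) a b) (f b) = ?s *\<^sub>C \<pi> (entry H X a b) (f b)"
        unfolding H.entry_scale \<pi>D(3)[OF me[OF a b]] scaleC_fun_apply ..
    qed
    also have "\<dots> = ?s *\<^sub>C ?g a" by (rule complex_vector.scale_sum_right[symmetric])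
    finally show ?thesis
      using r by (simp only: K.hnorm_scale[OF gc[OF a]]) (simp add: norm_divide power_divide power_mult_distrib)
  qed
  have "(\<Sum>a<k. (hnorm K (?g a))\<^sup>2 / (4 * r\<^sup>2)) \<le> (\<Sum>a<k. (hnorm K (f a))\<^sup>2)"
    using matrix_contraction_half[OF complex_vector.subspace_scale[OF MD(2) X(1)] bd, of f] f eq by simp
  then show ?thesis using r by (simp add: sum_divide_distrib[symmetric] divide_le_eq mult.commute)
qed

end

section \<open>Bessel's inequality, scalar contractions and the bound 2 sqrt n\<close>

section \<open>A norm estimate of Powers type\<close>

context hilb
begin

text \<open>For the sum \<open>s\<close> of the vectors \<open>D j x\<close>, orthogonality makes
  \<open>hinner H x s\<close> equal to the squared norm of \<open>s\<close>, which by Pythagoras is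
  the left side. Cauchy-Schwarz then shows that \<open>s\<close> is not longer than
  \<open>x\<close>.\<close>

lemma Bessel_projections:
  fixes n :: nat
  assumes D: "\<And>j. j < n \<Longrightarrow> D j \<in> bop H H" "\<And>j. j < n \<Longrightarrow> adj H H (D j) = D j"
      "\<And>j. j < n \<Longrightarrow> D j \<circ> D j = D j"
    and orth: "\<And>i j. i < n \<Longrightarrow> j < n \<Longrightarrow> i \<noteq> j \<Longrightarrow> D i \<circ> D j = 0"
    and x: "x \<in> hcarrier H"
  shows "(\<Sum>j<n. (hnorm H (D j x))\<^sup>2) \<le> (hnorm H x)\<^sup>2"
proof -
  interpret HH: hilb2 H H by (rule hilb2_self)
  have Dx: "D j x \<in> hcarrier H" if "j < n" for j using bop_closed[OF D(1)[OF that] x] .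
  have DD: "hinner H (D i x) (D j x) = hinner H x ((D i \<circ> D j) x)" if "i < n" "j < n" for i j
    using HH.adj_inner[OF D(1)[OF that(1)] x Dx[OF that(2)]] D(2)[OF that(1)] by simp
  define s where "s = (\<Sum>j<n. D j x)"
  have s: "s \<in> hcarrier H" unfolding s_def by (rule sum_closed) (simp add: Dx)
  have sq: "(hnorm H s)\<^sup>2 = (\<Sum>j<n. (hnorm H (D j x))\<^sup>2)"
    unfolding s_def
  proof (rule Pythagoras_sum)
    fix i j assume "i \<in> {..<n}" "j \<in> {..<n}" "i \<noteq> j"
    then show "hinner H (D i x) (D j x) = 0" using DD[of i j] orth[of i j] x by simp
  qed (use Dx in auto)
  have "hinner H x s = (\<Sum>j<n. hinner H x (D j x))"
    unfolding s_def by (rule hinner_sum_right) (use Dx x in auto)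
  also have "\<dots> = (\<Sum>j<n. complex_of_real ((hnorm H (D j x))\<^sup>2))"
  proof (intro sum.cong refl)
    fix j assume "j \<in> {..<n}"
    then have j: "j < n" by simp
    show "hinner H x (D j x) = complex_of_real ((hnorm H (D j x))\<^sup>2)"
      using DD[OF j j] D(3)[OF j] hinner_self[OF Dx[OF j]] by simp
  qed
  also have "\<dots> = complex_of_real ((hnorm H s)\<^sup>2)" unfolding sq by simp
  finally have "cmod (hinner H x s) = (hnorm H s)\<^sup>2" by (simp add: norm_power)
  then have le: "hnorm H s * hnorm H s \<le> hnorm H x * hnorm H s"
    using Cauchy_Schwarz[OF x s] by (simp add: power2_eq_square)
  have "hnorm H s \<le> hnorm H x"
  proof (cases "hnorm H s = 0")
    case True
    then show ?thesis using x by simp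
  next
    case False
    then have "hnorm H s > 0" using hnorm_nonneg[OF s] by linarith
    then show ?thesis using le by simp
  qed
  then show ?thesis unfolding sq[symmetric] using s by (intro power_mono) auto
qed

lemma projection_norms:
  assumes D: "D \<in> bop H H" "adj H H D = D" "D \<circ> D = D" and x: "x \<in> hcarrier H"
  shows "hnorm H (D x) \<le> hnorm H x" "hnorm H (x - D x) \<le> hnorm H x"
proof -
  interpret HH: hilb2 H H by (rule hilb2_self)
  have Dx: "D x \<in> hcarrier H" using bop_closed[OF D(1) x] .
  have "hinner H x (D x) = hinner H (D x) (D x)"
    using HH.adj_inner[OF D(1) x Dx] D(2) fun_cong[OF D(3), of x] by simp
  then have re: "Re (hinner H x (D x)) = (hnorm H (D x))\<^sup>2" by (simp add: Re_hinner_self[OF Dx])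
  have sq: "(hnorm H (x - D x))\<^sup>2 = (hnorm H x)\<^sup>2 - (hnorm H (D x))\<^sup>2"
    unfolding hnorm_diff_square[OF x Dx] re by simp
  have "(hnorm H (D x))\<^sup>2 \<le> (hnorm H x)\<^sup>2" using sq zero_le_power2[of "hnorm H (x - D x)"] by linarith
  then show "hnorm H (D x) \<le> hnorm H x" using hnorm_nonneg[OF x] by (rule power2_le_imp_le)
  have "(hnorm H (x - D x))\<^sup>2 \<le> (hnorm H x)\<^sup>2" using sq zero_le_power2[of "hnorm H (D x)"] by linarith
  then show "hnorm H (x - D x) \<le> hnorm H x" using hnorm_nonneg[OF x] by (rule power2_le_imp_le)
qed

text \<open>The Hadamard product of the positive matrix \<open>1 - c\<^sup>* c\<close> with a Gram matrix is positive.\<close>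

lemma scalar_contraction:
  fixes k :: nat
  assumes c: "psd {..<k} (\<lambda>b b'. (if b = b' then 1 else 0) - (\<Sum>a<k. c a b * cnj (c a b')))"
    and x: "\<And>b. b < k \<Longrightarrow> x b \<in> hcarrier H"
  shows "(\<Sum>a<k. (hnorm H (\<Sum>b<k. c a b *\<^sub>C x b))\<^sup>2) \<le> (\<Sum>b<k. (hnorm H (x b))\<^sup>2)"
proof -
  let ?d = "\<lambda>b b'. (if b = b' then 1 else 0 :: complex)"
  let ?G = "\<lambda>b b'. hinner H (x b) (x b')"
  have "psd {..<k} (\<lambda>b b'. (?d b b' - (\<Sum>a<k. c a b * cnj (c a b'))) * ?G b b')"
    by (rule Schur_product[OF c gram_psd]) (use x in simp)
  \<comment> \<open>With all coefficients equal to 1, the quadratic form of the product kernel is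
    the right side of the claim minus the left side.\<close>
  then have pos: "(\<Sum>b<k. \<Sum>b'<k. 1 * cnj 1 * ((?d b b' - (\<Sum>a<k. c a b * cnj (c a b'))) * ?G b b')) \<in> \<real>\<^sub>\<ge>\<^sub>0"
    by (rule psd_nonneg[where c = "\<lambda>_. 1"]) auto
  have yc: "(\<Sum>b<k. c a b *\<^sub>C x b) \<in> hcarrier H" for a
    by (rule sum_closed) (use x in auto)
  have sq: "complex_of_real ((hnorm H (\<Sum>b<k. c a b *\<^sub>C x b))\<^sup>2) = (\<Sum>b<k. \<Sum>b'<k. c a b * cnj (c a b') * ?G b b')" for a
    unfolding hinner_self[OF yc, symmetric] by (rule hinner_lincomb) (use x in auto)
  have "(\<Sum>b<k. \<Sum>b'<k. 1 * cnj 1 * ((?d b b' - (\<Sum>a<k. c a b * cnj (c a b'))) * ?G b b')) =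
    (\<Sum>b<k. \<Sum>b'<k. ?d b b' * ?G b b') - (\<Sum>b<k. \<Sum>b'<k. \<Sum>a<k. c a b * cnj (c a b') * ?G b b')"
    by (simp only: complex_cnj_one mult_1_left left_diff_distrib sum_subtractf sum_distrib_right)
  also have "(\<Sum>b<k. \<Sum>b'<k. ?d b b' * ?G b b') = complex_of_real (\<Sum>b<k. (hnorm H (x b))\<^sup>2)"
  proof -
    have "(\<Sum>b'<k. ?d b b' * ?G b b') = complex_of_real ((hnorm H (x b))\<^sup>2)" if "b < k" for b
    proof -
      have "(\<Sum>b'<k. ?d b b' * ?G b b') = (\<Sum>b'<k. if b' = b then ?G b b else 0)"
        by (intro sum.cong refl) auto
      also have "\<dots> = ?G b b" using that by simp
      finally show ?thesis unfolding hinner_self[OF x[OF that]] .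
    qed
    then have "(\<Sum>b<k. \<Sum>b'<k. ?d b b' * ?G b b') = (\<Sum>b<k. complex_of_real ((hnorm H (x b))\<^sup>2))"
      by (intro sum.cong refl) simp
    then show ?thesis by (simp only: of_real_sum)
  qed
  also have "(\<Sum>b<k. \<Sum>b'<k. \<Sum>a<k. c a b * cnj (c a b') * ?G b b') =
      (\<Sum>a<k. \<Sum>b<k. \<Sum>b'<k. c a b * cnj (c a b') * ?G b b')"
  proof -
    have "(\<Sum>b<k. \<Sum>b'<k. \<Sum>a<k. c a b * cnj (c a b') * ?G b b') =
        (\<Sum>b<k. \<Sum>a<k. \<Sum>b'<k. c a b * cnj (c a b') * ?G b b')"
      by (rule sum.cong[OF refl]) (rule sum.swap)
    also have "\<dots> = (\<Sum>a<k. \<Sum>b<k. \<Sum>b'<k. c a b * cnj (c a b') * ?G b b')" by (rule sum.swap)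
    finally show ?thesis .
  qed
  also have "\<dots> = complex_of_real (\<Sum>a<k. (hnorm H (\<Sum>b<k. c a b *\<^sub>C x b))\<^sup>2)"
    unfolding sq[symmetric] by (simp only: of_real_sum)
  finally have "complex_of_real (\<Sum>b<k. (hnorm H (x b))\<^sup>2) - complex_of_real (\<Sum>a<k. (hnorm H (\<Sum>b<k. c a b *\<^sub>C x b))\<^sup>2) \<in> \<real>\<^sub>\<ge>\<^sub>0"
    using pos by simp
  then show ?thesis
    unfolding of_real_diff[symmetric] by (simp only: nonneg_Reals_of_real_iff diff_ge_0_iff_ge)
qed

text \<open>Split \<open>U\<^sub>j = D\<^sub>j U\<^sub>j + (1 - D\<^sub>j) U\<^sub>j D\<^sub>j\<close>; each half contributes \<open>\<surd>n\<close>.\<close>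

lemma Powers_bound:
  fixes n k :: nat
  assumes D: "\<And>j. j < n \<Longrightarrow> D j \<in> bop H H" "\<And>j. j < n \<Longrightarrow> adj H H (D j) = D j"
      "\<And>j. j < n \<Longrightarrow> D j \<circ> D j = D j"
    and orth: "\<And>i j. i < n \<Longrightarrow> j < n \<Longrightarrow> i \<noteq> j \<Longrightarrow> D i \<circ> D j = 0"
    and U: "\<And>j. j < n \<Longrightarrow> U j \<in> bop H H" "\<And>j. j < n \<Longrightarrow> op_bdd H H (U j) 1"
    and UD: "\<And>j x. j < n \<Longrightarrow> x \<in> hcarrier H \<Longrightarrow> D j x = 0 \<Longrightarrow> D j (U j x) = U j x"
    and c: "\<And>j. j < n \<Longrightarrow> psd {..<k} (\<lambda>b b'. (if b = b' then 1 else 0) - (\<Sum>a<k. c j a b * cnj (c j a b')))"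
    and x: "x \<in> hcarrier (hpow k H)"
  shows "sqrt (\<Sum>a<k. (hnorm H (\<Sum>j<n. U j (\<Sum>b<k. c j a b *\<^sub>C x b)))\<^sup>2) \<le> 2 * sqrt n * hnorm (hpow k H) x"
proof -
  interpret HH: hilb2 H H by (rule hilb2_self)
  interpret P: hilb "hpow k H" by (rule hpow_hilb)
  have xb: "x b \<in> hcarrier H" if "b < k" for b by (rule hpow_carrierD[OF x that])
  define z where "z j a = (\<Sum>b<k. c j a b *\<^sub>C x b)" for j a
  have z: "z j a \<in> hcarrier H" for j a unfolding z_def by (rule sum_closed) (use xb in auto)
  have zn: "(\<Sum>a<k. (hnorm H (z j a))\<^sup>2) \<le> (hnorm (hpow k H) x)\<^sup>2" if "j < n" for j
    unfolding z_def hpow_hnorm[OF x] by (rule scalar_contraction[OF c[OF that] xb])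
  \<comment> \<open>\<open>D j\<close> is linear and so commutes with the scalar matrix
    \<open>c j\<close>. The contraction estimate therefore applies to the vectors
    \<open>D j (x b)\<close>, to which Bessel's inequality is applied below.\<close>
  have Dzn: "(\<Sum>a<k. (hnorm H (D j (z j a)))\<^sup>2) \<le> (\<Sum>b<k. (hnorm H (D j (x b)))\<^sup>2)" if j: "j < n" for j
  proof -
    have "D j (z j a) = (\<Sum>b<k. c j a b *\<^sub>C D j (x b))" for a
    proof -
      have "D j (z j a) = (\<Sum>b<k. D j (c j a b *\<^sub>C x b))"
        unfolding z_def by (rule HH.bop_sum[OF D(1)[OF j]]) (use xb in auto)
      then show ?thesis using xb by (simp add: bop_scale[OF D(1)[OF j]])
    qed
    then show ?thesis using scalar_contraction[OF c[OF j], of "\<lambda>b. D j (x b)"] bop_closed[OF D(1)[OF j] xb] by simp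
  qed
  define p where "p j a = D j (U j (z j a))" for j a
  define w where "w j a = U j (D j (z j a)) - D j (U j (D j (z j a)))" for j a
  have Uc: "U j y \<in> hcarrier H" if "j < n" "y \<in> hcarrier H" for j y using bop_closed[OF U(1)] that by blast
  have Dc: "D j y \<in> hcarrier H" if "j < n" "y \<in> hcarrier H" for j y using bop_closed[OF D(1)] that by blast
  have Un: "hnorm H (U j y) \<le> hnorm H y" if "j < n" "y \<in> hcarrier H" for j y
    using op_bddD[OF U(2)[OF that(1)] that(2)] by simp
  have pc: "p j a \<in> hcarrier H" and wc: "w j a \<in> hcarrier H" if "j < n" for j a
    using that z by (auto simp: p_def w_def intro!: Uc Dc diff_closed)
  have split: "U j (z j a) = p j a + w j a" if j: "j < n" for j a
  proof -
    let ?y = "z j a - D j (z j a)"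
    have y: "?y \<in> hcarrier H" using z Dc[OF j] by auto
    have "D j ?y = 0"
      using HH.bop_diff[OF D(1)[OF j] z Dc[OF j z]] fun_cong[OF D(3)[OF j], of "z j a"] by simp
    then have "D j (U j ?y) = U j ?y" by (rule UD[OF j y])
    moreover have "U j ?y = U j (z j a) - U j (D j (z j a))" by (rule HH.bop_diff[OF U(1)[OF j] z Dc[OF j z]])
    moreover have "D j (U j (z j a) - U j (D j (z j a))) = D j (U j (z j a)) - D j (U j (D j (z j a)))"
      by (rule HH.bop_diff[OF D(1)[OF j] Uc[OF j z] Uc[OF j Dc[OF j z]]])
    ultimately have "D j (U j (z j a)) - D j (U j (D j (z j a))) = U j (z j a) - U j (D j (z j a))" by simp
    then show ?thesis unfolding p_def w_def by (simp only: algebra_simps)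
  qed
  define X where "X = hnorm (hpow k H) x"
  have X0: "X \<ge> 0" unfolding X_def by (rule P.hnorm_nonneg[OF x])
  define Pv where "Pv a = (if a < k then \<Sum>j<n. p j a else 0)" for a
  define Wv where "Wv j a = (if a < k then w j a else 0)" for j a
  have Pvc: "Pv \<in> hcarrier (hpow k H)" using pc by (auto simp: hpow_carrier Pv_def intro!: sum_closed)
  have Wvc: "Wv j \<in> hcarrier (hpow k H)" if "j < n" for j using wc[OF that] by (auto simp: hpow_carrier Wv_def)
  \<comment> \<open>The vectors \<open>p j a\<close> lie in the mutually orthogonal ranges of the
    \<open>D j\<close>, so the squares of their norms add, and the sum over \<open>j\<close> costs
    no more than sqrt n.\<close>
  have "(hnorm (hpow k H) Pv)\<^sup>2 = (\<Sum>a<k. \<Sum>j<n. (hnorm H (p j a))\<^sup>2)"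
    unfolding hpow_hnorm[OF Pvc]
  proof (intro sum.cong refl)
    fix a assume "a \<in> {..<k}"
    then have "Pv a = (\<Sum>j<n. p j a)" by (simp add: Pv_def)
    moreover have "(hnorm H (\<Sum>j<n. p j a))\<^sup>2 = (\<Sum>j<n. (hnorm H (p j a))\<^sup>2)"
    proof (rule Pythagoras_sum)
      fix i j assume ij: "i \<in> {..<n}" "j \<in> {..<n}" "i \<noteq> j"
      then have i: "i < n" and j: "j < n" by auto
      have "hinner H (p i a) (p j a) = hinner H (U i (z i a)) ((D i \<circ> D j) (U j (z j a)))"
        using HH.adj_inner[OF D(1)[OF i] Uc[OF i z] Dc[OF j Uc[OF j z]]] D(2)[OF i] by (simp add: p_def)
      then show "hinner H (p i a) (p j a) = 0" using orth[OF i j ij(3)] Uc[OF i z] by simp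
    qed (use pc in auto)
    ultimately show "(hnorm H (Pv a))\<^sup>2 = (\<Sum>j<n. (hnorm H (p j a))\<^sup>2)" by simp
  qed
  also have "\<dots> = (\<Sum>j<n. \<Sum>a<k. (hnorm H (p j a))\<^sup>2)" by (rule sum.swap)
  also have "\<dots> \<le> (\<Sum>j<n. X\<^sup>2)"
  proof (rule sum_mono)
    fix j assume "j \<in> {..<n}"
    then have j: "j < n" by simp
    have "(\<Sum>a<k. (hnorm H (p j a))\<^sup>2) \<le> (\<Sum>a<k. (hnorm H (z j a))\<^sup>2)"
    proof (rule sum_mono)
      fix a
      have "hnorm H (p j a) \<le> hnorm H (U j (z j a))"
        unfolding p_def by (rule projection_norms(1)[OF D(1-3)[OF j] Uc[OF j z]])
      also have "\<dots> \<le> hnorm H (z j a)" by (rule Un[OF j z])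
      finally show "(hnorm H (p j a))\<^sup>2 \<le> (hnorm H (z j a))\<^sup>2"
        by (rule power_mono) (rule hnorm_nonneg[OF pc[OF j]])
    qed
    then show "(\<Sum>a<k. (hnorm H (p j a))\<^sup>2) \<le> X\<^sup>2" using zn[OF j] by (simp add: X_def)
  qed
  also have "\<dots> = (sqrt n * X)\<^sup>2" by (simp add: power_mult_distrib)
  finally have Pn: "hnorm (hpow k H) Pv \<le> sqrt n * X"
    by (rule power2_le_imp_le) (simp add: X0)
  have Wn: "(hnorm (hpow k H) (Wv j))\<^sup>2 \<le> (\<Sum>b<k. (hnorm H (D j (x b)))\<^sup>2)" if j: "j < n" for j
  proof -
    have "(hnorm (hpow k H) (Wv j))\<^sup>2 \<le> (\<Sum>a<k. (hnorm H (D j (z j a)))\<^sup>2)"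
      unfolding hpow_hnorm[OF Wvc[OF j]]
    proof (rule sum_mono)
      fix a assume a: "a \<in> {..<k}"
      have "hnorm H (w j a) \<le> hnorm H (U j (D j (z j a)))"
        unfolding w_def by (rule projection_norms(2)[OF D(1-3)[OF j] Uc[OF j Dc[OF j z]]])
      also have "\<dots> \<le> hnorm H (D j (z j a))" by (rule Un[OF j Dc[OF j z]])
      finally show "(hnorm H (Wv j a))\<^sup>2 \<le> (hnorm H (D j (z j a)))\<^sup>2"
        using a hnorm_nonneg[OF wc[OF j], of a] by (simp add: Wv_def power_mono)
    qed
    then show ?thesis using Dzn[OF j] by simp
  qed
  \<comment> \<open>The second halves need not be orthogonal for different \<open>j\<close>.
    Cauchy-Schwarz over \<open>j\<close> costs a factor \<open>n\<close> in the square, but Bessel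
    keeps the sum of the squares below the square of \<open>X\<close>.\<close>
  have "(\<Sum>j<n. hnorm (hpow k H) (Wv j))\<^sup>2 \<le> real n * (\<Sum>j<n. (hnorm (hpow k H) (Wv j))\<^sup>2)"
  proof -
    show ?thesis
      using sum_squared_le_sum_of_squares[of "\<lambda>j. hnorm (hpow k H) (Wv j)" "{..<n}"] by (simp add: mult.commute)
  qed
  also have "(\<Sum>j<n. (hnorm (hpow k H) (Wv j))\<^sup>2) \<le> (\<Sum>j<n. \<Sum>b<k. (hnorm H (D j (x b)))\<^sup>2)"
    by (rule sum_mono) (use Wn in simp)
  also have "\<dots> = (\<Sum>b<k. \<Sum>j<n. (hnorm H (D j (x b)))\<^sup>2)" by (rule sum.swap)
  also have "\<dots> \<le> (\<Sum>b<k. (hnorm H (x b))\<^sup>2)"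
    by (rule sum_mono, rule Bessel_projections[OF D orth xb]) auto
  also have "\<dots> = X\<^sup>2" unfolding X_def hpow_hnorm[OF x] ..
  finally have "(\<Sum>j<n. hnorm (hpow k H) (Wv j))\<^sup>2 \<le> (sqrt n * X)\<^sup>2"
    by (simp add: power_mult_distrib mult_left_mono)
  then have Wsum: "(\<Sum>j<n. hnorm (hpow k H) (Wv j)) \<le> sqrt n * X"
    by (rule power2_le_imp_le) (simp add: X0)
  let ?R = "Pv + (\<Sum>j<n. Wv j)"
  have Wsc: "(\<Sum>j<n. Wv j) \<in> hcarrier (hpow k H)" by (rule P.sum_closed) (use Wvc in simp)
  have Rc: "?R \<in> hcarrier (hpow k H)" by (rule P.add_closed[OF Pvc Wsc])
  have "hnorm (hpow k H) ?R \<le> hnorm (hpow k H) Pv + hnorm (hpow k H) (\<Sum>j<n. Wv j)"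
    by (rule P.hnorm_triangle[OF Pvc Wsc])
  also have "hnorm (hpow k H) (\<Sum>j<n. Wv j) \<le> (\<Sum>j<n. hnorm (hpow k H) (Wv j))"
    by (rule P.hnorm_sum_le) (use Wvc in simp)
  finally have "hnorm (hpow k H) ?R \<le> 2 * sqrt n * X" using Pn Wsum by linarith
  moreover have "hnorm (hpow k H) ?R = sqrt (\<Sum>a<k. (hnorm H (\<Sum>j<n. U j (z j a)))\<^sup>2)"
  proof -
    have "(hnorm (hpow k H) ?R)\<^sup>2 = (\<Sum>a<k. (hnorm H (\<Sum>j<n. U j (z j a)))\<^sup>2)"
      unfolding hpow_hnorm[OF Rc]
    proof (intro sum.cong refl)
      fix a assume a: "a \<in> {..<k}"
      have "?R a = (\<Sum>j<n. p j a) + (\<Sum>j<n. w j a)" using a by (simp add: Pv_def Wv_def sum_fun_apply)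
      also have "\<dots> = (\<Sum>j<n. U j (z j a))" using split by (simp add: sum.distrib[symmetric])
      finally show "(hnorm H (?R a))\<^sup>2 = (hnorm H (\<Sum>j<n. U j (z j a)))\<^sup>2" by simp
    qed
    then show ?thesis using P.hnorm_nonneg[OF Rc] by (simp add: real_sqrt_unique)
  qed
  ultimately show ?thesis by (simp add: z_def X_def)
qed

end

section \<open>Projections onto closed subspaces and near almost idempotent operators\<close>

section \<open>Projections\<close>

context hilb
begin

lemma closed_subspace_projection_ex:
  assumes sub: "complex_vector.subspace M" and MH: "M \<subseteq> hcarrier H"
    and closed: "\<And>s l. (\<And>n. s n \<in> M) \<Longrightarrow> l \<in> hcarrier H \<Longrightarrow> htendsto H s l \<Longrightarrow> l \<in> M"
  shows "\<exists>P\<in>bop H H. adj H H P = P \<and> P \<circ> P = P \<and> (\<forall>y\<in>M. P y = y) \<and>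
    (\<forall>y\<in>hcarrier H. P y \<in> M \<and> (\<forall>z\<in>M. hinner H (y - P y) z = 0))"
proof -
  interpret HH: hilb2 H H by (rule hilb2_self)
  have "\<forall>x\<in>hcarrier H. \<exists>m\<in>M. \<forall>y\<in>M. hinner H (x - m) y = 0"
  proof
    fix x assume x: "x \<in> hcarrier H"
    show "\<exists>m\<in>M. \<forall>y\<in>M. hinner H (x - m) y = 0"
      by (rule orthogonal_projection_ex[OF sub MH _ x]) (rule closed)
  qed
  then obtain P0 where P0: "\<And>x. x \<in> hcarrier H \<Longrightarrow> P0 x \<in> M" "\<And>x y. x \<in> hcarrier H \<Longrightarrow> y \<in> M \<Longrightarrow> hinner H (x - P0 x) y = 0"
    by metis
  define P where "P x = (if x \<in> hcarrier H then P0 x else 0)" for x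
  have P: "P x \<in> M" "P x \<in> hcarrier H" if "x \<in> hcarrier H" for x using P0(1)[OF that] MH that by (auto simp: P_def)
  have Pi: "hinner H (P x) y = hinner H x y" if "x \<in> hcarrier H" "y \<in> M" for x y
    using P0(2)[OF that] that MH P(2)[OF that(1)] by (simp add: P_def hinner_diff_left subset_iff)
  have uniq: "a = b" if ab: "a \<in> M" "b \<in> M" and "\<And>y. y \<in> M \<Longrightarrow> hinner H a y = hinner H b y" for a b
  proof -
    have d: "a - b \<in> M" by (rule complex_vector.subspace_diff[OF sub ab])
    have "hinner H (a - b) (a - b) = hinner H a (a - b) - hinner H b (a - b)"
      by (rule hinner_diff_left) (use ab d MH in blast)+
    also have "\<dots> = 0" using that(3)[OF d] by simp
    finally show ?thesis using hinner_definite[of "a - b"] d MH by (simp add: subset_iff)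
  qed
  have Pfix: "P y = y" if "y \<in> M" for y
    by (rule uniq[OF P(1) that Pi]) (use that MH in auto)
  have Pb: "P \<in> bop H H"
  proof (rule bopI[where C = 1])
    show "P (x + y) = P x + P y" if "x \<in> hcarrier H" "y \<in> hcarrier H" for x y
    proof (rule uniq[OF P(1)[OF add_closed[OF that]] complex_vector.subspace_add[OF sub P(1)[OF that(1)] P(1)[OF that(2)]]])
      fix z assume z: "z \<in> M"
      then have zF: "z \<in> hcarrier H" using MH by blast
      show "hinner H (P (x + y)) z = hinner H (P x + P y) z"
        unfolding Pi[OF add_closed[OF that] z] hinner_add_left[OF P(2)[OF that(1)] P(2)[OF that(2)] zF]
          Pi[OF that(1) z] Pi[OF that(2) z] by (rule hinner_add_left[OF that zF])
    qed
    show "P (c *\<^sub>C x) = c *\<^sub>C P x" if x: "x \<in> hcarrier H" for x c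
    proof (rule uniq[OF P(1)[OF scale_closed[OF x]] complex_vector.subspace_scale[OF sub P(1)[OF x]]])
      fix z assume z: "z \<in> M"
      then have zF: "z \<in> hcarrier H" using MH by blast
      show "hinner H (P (c *\<^sub>C x)) z = hinner H (c *\<^sub>C P x) z"
        unfolding Pi[OF scale_closed[OF x] z] hinner_scale_left[OF P(2)[OF x] zF]
          Pi[OF x z] by (rule hinner_scale_left[OF x zF])
    qed
    show "hnorm H (P x) \<le> 1 * hnorm H x" if x: "x \<in> hcarrier H" for x
    proof -
      have "(hnorm H (P x))\<^sup>2 = Re (hinner H x (P x))"
        using Pi[OF x P(1)[OF x]] Re_hinner_self[OF P(2)[OF x]] by simp
      also have "\<dots> \<le> hnorm H x * hnorm H (P x)"
        using Cauchy_Schwarz[OF x P(2)[OF x]] complex_Re_le_cmod order_trans by blast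
      finally have le: "hnorm H (P x) * hnorm H (P x) \<le> hnorm H x * hnorm H (P x)" by (simp only: power2_eq_square)
      show ?thesis
      proof (cases "hnorm H (P x) = 0")
        case True
        then show ?thesis using x by simp
      next
        case False
        then have "hnorm H (P x) > 0" using hnorm_nonneg[OF P(2)[OF x]] by linarith
        then show ?thesis using le by simp
      qed
    qed
    show "P x \<in> hcarrier H" if "x \<in> hcarrier H" for x by (rule P(2)[OF that])
    show "P x = 0" if "x \<notin> hcarrier H" for x unfolding P_def using that by (rule if_not_P)
  qed
  have "adj H H P = P"
  proof (rule HH.adjI[OF Pb Pb])
    fix x y assume x: "x \<in> hcarrier H" and y: "y \<in> hcarrier H"
    have "hinner H x (P y) = hinner H (P x) (P y)" using Pi[OF x P(1)[OF y]] by simp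
    also have "\<dots> = cnj (hinner H (P y) (P x))" by (rule hinner_commute[OF P(2)[OF y] P(2)[OF x]])
    also have "hinner H (P y) (P x) = hinner H y (P x)" by (rule Pi[OF y P(1)[OF x]])
    also have "cnj (hinner H y (P x)) = hinner H (P x) y" by (rule hinner_commute[OF y P(2)[OF x], symmetric])
    finally show "hinner H (P x) y = hinner H x (P y)" by (rule sym)
  qed
  moreover have "P \<circ> P = P"
    by (rule HH.bop_eqI[OF comp_bop_self[OF Pb Pb] Pb]) (simp add: Pfix P(1))
  moreover have "hinner H (y - P y) z = 0" if "y \<in> hcarrier H" "z \<in> M" for y z
    using P0(2)[OF that] that(1) by (simp add: P_def)
  ultimately show ?thesis using Pb Pfix P(1) by (intro bexI[of _ P] conjI ballI) blast+
qed

lemma htendsto_of_opnorm: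
  assumes X: "\<And>n. X n \<in> bop H H" and T: "T \<in> bop H H" "(\<lambda>n. opnorm H H (X n - T)) \<longlonglongrightarrow> 0" and x: "x \<in> hcarrier H"
  shows "htendsto H (\<lambda>n. X n x) (T x)"
proof -
  interpret HH: hilb2 H H by (rule hilb2_self)
  show ?thesis
  proof (rule htendstoI[OF _ _ bop_closed[OF X x] bop_closed[OF T(1) x]])
    show "hnorm H (X n x - T x) \<le> opnorm H H (X n - T) * hnorm H x" for n
      using op_bddD[OF HH.opnorm_bdd[OF HH.diff_bop[OF X T(1)]] x, of n] by (simp only: fun_diff_apply)
    show "(\<lambda>n. opnorm H H (X n - T) * hnorm H x) \<longlonglongrightarrow> 0" by (rule tendsto_mult_left_zero[OF T(2)])
  qed
qed

text \<open>With \<open>R = 2T - 1\<close>, the projection is the fixed point of the Newton type iteration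
  \<open>q \<mapsto> q - R (q\<^sup>2 - q)\<close>, which preserves commutation with \<open>T\<close>; note \<open>R\<^sup>2 = 1 + 4 (T\<^sup>2 - T)\<close>.\<close>

lemma near_projection:
  assumes T: "T \<in> bop H H" "adj H H T = T" "op_bdd H H T 1" "op_bdd H H ((T \<circ> T) - T) (1/96)"
  shows "\<exists>q\<in>bop H H. adj H H q = q \<and> q \<circ> q = q \<and> op_bdd H H (q - T) (1/16) \<and>
    (\<forall>P\<in>bop H H. P \<circ> T = T \<longrightarrow> P \<circ> q = q)"
proof -
  interpret HH: hilb2 H H by (rule hilb2_self)
  define R where "R = T + T - idop H"
  define D where "D = (T \<circ> T) - T"
  define N where "N q = (q \<circ> q) - q" for q :: "'a \<Rightarrow> 'a"
  define F where "F q = q - (R \<circ> N q)" for q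
  \<comment> \<open>The clause on \<open>P\<close> transports range inclusions from \<open>T\<close>
    to the fixed point. It is used with \<open>P\<close> a projection onto a finite-dimensional
    space and with \<open>P = e\<close>.\<close>
  define S where "S = {q \<in> bop H H. adj H H q = q \<and> q \<circ> T = T \<circ> q \<and> op_bdd H H (q - T) (1/16) \<and>
    (\<forall>P\<in>bop H H. P \<circ> T = T \<longrightarrow> P \<circ> q = q)}"
  note Tb = T(1)
  have Rb: "R \<in> bop H H" unfolding R_def by (intro HH.diff_bop HH.add_bop Tb idop_bop)
  have Db: "D \<in> bop H H" unfolding D_def by (intro HH.diff_bop comp_bop_self Tb)
  have Nb: "N q \<in> bop H H" if "q \<in> bop H H" for q unfolding N_def by (intro HH.diff_bop comp_bop_self that)
  have Fb: "F q \<in> bop H H" if "q \<in> bop H H" for q unfolding F_def by (intro HH.diff_bop comp_bop_self that Rb Nb)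
  have Rbd: "op_bdd H H R 3"
  proof -
    have "op_bdd H H (idop H) 1" by (rule op_bddI) simp_all
    then have "op_bdd H H R (1 + 1 + 1)" unfolding R_def
      by (intro HH.diff_op_bdd HH.add_op_bdd HH.add_bop T(1,3) idop_bop)
    then show ?thesis by simp
  qed
  have Dbd: "op_bdd H H D (1/96)" using T(4) by (simp only: D_def)
  have Rx: "R y = T y + T y - y" if "y \<in> hcarrier H" for y using that by (simp add: R_def fun_diff_apply)
  have Dx: "D y = T (T y) - T y" for y by (simp add: D_def fun_diff_apply)
  have Nx: "N q y = q (q y) - q y" for q y by (simp add: N_def fun_diff_apply)
  have Fx: "F q y = q y - R (N q y)" for q y by (simp add: F_def fun_diff_apply)
  have RR: "R (R y) = y + (D y + D y + (D y + D y))" if y: "y \<in> hcarrier H" for y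
  proof -
    have c: "T y \<in> hcarrier H" "T (T y) \<in> hcarrier H" using bop_closed[OF Tb] y by auto
    show ?thesis using y c by (simp add: Rx Dx bop_add[OF Tb] HH.bop_diff[OF Tb])
  qed
  have Ras: "adj H H R = R"
    unfolding R_def HH.adj_diff[OF HH.add_bop[OF Tb Tb] idop_bop] HH.adj_add[OF Tb Tb] T(2) adj_idop ..
  have SD: "q \<in> bop H H" "adj H H q = q" "\<And>y. q (T y) = T (q y)" "op_bdd H H (q - T) (1/16)"
      "\<And>P. P \<in> bop H H \<Longrightarrow> P \<circ> T = T \<Longrightarrow> P \<circ> q = q" if "q \<in> S" for q
  proof -
    show "q (T y) = T (q y)" for y
    proof -
      have "q \<circ> T = T \<circ> q" using that unfolding S_def by blast
      then show ?thesis by (metis comp_apply)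
    qed
  qed (use that in \<open>unfold S_def, blast\<close>)+
  have RN: "R (N q y) = N q (R y)" if q: "q \<in> S" and y: "y \<in> hcarrier H" for q y
  proof -
    note qb = SD(1)[OF q]
    have c: "T y \<in> hcarrier H" "q y \<in> hcarrier H" "q (q y) \<in> hcarrier H" "T (q y) \<in> hcarrier H" "T (q (q y)) \<in> hcarrier H"
      using bop_closed[OF Tb] bop_closed[OF qb] y by auto
    show ?thesis
      using y c by (simp add: Rx Nx SD(3)[OF q] bop_add[OF Tb] bop_add[OF qb] HH.bop_diff[OF Tb] HH.bop_diff[OF qb])
  qed
  have contr: "op_bdd H H (F a - F b) (d / 2)" if a: "a \<in> S" and b: "b \<in> S" and d: "op_bdd H H (a - b) d" for a b d
  proof -
    note ab = SD(1)[OF a] and bb = SD(1)[OF b]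
    define w where "w = a - b"
    have wb: "w \<in> bop H H" unfolding w_def by (rule HH.diff_bop[OF ab bb])
    define G where "G = (D \<circ> w) + (D \<circ> w)"
    define E where "E = ((a - T) \<circ> w) + (w \<circ> (b - T))"
    have Gb: "G \<in> bop H H" unfolding G_def by (intro HH.add_bop comp_bop_self Db wb)
    have Eb: "E \<in> bop H H" unfolding E_def by (intro HH.add_bop HH.diff_bop comp_bop_self wb ab bb Tb)
    \<comment> \<open>As \<open>w\<close> commutes with \<open>T\<close>, one has
      \<open>N a - N b = E + R w\<close>. Since \<open>R\<^sup>2 = 1 + 4 D\<close>, applying
      \<open>R\<close> produces a term \<open>w\<close> that cancels \<open>a - b\<close>; what
      remains, \<open>4 D w\<close> and \<open>R E\<close>, is small because \<open>D\<close>,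
      \<open>a - T\<close> and \<open>b - T\<close> are.\<close>
    have "F a - F b = - (G + G) - (R \<circ> E)"
    proof (rule HH.bop_eqI)
      show "F a - F b \<in> bop H H" by (intro HH.diff_bop Fb ab bb)
      show "- (G + G) - (R \<circ> E) \<in> bop H H"
        by (intro HH.diff_bop HH.minus_bop HH.add_bop Gb comp_bop_self Rb Eb)
      fix x assume x: "x \<in> hcarrier H"
      have c: "T x \<in> hcarrier H" "a x \<in> hcarrier H" "b x \<in> hcarrier H" "a (a x) \<in> hcarrier H" "b (b x) \<in> hcarrier H"
          "a (b x) \<in> hcarrier H"
        using bop_closed[OF Tb] bop_closed[OF ab] bop_closed[OF bb] x by auto
      have c': "T (a x) \<in> hcarrier H" "T (b x) \<in> hcarrier H" "T (a (a x)) \<in> hcarrier H" "T (b (b x)) \<in> hcarrier H"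
          "T (a (b x)) \<in> hcarrier H" "T (T (a x)) \<in> hcarrier H" "T (T (b x)) \<in> hcarrier H"
        using bop_closed[OF Tb] c by auto
      note lin = bop_add[OF Tb] bop_add[OF ab] bop_add[OF bb] HH.bop_diff[OF Tb] HH.bop_diff[OF ab] HH.bop_diff[OF bb]
      have 1: "(F a - F b) x = a x - (T (a (a x)) - T (a x) + (T (a (a x)) - T (a x)) - (a (a x) - a x))
          - (b x - (T (b (b x)) - T (b x) + (T (b (b x)) - T (b x)) - (b (b x) - b x)))"
        using x c c' by (simp add: Fx Nx Rx lin fun_diff_apply)
      have Ex: "E x = a (a x) - a (b x) - (T (a x) - T (b x)) + ((a (b x) - T (a x)) - (b (b x) - T (b x)))"
        using x c c' by (simp add: E_def w_def fun_diff_apply lin SD(3)[OF a] SD(3)[OF b])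
      have Gx: "G x = T (T (a x)) - T (T (b x)) - (T (a x) - T (b x)) + (T (T (a x)) - T (T (b x)) - (T (a x) - T (b x)))"
        using x c c' by (simp add: G_def w_def fun_diff_apply Dx lin)
      have REx: "R (E x) = T (E x) + T (E x) - E x" by (rule Rx[OF bop_closed[OF Eb x]])
      have TEx: "T (E x) = T (a (a x)) - T (a (b x)) - (T (T (a x)) - T (T (b x))) + ((T (a (b x)) - T (T (a x))) - (T (b (b x)) - T (T (b x))))"
        unfolding Ex using x c c' by (simp add: lin HH.bop_minus[OF Tb])
      show "(F a - F b) x = (- (G + G) - (R \<circ> E)) x"
        unfolding 1 unfolding fun_diff_apply uminus_apply plus_fun_apply comp_apply REx TEx unfolding Ex Gx
        by (simp add: algebra_simps)
    qed
    \<comment> \<open>The constants add up to 4/96 + 6/16 = 5/12, which is below 1/2.\<close>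
    moreover have "op_bdd H H (- (G + G) - (R \<circ> E)) ((1/96 * d + 1/96 * d) + (1/96 * d + 1/96 * d) + 3 * (1/16 * d + d * (1/16)))"
    proof -
      have Dw: "op_bdd H H (D \<circ> w) (1/96 * d)" by (rule comp_op_bdd[OF d[folded w_def] Dbd wb])
      have Gd: "op_bdd H H G (1/96 * d + 1/96 * d)" unfolding G_def by (intro HH.add_op_bdd comp_bop_self Db wb Dw)
      have Ed: "op_bdd H H E (1/16 * d + d * (1/16))" unfolding E_def
        by (intro HH.add_op_bdd comp_bop_self HH.diff_bop wb ab bb Tb
            comp_op_bdd[OF d[folded w_def] SD(4)[OF a] wb] comp_op_bdd[OF SD(4)[OF b] d[folded w_def]])
      show ?thesis
        by (intro HH.diff_op_bdd HH.minus_bop HH.add_bop Gb comp_bop_self Rb Eb HH.minus_op_bdd HH.add_op_bdd Gd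
            comp_op_bdd[OF Ed Rbd Eb])
    qed
    ultimately have "op_bdd H H (F a - F b) ((1/96 * d + 1/96 * d) + (1/96 * d + 1/96 * d) + 3 * (1/16 * d + d * (1/16)))"
      by (simp only:)
    then show ?thesis by (rule HH.op_bdd_mono) (use op_bddD0[OF d] in simp)
  qed
  have TS: "T \<in> S"
  proof -
    have "op_bdd H H (T - T) (1/16)" unfolding diff_self by (rule HH.op_bdd_mono[OF HH.zero_op_bdd]) simp
    then show ?thesis unfolding S_def using T(1,2) by blast
  qed
  have FS: "F q \<in> S" if q: "q \<in> S" for q
  proof -
    note qb = SD(1)[OF q]
    have RNq: "R \<circ> N q = N q \<circ> R"
      by (rule HH.bop_eqI) (intro comp_bop_self Rb Nb qb, intro comp_bop_self Rb Nb qb, simp add: RN[OF q])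
    have aN: "adj H H (N q) = N q"
      unfolding N_def HH.adj_diff[OF comp_bop_self[OF qb qb] qb] adj_comp[OF hilb_axioms hilb_axioms hilb_axioms qb qb]
        SD(2)[OF q] ..
    have "adj H H (R \<circ> N q) = R \<circ> N q"
      unfolding adj_comp[OF hilb_axioms hilb_axioms hilb_axioms Nb[OF qb] Rb] Ras aN by (rule RNq[symmetric])
    then have Fadj: "adj H H (F q) = F q"
      unfolding F_def HH.adj_diff[OF qb comp_bop_self[OF Rb Nb[OF qb]]] SD(2)[OF q] by (simp only:)
    have Fcomm: "F q \<circ> T = T \<circ> F q"
    proof (rule HH.bop_eqI[OF comp_bop_self[OF Fb[OF qb] Tb] comp_bop_self[OF Tb Fb[OF qb]]])
      fix y assume y: "y \<in> hcarrier H"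
      have c: "q y \<in> hcarrier H" "q (q y) \<in> hcarrier H" "T (q y) \<in> hcarrier H" "T (q (q y)) \<in> hcarrier H"
          "T (T (q y)) \<in> hcarrier H" "T (T (q (q y))) \<in> hcarrier H"
        using bop_closed[OF Tb] bop_closed[OF qb] y by auto
      show "(F q \<circ> T) y = (T \<circ> F q) y"
        using y c by (simp add: Fx Nx Rx SD(3)[OF q] bop_add[OF Tb] HH.bop_diff[OF Tb])
    qed
    \<comment> \<open>\<open>F\<close> moves \<open>T\<close> by at most 3/96 = 1/32, and the
      contraction leaves half of the radius 1/16, again 1/32. This is what the bound 1/96 is made
      for.\<close>
    have Fnear: "op_bdd H H (F q - T) (1/16)"
    proof -
      have "op_bdd H H (F q - F T) (1/16/2)" by (rule contr[OF q TS SD(4)[OF q]])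
      moreover have "op_bdd H H (F T - T) (3 * (1/96))"
      proof -
        have "F T - T = - (R \<circ> D)" by (simp add: F_def N_def D_def)
        then show ?thesis using HH.minus_op_bdd[OF comp_bop_self[OF Rb Db] comp_op_bdd[OF Dbd Rbd Db]] by (simp only:)
      qed
      ultimately have "op_bdd H H ((F q - F T) + (F T - T)) (1/16/2 + 3 * (1/96))"
        by (intro HH.add_op_bdd HH.diff_bop Fb qb Tb)
      moreover have "(F q - F T) + (F T - T) = F q - T" "(1/16/2 + 3 * (1/96)) = (1/16::real)" by simp_all
      ultimately show ?thesis by (simp only:)
    qed
    \<comment> \<open>\<open>R\<close> commutes with \<open>N q\<close>, so every term of
      \<open>F q y\<close> can be written with \<open>q\<close> outermost, where \<open>P\<close>
      has no effect.\<close>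
    have FP: "P \<circ> F q = F q" if P: "P \<in> bop H H" "P \<circ> T = T" for P
    proof (rule HH.bop_eqI[OF comp_bop_self[OF P(1) Fb[OF qb]] Fb[OF qb]])
      fix y assume y: "y \<in> hcarrier H"
      have Pq: "P (q z) = q z" for z using fun_cong[OF SD(5)[OF q P], of z] by simp
      have c: "q y \<in> hcarrier H" "q (R y) \<in> hcarrier H" "q (q (R y)) \<in> hcarrier H"
        using bop_closed[OF Rb] bop_closed[OF qb] y by auto
      have "F q y = q y - R (N q y)" by (rule Fx)
      also have "R (N q y) = N q (R y)" by (rule RN[OF q y])
      also have "N q (R y) = q (q (R y)) - q (R y)" by (rule Nx)
      finally show "(P \<circ> F q) y = F q y" using c by (simp add: HH.bop_diff[OF P(1)] Pq)
    qed
    show ?thesis unfolding S_def using Fb[OF qb] Fadj Fcomm Fnear FP by blast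
  qed
  have "\<exists>q\<in>S. F q = q"
  proof (rule op_fixed_point[OF _ _ FS TS contr])
    show "S \<subseteq> bop H H" using SD(1) by blast
    fix X q assume X: "\<And>n. X n \<in> S" and q: "q \<in> bop H H" "(\<lambda>n. opnorm H H (X n - q)) \<longlonglongrightarrow> 0"
    note Xb = SD(1)[OF X]
    have pt: "htendsto H (\<lambda>n. X n x) (q x)" if "x \<in> hcarrier H" for x by (rule htendsto_of_opnorm[OF Xb q that])
    have "adj H H q = q"
    proof (rule HH.op_limit_unique[OF Xb HH.adj_bop[OF q(1)] q(1) _ q(2)])
      show "(\<lambda>n. opnorm H H (X n - adj H H q)) \<longlonglongrightarrow> 0"
        using HH.adj_limit[OF Xb q] by (simp only: SD(2)[OF X])
    qed
    moreover have "q \<circ> T = T \<circ> q"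
    proof (rule HH.bop_eqI[OF comp_bop_self[OF q(1) Tb] comp_bop_self[OF Tb q(1)]])
      fix x assume x: "x \<in> hcarrier H"
      have "htendsto H (\<lambda>n. T (X n x)) (T (q x))"
        by (rule HH.htendsto_bop[OF Tb bop_closed[OF Xb x] bop_closed[OF q(1) x] pt[OF x]])
      then have "htendsto H (\<lambda>n. X n (T x)) (T (q x))" by (simp only: SD(3)[OF X])
      then have "q (T x) = T (q x)"
        by (rule htendsto_unique[OF bop_closed[OF Xb bop_closed[OF Tb x]] bop_closed[OF q(1) bop_closed[OF Tb x]]
            bop_closed[OF Tb bop_closed[OF q(1) x]] pt[OF bop_closed[OF Tb x]]])
      then show "(q \<circ> T) x = (T \<circ> q) x" by simp
    qed
    moreover have "op_bdd H H (q - T) (1/16)"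
    proof (rule op_bdd_limit[OF HH.diff_bop[OF Xb Tb] SD(4)[OF X] HH.diff_bop[OF q(1) Tb]])
      have "X n - T - (q - T) = X n - q" for n by simp
      then show "(\<lambda>n. opnorm H H (X n - T - (q - T))) \<longlonglongrightarrow> 0" using q(2) by (simp only:)
    qed
    moreover have "P \<circ> q = q" if P: "P \<in> bop H H" "P \<circ> T = T" for P
    proof (rule HH.bop_eqI[OF comp_bop_self[OF P(1) q(1)] q(1)])
      fix x assume x: "x \<in> hcarrier H"
      have PX: "P (X n x) = X n x" for n using fun_cong[OF SD(5)[OF X P], of n x] by simp
      have "htendsto H (\<lambda>n. P (X n x)) (P (q x))"
        by (rule HH.htendsto_bop[OF P(1) bop_closed[OF Xb x] bop_closed[OF q(1) x] pt[OF x]])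
      then have "htendsto H (\<lambda>n. X n x) (P (q x))" by (simp only: PX)
      then have "P (q x) = q x"
        by (rule htendsto_unique[OF bop_closed[OF Xb x] bop_closed[OF P(1) bop_closed[OF q(1) x]] bop_closed[OF q(1) x] _ pt[OF x]])
      then show "(P \<circ> q) x = q x" by simp
    qed
    ultimately show "q \<in> S" unfolding S_def using q(1) by blast
  qed
  then obtain q where q: "q \<in> S" "F q = q" by blast
  note qb = SD(1)[OF q(1)]
  have "q \<circ> q = q"
  proof (rule HH.bop_eqI[OF comp_bop_self[OF qb qb] qb])
    fix x assume x: "x \<in> hcarrier H"
    let ?y = "N q x"
    have y: "?y \<in> hcarrier H" by (rule bop_closed[OF Nb[OF qb] x])
    \<comment> \<open>A fixed point satisfies \<open>R (N q x) = 0\<close>. By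
      \<open>R\<^sup>2 = 1 + 4 D\<close> and the bound 1/96 on \<open>D\<close>, the operator
      \<open>R\<close> is injective, hence \<open>N q x = 0\<close>.\<close>
    have "R ?y = 0" using fun_cong[OF q(2), of x] unfolding Fx by simp
    then have "?y + (D ?y + D ?y + (D ?y + D ?y)) = 0" using RR[OF y] HH.bop_zero[OF Rb] by simp
    then have y_eq: "?y = - (D ?y + D ?y + (D ?y + D ?y))" by (rule eq_neg_iff_add_eq_0[THEN iffD2])
    have Dc: "D ?y \<in> hcarrier H" by (rule bop_closed[OF Db y])
    have "hnorm H ?y = hnorm H (D ?y + D ?y + (D ?y + D ?y))"
      by (subst y_eq, rule hnorm_minus) (use Dc in blast)
    also have "\<dots> \<le> (hnorm H (D ?y) + hnorm H (D ?y)) + (hnorm H (D ?y) + hnorm H (D ?y))"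
      using hnorm_triangle[OF add_closed[OF Dc Dc] add_closed[OF Dc Dc]] hnorm_triangle[OF Dc Dc] by linarith
    finally have "hnorm H ?y \<le> 4 * (1/96 * hnorm H ?y)" using op_bddD[OF Dbd y] by linarith
    then have "hnorm H ?y = 0" using hnorm_nonneg[OF y] by linarith
    then have "?y = 0" using hnorm_eq_0_iff[OF y] by blast
    then show "(q \<circ> q) x = q x" unfolding Nx by simp
  qed
  then show ?thesis using SD[OF q(1)] by (intro bexI[of _ q] conjI ballI impI) blast+
qed

lemma finite_rank_basis:
  assumes T: "T \<in> bop H H" and fr: "finite_rank H T"
  shows "\<exists>E. orthonormal H E \<and> (\<forall>x\<in>hcarrier H. T x = (\<Sum>m\<in>E. hinner H (T x) m *\<^sub>C m))"
proof -
  obtain B where B: "finite B" "T ` hcarrier H \<subseteq> complex_vector.span B" using fr by (auto simp: finite_rank_def)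
  \<comment> \<open>The set \<open>B\<close> from \<open>finite_rank\<close> may lie outside the
    carrier. A maximal independent subset of the range lies inside, and it is finite because it is
    contained in the span of \<open>B\<close>.\<close>
  obtain B' where B': "B' \<subseteq> T ` hcarrier H" "complex_vector.independent B'" "T ` hcarrier H \<subseteq> complex_vector.span B'"
    by (rule complex_vector.maximal_independent_subset)
  have fin: "finite B'"
    using complex_vector.independent_span_bound[OF B(1) B'(2)] B'(1) B(2) by blast
  have BH: "B' \<subseteq> hcarrier H" using B'(1) bop_closed[OF T] by blast
  obtain E where E: "orthonormal H E" "\<And>b. b \<in> B' \<Longrightarrow> b = (\<Sum>e\<in>E. hinner H b e *\<^sub>C e)"
    using orthonormal_basis_ex[OF fin BH] by blast
  have "T x = (\<Sum>m\<in>E. hinner H (T x) m *\<^sub>C m)" if "x \<in> hcarrier H" for x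
    by (rule orthonormal_expand_span[OF E(1) BH E(2)]) (use B'(3) that in auto)
  then show ?thesis using E(1) by blast
qed

lemma span_projection_bop:
  assumes E: "orthonormal H E"
  shows "(\<lambda>x. if x \<in> hcarrier H then \<Sum>m\<in>E. hinner H x m *\<^sub>C m else 0) \<in> bop H H" (is "?P \<in> _")
proof (rule bopI[where C = "real (card E)"])
  have EH: "\<And>m. m \<in> E \<Longrightarrow> m \<in> hcarrier H" and fin: "finite E" using E by (auto simp: orthonormal_def)
  have one: "hnorm H m = 1" if "m \<in> E" for m using E that by (auto simp: orthonormal_def hnorm_def)
  fix x assume x: "x \<in> hcarrier H"
  show "?P x \<in> hcarrier H" using x EH by (auto intro!: sum_closed)
  show "?P (c *\<^sub>C x) = c *\<^sub>C ?P x" for c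
    using x EH by (simp add: hinner_scale_left complex_vector.scale_sum_right scaleC_scaleC)
  show "?P (x + y) = ?P x + ?P y" if y: "y \<in> hcarrier H" for y
    using x y EH by (simp add: hinner_add_left scaleC_add_left sum.distrib)
  have "hnorm H (\<Sum>m\<in>E. hinner H x m *\<^sub>C m) \<le> (\<Sum>m\<in>E. hnorm H (hinner H x m *\<^sub>C m))"
    by (rule hnorm_sum_le) (use EH in auto)
  also have "\<dots> \<le> (\<Sum>m\<in>E. hnorm H x)"
  proof (rule sum_mono)
    fix m assume m: "m \<in> E"
    show "hnorm H (hinner H x m *\<^sub>C m) \<le> hnorm H x"
      using Cauchy_Schwarz[OF x EH[OF m]] by (simp add: hnorm_scale[OF EH[OF m]] one[OF m])
  qed
  finally show "hnorm H (?P x) \<le> real (card E) * hnorm H x" using x by simp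
qed auto

text \<open>Let \<open>P\<close> be the projection onto the span of an orthonormal basis
  \<open>M\<close> for the range of \<open>T\<close>. From \<open>P \<circ> T = T\<close> follows
  \<open>P \<circ> q = q\<close>, so the range of \<open>q\<close> is spanned by the finitely many
  \<open>q m\<close>; an orthonormal basis of this span is fixed by \<open>q\<close> and expands
  it.\<close>

lemma projection_near_finite_rank:
  assumes T: "T \<in> bop H H" "adj H H T = T" "op_bdd H H T 1" "op_bdd H H ((T \<circ> T) - T) (1/96)"
    and fr: "finite_rank H T"
  shows "\<exists>q E. q \<in> bop H H \<and> adj H H q = q \<and> q \<circ> q = q \<and> op_bdd H H (q - T) (1/16) \<and>
    (\<forall>P\<in>bop H H. P \<circ> T = T \<longrightarrow> P \<circ> q = q) \<and> orthonormal H E \<and> (\<forall>f\<in>E. q f = f) \<and>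
    (\<forall>x\<in>hcarrier H. q x = (\<Sum>f\<in>E. hinner H x f *\<^sub>C f))"
proof -
  interpret HH: hilb2 H H by (rule hilb2_self)
  obtain q where q: "q \<in> bop H H" "adj H H q = q" "q \<circ> q = q" "op_bdd H H (q - T) (1/16)"
    "\<And>P. P \<in> bop H H \<Longrightarrow> P \<circ> T = T \<Longrightarrow> P \<circ> q = q" using near_projection[OF T] by blast
  obtain M where M: "orthonormal H M" "\<And>x. x \<in> hcarrier H \<Longrightarrow> T x = (\<Sum>m\<in>M. hinner H (T x) m *\<^sub>C m)"
    using finite_rank_basis[OF T(1) fr] by blast
  have MH: "\<And>m. m \<in> M \<Longrightarrow> m \<in> hcarrier H" and fin: "finite M" using M(1) by (auto simp: orthonormal_def)
  define P where "P x = (if x \<in> hcarrier H then \<Sum>m\<in>M. hinner H x m *\<^sub>C m else 0)" for x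
  have Pb: "P \<in> bop H H" unfolding P_def by (rule span_projection_bop[OF M(1)])
  have "P \<circ> T = T"
    by (rule HH.bop_eqI[OF comp_bop_self[OF Pb T(1)] T(1)]) (simp add: P_def bop_closed[OF T(1)] M(2)[symmetric])
  then have Pq: "P \<circ> q = q" by (rule q(5)[OF Pb])
  have qq: "q (q x) = q x" for x using fun_cong[OF q(3), of x] by simp
  have qx: "q x \<in> complex_vector.span (q ` M)" if x: "x \<in> hcarrier H" for x
  proof -
    have "q x = (\<Sum>m\<in>M. hinner H (q x) m *\<^sub>C m)"
      using fun_cong[OF Pq, of x] bop_closed[OF q(1) x] by (simp add: P_def)
    then have "q (q x) = q (\<Sum>m\<in>M. hinner H (q x) m *\<^sub>C m)" by simp
    also have "\<dots> = (\<Sum>m\<in>M. hinner H (q x) m *\<^sub>C q m)"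
      using MH by (subst HH.bop_sum[OF q(1)]) (auto simp: bop_scale[OF q(1)])
    also have "\<dots> \<in> complex_vector.span (q ` M)"
      by (intro complex_vector.span_sum complex_vector.span_scale complex_vector.span_base imageI)
    finally show ?thesis by (simp only: qq)
  qed
  have qM: "finite (q ` M)" "q ` M \<subseteq> hcarrier H" using fin MH bop_closed[OF q(1)] by auto
  obtain E where E: "orthonormal H E" "E \<subseteq> complex_vector.span (q ` M)"
    "\<And>b. b \<in> q ` M \<Longrightarrow> b = (\<Sum>e\<in>E. hinner H b e *\<^sub>C e)"
    using orthonormal_basis_ex[OF qM] by blast
  have EH: "\<And>m. m \<in> E \<Longrightarrow> m \<in> hcarrier H" using E(1) by (auto simp: orthonormal_def)
  have qspan: "q z = z" if "z \<in> complex_vector.span (q ` M)" for z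
  proof -
    have "z \<in> hcarrier H \<and> q z = z"
      using that
    proof (induction rule: complex_vector.span_induct_alt)
      case base
      then show ?case using HH.bop_zero[OF q(1)] by (intro conjI zero_closed)
    next
      case (step c b y)
      then obtain m where m: "m \<in> M" "b = q m" by blast
      have b: "b \<in> hcarrier H" "q b = b" using m qq MH bop_closed[OF q(1)] by auto
      have y: "y \<in> hcarrier H" "q y = y" using step by auto
      have "q (c *\<^sub>C b + y) = c *\<^sub>C b + y"
        using b y by (simp add: bop_add[OF q(1)] bop_scale[OF q(1)])
      then show ?case using b y by (intro conjI add_closed scale_closed)
    qed
    then show ?thesis by blast
  qed
  have "q x = (\<Sum>f\<in>E. hinner H x f *\<^sub>C f)" if x: "x \<in> hcarrier H" for x
  proof -
    have "q x = (\<Sum>f\<in>E. hinner H (q x) f *\<^sub>C f)"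
      by (rule orthonormal_expand_span[OF E(1) qM(2) E(3) qx[OF x]])
    also have "\<dots> = (\<Sum>f\<in>E. hinner H x f *\<^sub>C f)"
    proof (intro sum.cong refl)
      fix f assume f: "f \<in> E"
      have "hinner H (q x) f = hinner H x f"
        using HH.adj_inner[OF q(1) x EH[OF f]] q(2) qspan E(2) f by auto
      then show "hinner H (q x) f *\<^sub>C f = hinner H x f *\<^sub>C f" by simp
    qed
    finally show ?thesis .
  qed
  then show ?thesis using q E(1,2) qspan by (intro exI[of _ q] exI[of _ E] conjI ballI impI) blast+
qed

end

section \<open>The finite rank projection below \<open>e\<close> and the numerical
  contradiction\<close>

section \<open>Quasidiagonality and the norm estimate\<close>

text \<open>Transposing a Hermitian kernel conjugates it; this is wanted for the complex conjugates
  of corners that serve as scalar matrices.\<close>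

lemma psd_transpose: "psd X k \<Longrightarrow> psd X (\<lambda>x y. k y x)"
proof (rule psdI)
  assume k: "psd X k"
  show "k x y = cnj (k y x)" if "x \<in> X" "y \<in> X" for x y by (rule psd_commute[OF k that(2,1)])
  fix I and c :: "'a \<Rightarrow> complex" assume I: "finite I" "I \<subseteq> X"
  have "(\<Sum>x\<in>I. \<Sum>y\<in>I. c x * cnj (c y) * k y x) = (\<Sum>y\<in>I. \<Sum>x\<in>I. c x * cnj (c y) * k y x)"
    by (rule sum.swap)
  also have "\<dots> = (\<Sum>y\<in>I. \<Sum>x\<in>I. cnj (c y) * cnj (cnj (c x)) * k y x)"
    by (simp add: mult.commute)
  finally show "(\<Sum>x\<in>I. \<Sum>y\<in>I. c x * cnj (c y) * k y x) \<in> \<real>\<^sub>\<ge>\<^sub>0"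
    using psd_nonneg[OF k I, of "\<lambda>x. cnj (c x)"] by simp
qed

lemma (in hilb) isometry_op_bdd:
  assumes U: "U \<in> bop H H" "adj H H U \<circ> U = idop H"
  shows "op_bdd H H U 1"
proof (rule op_bddI)
  interpret HH: hilb2 H H by (rule hilb2_self)
  fix x assume x: "x \<in> hcarrier H"
  note Ux = bop_closed[OF U(1) x]
  have "hinner H (U x) (U x) = hinner H x x"
    using HH.adj_inner[OF U(1) x Ux] fun_cong[OF U(2), of x] x by simp
  then show "hnorm H (U x) \<le> 1 * hnorm H x" by (simp add: hnorm_def)
qed simp

context cstar_rep
begin

text \<open>Compression by \<open>e\<close> puts the range below \<open>e\<close>, at the price of
  idempotence. The defect is small because \<open>T\<^sup>2 - T = e p C e\<close> with the
  commutator \<open>C = e p - p e\<close>.\<close>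

lemma compressed_projection:
  assumes p: "projection K p" "finite_rank K p"
    and comm: "op_bdd K K ((e \<circ> p) - (p \<circ> e)) (1/96)"
  defines "T \<equiv> e \<circ> (p \<circ> e)"
  shows "T \<in> bop K K" "adj K K T = T" "op_bdd K K T 1" "op_bdd K K ((T \<circ> T) - T) (1/96)" "finite_rank K T"
proof -
  have pb: "p \<in> bop K K" "p \<circ> p = p" "adj K K p = p" using p(1) by (auto simp: projection_def)
  have pe: "p \<circ> e \<in> bop K K" by (rule K.comp_bop_self[OF pb(1) e_bop])
  show Tb: "T \<in> bop K K" unfolding T_def by (rule K.comp_bop_self[OF e_bop pe])
  show "adj K K T = T"
    unfolding T_def adj_comp[OF K.hilb_axioms K.hilb_axioms K.hilb_axioms pe e_bop]
      adj_comp[OF K.hilb_axioms K.hilb_axioms K.hilb_axioms e_bop pb(1)] e_adj pb(3) by (simp only: comp_assoc)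
  have e1: "op_bdd K K e 1"
    by (rule op_bddI) (simp_all add: K.projection_norms(1)[OF e_bop e_adj e_idem])
  have p1: "op_bdd K K p 1"
    by (rule op_bddI) (simp_all add: K.projection_norms(1)[OF pb(1,3,2)])
  show "op_bdd K K T 1"
    using comp_op_bdd[OF comp_op_bdd[OF e1 p1 e_bop] e1 pe] by (simp add: T_def)
  have ee: "e (e x) = e x" and pp: "p (p x) = p x" for x
    using fun_cong[OF e_idem, of x] fun_cong[OF pb(2), of x] by simp_all
  define C where "C = (e \<circ> p) - (p \<circ> e)"
  have Cb: "C \<in> bop K K" unfolding C_def by (intro KK.diff_bop K.comp_bop_self e_bop pb(1))
  have "(T \<circ> T) - T = e \<circ> (p \<circ> (C \<circ> e))"
  proof (rule KK.bop_eqI)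
    show "(T \<circ> T) - T \<in> bop K K" by (intro KK.diff_bop K.comp_bop_self Tb)
    show "e \<circ> (p \<circ> (C \<circ> e)) \<in> bop K K" by (intro K.comp_bop_self e_bop pb(1) Cb)
    fix x assume x: "x \<in> hcarrier K"
    have c: "e x \<in> hcarrier K" "p (e x) \<in> hcarrier K" "e (p (e x)) \<in> hcarrier K" "p (e (p (e x))) \<in> hcarrier K"
      using bop_closed[OF e_bop] bop_closed[OF pb(1)] x by auto
    show "((T \<circ> T) - T) x = (e \<circ> (p \<circ> (C \<circ> e))) x"
      using c by (simp add: T_def C_def fun_diff_apply ee pp KK.bop_diff[OF pb(1)] KK.bop_diff[OF e_bop])
  qed
  moreover have "op_bdd K K (e \<circ> (p \<circ> (C \<circ> e))) (1 * (1 * (1/96 * 1)))"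
    by (intro comp_op_bdd[OF _ e1] comp_op_bdd[OF _ p1] comp_op_bdd[OF e1 comm[folded C_def] e_bop]
        K.comp_bop_self pb(1) Cb e_bop)
  ultimately show "op_bdd K K ((T \<circ> T) - T) (1/96)" by (simp only: mult_1 mult_1_right)
  show "finite_rank K T"
  proof -
    obtain E where E: "orthonormal K E" "\<And>x. x \<in> hcarrier K \<Longrightarrow> p x = (\<Sum>m\<in>E. hinner K (p x) m *\<^sub>C m)"
      using K.finite_rank_basis[OF pb(1) p(2)] by blast
    have EK: "\<And>m. m \<in> E \<Longrightarrow> m \<in> hcarrier K" and fin: "finite E" using E(1) by (auto simp: orthonormal_def)
    have "T x \<in> complex_vector.span (e ` E)" if x: "x \<in> hcarrier K" for x
    proof -
      have "p (e x) = (\<Sum>m\<in>E. hinner K (p (e x)) m *\<^sub>C m)" by (rule E(2)[OF bop_closed[OF e_bop x]])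
      then have "T x = e (\<Sum>m\<in>E. hinner K (p (e x)) m *\<^sub>C m)" by (simp add: T_def)
      also have "\<dots> = (\<Sum>m\<in>E. hinner K (p (e x)) m *\<^sub>C e m)"
        using EK by (subst KK.bop_sum[OF e_bop]) (auto simp: bop_scale[OF e_bop])
      also have "\<dots> \<in> complex_vector.span (e ` E)"
        by (intro complex_vector.span_sum complex_vector.span_scale complex_vector.span_base imageI)
      finally show ?thesis .
    qed
    then show ?thesis unfolding finite_rank_def using fin by (intro exI[of _ "e ` E"]) auto
  qed
qed

text \<open>The tuple \<open>(f b)\<close> in \<open>k\<close> copies of \<open>K\<close> plays the
  role of \<open>\<Sum> f\<^sub>b \<otimes> f\<^sub>b\<close>, with squared norm \<open>k\<close>.
  Its pairing with its image \<open>g\<close> is at most 4 * 10 * k = 40 k by the norm estimate, and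
  at least 100 * 9/16 * k = 56.25 k by almost invariance.\<close>

lemma almost_invariant_contradiction:
  fixes k :: nat and D U :: "nat \<Rightarrow> 'h \<Rightarrow> 'h"
  assumes q: "q \<in> bop K K" "adj K K q = q" "q \<circ> q = q"
    and f: "\<And>b. b < k \<Longrightarrow> f b \<in> hcarrier K"
      "\<And>a b. a < k \<Longrightarrow> b < k \<Longrightarrow> hinner K (f a) (f b) = (if a = b then 1 else 0)"
      "\<And>x. x \<in> hcarrier K \<Longrightarrow> q x = (\<Sum>a<k. hinner K x (f a) *\<^sub>C f a)"
    and ef: "\<And>b. b < k \<Longrightarrow> e (f b) = f b"
    and k: "k > 0"
    and D: "\<And>j. j < 100 \<Longrightarrow> D j \<in> bop H H" "\<And>j. j < 100 \<Longrightarrow> adj H H (D j) = D j"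
      "\<And>j. j < 100 \<Longrightarrow> D j \<circ> D j = D j"
    and orth: "\<And>i j. i < 100 \<Longrightarrow> j < 100 \<Longrightarrow> i \<noteq> j \<Longrightarrow> D i \<circ> D j = 0"
    and U: "\<And>j. j < 100 \<Longrightarrow> U j \<in> A" "\<And>j. j < 100 \<Longrightarrow> adj H H (U j) \<circ> U j = idop H"
    and UD: "\<And>j x. j < 100 \<Longrightarrow> x \<in> hcarrier H \<Longrightarrow> D j x = 0 \<Longrightarrow> D j (U j x) = U j x"
    and near: "\<And>j b. j < 100 \<Longrightarrow> b < k \<Longrightarrow> hnorm K (\<pi> (U j) (f b) - q (\<pi> (U j) (f b))) \<le> 1/4"
  shows False
proof -
  interpret P: hilb "hpow k H" by (rule H.hpow_hilb)
  interpret PP: hilb2 "hpow k H" "hpow k H" ..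
  have Ub: "U j \<in> bop H H" if "j < 100" for j by (rule AD(1)[OF U(1)[OF that]])
  have U1: "op_bdd H H (U j) 1" if "j < 100" for j by (rule H.isometry_op_bdd[OF Ub[OF that] U(2)[OF that]])
  have \<pi>Ub: "\<pi> (U j) \<in> bop K K" if "j < 100" for j by (rule \<pi>D(1)[OF U(1)[OF that]])
  have \<pi>UU: "adj K K (\<pi> (U j)) \<circ> \<pi> (U j) = e" if j: "j < 100" for j
    unfolding \<pi>D(5)[OF U(1)[OF j], symmetric] \<pi>D(4)[OF AD(4)[OF U(1)[OF j]] U(1)[OF j], symmetric] U(2)[OF j] e_def ..
  have \<pi>U_inner: "hinner K (\<pi> (U j) x) (\<pi> (U j) y) = hinner K x (e y)" if j: "j < 100" and xy: "x \<in> hcarrier K" "y \<in> hcarrier K" for j x y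
    using KK.adj_inner[OF \<pi>Ub[OF j] xy(1) bop_closed[OF \<pi>Ub[OF j] xy(2)]] fun_cong[OF \<pi>UU[OF j], of y] by simp
  have \<pi>U1: "op_bdd K K (\<pi> (U j)) 1" if j: "j < 100" for j
  proof (rule op_bddI)
    fix x assume x: "x \<in> hcarrier K"
    have "Re (hinner K x (e x)) = Re (hinner K (e x) x)"
      using K.hinner_commute[OF bop_closed[OF e_bop x] x] by simp
    then have "(hnorm K (\<pi> (U j) x))\<^sup>2 \<le> (hnorm K x)\<^sup>2"
      using e_hinner[OF x] K.Re_hinner_self[OF bop_closed[OF \<pi>Ub[OF j] x]] \<pi>U_inner[OF j x x] by simp
    then have "hnorm K (\<pi> (U j) x) \<le> hnorm K x" by (rule power2_le_imp_le) (rule K.hnorm_nonneg[OF x])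
    then show "hnorm K (\<pi> (U j) x) \<le> 1 * hnorm K x" by simp
  qed simp
  have nf: "hnorm K (f b) = 1" if "b < k" for b using f(2)[OF that that] by (simp add: hnorm_def)
  have n\<pi>f: "hnorm K (\<pi> (U j) (f b)) = 1" if "j < 100" "b < k" for j b
    unfolding hnorm_def \<pi>U_inner[OF that(1) f(1)[OF that(2)] f(1)[OF that(2)]] ef[OF that(2)] f(2)[OF that(2) that(2)]
    by simp
  \<comment> \<open>The conjugate turns the pairing of \<open>g\<close> with \<open>f\<close> into a
    sum of squares of absolute values, so that nothing can cancel.\<close>
  define c where "c j a b = cnj (hinner K (\<pi> (U j) (f b)) (f a))" for j a b
  define y where "y j b = q (\<pi> (U j) (f b))" for j b
  have \<pi>fc: "\<pi> (U j) (f b) \<in> hcarrier K" if "j < 100" "b < k" for j b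
    by (rule bop_closed[OF \<pi>Ub[OF that(1)] f(1)[OF that(2)]])
  have yc: "y j b \<in> hcarrier K" if "j < 100" "b < k" for j b
    unfolding y_def by (rule bop_closed[OF q(1) \<pi>fc[OF that]])
  have y_inner: "hinner K (y j b) (y j b') = (\<Sum>a<k. cnj (c j a b) * c j a b')" if "j < 100" "b < k" "b' < k" for j b b'
  proof -
    have "hinner K (y j b) (y j b') = hinner K (q (\<pi> (U j) (f b))) (\<pi> (U j) (f b'))"
      using KK.adj_inner[OF q(1) yc[OF that(1,2)] \<pi>fc[OF that(1,3)]] q(2) fun_cong[OF q(3), of "\<pi> (U j) (f b)"]
      by (simp add: y_def)
    also have "\<dots> = (\<Sum>a<k. hinner K (hinner K (\<pi> (U j) (f b)) (f a) *\<^sub>C f a) (\<pi> (U j) (f b')))"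
      unfolding f(3)[OF \<pi>fc[OF that(1,2)]] by (rule K.hinner_sum_left) (use f(1) \<pi>fc that in auto)
    also have "\<dots> = (\<Sum>a<k. cnj (c j a b) * c j a b')"
    proof (intro sum.cong refl)
      fix a assume "a \<in> {..<k}"
      then have a: "a < k" by simp
      show "hinner K (hinner K (\<pi> (U j) (f b)) (f a) *\<^sub>C f a) (\<pi> (U j) (f b')) = cnj (c j a b) * c j a b'"
        unfolding K.hinner_scale_left[OF f(1)[OF a] \<pi>fc[OF that(1,3)]] K.hinner_commute[OF \<pi>fc[OF that(1,3)] f(1)[OF a]]
        by (simp add: c_def)
    qed
    finally show ?thesis .
  qed
  have q1: "op_bdd K K q 1" by (rule op_bddI) (simp_all add: K.projection_norms(1)[OF q])
  have psd_c: "psd {..<k} (\<lambda>b b'. (if b = b' then 1 else 0) - (\<Sum>a<k. c j a b * cnj (c j a b')))" if j: "j < 100" for j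
  proof -
    have S: "q \<circ> \<pi> (U j) \<in> bop K K" by (rule K.comp_bop_self[OF q(1) \<pi>Ub[OF j]])
    have S1: "op_bdd K K (q \<circ> \<pi> (U j)) 1" using comp_op_bdd[OF \<pi>U1[OF j] q1 \<pi>Ub[OF j]] by simp
    have "psd {..<k} (\<lambda>b b'. complex_of_real (1\<^sup>2) * hinner K (f b) (f b') - hinner K ((q \<circ> \<pi> (U j)) (f b)) ((q \<circ> \<pi> (U j)) (f b')))"
      by (rule KK.op_psd[OF S S1]) (simp add: f(1))
    \<comment> \<open>The entries of \<open>c j\<close> are conjugates of those of the corner, so
      the kernel of \<open>1 - c\<^sup>* c\<close> is the transpose of the one just
      obtained.\<close>
    then have "psd {..<k} (\<lambda>b b'. complex_of_real (1\<^sup>2) * hinner K (f b') (f b) - hinner K ((q \<circ> \<pi> (U j)) (f b')) ((q \<circ> \<pi> (U j)) (f b)))"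
      by (rule psd_transpose)
    then show ?thesis
    proof (rule psd_cong[rotated])
      fix b b' assume "b \<in> {..<k}" "b' \<in> {..<k}"
      then have b: "b < k" "b' < k" by auto
      show "complex_of_real (1\<^sup>2) * hinner K (f b') (f b) - hinner K ((q \<circ> \<pi> (U j)) (f b')) ((q \<circ> \<pi> (U j)) (f b)) =
        (if b = b' then 1 else 0) - (\<Sum>a<k. c j a b * cnj (c j a b'))"
        using y_inner[OF j b(2,1)] f(2)[OF b(2,1)] by (auto simp: y_def mult.commute)
    qed
  qed
  \<comment> \<open>The operator \<open>\<Sum> U\<^sub>j \<otimes> c\<^sub>j\<close> on
    \<open>k\<close> copies of \<open>H\<close>. The values 0 beyond coordinate \<open>k\<close> and
    off the carrier are required by \<open>hpow\<close> and \<open>bop\<close>.\<close>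
  define X where "X x = (if x \<in> hcarrier (hpow k H) then
      (\<lambda>a. if a < k then \<Sum>j<100::nat. U j (\<Sum>b<k. c j a b *\<^sub>C x b) else 0) else 0)" for x
  have zc: "(\<Sum>b<k. c j a b *\<^sub>C x b) \<in> hcarrier H" if "x \<in> hcarrier (hpow k H)" for x j a
    by (rule H.sum_closed) (use hpow_carrierD[OF that] in auto)
  have Xc: "X x \<in> hcarrier (hpow k H)" if x: "x \<in> hcarrier (hpow k H)" for x
    using x by (auto simp: X_def hpow_carrier[of "\<lambda>a. _ a"] intro!: H.sum_closed bop_closed[OF Ub] zc[OF x])
  have Xbd: "op_bdd (hpow k H) (hpow k H) X 20"
  proof (rule op_bddI)
    fix x assume x: "x \<in> hcarrier (hpow k H)"
    have "(hnorm (hpow k H) (X x))\<^sup>2 = (\<Sum>a<k. (hnorm H (\<Sum>j<100::nat. U j (\<Sum>b<k. c j a b *\<^sub>C x b)))\<^sup>2)"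
      unfolding H.hpow_hnorm[OF Xc[OF x]] using x by (intro sum.cong refl) (simp add: X_def)
    then have "hnorm (hpow k H) (X x) = sqrt (\<Sum>a<k. (hnorm H (\<Sum>j<100::nat. U j (\<Sum>b<k. c j a b *\<^sub>C x b)))\<^sup>2)"
      using P.hnorm_nonneg[OF Xc[OF x]] by (simp add: real_sqrt_unique)
    also have "\<dots> \<le> 2 * sqrt (real 100) * hnorm (hpow k H) x"
      by (rule H.Powers_bound[OF D orth Ub U1 UD psd_c x])
    also have "sqrt (real 100) = 10" by (rule real_sqrt_unique) auto
    finally show "hnorm (hpow k H) (X x) \<le> 20 * hnorm (hpow k H) x" by simp
  qed simp
  have Xb: "X \<in> bop (hpow k H) (hpow k H)"
  proof (rule bop_op_bddI[OF Xbd Xc])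
    fix x assume x: "x \<in> hcarrier (hpow k H)"
    have xb: "x b \<in> hcarrier H" if "b < k" for b by (rule hpow_carrierD[OF x that])
    show "X (s *\<^sub>C x) = s *\<^sub>C X x" for s
    proof (rule ext)
      fix a
      have "(\<Sum>b<k. c j a b *\<^sub>C (s *\<^sub>C x) b) = s *\<^sub>C (\<Sum>b<k. c j a b *\<^sub>C x b)" for j
        by (simp add: scaleC_fun_apply complex_vector.scale_sum_right scaleC_scaleC mult.commute)
      then have "U j (\<Sum>b<k. c j a b *\<^sub>C (s *\<^sub>C x) b) = s *\<^sub>C U j (\<Sum>b<k. c j a b *\<^sub>C x b)" if "j < 100" for j
        using bop_scale[OF Ub[OF that] zc[OF x]] by simp
      then show "X (s *\<^sub>C x) a = (s *\<^sub>C X x) a"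
        using x by (simp add: X_def scaleC_fun_apply complex_vector.scale_sum_right)
    qed
    fix x' assume x': "x' \<in> hcarrier (hpow k H)"
    show "X (x + x') = X x + X x'"
    proof (rule ext)
      fix a
      have "(\<Sum>b<k. c j a b *\<^sub>C (x + x') b) = (\<Sum>b<k. c j a b *\<^sub>C x b) + (\<Sum>b<k. c j a b *\<^sub>C x' b)" for j
        by (simp add: scaleC_add_right sum.distrib)
      then have "U j (\<Sum>b<k. c j a b *\<^sub>C (x + x') b) = U j (\<Sum>b<k. c j a b *\<^sub>C x b) + U j (\<Sum>b<k. c j a b *\<^sub>C x' b)" if "j < 100" for j
        using bop_add[OF Ub[OF that] zc[OF x] zc[OF x']] by simp
      then show "X (x + x') a = (X x + X x') a"
        using x x' by (simp add: X_def sum.distrib)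
    qed
  qed (assumption, unfold X_def, rule if_not_P)
  have cUA: "c j a b *\<^sub>C U j \<in> A" if "j < 100" for j a b
    by (rule complex_vector.subspace_scale[OF AD(2) U(1)[OF that]])
  have ent: "entry H X a b = (\<Sum>j<100::nat. c j a b *\<^sub>C U j)" if ab: "a < k" "b < k" for a b
  proof (rule ext)
    fix x
    show "entry H X a b x = (\<Sum>j<100::nat. c j a b *\<^sub>C U j) x"
    proof (cases "x \<in> hcarrier H")
      case True
      have "(\<Sum>b'<k. c j a b' *\<^sub>C single b x b') = (\<Sum>b'<k. if b' = b then c j a b *\<^sub>C x else 0)" for j
        by (intro sum.cong refl) (simp add: single_def)
      then have "(\<Sum>b'<k. c j a b' *\<^sub>C single b x b') = c j a b *\<^sub>C x" for j using ab by simp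
      then have "entry H X a b x = (\<Sum>j<100::nat. U j (c j a b *\<^sub>C x))"
        using True ab H.single_closed[OF ab(2) True] by (simp add: entry_def X_def)
      then show ?thesis using bop_scale[OF Ub True] by (simp add: sum_fun_apply scaleC_fun_apply)
    next
      case False
      then show ?thesis using bop_off[OF Ub False] by (simp add: entry_def sum_fun_apply scaleC_fun_apply)
    qed
  qed
  have XM: "X \<in> H.matrices k A"
    using Xb ent complex_vector.subspace_sum[OF AD(2), of "{..<100::nat}"] cUA by (simp add: H.matrices_def)
  define g where "g a = (\<Sum>b<k. \<pi> (entry H X a b) (f b))" for a
  have g_eq: "g a = (\<Sum>b<k. \<Sum>j<100::nat. c j a b *\<^sub>C \<pi> (U j) (f b))" if a: "a < k" for a
    unfolding g_def
  proof (intro sum.cong refl)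
    fix b assume "b \<in> {..<k}"
    then have b: "b < k" by simp
    have "\<pi> (\<Sum>j<100::nat. c j a b *\<^sub>C U j) = (\<Sum>j<100::nat. \<pi> (c j a b *\<^sub>C U j))"
      by (rule rep_sum) (simp add: cUA)
    also have "\<dots> = (\<Sum>j<100::nat. c j a b *\<^sub>C \<pi> (U j))"
      by (intro sum.cong refl \<pi>D(3) U(1)) simp
    finally show "\<pi> (entry H X a b) (f b) = (\<Sum>j<100::nat. c j a b *\<^sub>C \<pi> (U j) (f b))"
      unfolding ent[OF a b] by (simp add: sum_fun_apply scaleC_fun_apply)
  qed
  have gc: "g a \<in> hcarrier K" if a: "a < k" for a
    unfolding g_eq[OF a] by (intro K.sum_closed K.scale_closed \<pi>fc) auto
  have "(\<Sum>a<k. (hnorm K (g a))\<^sup>2) \<le> 4 * 20\<^sup>2 * (\<Sum>a<k. (hnorm K (f a))\<^sup>2)"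
    unfolding g_def by (rule matrix_contraction[OF XM Xbd _ f(1)]) simp_all
  also have "\<dots> = 1600 * real k" using nf by simp
  finally have gb: "(\<Sum>a<k. (hnorm K (g a))\<^sup>2) \<le> 1600 * real k" .
  \<comment> \<open>Cauchy-Schwarz over the \<open>k\<close> coordinates turns the bound on squares
    into one on the plain sum of norms, which dominates the pairing because the \<open>f a\<close>
    are unit vectors.\<close>
  have "(\<Sum>a<k. hnorm K (g a))\<^sup>2 \<le> (\<Sum>a<k. (hnorm K (g a))\<^sup>2) * real k"
    using sum_squared_le_sum_of_squares[of "\<lambda>a. hnorm K (g a)" "{..<k}"] by simp
  also have "\<dots> \<le> (1600 * real k) * real k" by (rule mult_right_mono[OF gb]) simp
  also have "\<dots> = (40 * real k)\<^sup>2" by (simp add: power2_eq_square)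
  finally have gsum: "(\<Sum>a<k. hnorm K (g a)) \<le> 40 * real k"
    by (rule power2_le_imp_le) simp
  have "cmod (\<Sum>a<k. hinner K (g a) (f a)) \<le> (\<Sum>a<k. cmod (hinner K (g a) (f a)))" by (rule norm_sum)
  also have "\<dots> \<le> (\<Sum>a<k. hnorm K (g a))"
    by (rule sum_mono) (use K.Cauchy_Schwarz[OF gc f(1)] nf in fastforce)
  finally have upper: "cmod (\<Sum>a<k. hinner K (g a) (f a)) \<le> 40 * real k" using gsum by linarith
  \<comment> \<open>The pairing is the sum of all squared absolute values of the
    \<open>c j a b\<close>. For fixed \<open>j\<close> and \<open>b\<close> they add up to the
    squared norm of \<open>y j b\<close>, by Parseval in the range of \<open>q\<close>.\<close>
  have "(\<Sum>a<k. hinner K (g a) (f a)) = (\<Sum>a<k. \<Sum>b<k. \<Sum>j<100::nat. cnj (c j a b) * c j a b)"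
  proof (intro sum.cong refl)
    fix a assume "a \<in> {..<k}"
    then have a: "a < k" by simp
    have "hinner K (g a) (f a) = (\<Sum>b<k. hinner K (\<Sum>j<100::nat. c j a b *\<^sub>C \<pi> (U j) (f b)) (f a))"
      unfolding g_eq[OF a] by (rule K.hinner_sum_left[OF _ f(1)[OF a]]) (intro K.sum_closed K.scale_closed \<pi>fc; simp)
    also have "\<dots> = (\<Sum>b<k. \<Sum>j<100::nat. cnj (c j a b) * c j a b)"
    proof (intro sum.cong refl)
      fix b assume "b \<in> {..<k}"
      then have b: "b < k" by simp
      have "hinner K (\<Sum>j<100::nat. c j a b *\<^sub>C \<pi> (U j) (f b)) (f a) = (\<Sum>j<100::nat. hinner K (c j a b *\<^sub>C \<pi> (U j) (f b)) (f a))"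
        by (rule K.hinner_sum_left[OF _ f(1)[OF a]]) (intro K.scale_closed \<pi>fc; use b in simp)
      also have "\<dots> = (\<Sum>j<100::nat. cnj (c j a b) * c j a b)"
        using K.hinner_scale_left[OF \<pi>fc[OF _ b] f(1)[OF a]] by (intro sum.cong refl) (simp add: c_def mult.commute)
      finally show "hinner K (\<Sum>j<100::nat. c j a b *\<^sub>C \<pi> (U j) (f b)) (f a) = (\<Sum>j<100::nat. cnj (c j a b) * c j a b)" .
    qed
    finally show "hinner K (g a) (f a) = (\<Sum>b<k. \<Sum>j<100::nat. cnj (c j a b) * c j a b)" .
  qed
  also have "\<dots> = (\<Sum>b<k. \<Sum>a<k. \<Sum>j<100::nat. cnj (c j a b) * c j a b)" by (rule sum.swap)
  also have "\<dots> = (\<Sum>b<k. \<Sum>j<100::nat. \<Sum>a<k. cnj (c j a b) * c j a b)"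
    by (rule sum.cong[OF refl]) (rule sum.swap)
  also have "\<dots> = (\<Sum>b<k. \<Sum>j<100::nat. complex_of_real ((hnorm K (y j b))\<^sup>2))"
  proof (intro sum.cong refl)
    fix b j assume "b \<in> {..<k}" "j \<in> {..<100::nat}"
    then have bj: "b < k" "j < 100" by auto
    show "(\<Sum>a<k. cnj (c j a b) * c j a b) = complex_of_real ((hnorm K (y j b))\<^sup>2)"
      unfolding y_inner[OF bj(2,1,1), symmetric] by (rule K.hinner_self[OF yc[OF bj(2,1)]])
  qed
  finally have eq: "(\<Sum>a<k. hinner K (g a) (f a)) = complex_of_real (\<Sum>b<k. \<Sum>j<100::nat. (hnorm K (y j b))\<^sup>2)"
    by (simp only: of_real_sum)
  \<comment> \<open>The unit vector \<open>\<pi> (U j) (f b)\<close> is within 1/4 of its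
    projection, which therefore has norm at least 3/4.\<close>
  have ny: "9/16 \<le> (hnorm K (y j b))\<^sup>2" if "j < 100" "b < k" for j b
  proof -
    have "hnorm K (\<pi> (U j) (f b)) \<le> hnorm K (\<pi> (U j) (f b) - y j b) + hnorm K (y j b)"
      using K.hnorm_triangle[OF K.diff_closed[OF \<pi>fc[OF that] yc[OF that]] yc[OF that]] by simp
    then have "3/4 \<le> hnorm K (y j b)" using near[OF that] n\<pi>f[OF that] by (simp add: y_def)
    then have "(3/4)\<^sup>2 \<le> (hnorm K (y j b))\<^sup>2" by (rule power_mono) simp
    then show ?thesis by (simp add: power2_eq_square)
  qed
  have "(\<Sum>b<k. \<Sum>j<100::nat. 9/16) \<le> (\<Sum>b<k. \<Sum>j<100::nat. (hnorm K (y j b))\<^sup>2)"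
    by (intro sum_mono ny) auto
  also have "\<dots> \<le> cmod (\<Sum>a<k. hinner K (g a) (f a))" unfolding eq norm_of_real by simp
  finally have "real k * (100 * (9/16)) \<le> 40 * real k" using upper by simp
  then show False using k by simp
qed

text \<open>The quasidiagonalising sequence is used at a single index \<open>n\<close>, so late that
  the 100 commutators with the \<open>\<pi> (U j)\<close> and the one with \<open>e\<close> are
  small, and that \<open>p n\<close> nearly fixes one vector \<open>x1\<close>.\<close>

lemma quasidiagonal_contradiction:
  fixes D U :: "nat \<Rightarrow> 'h \<Rightarrow> 'h"
  assumes inj: "inj_on \<pi> A" and nz: "idop H \<noteq> 0"
    and p: "\<And>n. projection K (p n)" "\<And>n. finite_rank K (p n)"
    and conv: "\<And>x. x \<in> hcarrier K \<Longrightarrow> htendsto K (\<lambda>n. p n x) x"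
    and comm: "\<And>S. S \<in> A \<Longrightarrow> (\<lambda>n. opnorm K K ((\<pi> S \<circ> p n) - (p n \<circ> \<pi> S))) \<longlonglongrightarrow> 0"
    and D: "\<And>j. j < 100 \<Longrightarrow> D j \<in> bop H H" "\<And>j. j < 100 \<Longrightarrow> adj H H (D j) = D j"
      "\<And>j. j < 100 \<Longrightarrow> D j \<circ> D j = D j"
    and orth: "\<And>i j. i < 100 \<Longrightarrow> j < 100 \<Longrightarrow> i \<noteq> j \<Longrightarrow> D i \<circ> D j = 0"
    and U: "\<And>j. j < 100 \<Longrightarrow> U j \<in> A" "\<And>j. j < 100 \<Longrightarrow> adj H H (U j) \<circ> U j = idop H"
    and UD: "\<And>j x. j < 100 \<Longrightarrow> x \<in> hcarrier H \<Longrightarrow> D j x = 0 \<Longrightarrow> D j (U j x) = U j x"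
  shows False
proof -
  have pb: "p n \<in> bop K K" for n using p(1)[of n] by (simp add: projection_def)
  have "e \<noteq> 0"
  proof
    assume "e = 0"
    then have "\<pi> (idop H) = \<pi> 0" unfolding e_def by (simp only: rep_zero)
    then have "idop H = 0" using inj_onD[OF inj] A(2) complex_vector.subspace_0[OF AD(2)] by blast
    then show False using nz by blast
  qed
  then obtain x0 where x0: "x0 \<in> hcarrier K" "e x0 \<noteq> 0"
    using KK.bop_eqI[OF e_bop KK.zero_bop] by auto
  \<comment> \<open>A unit vector in the range of \<open>e\<close>, which is nonzero by
    faithfulness. Its purpose is to rule out that the projection found near \<open>e p e\<close> is
    0.\<close>
  define x1 where "x1 = complex_of_real (1 / hnorm K (e x0)) *\<^sub>C e x0"
  have ex0: "e x0 \<in> hcarrier K" by (rule bop_closed[OF e_bop x0(1)])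
  have nx0: "hnorm K (e x0) > 0" using K.hnorm_eq_0_iff[OF ex0] x0(2) K.hnorm_nonneg[OF ex0] by (simp add: less_le)
  have x1: "x1 \<in> hcarrier K" "hnorm K x1 = 1" "e x1 = x1"
    using ex0 nx0 fun_cong[OF e_idem, of x0]
    by (auto simp: x1_def K.hnorm_scale norm_divide bop_scale[OF e_bop ex0])
  have ev1: "\<forall>\<^sub>F n in sequentially. opnorm K K ((\<pi> S \<circ> p n) - (p n \<circ> \<pi> S)) < 1/96" if "S \<in> A" for S
    by (rule order_tendstoD(2)[OF comm[OF that]]) simp
  have ev2: "\<forall>\<^sub>F n in sequentially. \<forall>j\<in>{..<100::nat}. opnorm K K ((\<pi> (U j) \<circ> p n) - (p n \<circ> \<pi> (U j))) < 1/96"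
    by (rule eventually_ball_finite) (use ev1 U(1) in auto)
  have ev3: "\<forall>\<^sub>F n in sequentially. hnorm K (p n x1 - x1) < 1/4"
    by (rule order_tendstoD(2)[OF conv[OF x1(1), unfolded htendsto_def]]) simp
  have "\<forall>\<^sub>F n in sequentially. (\<forall>j\<in>{..<100::nat}. opnorm K K ((\<pi> (U j) \<circ> p n) - (p n \<circ> \<pi> (U j))) < 1/96) \<and>
      hnorm K (p n x1 - x1) < 1/4 \<and> opnorm K K ((e \<circ> p n) - (p n \<circ> e)) < 1/96"
    unfolding e_def by (intro eventually_conj ev2 ev3 ev1[OF A(2)])
  then obtain n where n: "\<And>j. j < 100 \<Longrightarrow> opnorm K K ((\<pi> (U j) \<circ> p n) - (p n \<circ> \<pi> (U j))) < 1/96"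
    "hnorm K (p n x1 - x1) < 1/4" "opnorm K K ((e \<circ> p n) - (p n \<circ> e)) < 1/96"
    unfolding eventually_sequentially by blast
  have small: "op_bdd K K ((S \<circ> p n) - (p n \<circ> S)) (1/96)" if "S \<in> bop K K" "opnorm K K ((S \<circ> p n) - (p n \<circ> S)) < 1/96" for S
  proof (rule KK.op_bdd_mono[OF KK.opnorm_bdd])
    show "(S \<circ> p n) - (p n \<circ> S) \<in> bop K K" by (intro KK.diff_bop K.comp_bop_self that pb)
  qed (use that in simp)
  define T where "T = e \<circ> (p n \<circ> e)"
  note Tp = compressed_projection[OF p small[OF e_bop n(3)], folded T_def]
  obtain q E where q: "q \<in> bop K K" "adj K K q = q" "q \<circ> q = q" "op_bdd K K (q - T) (1/16)"
      "\<And>P. P \<in> bop K K \<Longrightarrow> P \<circ> T = T \<Longrightarrow> P \<circ> q = q"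
    and E: "orthonormal K E" "\<And>f. f \<in> E \<Longrightarrow> q f = f" "\<And>x. x \<in> hcarrier K \<Longrightarrow> q x = (\<Sum>f\<in>E. hinner K x f *\<^sub>C f)"
    using K.projection_near_finite_rank[OF Tp] by blast
  have EK: "\<And>m. m \<in> E \<Longrightarrow> m \<in> hcarrier K" and fin: "finite E" using E(1) by (auto simp: orthonormal_def)
  have ee: "e (e x) = e x" for x using fun_cong[OF e_idem, of x] by simp
  have "e \<circ> T = T" unfolding T_def comp_assoc[symmetric] e_idem ..
  then have eq: "e \<circ> q = q" by (rule q(5)[OF e_bop])
  have ef: "e f = f" if "f \<in> E" for f using fun_cong[OF eq, of f] E(2)[OF that] by simp
  \<comment> \<open>If \<open>q\<close> were 0, then \<open>T x1\<close> would have norm at most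
    1/16 and yet lie within 1/4 of the unit vector \<open>x1\<close>.\<close>
  have Ene: "E \<noteq> {}"
  proof
    assume "E = {}"
    then have q0: "q x1 = 0" using E(3)[OF x1(1)] by simp
    have Tx1: "T x1 = e (p n x1)" using x1(3) by (simp add: T_def)
    note c = bop_closed[OF pb x1(1), of n] bop_closed[OF Tp(1) x1(1)]
    have "e (p n x1 - x1) = T x1 - x1"
      using KK.bop_diff[OF e_bop c(1) x1(1)] Tx1 x1(3) by simp
    then have "hnorm K (T x1 - x1) \<le> hnorm K (p n x1 - x1)"
      using K.projection_norms(1)[OF e_bop e_adj e_idem K.diff_closed[OF c(1) x1(1)]] by simp
    then have "hnorm K (T x1 - x1) < 1/4" using n(2) by linarith
    moreover have "hnorm K (q x1 - T x1) \<le> 1/16"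
      using op_bddD[OF q(4) x1(1)] x1(2) by (simp add: fun_diff_apply)
    then have "hnorm K (T x1) \<le> 1/16" using K.hnorm_minus[OF c(2)] by (simp add: q0)
    moreover have "hnorm K x1 \<le> hnorm K (T x1) + hnorm K (T x1 - x1)"
      using K.hnorm_triangle_diff[OF c(2) K.diff_closed[OF c(2) x1(1)]] by simp
    ultimately show False using x1(2) by linarith
  qed
  define k where "k = card E"
  have k: "k > 0" using Ene fin by (simp add: k_def card_gt_0_iff)
  obtain f where f: "bij_betw f {..<k} E" using ex_bij_betw_nat_finite[OF fin] by (auto simp: k_def atLeast0LessThan)
  have fE: "f b \<in> E" if "b < k" for b using bij_betwE[OF f] that by blast
  show False
  proof (rule almost_invariant_contradiction[OF q(1-3) _ _ _ _ k D orth U UD])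
    show "f b \<in> hcarrier K" if "b < k" for b by (rule EK[OF fE[OF that]])
    show "hinner K (f a) (f b) = (if a = b then 1 else 0)" if "a < k" "b < k" for a b
    proof -
      have "f a = f b \<longleftrightarrow> a = b" using inj_on_eq_iff[OF bij_betw_imp_inj_on[OF f]] that by simp
      then show ?thesis using E(1) fE[OF that(1)] fE[OF that(2)] by (simp add: orthonormal_def)
    qed
    show "q x = (\<Sum>a<k. hinner K x (f a) *\<^sub>C f a)" if "x \<in> hcarrier K" for x
      unfolding E(3)[OF that] by (rule sum.reindex_bij_betw[OF f, symmetric])
    show "e (f b) = f b" if "b < k" for b by (rule ef[OF fE[OF that]])
    fix j :: nat and b assume j: "j < 100" and b: "b < k"
    let ?f = "f b" and ?u = "\<pi> (U j)"
    have fc: "?f \<in> hcarrier K" "q ?f = ?f" "e ?f = ?f" using fE[OF b] EK E(2) ef by auto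
    have ub: "?u \<in> bop K K" by (rule \<pi>D(1)[OF U(1)[OF j]])
    have eu: "e (?u x) = ?u x" "?u (e x) = ?u x" for x
      using fun_cong[OF e_mult(1)[OF U(1)[OF j]], of x] fun_cong[OF e_mult(2)[OF U(1)[OF j]], of x] by simp_all
    have n1: "hnorm K ?f = 1" using E(1) fE[OF b] by (auto simp: orthonormal_def hnorm_def)
    have u1: "hnorm K (?u x) \<le> hnorm K x" if x: "x \<in> hcarrier K" for x
    proof -
      have "adj K K ?u \<circ> ?u = e"
        unfolding \<pi>D(5)[OF U(1)[OF j], symmetric] \<pi>D(4)[OF AD(4)[OF U(1)[OF j]] U(1)[OF j], symmetric] U(2)[OF j] e_def ..
      then have "Re (hinner K (?u x) (?u x)) = Re (hinner K x (e x))"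
        using KK.adj_inner[OF ub x bop_closed[OF ub x]] by (metis comp_apply)
      moreover have "Re (hinner K x (e x)) = Re (hinner K (e x) x)"
        using K.hinner_commute[OF bop_closed[OF e_bop x] x] by simp
      ultimately have "(hnorm K (?u x))\<^sup>2 \<le> (hnorm K x)\<^sup>2"
        using e_hinner[OF x] K.Re_hinner_self[OF bop_closed[OF ub x]] by linarith
      then show ?thesis using K.hnorm_nonneg[OF x] by (rule power2_le_imp_le)
    qed
    have uf: "?u ?f \<in> hcarrier K" by (rule bop_closed[OF ub fc(1)])
    have Tf: "T ?f \<in> hcarrier K" by (rule bop_closed[OF Tp(1) fc(1)])
    have nuf: "hnorm K (?u ?f) \<le> 1" using u1[OF fc(1)] n1 by simp
    let ?C = "(?u \<circ> p n) - (p n \<circ> ?u)"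
    have pf: "p n ?f \<in> hcarrier K" "p n (?u ?f) \<in> hcarrier K" "?u (p n ?f) \<in> hcarrier K"
      using bop_closed[OF pb] bop_closed[OF ub] fc(1) uf by auto
    have t1: "hnorm K (?u (T ?f) - T (?u ?f)) \<le> 1/96"
    proof -
      \<comment> \<open>\<open>?u\<close> absorbs \<open>e\<close> on both sides and
        \<open>e\<close> fixes \<open>?f\<close>, so the commutator with the compression is, at
        \<open>?f\<close>, \<open>e\<close> applied to the commutator with
        \<open>p n\<close>.\<close>
      have "?u (T ?f) - T (?u ?f) = e (?C ?f)"
        using pf by (simp add: T_def fun_diff_apply fc(3) eu KK.bop_diff[OF e_bop])
      moreover have "hnorm K (e (?C ?f)) \<le> hnorm K (?C ?f)"
        by (rule K.projection_norms(1)[OF e_bop e_adj e_idem]) (use pf in \<open>simp add: fun_diff_apply\<close>)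
      moreover have "hnorm K (?C ?f) \<le> 1/96"
        using op_bddD[OF small[OF ub n(1)[OF j]] fc(1)] n1 by simp
      ultimately show ?thesis by simp
    qed
    have t2: "hnorm K (?f - T ?f) \<le> 1/16"
      using op_bddD[OF q(4) fc(1)] n1 fc(2) by (simp add: fun_diff_apply)
    then have t3: "hnorm K (?u ?f - ?u (T ?f)) \<le> 1/16"
      using u1[OF K.diff_closed[OF fc(1) Tf]] by (simp add: KK.bop_diff[OF ub fc(1) Tf])
    have t4: "hnorm K (T (?u ?f) - q (?u ?f)) \<le> 1/16"
    proof -
      have "hnorm K (q (?u ?f) - T (?u ?f)) \<le> 1/16 * hnorm K (?u ?f)"
        using op_bddD[OF q(4) uf] by (simp only: fun_diff_apply)
      then show ?thesis
        using nuf K.hnorm_minus_commute[OF bop_closed[OF q(1) uf] bop_closed[OF Tp(1) uf]] by linarith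
    qed
    have c: "?u (T ?f) \<in> hcarrier K" "T (?u ?f) \<in> hcarrier K" "q (?u ?f) \<in> hcarrier K"
      using bop_closed[OF ub Tf] bop_closed[OF Tp(1) uf] bop_closed[OF q(1) uf] by auto
    \<comment> \<open>The path runs through \<open>?u (T ?f)\<close> and \<open>T (?u ?f)\<close>;
      its three legs have lengths at most 1/16, 1/96 and 1/16.\<close>
    show "hnorm K (?u ?f - q (?u ?f)) \<le> 1/4"
      using K.hnorm_triangle_mid[OF uf c(1,3)] K.hnorm_triangle_mid[OF c(1,2,3)] t1 t3 t4 by linarith
  qed
qed

end

section \<open>Ping-pong in the free product and conclusion\<close>

section \<open>The reduced free product\<close>

context free_leg
begin

text \<open>The closed span of the words that start in factor \<open>i\<close>, described as the
  orthogonal complement of all other words, the empty one included. In this form closedness is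
  immediate and membership is tested on words.\<close>

definition ann where "ann = {y \<in> hcarrier F. \<forall>w\<in>legs. hinner F y (e w) = 0}"

lemma e_Cons_ann: "\<iota> x # w \<in> words \<Longrightarrow> e (\<iota> x # w) \<in> ann"
  by (auto simp: ann_def e_closed e_hinner legs_words word_inner_leg)

text \<open>Moving \<open>T\<close> across the inner product,
  \<open>hinner F (act T y) (e w)\<close> becomes the inner product of \<open>y\<close> with the
  longer word whose first letter is the adjoint of \<open>T\<close> at \<open>\<xi>i\<close>; this
  letter is admissible by centeredness, and \<open>y\<close> is orthogonal to such words.\<close>

lemma act_ann:
  assumes T: "T \<in> bop Hi Hi" "hinner Hi (adj Hi Hi T \<xi>i) \<xi>i = 0"
    and y: "y \<in> hcarrier F" "\<And>x w. \<iota> x # w \<in> words \<Longrightarrow> hinner F y (e (\<iota> x # w)) = 0"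
  shows "act T y \<in> ann"
proof -
  interpret FF: hilb2 F F ..
  interpret Hii: hilb2 Hi Hi ..
  note aT = Hii.adj_bop[OF T(1)]
  have "hinner F (act T y) (e w) = 0" if w: "w \<in> legs" for w
  proof -
    have "hinner F (act T y) (e w) = hinner F y (act (adj Hi Hi T) (e w))"
      unfolding act_adj[OF T(1)] by (rule FF.adj_inner[OF act_bop[OF T(1)] y(1) e_closed[OF legs_words[OF w]]])
    also have "\<dots> = hinner F y (e (\<iota> (adj Hi Hi T \<xi>i) # w))"
      by (simp only: act_e(1)[OF aT T(2) w])
    also have "\<dots> = 0" by (rule y(2)[OF act_e(2)[OF aT T(2) w]])
    finally show ?thesis .
  qed
  then show ?thesis using bop_closed[OF act_bop[OF T(1)] y(1)] by (simp add: ann_def)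
qed

lemma ann_projection_ex:
  "\<exists>P\<in>bop F F. adj F F P = P \<and> P \<circ> P = P \<and> (\<forall>y\<in>ann. P y = y) \<and>
    (\<forall>y\<in>hcarrier F. P y \<in> ann \<and> (\<forall>z\<in>ann. hinner F (y - P y) z = 0))"
proof (rule F.closed_subspace_projection_ex)
  have ec: "e w \<in> hcarrier F" if "w \<in> legs" for w by (rule e_closed[OF legs_words[OF that]])
  show annF: "ann \<subseteq> hcarrier F" by (auto simp: ann_def)
  show "complex_vector.subspace ann"
    by (rule complex_vector.subspaceI) (use ec in \<open>auto simp: ann_def F.hinner_add_left F.hinner_scale_left\<close>)
  show "l \<in> ann" if s: "\<And>n. s n \<in> ann" and l: "l \<in> hcarrier F" "htendsto F s l" for s l
  proof -
    have "hinner F l (e w) = 0" if w: "w \<in> legs" for w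
    proof -
      have "(\<lambda>n. hinner F (s n) (e w)) \<longlonglongrightarrow> hinner F l (e w)"
        by (rule F.htendsto_hinner[OF _ l ec[OF w]]) (use s annF in blast)
      moreover have "hinner F (s n) (e w) = 0" for n using s[of n] w by (simp add: ann_def)
      ultimately show ?thesis by (simp add: LIMSEQ_const_iff)
    qed
    then show ?thesis using l by (simp add: ann_def)
  qed
qed

end

context free_pair
begin

text \<open>Here \<open>E1\<close> and \<open>E2\<close> stand for the closed spans of the words starting in the first and in the second
  factor; a centered operator maps the orthogonal complement of the words starting in its factor into
  their span. The conjugates of \<open>u\<close> by \<open>C\<^sub>j = (vu)\<^sup>j w\<close> satisfy the hypotheses of the norm
  estimate, since \<open>C\<^sub>i\<^sup>* C\<^sub>j\<close> for \<open>i < j\<close> is an alternating product beginning with \<open>w\<^sup>* v\<close>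
  and ending in \<open>w\<close>.\<close>

lemma conjugates_of_centered:
  fixes E1 E2 :: "((('h + 'k) list \<Rightarrow> complex) \<Rightarrow> complex) set"
  assumes P: "P \<in> bop F F" "adj F F P = P" "P \<circ> P = P" "\<And>y. y \<in> E1 \<Longrightarrow> P y = y" "\<And>y. y \<in> hcarrier F \<Longrightarrow> P y \<in> E1"
      "\<And>y. y \<in> E2 \<Longrightarrow> P y = 0" "E1 \<subseteq> hcarrier F" "E2 \<subseteq> hcarrier F"
    and A: "cstar_subalgebra F A" "u \<in> A" "v \<in> A" "w \<in> A"
    and unit: "adj F F u \<circ> u = idop F" "u \<circ> adj F F u = idop F" "adj F F v \<circ> v = idop F" "v \<circ> adj F F v = idop F"
      "adj F F w \<circ> w = idop F" "w \<circ> adj F F w = idop F"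
    and u: "\<And>y. y \<in> hcarrier F \<Longrightarrow> P y = 0 \<Longrightarrow> u y \<in> E1"
    and vw: "\<And>y. y \<in> E1 \<Longrightarrow> v y \<in> E2" "\<And>y. y \<in> E1 \<Longrightarrow> w y \<in> E2" "\<And>y. y \<in> E1 \<Longrightarrow> adj F F w (v y) \<in> E2"
  obtains D U where "\<And>j::nat. D j \<in> bop F F" "\<And>j. adj F F (D j) = D j" "\<And>j. D j \<circ> D j = D j"
    "\<And>i j. i \<noteq> j \<Longrightarrow> D i \<circ> D j = 0" "\<And>j. U j \<in> A" "\<And>j. adj F F (U j) \<circ> U j = idop F"
    "\<And>j x. x \<in> hcarrier F \<Longrightarrow> D j x = 0 \<Longrightarrow> D j (U j x) = U j x"
proof -
  interpret FF: hilb2 F F ..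
  note AD = cstar_subalgebraD[OF A(1)]
  have ub: "u \<in> bop F F" and vb: "v \<in> bop F F" and wb: "w \<in> bop F F" using AD(1) A by blast+
  have u2: "u y \<in> E1" if "y \<in> E2" for y using u P(6,8) that by blast
  \<comment> \<open>New factors \<open>v u\<close> are added on the left, so that they meet and
    cancel in \<open>C\<^sub>i\<^sup>* C\<^sub>j\<close>.\<close>
  define C where "C j = ((\<lambda>Z. v \<circ> (u \<circ> Z)) ^^ j) w" for j :: nat
  have C0: "C 0 = w" and CS: "C (Suc j) = v \<circ> (u \<circ> C j)" for j by (simp_all add: C_def)
  have CA: "C j \<in> A" for j
    by (induction j) (simp_all only: C0 CS A AD(3))
  have Cb: "C j \<in> bop F F" for j by (rule AD(1)[OF CA])
  have aCb: "adj F F (C j) \<in> bop F F" for j by (rule FF.adj_bop[OF Cb])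
  have adjCS: "adj F F (C (Suc j)) = adj F F (C j) \<circ> (adj F F u \<circ> adj F F v)" for j
    unfolding CS adj_comp[OF F.hilb_axioms F.hilb_axioms F.hilb_axioms F.comp_bop_self[OF ub Cb] vb]
      adj_comp[OF F.hilb_axioms F.hilb_axioms F.hilb_axioms Cb ub] comp_assoc ..
  have cancel: "adj F F Z (Z y) = y" "Z (adj F F Z y) = y"
    if "adj F F Z \<circ> Z = idop F" "Z \<circ> adj F F Z = idop F" "y \<in> hcarrier F" for Z y
    using fun_cong[OF that(1), of y] fun_cong[OF that(2), of y] that(3) by simp_all
  have CuC: "adj F F (C j) (C j y) = y \<and> C j (adj F F (C j) y) = y" if "y \<in> hcarrier F" for j y
    using that
  proof (induction j arbitrary: y)
    case 0
    then show ?case using cancel[OF unit(5,6)] by (simp add: C0)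
  next
    case (Suc j)
    have c: "C j y \<in> hcarrier F" "u (C j y) \<in> hcarrier F" "adj F F v y \<in> hcarrier F" "adj F F u (adj F F v y) \<in> hcarrier F"
      using bop_closed[OF Cb] bop_closed[OF ub] FF.adj_closed[OF vb] FF.adj_closed[OF ub] Suc.prems by auto
    show ?case
      unfolding adjCS unfolding CS comp_apply cancel(1)[OF unit(3,4) c(2)] cancel(1)[OF unit(1,2) c(1)]
      using Suc.IH[OF Suc.prems] Suc.IH[OF c(4)] cancel(2)[OF unit(1,2) c(3)] cancel(2)[OF unit(3,4) Suc.prems] by simp
  qed
  have CE: "C j y \<in> E2" if "y \<in> E1" for j y
    using that by (induction j) (simp_all add: C0 CS vw u2)
  \<comment> \<open>After cancellation \<open>C\<^sub>i\<^sup>* C\<^sub>j\<close> with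
    \<open>j = i + d + 1\<close> is \<open>w\<^sup>* v u C\<^sub>d\<close>. Here
    \<open>C\<^sub>d\<close> maps \<open>E1\<close> into \<open>E2\<close>, \<open>u\<close> leads
    back to \<open>E1\<close>, and \<open>w\<^sup>* v\<close>, acting as one letter, into
    \<open>E2\<close>.\<close>
  have CCE: "adj F F (C i) (C (i + Suc d) y) \<in> E2" if "y \<in> E1" for i d y
  proof (induction i)
    case 0
    then show ?case using CE[OF that] by (simp add: C0 CS vw u2)
  next
    case (Suc i)
    have c: "C (i + Suc d) y \<in> hcarrier F" "u (C (i + Suc d) y) \<in> hcarrier F"
      using bop_closed[OF Cb] bop_closed[OF ub] that P(7) by auto
    have "C (Suc i + Suc d) y = v (u (C (i + Suc d) y))" by (simp add: CS)
    then have "adj F F (C (Suc i)) (C (Suc i + Suc d) y) = adj F F (C i) (adj F F u (adj F F v (v (u (C (i + Suc d) y)))))"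
      by (simp only: adjCS comp_apply)
    also have "\<dots> = adj F F (C i) (C (i + Suc d) y)"
      unfolding cancel(1)[OF unit(3,4) c(2)] cancel(1)[OF unit(1,2) c(1)] ..
    finally show ?case using Suc by simp
  qed
  \<comment> \<open>The projection onto the image of \<open>E1\<close> under
    \<open>C\<^sub>j\<close>. Orthogonality for different indices means that
    \<open>C\<^sub>i\<^sup>* C\<^sub>j\<close> maps \<open>E1\<close> into \<open>E2\<close>, where
    \<open>P\<close> vanishes.\<close>
  define D where "D j = C j \<circ> (P \<circ> adj F F (C j))" for j
  define U where "U j = C j \<circ> (u \<circ> adj F F (C j))" for j
  have Db: "D j \<in> bop F F" for j unfolding D_def by (intro F.comp_bop_self Cb P(1) aCb)
  have Dadj: "adj F F (D j) = D j" for j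
    unfolding D_def adj_comp[OF F.hilb_axioms F.hilb_axioms F.hilb_axioms F.comp_bop_self[OF P(1) aCb] Cb]
      adj_comp[OF F.hilb_axioms F.hilb_axioms F.hilb_axioms aCb P(1)] P(2) FF.adj_adj[OF Cb] comp_assoc ..
  have PP: "P (P y) = P y" for y using fun_cong[OF P(3), of y] by simp
  have aCc: "adj F F (C j) y \<in> hcarrier F" if "y \<in> hcarrier F" for j y by (rule FF.adj_closed[OF Cb that])
  have Pc: "P y \<in> hcarrier F" if "y \<in> hcarrier F" for y by (rule bop_closed[OF P(1) that])
  have uc: "u y \<in> hcarrier F" if "y \<in> hcarrier F" for y by (rule bop_closed[OF ub that])
  have DD: "D j \<circ> D j = D j" for j
    by (rule FF.bop_eqI[OF F.comp_bop_self[OF Db Db] Db]) (simp add: D_def CuC Pc aCc PP)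
  have orth_less: "D i \<circ> D (i + Suc d) = 0" for i d
  proof (rule FF.bop_eqI[OF F.comp_bop_self[OF Db Db] FF.zero_bop])
    fix y assume y: "y \<in> hcarrier F"
    have "P (adj F F (C i) (C (i + Suc d) (P (adj F F (C (i + Suc d)) y)))) = 0"
      by (rule P(6)[OF CCE[OF P(5)[OF aCc[OF y]]]])
    then show "(D i \<circ> D (i + Suc d)) y = 0 y" by (simp add: D_def FF.bop_zero[OF Cb])
  qed
  have orth: "D i \<circ> D j = 0" if ij: "i \<noteq> j" for i j
  proof (cases "i < j")
    case True
    then obtain d where "j = i + Suc d" using less_imp_Suc_add by force
    then show ?thesis using orth_less by simp
  next
    case False
    then obtain d where d: "i = j + Suc d" using ij less_imp_Suc_add[of j i] by force
    have "D i \<circ> D j = adj F F (D j \<circ> D i)"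
      unfolding adj_comp[OF F.hilb_axioms F.hilb_axioms F.hilb_axioms Db Db] Dadj ..
    also have "\<dots> = adj F F 0" unfolding d orth_less ..
    also have "adj F F 0 = 0"
      using FF.adj_scale[OF FF.zero_bop, of 0] unfolding complex_vector.scale_zero_left complex_cnj_zero .
    finally show ?thesis .
  qed
  have UA: "U j \<in> A" for j unfolding U_def by (intro AD(3) AD(4) CA A)
  have Ub: "U j \<in> bop F F" for j by (rule AD(1)[OF UA])
  have Uadj: "adj F F (U j) = C j \<circ> (adj F F u \<circ> adj F F (C j))" for j
    unfolding U_def adj_comp[OF F.hilb_axioms F.hilb_axioms F.hilb_axioms F.comp_bop_self[OF ub aCb] Cb]
      adj_comp[OF F.hilb_axioms F.hilb_axioms F.hilb_axioms aCb ub] FF.adj_adj[OF Cb] comp_assoc ..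
  have UU: "adj F F (U j) \<circ> U j = idop F" for j
    by (rule FF.bop_eqI[OF F.comp_bop_self[OF FF.adj_bop[OF Ub] Ub] F.idop_bop], unfold Uadj)
       (simp add: U_def CuC uc aCc cancel[OF unit(1,2)])
  have UD: "D j (U j x) = U j x" if x: "x \<in> hcarrier F" and 0: "D j x = 0" for j x
  proof -
    let ?z = "adj F F (C j) x"
    have z: "?z \<in> hcarrier F" by (rule aCc[OF x])
    have "adj F F (C j) (D j x) = P ?z" using CuC[OF Pc[OF z]] by (simp add: D_def)
    then have "P ?z = 0" unfolding 0 FF.bop_zero[OF aCb] by simp
    then have "u ?z \<in> E1" by (rule u[OF z])
    then have Pu: "P (u ?z) = u ?z" by (rule P(4))
    show ?thesis using CuC[OF uc[OF z]] by (simp add: D_def U_def Pu)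
  qed
  show thesis by (rule that[OF Db Dadj DD orth UA UU UD])
qed

end

locale free_states = A: gns \<tau>1 + B: gns \<tau>2
  for \<tau>1 :: "'a::unital_cstar_algebra \<Rightarrow> complex" and \<tau>2 :: "'b::unital_cstar_algebra \<Rightarrow> complex"

sublocale free_states \<subseteq> free_pair "gns_space \<tau>1" "gns_space \<tau>2" "gns_vector \<tau>1" "gns_vector \<tau>2"
  by unfold_locales
     (rule A.gns_vector_closed A.gns_vector_unit B.gns_vector_closed B.gns_vector_unit)+

sublocale free_states \<subseteq> L1: free_leg "gns_space \<tau>1" "gns_space \<tau>2" "gns_vector \<tau>1" "gns_vector \<tau>2" "gns_space \<tau>1" Inl "gns_vector \<tau>1"
  by (rule free_leg_Inl)

sublocale free_states \<subseteq> L2: free_leg "gns_space \<tau>1" "gns_space \<tau>2" "gns_vector \<tau>1" "gns_vector \<tau>2" "gns_space \<tau>2" Inr "gns_vector \<tau>2"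
  by (rule free_leg_Inr)

context free_states
begin

lemma free_space_eq: "free_product_space \<tau>1 \<tau>2 = F"
  by (simp add: free_product_space_def)

lemma free_rep1_eq: "free_rep1 \<tau>1 \<tau>2 a = L1.act (gns_rep \<tau>1 a)"
  by (simp add: free_rep1_def L1.act_def)

lemma free_rep2_eq: "free_rep2 \<tau>1 \<tau>2 b = L2.act (gns_rep \<tau>2 b)"
  by (simp add: free_rep2_def L2.act_def)

lemma reduced_cstar:
  shows "cstar_subalgebra F (reduced_free_product \<tau>1 \<tau>2)"
    and "L1.act (gns_rep \<tau>1 a) \<in> reduced_free_product \<tau>1 \<tau>2"
    and "L2.act (gns_rep \<tau>2 b) \<in> reduced_free_product \<tau>1 \<tau>2"
proof -
  let ?G = "range (free_rep1 \<tau>1 \<tau>2) \<union> range (free_rep2 \<tau>1 \<tau>2)"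
  have G: "?G \<subseteq> bop F F"
    using L1.act_bop[OF A.gns_rep_bop] L2.act_bop[OF B.gns_rep_bop] by (auto simp: free_rep1_eq free_rep2_eq)
  note * = F.cstar_generated_subalgebra[OF G]
  show "cstar_subalgebra F (reduced_free_product \<tau>1 \<tau>2)"
    unfolding reduced_free_product_def free_space_eq by (rule *(1))
  have "free_rep1 \<tau>1 \<tau>2 a \<in> reduced_free_product \<tau>1 \<tau>2" "free_rep2 \<tau>1 \<tau>2 b \<in> reduced_free_product \<tau>1 \<tau>2"
    unfolding reduced_free_product_def free_space_eq using *(2) by blast+
  then show "L1.act (gns_rep \<tau>1 a) \<in> reduced_free_product \<tau>1 \<tau>2" "L2.act (gns_rep \<tau>2 b) \<in> reduced_free_product \<tau>1 \<tau>2"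
    by (simp_all only: free_rep1_eq free_rep2_eq)
qed

lemma legs_cover:
  assumes "w \<in> words"
  obtains "w \<in> L1.legs" | x v where "w = Inl x # v"
  using assms by (rule L1.words_cases) blast+

text \<open>Here \<open>z0\<close> is the projection of \<open>y\<close> onto \<open>L1.ann\<close>,
  tested on words. Words in \<open>L1.legs\<close> are orthogonal to \<open>z0\<close> by
  definition. A word starting in the first factor is orthogonal to \<open>y\<close>, and also to
  \<open>y - z0\<close> as it gives a vector of \<open>L1.ann\<close>.\<close>

lemma ann_projection_zero:
  assumes y: "y \<in> L2.ann" and yz: "\<And>z. z \<in> L1.ann \<Longrightarrow> hinner F (y - z0) z = 0" and z0: "z0 \<in> L1.ann"
  shows "z0 = 0"
proof (rule totalD[OF e_total])
  have yF: "y \<in> hcarrier F" and zF: "z0 \<in> hcarrier F" using y z0 by (auto simp: L1.ann_def L2.ann_def)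
  show "z0 \<in> hcarrier F" by (rule zF)
  fix d assume "d \<in> e ` words"
  then obtain w where w: "w \<in> words" "d = e w" by blast
  have "hinner F z0 (e w) = 0"
    using w(1)
  proof (rule legs_cover)
    assume "w \<in> L1.legs"
    then show ?thesis using z0 by (simp add: L1.ann_def)
  next
    fix x v assume wx: "w = Inl x # v"
    have "w \<in> L2.legs" using w(1) wx by (auto simp: leg_words_def)
    then have "hinner F y (e w) = 0" using y by (simp add: L2.ann_def)
    moreover have "hinner F (y - z0) (e w) = 0"
      using yz[OF L1.e_Cons_ann] w(1) wx by blast
    ultimately show ?thesis using F.hinner_diff_left[OF yF zF e_closed[OF w(1)]] by simp
  qed
  then show "hinner F d z0 = 0"
    using F.hinner_commute[OF zF e_closed[OF w(1)]] w(2) by simp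
qed

text \<open>A word starting in the second factor is among \<open>L1.legs\<close>, hence orthogonal
  to \<open>L1.ann\<close>, and so \<open>act_ann\<close> applies to the second factor.\<close>

lemma ann1_ann2:
  assumes a: "\<tau>2 a = 0" and y: "y \<in> L1.ann"
  shows "L2.act (gns_rep \<tau>2 a) y \<in> L2.ann"
proof (rule L2.act_ann[OF B.gns_rep_bop B.gns_rep_centered[OF a]])
  show "y \<in> hcarrier F" using y by (simp add: L1.ann_def)
  fix x w assume "Inr x # w \<in> words"
  then have "Inr x # w \<in> L1.legs" by (auto simp: leg_words_def)
  then show "hinner F y (e (Inr x # w)) = 0" using y by (simp add: L1.ann_def)
qed

lemma not_quasidiagonal:
  assumes av: "avitzour_condition \<tau>1 \<tau>2"
  shows "\<not> quasidiagonal TYPE('k::complex_vector) F (reduced_free_product \<tau>1 \<tau>2)"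
proof
  let ?A = "reduced_free_product \<tau>1 \<tau>2"
  assume "quasidiagonal TYPE('k) F ?A"
  then obtain K :: "'k hspace" and \<pi> p where K: "hilbert_space K" and \<pi>: "star_representation F ?A K \<pi>" "inj_on \<pi> ?A"
    and p': "\<forall>n. projection K (p n) \<and> finite_rank K (p n)"
    and conv': "\<forall>x\<in>hcarrier K. htendsto K (\<lambda>n. p n x) x"
    and comm': "\<forall>T\<in>?A. (\<lambda>n. opnorm K K ((\<pi> T \<circ> p n) - (p n \<circ> \<pi> T))) \<longlonglongrightarrow> 0"
    unfolding quasidiagonal_def by (elim exE conjE)
  have p: "projection K (p n)" "finite_rank K (p n)" for n using p' by simp_all
  note conv = bspec[OF conv'] and comm = bspec[OF comm']
  have idA: "idop F \<in> ?A"
    using reduced_cstar(2)[of 1] by (simp only: A.gns_rep_one L1.act_idop)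
  interpret K: hilb K by (rule hilb_of_hilbert_space[OF K])
  interpret R: cstar_rep F K ?A \<pi>
    by unfold_locales (rule reduced_cstar(1) idA \<pi>(1))+
  from av obtain u v w where unit: "unitary u" "unitary v" "unitary w"
    and u: "\<tau>1 u = 0" and vw: "\<tau>2 v = 0" "\<tau>2 w = 0" "\<tau>2 (star w * v) = 0"
    unfolding avitzour_condition_def by blast
  obtain P where P: "P \<in> bop F F" "adj F F P = P" "P \<circ> P = P" "\<And>y. y \<in> L1.ann \<Longrightarrow> P y = y"
      "\<And>y. y \<in> hcarrier F \<Longrightarrow> P y \<in> L1.ann" "\<And>y z. y \<in> hcarrier F \<Longrightarrow> z \<in> L1.ann \<Longrightarrow> hinner F (y - P y) z = 0"
    using L1.ann_projection_ex by blast
  have annF: "L1.ann \<subseteq> hcarrier F" "L2.ann \<subseteq> hcarrier F" by (auto simp: L1.ann_def L2.ann_def)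
  have P0: "P y = 0" if y: "y \<in> L2.ann" for y
    by (rule ann_projection_zero[OF y P(6) P(5)]) (use y annF in blast)+
  have u1: "L1.act (gns_rep \<tau>1 u) y \<in> L1.ann" if y: "y \<in> hcarrier F" "P y = 0" for y
  proof (rule L1.act_ann[OF A.gns_rep_bop A.gns_rep_centered[OF u] y(1)])
    fix x w assume "Inl x # w \<in> words"
    then show "hinner F y (e (Inl x # w)) = 0" using P(6)[OF y(1) L1.e_Cons_ann] y(2) by simp
  qed
  \<comment> \<open>The product acts as a single element of the second algebra. Through this
    identity the condition \<open>\<tau>2 (star w * v) = 0\<close> enters, as centeredness of that
    element.\<close>
  have wv: "adj F F (L2.act (gns_rep \<tau>2 w)) (L2.act (gns_rep \<tau>2 v) y) = L2.act (gns_rep \<tau>2 (star w * v)) y" for y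
    unfolding L2.act_adj[OF B.gns_rep_bop, symmetric] B.gns_rep_star[symmetric] B.gns_rep_mult
      L2.act_comp[OF B.gns_rep_bop B.gns_rep_bop] comp_apply ..
  have nz: "idop F \<noteq> 0"
  proof
    assume "idop F = 0"
    then have "e [] = 0" using idop_apply[OF e_closed[OF Nil_words]] by simp
    then have "hinner F (e []) (e []) = 0" using F.hinner_zero_left[OF e_closed[OF Nil_words]] by simp
    then show False by (simp add: e_hinner[OF Nil_words Nil_words])
  qed
  show False
  proof (rule conjugates_of_centered[OF P(1-5) P0 annF reduced_cstar(1) reduced_cstar(2)[of u] reduced_cstar(3)[of v] reduced_cstar(3)[of w]])
    note unit1 = L1.act_unitary[OF A.gns_rep_bop A.gns_rep_unitary] and unit2 = L2.act_unitary[OF B.gns_rep_bop B.gns_rep_unitary]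
    show "adj F F (L1.act (gns_rep \<tau>1 u)) \<circ> L1.act (gns_rep \<tau>1 u) = idop F" "L1.act (gns_rep \<tau>1 u) \<circ> adj F F (L1.act (gns_rep \<tau>1 u)) = idop F"
      by (rule unit1[OF unit(1) unit(1)])+
    show "adj F F (L2.act (gns_rep \<tau>2 v)) \<circ> L2.act (gns_rep \<tau>2 v) = idop F" "L2.act (gns_rep \<tau>2 v) \<circ> adj F F (L2.act (gns_rep \<tau>2 v)) = idop F"
      by (rule unit2[OF unit(2) unit(2)])+
    show "adj F F (L2.act (gns_rep \<tau>2 w)) \<circ> L2.act (gns_rep \<tau>2 w) = idop F" "L2.act (gns_rep \<tau>2 w) \<circ> adj F F (L2.act (gns_rep \<tau>2 w)) = idop F"
      by (rule unit2[OF unit(3) unit(3)])+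
    show "L1.act (gns_rep \<tau>1 u) y \<in> L1.ann" if "y \<in> hcarrier F" "P y = 0" for y by (rule u1[OF that])
    show "L2.act (gns_rep \<tau>2 v) y \<in> L2.ann" "L2.act (gns_rep \<tau>2 w) y \<in> L2.ann"
      "adj F F (L2.act (gns_rep \<tau>2 w)) (L2.act (gns_rep \<tau>2 v) y) \<in> L2.ann" if "y \<in> L1.ann" for y
      unfolding wv by (rule ann1_ann2[OF vw(1) that] ann1_ann2[OF vw(2) that] ann1_ann2[OF vw(3) that])+
    fix D U
    assume DU: "\<And>j::nat. D j \<in> bop F F" "\<And>j. adj F F (D j) = D j" "\<And>j. D j \<circ> D j = D j"
        "\<And>i j. i \<noteq> j \<Longrightarrow> D i \<circ> D j = 0" "\<And>j. U j \<in> ?A" "\<And>j. adj F F (U j) \<circ> U j = idop F"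
        "\<And>j x. x \<in> hcarrier F \<Longrightarrow> D j x = 0 \<Longrightarrow> D j (U j x) = U j x"
    show False
      by (rule R.quasidiagonal_contradiction[OF \<pi>(2) nz p conv comm DU(1-3) DU(4) DU(5,6) DU(7)])
  qed
qed

end

theorem theorem4p1p1:
  fixes \<tau>1 :: "'a::unital_cstar_algebra \<Rightarrow> complex"
    and \<tau>2 :: "'b::unital_cstar_algebra \<Rightarrow> complex"
  assumes "separable_space (euclidean :: 'a topology)"
    and "separable_space (euclidean :: 'b topology)"
    and "faithful_tracial_state \<tau>1" and "faithful_tracial_state \<tau>2"
    and "avitzour_condition \<tau>1 \<tau>2"
  shows "\<not> quasidiagonal TYPE('k::complex_vector)
           (free_product_space \<tau>1 \<tau>2) (reduced_free_product \<tau>1 \<tau>2)"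
proof -
  interpret free_states \<tau>1 \<tau>2
    using assms(3,4) by unfold_locales (simp_all add: faithful_tracial_state_def)
  show ?thesis unfolding free_space_eq by (rule not_quasidiagonal[OF assms(5)])
qed

end
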